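(* Let $Q$ be a finite tree quiver, $A=\Bbbk Q$ its path algebra, and $\mathscr{D}_A$ the $2$-category of dual projection functors defined in the context. Let $I$ be an indecomposable ideal of $A$, let $G(I)$ be its minimal set of path generators, let $s_{G(I)}$ be the set of sources of all paths in $G(I)$, and set $J:=\langle \varepsilon_i \mid i\in s_{G(I)}\rangle$. Then $\mathrm{Dp}_J$ is the Duflo involution for the left cell $\{[\mathrm{Dp}_I]\}$ of $\mathscr{D}_A$.
   Context: $\Bbbk$ is an algebraically closed field; all categories and functors are $\Bbbk$-linear; modules are finitely generated left modules. A finite tree quiver $Q=(Q_0,Q_1,s,t)$ is a finite quiver whose underlying graph is a tree. $A=\Bbbk Q$ is its path algebra, with paths composed right to left ($\beta\alpha$ means first $\alpha$, then $\beta$). For $v\in Q_0$, $\varepsilon_v$ is the trivial path at $v$; $Q^p$ is the (finite) set of all paths, including trivial ones. "Ideal" means two-sided ideal; ideals of $A$ are identified with subbimodules of ${}_AA_A$, and an ideal is indecomposable if it is (nonzero and) indecomposable as an $A$-$A$-bimodule. Every ideal $I$ is generated by a unique minimal set of paths, denoted $G(I)$; $\langle X\rangle$ is the ideal generated by $X$. For an ideal $I$, $\mathrm{Dp}_I$ is the functor $I\otimes_A{}_-:A\text{-mod}\to A\text{-mod}$. The $2$-category $\mathscr{D}_A$ has one object $\mathtt{i}$ (identified with a small category $\mathcal{C}$ equivalent to $A$-mod); its $1$-morphisms are the functors given, up to equivalence with $A$-mod, by functors in the additive closure of all $\mathrm{Dp}_I$, $I$ an ideal of $A$; its $2$-morphisms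 are all natural transformations. It is a finitary $2$-category, with identity $1$-morphism $\mathbb{1}_{\mathtt{i}}=\mathrm{Dp}_A$. Indecomposable $1$-morphisms are identified with their isomorphism classes. Left cells: for indecomposable $1$-morphisms $F,G$, write $G\geq_L F$ if $G$ is isomorphic to a direct summand of $H\circ F$ for some $1$-morphism $H$; left cells are the equivalence classes of $F\sim_L G$ ($F\ge_L G$ and $G\ge_L F$). In $\mathscr{D}_A$ each set $\{[\mathrm{Dp}_I]\}$, $I$ an indecomposable ideal, is a left cell. Abelianized principal $2$-representation (one-object finitary $2$-category $\mathscr{C}$ with object $\mathtt{i}$): $\overline{\mathbf{P}}_{\mathtt{i}}(\mathtt{i})$ is the abelian category whose objects are diagrams $X\overset{\alpha}{\to}Y$ in $\mathscr{C}(\mathtt{i},\mathtt{i})$; morphisms from $X\overset{\alpha}{\to}Y$ to $X'\overset{\alpha'}{\to}Y'$ are pairs $(f:X\to X',\,g:Y\to Y')$ with $g\alpha=\alpha' f$, modulo those pairs for which $g=\alpha' h$ for some $h:Y\to X'$. A $1$-morphism $F$ acts on it componentwise by left composition, sending $X\overset{\alpha}{\to}Y$ to $F\circ X\overset{F(\alpha)}{\to}F\circ Y$. For an indecomposable $1$-morphism $F$, $P_F$ denotes the indecomposable projective object $0\to F$ and $L_F$ its simple top. Duflo involution: let $\mathcal{L}$ be a left cell of $\mathscr{C}$. An indecomposable $1$-morphism $G$ (not necessarily in $\mathcal{L}$) is a Duflo involution for $\mathcal{L}$ if there is a subobject $K\subset P_{\mathbb{1}_{\mathtt{i}}}$ in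 $\overline{\mathbf{P}}_{\mathtt{i}}(\mathtt{i})$ such that (1) $F L_H=0$ for all $F\in\mathcal{L}$ and all simple subquotients $L_H$ of $P_{\mathbb{1}_{\mathtt{i}}}/K$; (2) $K$ has a simple top isomorphic to $L_G$; (3) $F L_G\neq 0$ for all $F\in\mathcal{L}$. *)

theory Defs
  imports
    "HOL-Library.FuncSet"
    "HOL-Computational_Algebra.Polynomial"
    "HOL-Algebra.Ideal"
    "HOL-Algebra.AbelCoset"
    "Jordan_Normal_Form.Matrix"
    "Graph_Theory.Digraph_Component"
begin

section \<open>Tree quivers and their path algebras\<close>

text \<open>Oriented steps along the edges of the underlying graph: \<open>(a, True)\<close> traverses the arrow
  \<open>a\<close> forwards, \<open>(a, False)\<close> traverses it backwards.\<close>

definition double_quiver :: "('v, 'a) pre_digraph \<Rightarrow> ('v, 'a \<times> bool) pre_digraph" where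
  "double_quiver Q = \<lparr> verts = verts Q, arcs = arcs Q \<times> UNIV,
     tail = (\<lambda>(a, b). if b then tail Q a else head Q a),
     head = (\<lambda>(a, b). if b then head Q a else tail Q a) \<rparr>"

text \<open>The library predicate \<open>tree\<close> only excludes oriented cycles, so cycles of the underlying
  multigraph are excluded here explicitly; the condition on \<open>map fst p\<close> says that no edge is used
  twice (in particular \<open>a\<close> followed by its own reverse is not a cycle).\<close>

definition tree_quiver :: "('v, 'a) pre_digraph \<Rightarrow> bool" where
  "tree_quiver Q \<longleftrightarrow> fin_digraph Q \<and> Digraph_Component.connected Q \<and>
     \<not> (\<exists>p. pre_digraph.cycle (double_quiver Q) p \<and> distinct (map fst p))"

text \<open>A path is its starting vertex together with its list of arrows in order of traversal, so the
  product \<open>\<beta>\<alpha>\<close> (first \<open>\<alpha>\<close>, then \<open>\<beta>\<close>) is the list of \<open>\<alpha>\<close> followed by that of \<open>\<beta>\<close>.\<close>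

type_synonym ('v, 'a) path = "'v \<times> 'a list"

definition paths :: "('v, 'a) pre_digraph \<Rightarrow> ('v, 'a) path set" where
  "paths Q = {(u, p). \<exists>v. pre_digraph.awalk Q u p v}"

definition path_source :: "('v, 'a) path \<Rightarrow> 'v" where
  "path_source p = fst p"

definition path_target :: "('v, 'a) pre_digraph \<Rightarrow> ('v, 'a) path \<Rightarrow> 'v" where
  "path_target Q p = pre_digraph.awlast Q (fst p) (snd p)"

definition path_comp :: "('v, 'a) path \<Rightarrow> ('v, 'a) path \<Rightarrow> ('v, 'a) path" where
  "path_comp q p = (fst p, snd p @ snd q)"

definition path_elem :: "('v, 'a) path \<Rightarrow> (('v, 'a) path \<Rightarrow> 'k::field)" where
  "path_elem p = (\<lambda>q. if q = p then 1 else 0)"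

definition vertex_idem :: "'v \<Rightarrow> (('v, 'a) path \<Rightarrow> 'k::field)" where
  "vertex_idem v = path_elem (v, [])"

definition path_algebra ::
    "('v, 'a) pre_digraph \<Rightarrow> (('v, 'a) path \<Rightarrow> 'k::field) ring" where
  "path_algebra Q =
     \<lparr> carrier = {x. finite {p. x p \<noteq> 0} \<and> {p. x p \<noteq> 0} \<subseteq> paths Q},
       mult = (\<lambda>x y r. \<Sum>(q, p) \<in> {(q, p). q \<in> paths Q \<and> p \<in> paths Q \<and>
                 path_target Q p = path_source q \<and> path_comp q p = r}. x q * y p),
       one = (\<lambda>p. \<Sum>v\<in>verts Q. vertex_idem v p),
       zero = (\<lambda>p. 0),
       add = (\<lambda>x y p. x p + y p) \<rparr>"

definition indecomposable_ideal :: "('r, 'm) ring_scheme \<Rightarrow> 'r set \<Rightarrow> bool" where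
  "indecomposable_ideal R I \<longleftrightarrow> ideal I R \<and> I \<noteq> {\<zero>\<^bsub>R\<^esub>} \<and>
     (\<forall>X Y. ideal X R \<and> ideal Y R \<and> X \<inter> Y = {\<zero>\<^bsub>R\<^esub>} \<and> X <+>\<^bsub>R\<^esub> Y = I \<longrightarrow>
        X = {\<zero>\<^bsub>R\<^esub>} \<or> Y = {\<zero>\<^bsub>R\<^esub>})"

definition minimal_path_generators ::
    "('v, 'a) pre_digraph \<Rightarrow> (('v, 'a) path \<Rightarrow> 'k::field) set \<Rightarrow> ('v, 'a) path set \<Rightarrow> bool" where
  "minimal_path_generators Q I G \<longleftrightarrow> G \<subseteq> paths Q \<and>
     Idl\<^bsub>path_algebra Q\<^esub> (path_elem ` G) = I \<and>
     (\<forall>G'. G' \<subset> G \<longrightarrow> Idl\<^bsub>path_algebra Q\<^esub> (path_elem ` G') \<noteq> I)"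


section \<open>Linear categories\<close>

datatype ('o, 'd) arr = Arr (src: 'o) (trg: 'o) (dat: 'd)

record ('k, 'o, 'd) lincat =
  Obj :: "'o set"
  Mor :: "'o \<Rightarrow> 'o \<Rightarrow> ('o, 'd) arr set"
  Idm :: "'o \<Rightarrow> ('o, 'd) arr"
  Cmp :: "('o, 'd) arr \<Rightarrow> ('o, 'd) arr \<Rightarrow> ('o, 'd) arr"
  Nul :: "'o \<Rightarrow> 'o \<Rightarrow> ('o, 'd) arr"
  Add :: "('o, 'd) arr \<Rightarrow> ('o, 'd) arr \<Rightarrow> ('o, 'd) arr"
  Scl :: "'k \<Rightarrow> ('o, 'd) arr \<Rightarrow> ('o, 'd) arr"

definition arrow :: "('k, 'o, 'd, 'z) lincat_scheme \<Rightarrow> ('o, 'd) arr \<Rightarrow> bool" where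
  "arrow C f \<longleftrightarrow> src f \<in> Obj C \<and> trg f \<in> Obj C \<and> f \<in> Mor C (src f) (trg f)"

definition mono_arr :: "('k, 'o, 'd, 'z) lincat_scheme \<Rightarrow> ('o, 'd) arr \<Rightarrow> bool" where
  "mono_arr C m \<longleftrightarrow> arrow C m \<and>
     (\<forall>Z\<in>Obj C. \<forall>u\<in>Mor C Z (src m). \<forall>v\<in>Mor C Z (src m). Cmp C m u = Cmp C m v \<longrightarrow> u = v)"

definition epi_arr :: "('k, 'o, 'd, 'z) lincat_scheme \<Rightarrow> ('o, 'd) arr \<Rightarrow> bool" where
  "epi_arr C e \<longleftrightarrow> arrow C e \<and>
     (\<forall>Z\<in>Obj C. \<forall>u\<in>Mor C (trg e) Z. \<forall>v\<in>Mor C (trg e) Z. Cmp C u e = Cmp C v e \<longrightarrow> u = v)"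

definition iso_arr :: "('k, 'o, 'd, 'z) lincat_scheme \<Rightarrow> ('o, 'd) arr \<Rightarrow> bool" where
  "iso_arr C f \<longleftrightarrow> arrow C f \<and>
     (\<exists>g\<in>Mor C (trg f) (src f). Cmp C g f = Idm C (src f) \<and> Cmp C f g = Idm C (trg f))"

definition isomorphic :: "('k, 'o, 'd, 'z) lincat_scheme \<Rightarrow> 'o \<Rightarrow> 'o \<Rightarrow> bool" where
  "isomorphic C X Y \<longleftrightarrow> (\<exists>f. iso_arr C f \<and> src f = X \<and> trg f = Y)"

definition iso_class :: "('k, 'o, 'd, 'z) lincat_scheme \<Rightarrow> 'o \<Rightarrow> 'o set" where
  "iso_class C X = {Y \<in> Obj C. isomorphic C Y X}"

definition zero_object :: "('k, 'o, 'd, 'z) lincat_scheme \<Rightarrow> 'o \<Rightarrow> bool" where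
  "zero_object C X \<longleftrightarrow> X \<in> Obj C \<and> Idm C X = Nul C X X"

definition direct_sum :: "('k, 'o, 'd, 'z) lincat_scheme \<Rightarrow> 'o \<Rightarrow> 'o \<Rightarrow> 'o \<Rightarrow> bool" where
  "direct_sum C Z X Y \<longleftrightarrow> X \<in> Obj C \<and> Y \<in> Obj C \<and> Z \<in> Obj C \<and>
     (\<exists>i\<^sub>1\<in>Mor C X Z. \<exists>i\<^sub>2\<in>Mor C Y Z. \<exists>p\<^sub>1\<in>Mor C Z X. \<exists>p\<^sub>2\<in>Mor C Z Y.
        Cmp C p\<^sub>1 i\<^sub>1 = Idm C X \<and> Cmp C p\<^sub>2 i\<^sub>2 = Idm C Y \<and>
        Cmp C p\<^sub>1 i\<^sub>2 = Nul C Y X \<and> Cmp C p\<^sub>2 i\<^sub>1 = Nul C X Y \<and>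
        Add C (Cmp C i\<^sub>1 p\<^sub>1) (Cmp C i\<^sub>2 p\<^sub>2) = Idm C Z)"

text \<open>Being isomorphic to a direct summand.\<close>

definition summand :: "('k, 'o, 'd, 'z) lincat_scheme \<Rightarrow> 'o \<Rightarrow> 'o \<Rightarrow> bool" where
  "summand C X Z \<longleftrightarrow> (\<exists>Y. direct_sum C Z X Y)"

definition indecomposable :: "('k, 'o, 'd, 'z) lincat_scheme \<Rightarrow> 'o \<Rightarrow> bool" where
  "indecomposable C Z \<longleftrightarrow> Z \<in> Obj C \<and> \<not> zero_object C Z \<and>
     (\<forall>X Y. direct_sum C Z X Y \<longrightarrow> zero_object C X \<or> zero_object C Y)"

inductive_set add_closure :: "('k, 'o, 'd, 'z) lincat_scheme \<Rightarrow> 'o set \<Rightarrow> 'o set"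
  for C S where
  base: "X \<in> S \<Longrightarrow> X \<in> Obj C \<Longrightarrow> X \<in> add_closure C S"
| zero: "zero_object C X \<Longrightarrow> X \<in> add_closure C S"
| sum: "X \<in> add_closure C S \<Longrightarrow> Y \<in> add_closure C S \<Longrightarrow> direct_sum C Z X Y \<Longrightarrow>
    Z \<in> add_closure C S"
| summand: "Z \<in> add_closure C S \<Longrightarrow> summand C X Z \<Longrightarrow> X \<in> add_closure C S"

definition cokernel :: "('k, 'o, 'd, 'z) lincat_scheme \<Rightarrow> ('o, 'd) arr \<Rightarrow> ('o, 'd) arr \<Rightarrow> bool" where
  "cokernel C f q \<longleftrightarrow> arrow C f \<and> arrow C q \<and> src q = trg f \<and>
     Cmp C q f = Nul C (src f) (trg q) \<and>
     (\<forall>Z\<in>Obj C. \<forall>g\<in>Mor C (trg f) Z. Cmp C g f = Nul C (src f) Z \<longrightarrow>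
        (\<exists>!u. u \<in> Mor C (trg q) Z \<and> Cmp C u q = g))"

definition simple_object :: "('k, 'o, 'd, 'z) lincat_scheme \<Rightarrow> 'o \<Rightarrow> bool" where
  "simple_object C S \<longleftrightarrow> S \<in> Obj C \<and> \<not> zero_object C S \<and>
     (\<forall>m. mono_arr C m \<and> trg m = S \<longrightarrow> zero_object C (src m) \<or> iso_arr C m)"

definition subquotient :: "('k, 'o, 'd, 'z) lincat_scheme \<Rightarrow> 'o \<Rightarrow> 'o \<Rightarrow> bool" where
  "subquotient C S X \<longleftrightarrow>
     (\<exists>m e. mono_arr C m \<and> trg m = X \<and> epi_arr C e \<and> src e = src m \<and> trg e = S)"

definition factors_through ::
    "('k, 'o, 'd, 'z) lincat_scheme \<Rightarrow> ('o, 'd) arr \<Rightarrow> ('o, 'd) arr \<Rightarrow> bool" where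
  "factors_through C f m \<longleftrightarrow> (\<exists>u\<in>Mor C (src f) (src m). Cmp C m u = f)"

definition maximal_sub :: "('k, 'o, 'd, 'z) lincat_scheme \<Rightarrow> 'o \<Rightarrow> ('o, 'd) arr \<Rightarrow> bool" where
  "maximal_sub C X m \<longleftrightarrow> mono_arr C m \<and> trg m = X \<and> \<not> iso_arr C m \<and>
     (\<forall>n. mono_arr C n \<and> trg n = X \<and> factors_through C m n \<longrightarrow>
        iso_arr C n \<or> factors_through C n m)"

text \<open>The radical is the intersection of all maximal subobjects.\<close>

definition radical :: "('k, 'o, 'd, 'z) lincat_scheme \<Rightarrow> 'o \<Rightarrow> ('o, 'd) arr \<Rightarrow> bool" where
  "radical C X r \<longleftrightarrow> mono_arr C r \<and> trg r = X \<and>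
     (\<forall>m. maximal_sub C X m \<longrightarrow> factors_through C r m) \<and>
     (\<forall>f. arrow C f \<and> trg f = X \<and> (\<forall>m. maximal_sub C X m \<longrightarrow> factors_through C f m) \<longrightarrow>
        factors_through C f r)"

definition simple_top :: "('k, 'o, 'd, 'z) lincat_scheme \<Rightarrow> 'o \<Rightarrow> 'o \<Rightarrow> bool" where
  "simple_top C X T \<longleftrightarrow> simple_object C T \<and> (\<exists>r q. radical C X r \<and> cokernel C r q \<and> trg q = T)"


section \<open>Linear endofunctors and natural transformations\<close>

datatype ('o, 'd) endofunctor = Functor (fobj: "'o \<Rightarrow> 'o") (farr: "('o, 'd) arr \<Rightarrow> ('o, 'd) arr")

definition linear_functor :: "('k, 'o, 'd, 'z) lincat_scheme \<Rightarrow> ('o, 'd) endofunctor \<Rightarrow> bool" where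
  "linear_functor C F \<longleftrightarrow>
     (\<forall>X\<in>Obj C. fobj F X \<in> Obj C \<and> farr F (Idm C X) = Idm C (fobj F X)) \<and>
     (\<forall>X\<in>Obj C. \<forall>Y\<in>Obj C. \<forall>f\<in>Mor C X Y. farr F f \<in> Mor C (fobj F X) (fobj F Y)) \<and>
     (\<forall>X\<in>Obj C. \<forall>Y\<in>Obj C. \<forall>Z\<in>Obj C. \<forall>f\<in>Mor C X Y. \<forall>g\<in>Mor C Y Z.
        farr F (Cmp C g f) = Cmp C (farr F g) (farr F f)) \<and>
     (\<forall>X\<in>Obj C. \<forall>Y\<in>Obj C. \<forall>f\<in>Mor C X Y. \<forall>g\<in>Mor C X Y.
        farr F (Add C f g) = Add C (farr F f) (farr F g)) \<and>
     (\<forall>X\<in>Obj C. \<forall>Y\<in>Obj C. \<forall>f\<in>Mor C X Y. \<forall>c. farr F (Scl C c f) = Scl C c (farr F f))"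

text \<open>Components of natural transformations are extensional, so that equality of \<open>2\<close>-morphisms is
  equality of all components. Functors are not normalised outside the category; functors that agree
  on the category are isomorphic via the identity transformation.\<close>

definition endofunctor_cat ::
    "('k, 'o, 'd) lincat \<Rightarrow> ('k, ('o, 'd) endofunctor, 'o \<Rightarrow> ('o, 'd) arr) lincat" where
  "endofunctor_cat C =
     \<lparr> Obj = {F. linear_functor C F},
       Mor = (\<lambda>F G. {Arr F G \<eta> | \<eta>. \<eta> \<in> extensional (Obj C) \<and>
          (\<forall>X\<in>Obj C. \<eta> X \<in> Mor C (fobj F X) (fobj G X)) \<and>
          (\<forall>X\<in>Obj C. \<forall>Y\<in>Obj C. \<forall>f\<in>Mor C X Y.
             Cmp C (\<eta> Y) (farr F f) = Cmp C (farr G f) (\<eta> X))}),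
       Idm = (\<lambda>F. Arr F F (\<lambda>X\<in>Obj C. Idm C (fobj F X))),
       Cmp = (\<lambda>\<beta> \<alpha>. Arr (src \<alpha>) (trg \<beta>) (\<lambda>X\<in>Obj C. Cmp C (dat \<beta> X) (dat \<alpha> X))),
       Nul = (\<lambda>F G. Arr F G (\<lambda>X\<in>Obj C. Nul C (fobj F X) (fobj G X))),
       Add = (\<lambda>\<alpha> \<beta>. Arr (src \<alpha>) (trg \<alpha>) (\<lambda>X\<in>Obj C. Add C (dat \<alpha> X) (dat \<beta> X))),
       Scl = (\<lambda>c \<alpha>. Arr (src \<alpha>) (trg \<alpha>) (\<lambda>X\<in>Obj C. Scl C c (dat \<alpha> X))) \<rparr>"


section \<open>One-object 2-categories\<close>

text \<open>The underlying linear category is the category of \<open>1\<close>-morphisms (objects) and \<open>2\<close>-morphisms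
  (arrows) of the unique object; \<open>HObj\<close> and \<open>HArr\<close> are horizontal composition.\<close>

record ('k, 'o, 'd) two_cat = "('k, 'o, 'd) lincat" +
  Unit :: "'o"
  HObj :: "'o \<Rightarrow> 'o \<Rightarrow> 'o"
  HArr :: "('o, 'd) arr \<Rightarrow> ('o, 'd) arr \<Rightarrow> ('o, 'd) arr"

definition left_ge :: "('k, 'o, 'd) two_cat \<Rightarrow> 'o \<Rightarrow> 'o \<Rightarrow> bool" where
  "left_ge C G F \<longleftrightarrow> (\<exists>H\<in>Obj C. summand C G (HObj C H F))"

definition left_cell :: "('k, 'o, 'd) two_cat \<Rightarrow> 'o set \<Rightarrow> bool" where
  "left_cell C L \<longleftrightarrow> (\<exists>F. indecomposable C F \<and>
     L = {G. indecomposable C G \<and> left_ge C G F \<and> left_ge C F G})"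

text \<open>The abelianized principal \<open>2\<close>-representation. Its objects are the arrows of \<open>C\<close>.\<close>

definition diagram_maps :: "('k, 'o, 'd, 'z) lincat_scheme \<Rightarrow> ('o, 'd) arr \<Rightarrow> ('o, 'd) arr \<Rightarrow>
    (('o, 'd) arr \<times> ('o, 'd) arr) set" where
  "diagram_maps C \<alpha> \<alpha>' = {(f, g). f \<in> Mor C (src \<alpha>) (src \<alpha>') \<and> g \<in> Mor C (trg \<alpha>) (trg \<alpha>') \<and>
     Cmp C g \<alpha> = Cmp C \<alpha>' f}"

definition diagram_null :: "('k, 'o, 'd, 'z) lincat_scheme \<Rightarrow> ('o, 'd) arr \<Rightarrow> ('o, 'd) arr \<Rightarrow>
    (('o, 'd) arr \<times> ('o, 'd) arr) set" where
  "diagram_null C \<alpha> \<alpha>' = {(f, g) \<in> diagram_maps C \<alpha> \<alpha>'.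
     \<exists>h\<in>Mor C (trg \<alpha>) (src \<alpha>'). g = Cmp C \<alpha>' h}"

definition diagram_class :: "('k, 'o, 'd, 'z) lincat_scheme \<Rightarrow> ('o, 'd) arr \<Rightarrow> ('o, 'd) arr \<Rightarrow>
    ('o, 'd) arr \<times> ('o, 'd) arr \<Rightarrow> (('o, 'd) arr \<times> ('o, 'd) arr) set" where
  "diagram_class C \<alpha> \<alpha>' x =
     (\<lambda>n. (Add C (fst x) (fst n), Add C (snd x) (snd n))) ` diagram_null C \<alpha> \<alpha>'"

text \<open>Morphisms are cosets of \<open>diagram_null\<close>; the operations are computed on representatives, the
  unions running over sets that all coincide.\<close>

definition abelianized_principal :: "('k, 'o, 'd, 'z) lincat_scheme \<Rightarrow>
    ('k, ('o, 'd) arr, (('o, 'd) arr \<times> ('o, 'd) arr) set) lincat" where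
  "abelianized_principal C =
     \<lparr> Obj = {\<alpha>. arrow C \<alpha>},
       Mor = (\<lambda>\<alpha> \<alpha>'. {Arr \<alpha> \<alpha>' (diagram_class C \<alpha> \<alpha>' x) | x. x \<in> diagram_maps C \<alpha> \<alpha>'}),
       Idm = (\<lambda>\<alpha>. Arr \<alpha> \<alpha> (diagram_class C \<alpha> \<alpha> (Idm C (src \<alpha>), Idm C (trg \<alpha>)))),
       Cmp = (\<lambda>b a. Arr (src a) (trg b) (\<Union>x\<in>dat a. \<Union>y\<in>dat b.
          diagram_class C (src a) (trg b) (Cmp C (fst y) (fst x), Cmp C (snd y) (snd x)))),
       Nul = (\<lambda>\<alpha> \<alpha>'. Arr \<alpha> \<alpha>' (diagram_null C \<alpha> \<alpha>')),
       Add = (\<lambda>a b. Arr (src a) (trg a) (\<Union>x\<in>dat a. \<Union>y\<in>dat b.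
          diagram_class C (src a) (trg a) (Add C (fst x) (fst y), Add C (snd x) (snd y)))),
       Scl = (\<lambda>c a. Arr (src a) (trg a) (\<Union>x\<in>dat a.
          diagram_class C (src a) (trg a) (Scl C c (fst x), Scl C c (snd x)))) \<rparr>"

definition act :: "('k, 'o, 'd) two_cat \<Rightarrow> 'o \<Rightarrow> ('o, 'd) arr \<Rightarrow> ('o, 'd) arr" where
  "act C F \<alpha> = HArr C (Idm C F) \<alpha>"

definition proj_object :: "('k, 'o, 'd, 'z) lincat_scheme \<Rightarrow> 'o \<Rightarrow> ('o, 'd) arr" where
  "proj_object C F = Nul C (SOME Z. zero_object C Z) F"

text \<open>\<open>simple_at C F S\<close>: \<open>S\<close> is (a model of) the simple top \<open>L\<^sub>F\<close> of \<open>P\<^sub>F\<close>.\<close>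

definition simple_at :: "('k, 'o, 'd, 'z) lincat_scheme \<Rightarrow> 'o \<Rightarrow> ('o, 'd) arr \<Rightarrow> bool" where
  "simple_at C F S \<longleftrightarrow> simple_top (abelianized_principal C) (proj_object C F) S"

definition duflo_involution :: "('k, 'o, 'd) two_cat \<Rightarrow> 'o set \<Rightarrow> 'o \<Rightarrow> bool" where
  "duflo_involution C L G \<longleftrightarrow> left_cell C L \<and> indecomposable C G \<and>
     (let P = abelianized_principal C in
        \<exists>k q. mono_arr P k \<and> trg k = proj_object C (Unit C) \<and> cokernel P k q \<and>
          (\<forall>F\<in>L. \<forall>H S. indecomposable C H \<and> simple_at C H S \<and> subquotient P S (trg q) \<longrightarrow>
             zero_object P (act C F S)) \<and>
          (\<exists>T S. simple_top P (src k) T \<and> simple_at C G S \<and> isomorphic P T S) \<and>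
          (\<forall>F\<in>L. \<forall>S. simple_at C G S \<longrightarrow> \<not> zero_object P (act C F S)))"


section \<open>The 2-category of dual projection functors\<close>

text \<open>A small category equivalent to the category of finitely generated left \<open>A\<close>-modules. As \<open>A\<close> is
  finite dimensional, every such module is isomorphic to a column space \<open>k\<^sup>n\<close> on which \<open>A\<close> acts by
  matrices; an object is \<open>n\<close> together with this action.\<close>

type_synonym ('v, 'a, 'k) module_obj = "nat \<times> ((('v, 'a) path \<Rightarrow> 'k) \<Rightarrow> 'k mat)"

definition left_module ::
    "('v, 'a) pre_digraph \<Rightarrow> ('v, 'a, 'k::field) module_obj \<Rightarrow> bool" where
  "left_module Q M \<longleftrightarrow> (let A = path_algebra Q; n = fst M; \<rho> = snd M in
     \<rho> \<in> carrier A \<rightarrow>\<^sub>E carrier_mat n n \<and>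
     \<rho> \<one>\<^bsub>A\<^esub> = 1\<^sub>m n \<and>
     (\<forall>a\<in>carrier A. \<forall>b\<in>carrier A. \<rho> (a \<otimes>\<^bsub>A\<^esub> b) = \<rho> a * \<rho> b \<and> \<rho> (a \<oplus>\<^bsub>A\<^esub> b) = \<rho> a + \<rho> b) \<and>
     (\<forall>c. \<forall>a\<in>carrier A. \<rho> (\<lambda>p. c * a p) = c \<cdot>\<^sub>m \<rho> a))"

definition module_cat :: "('v, 'a) pre_digraph \<Rightarrow>
    ('k::field, ('v, 'a, 'k) module_obj, 'k mat) lincat" where
  "module_cat Q =
     \<lparr> Obj = {M. left_module Q M},
       Mor = (\<lambda>M N. {Arr M N T | T. T \<in> carrier_mat (fst N) (fst M) \<and>
          (\<forall>a\<in>carrier (path_algebra Q). T * snd M a = snd N a * T)}),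
       Idm = (\<lambda>M. Arr M M (1\<^sub>m (fst M))),
       Cmp = (\<lambda>g f. Arr (src f) (trg g) (dat g * dat f)),
       Nul = (\<lambda>M N. Arr M N (0\<^sub>m (fst N) (fst M))),
       Add = (\<lambda>f g. Arr (src f) (trg f) (dat f + dat g)),
       Scl = (\<lambda>c f. Arr (src f) (trg f) (c \<cdot>\<^sub>m dat f)) \<rparr>"

text \<open>\<open>k\<close>-bilinear \<open>A\<close>-balanced maps \<open>I \<times> M \<rightarrow> k\<^sup>n\<close>.\<close>

definition balanced_map :: "('v, 'a) pre_digraph \<Rightarrow> (('v, 'a) path \<Rightarrow> 'k::field) set \<Rightarrow>
    ('v, 'a, 'k) module_obj \<Rightarrow> nat \<Rightarrow> ((('v, 'a) path \<Rightarrow> 'k) \<Rightarrow> 'k vec \<Rightarrow> 'k vec) \<Rightarrow> bool" where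
  "balanced_map Q I M n b \<longleftrightarrow> (let A = path_algebra Q; V = carrier_vec (fst M) in
     (\<forall>x\<in>I. \<forall>v\<in>V. b x v \<in> carrier_vec n) \<and>
     (\<forall>x\<in>I. \<forall>y\<in>I. \<forall>v\<in>V. b (x \<oplus>\<^bsub>A\<^esub> y) v = b x v + b y v) \<and>
     (\<forall>x\<in>I. \<forall>v\<in>V. \<forall>w\<in>V. b x (v + w) = b x v + b x w) \<and>
     (\<forall>c. \<forall>x\<in>I. \<forall>v\<in>V. b (\<lambda>p. c * x p) v = c \<cdot>\<^sub>v b x v \<and> b x (c \<cdot>\<^sub>v v) = c \<cdot>\<^sub>v b x v) \<and>
     (\<forall>x\<in>I. \<forall>a\<in>carrier A. \<forall>v\<in>V. b (x \<otimes>\<^bsub>A\<^esub> a) v = b x (snd M a *\<^sub>v v)))"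

text \<open>\<open>T\<close> together with \<open>t x v = x \<otimes> v\<close> is the left \<open>A\<close>-module \<open>I \<otimes>\<^sub>A M\<close>.\<close>

definition tensor_product :: "('v, 'a) pre_digraph \<Rightarrow> (('v, 'a) path \<Rightarrow> 'k::field) set \<Rightarrow>
    ('v, 'a, 'k) module_obj \<Rightarrow> ('v, 'a, 'k) module_obj \<Rightarrow>
    ((('v, 'a) path \<Rightarrow> 'k) \<Rightarrow> 'k vec \<Rightarrow> 'k vec) \<Rightarrow> bool" where
  "tensor_product Q I M T t \<longleftrightarrow> balanced_map Q I M (fst T) t \<and>
     (\<forall>a\<in>carrier (path_algebra Q). \<forall>x\<in>I. \<forall>v\<in>carrier_vec (fst M).
        t (a \<otimes>\<^bsub>path_algebra Q\<^esub> x) v = snd T a *\<^sub>v t x v) \<and>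
     (\<forall>n b. balanced_map Q I M n b \<longrightarrow>
        (\<exists>!B. B \<in> carrier_mat n (fst T) \<and>
           (\<forall>x\<in>I. \<forall>v\<in>carrier_vec (fst M). B *\<^sub>v t x v = b x v)))"

definition tensor_functor :: "('v, 'a) pre_digraph \<Rightarrow> (('v, 'a) path \<Rightarrow> 'k::field) set \<Rightarrow>
    (('v, 'a, 'k) module_obj, 'k mat) endofunctor \<Rightarrow> bool" where
  "tensor_functor Q I F \<longleftrightarrow> linear_functor (module_cat Q) F \<and>
     (\<exists>\<tau>. (\<forall>M\<in>Obj (module_cat Q). tensor_product Q I M (fobj F M) (\<tau> M)) \<and>
        (\<forall>M\<in>Obj (module_cat Q). \<forall>N\<in>Obj (module_cat Q). \<forall>f\<in>Mor (module_cat Q) M N.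
           \<forall>x\<in>I. \<forall>v\<in>carrier_vec (fst M).
             dat (farr F f) *\<^sub>v \<tau> M x v = \<tau> N x (dat f *\<^sub>v v)))"

text \<open>The functor \<open>I \<otimes>\<^sub>A _\<close> on the small category above; it is determined up to natural
  isomorphism by \<open>tensor_functor\<close>.\<close>

definition Dp :: "('v, 'a) pre_digraph \<Rightarrow> (('v, 'a) path \<Rightarrow> 'k::field) set \<Rightarrow>
    (('v, 'a, 'k) module_obj, 'k mat) endofunctor" where
  "Dp Q I = (SOME F. tensor_functor Q I F)"

definition dual_projection_2cat :: "('v, 'a) pre_digraph \<Rightarrow>
    ('k::field, (('v, 'a, 'k) module_obj, 'k mat) endofunctor,
      ('v, 'a, 'k) module_obj \<Rightarrow> (('v, 'a, 'k) module_obj, 'k mat) arr) two_cat" where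
  "dual_projection_2cat Q =
     (let C = module_cat Q; E = endofunctor_cat C in
      \<lparr> Obj = add_closure E {Dp Q I | I. ideal I (path_algebra Q)},
        Mor = Mor E, Idm = Idm E, Cmp = Cmp E, Nul = Nul E, Add = Add E, Scl = Scl E,
        Unit = Functor (\<lambda>M. M) (\<lambda>f. f),
        HObj = (\<lambda>F G. Functor (fobj F \<circ> fobj G) (farr F \<circ> farr G)),
        HArr = (\<lambda>\<beta> \<alpha>.
          Arr (Functor (fobj (src \<beta>) \<circ> fobj (src \<alpha>)) (farr (src \<beta>) \<circ> farr (src \<alpha>)))
              (Functor (fobj (trg \<beta>) \<circ> fobj (trg \<alpha>)) (farr (trg \<beta>) \<circ> farr (trg \<alpha>)))
              (\<lambda>M\<in>Obj C. Cmp C (dat \<beta> (fobj (trg \<alpha>) M)) (farr (src \<beta>) (dat \<alpha> M)))) \<rparr>)"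

end

theory Submission
  imports Defs
begin

text \<open>Ideals of \<open>A\<close> are spanned by sets of paths, and the indecomposable ones among them are the
  connected ones. Since \<open>Q\<close> is a tree, there is at most one path between two vertices, so bimodule
  maps out of an indecomposable ideal are multiples of an inclusion; evaluating natural
  transformations at the regular module carries this over to the functors \<open>Dp\<^sub>U\<close>. Hence the category
  of 1-morphisms is generated by finitely many objects whose morphisms are those of a linearized
  poset, the unit being its greatest element.

  Moreover \<open>Dp\<^sub>U \<circ> Dp\<^sub>V \<cong> Dp\<^sub>U\<^sub>V\<close>. An ideal \<open>V\<close> satisfies \<open>I V = I\<close> iff it contains \<open>J\<close>, which makes
  \<open>Hom(Dp\<^sub>J, -) \<rightarrow> Hom(Dp\<^sub>I Dp\<^sub>J, Dp\<^sub>I -)\<close> bijective, so \<open>Dp\<^sub>I\<close> does not kill \<open>L\<^sub>J\<close>; and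
  \<open>I V = I (V \<inter> J)\<close> shows that \<open>Dp\<^sub>I\<close> kills \<open>L\<^sub>V\<close> whenever \<open>V\<close> is not contained in \<open>J\<close>. Hence the image
  \<open>K\<close> of \<open>Dp\<^sub>J\<close> in the unit projective has the required properties, and conversely the top of any
  admissible \<open>K\<close> must be \<open>L\<^sub>J\<close>.\<close>

subsection \<open>Linear categories\<close>

text \<open>The abelianization is never shown to be abelian, and radicals, cokernels and simple tops
  are known only by universal properties. The argument therefore works with points: a diagram
  \<open>av\<close> stands for the functor that sends X to Hom(X, trg av) modulo the maps factoring
  through \<open>av\<close>, and since every identity is a sum of maps through generators, it is
  enough to evaluate at the generators \<open>D s\<close>. The unit projective then has a
  one-dimensional space of points at each \<open>D s\<close>, its subobjects are governed by the
  down-closed sets of generators whose points they contain, and the simple object at g has nonzero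
  points at g only. A diagram is zero exactly when its arrow is a split epimorphism. So vanishing
  under Dp_I is proved by factoring an identity, and non-vanishing by pulling a hypothetical section
  back along Hom(Dp_J, -) -> Hom(Dp_I Dp_J, Dp_I -). The isomorphism of Dp_U Dp_V with Dp_UV rests
  on paths alone: two factorizations of a path into a member of U and a member of V differ by a path
  moved across the tensor sign.\<close>

definition hom :: "('k, 'o, 'd, 'z) lincat_scheme=>'o=>'o=>('o, 'd) arr set" where
 "hom C X Y = {f:Mor C X Y. X:Obj C & Y:Obj C}"

text \<open>Only sums are formed. The spanning sets below consist either of composites of arbitrary
  morphisms, which absorb scalars, or of terms whose plain sum is an identity. The objects X and Y
  name the zero morphism.\<close>

inductive_set aspan :: "('k, 'o, 'd, 'z) lincat_scheme=>'o=>'o=>('o, 'd) arr set=>('o, 'd) arr set"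
 for C X Y S where
 nul: "Nul C X Y:aspan C X Y S"
| base: "f:S==>f:aspan C X Y S"
| add: "f:aspan C X Y S==>g:aspan C X Y S==>Add C f g:aspan C X Y S"

text \<open>That \<open>Idm C X\<close> lies in the additive span of these composites says that X is
  a retract of a finite direct sum of objects \<open>D s\<close>; in this form generation by D is
  used throughout.\<close>

definition through :: "('k, 'o, 'd, 'z) lincat_scheme=>('s=>'o)=>'s set=>'o=>'o=>('o, 'd) arr set" where
 "through C D P X Y = {Cmp C i p | i p s. s:P & p:hom C X (D s) & i:hom C (D s) Y}"

text \<open>The axioms speak of \<open>hom\<close> and not of \<open>Mor\<close>: in the endofunctor
  category \<open>Mor\<close> puts no condition on its endpoints, whereas membership in
  \<open>hom\<close> carries the fact that both are objects. Negatives are obtained as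
  \<open>Scl C (-1)\<close>.\<close>

locale linear_category =
 fixes C :: "('k::field, 'o, 'd, 'z) lincat_scheme"
 assumes hom_src: "f:hom C X Y==>src f = X"
  and hom_trg: "f:hom C X Y==>trg f = Y"
  and Idm_hom [intro]: "X:Obj C==>Idm C X:hom C X X"
  and Cmp_hom [intro]: "g:hom C Y Z==>f:hom C X Y==>Cmp C g f:hom C X Z"
  and Cmp_assoc: "h:hom C Y Z==>g:hom C X Y==>f:hom C W X ==>
  Cmp C (Cmp C h g) f = Cmp C h (Cmp C g f)"
  and Cmp_Idm_left: "f:hom C X Y==>Cmp C (Idm C Y) f = f"
  and Cmp_Idm_right: "f:hom C X Y==>Cmp C f (Idm C X) = f"
  and Nul_hom [intro]: "X:Obj C==>Y:Obj C==>Nul C X Y:hom C X Y"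
  and Add_hom [intro]: "f:hom C X Y==>g:hom C X Y==>Add C f g:hom C X Y"
  and Scl_hom [intro]: "f:hom C X Y==>Scl C c f:hom C X Y"
  and Add_assoc: "f:hom C X Y==>g:hom C X Y==>h:hom C X Y ==>
  Add C (Add C f g) h = Add C f (Add C g h)"
  and Add_commute: "f:hom C X Y==>g:hom C X Y==>Add C f g = Add C g f"
  and Add_Nul: "f:hom C X Y==>Add C f (Nul C X Y) = f"
  and Scl_0: "f:hom C X Y==>Scl C 0 f = Nul C X Y"
  and Scl_1: "f:hom C X Y==>Scl C 1 f = f"
  and Scl_Scl: "f:hom C X Y==>Scl C a (Scl C b f) = Scl C (a * b) f"
  and Scl_add: "f:hom C X Y==>Scl C (a + b) f = Add C (Scl C a f) (Scl C b f)"
  and Scl_Add: "f:hom C X Y==>g:hom C X Y==>Scl C a (Add C f g) = Add C (Scl C a f) (Scl C a g)"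
  and Cmp_Add_left: "g:hom C Y Z==>h:hom C Y Z==>f:hom C X Y ==>
  Cmp C (Add C g h) f = Add C (Cmp C g f) (Cmp C h f)"
  and Cmp_Add_right: "g:hom C Y Z==>f:hom C X Y==>h:hom C X Y ==>
  Cmp C g (Add C f h) = Add C (Cmp C g f) (Cmp C g h)"
  and Cmp_Scl_left: "g:hom C Y Z==>f:hom C X Y==>Cmp C (Scl C a g) f = Scl C a (Cmp C g f)"
  and Cmp_Scl_right: "g:hom C Y Z==>f:hom C X Y==>Cmp C g (Scl C a f) = Scl C a (Cmp C g f)"
begin

abbreviation homc :: "'o=>'o=>('o, 'd) arr set" (\<open>H\<close>) where "H == hom C"
abbreviation cmpc (infixl \<open>**\<close> 70) where "g**f == Cmp C g f"
abbreviation addc (infixl \<open>+.\<close> 65) where "g+.f == Add C g f"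

lemma hom_Obj: "f:H X Y==>X:Obj C" "f:H X Y==>Y:Obj C"
 by (auto simp: hom_def)

lemma Scl_Nul: "X:Obj C==>Y:Obj C==>Scl C a (Nul C X Y) = Nul C X Y"
 using Scl_0[OF Nul_hom] Scl_Scl[OF Nul_hom, of X Y a 0] by simp

lemma Nul_Add: "f:H X Y==>Nul C X Y+.f = f"
 using Add_Nul Add_commute Nul_hom hom_Obj by metis

lemma Add_uminus: "f:H X Y==>f+.Scl C (-1) f = Nul C X Y"
 using Scl_add[of f X Y 1 "-1"] by (simp add: Scl_0 Scl_1)

lemma Cmp_Nul_right:
 assumes "g:H Y Z" "X:Obj C"
 shows "g**Nul C X Y = Nul C X Z"
proof -
 have n: "Nul C X Y:H X Y" using assms hom_Obj by auto
 show ?thesis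
  using Cmp_Scl_right[OF assms(1) n, of 0] Scl_0[OF n] Scl_0[OF Cmp_hom[OF assms(1) n]] by simp
qed

lemma Cmp_Nul_left:
 assumes "f:H X Y" "Z:Obj C"
 shows "Nul C Y Z**f = Nul C X Z"
proof -
 have n: "Nul C Y Z:H Y Z" using assms hom_Obj by auto
 show ?thesis
  using Cmp_Scl_left[OF n assms(1), of 0] Scl_0[OF n] Scl_0[OF Cmp_hom[OF n assms(1)]] by simp
qed

definition dif :: "('o, 'd) arr=>('o, 'd) arr=>('o, 'd) arr" (infixl \<open>-.\<close> 65) where
 "f-.g = f+.Scl C (-1) g"

lemma dif_hom [intro]: "f:H X Y==>g:H X Y==>f-.g:H X Y"
 by (auto simp: dif_def)

lemma dif_self: "f:H X Y==>f-.f = Nul C X Y"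
 by (simp add: dif_def Add_uminus)

lemma dif_Nul: "f:H X Y==>f-.Nul C X Y = f"
 by (simp add: dif_def Scl_Nul hom_Obj Add_Nul)

lemma uminus_Add: "f:H X Y==>Scl C (-1) f+.f = Nul C X Y"
 using Add_uminus Add_commute Scl_hom by metis

lemma add_dif:
 assumes "f:H X Y" "g:H X Y"
 shows "g+.(f-.g) = f"
proof -
 have m: "Scl C (-1) g:H X Y" using assms by auto
 have "g+.(f+.Scl C (-1) g) = g+.(Scl C (-1) g+.f)"
  using assms m Add_commute by metis
 also have "... = f" using assms m by (simp add: Add_assoc[symmetric] Add_uminus Nul_Add)
 finally show ?thesis by (simp add: dif_def)
qed

lemma dif_add:
 assumes "f:H X Y" "g:H X Y"
 shows "(g+.f)-.g = f"
proof -
 have m: "Scl C (-1) g:H X Y" using assms by auto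
 have "(g+.f)+.Scl C (-1) g = f+.(g+.Scl C (-1) g)"
  using assms m Add_commute Add_assoc by metis
 also have "... = f" using assms m by (simp add: Add_uminus Add_Nul)
 finally show ?thesis by (simp add: dif_def)
qed

lemma dif_eq_Nul: "f:H X Y==>g:H X Y==>f-.g = Nul C X Y==>f = g"
 using add_dif Add_Nul by metis

lemma Cmp_dif_left: "g:H Y Z==>h:H Y Z==>f:H X Y==>(g-.h)**f = g**f-.h**f"
 unfolding dif_def by (simp add: Cmp_Add_left[OF _ Scl_hom] Cmp_Scl_left)

lemma Cmp_dif_right: "g:H Y Z==>f:H X Y==>h:H X Y==>g**(f-.h) = g**f-.g**h"
 unfolding dif_def by (simp add: Cmp_Add_right[OF _ _ Scl_hom] Cmp_Scl_right)

lemma dif_trans: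
 assumes "f:H X Y" "g:H X Y" "h:H X Y"
 shows "(f-.g)+.(g-.h) = f-.h"
proof -
 have m: "Scl C (-1) g:H X Y" "Scl C (-1) h:H X Y" using assms by auto
 have "(f+.Scl C (-1) g)+.(g+.Scl C (-1) h)
  = f+.((Scl C (-1) g+.g)+.Scl C (-1) h)"
  using assms m by (simp add: Add_assoc Add_hom)
 thus ?thesis using assms m by (simp add: dif_def uminus_Add Nul_Add)
qed

lemma Scl_inverse: "f:H X Y==>c ~= 0==>Scl C (inverse c) (Scl C c f) = f"
 by (simp add: Scl_Scl Scl_1)

lemma Scl_eq_Nul: "f:H X Y==>Scl C c f = Nul C X Y==>c = 0 \<or> f = Nul C X Y"
 by (metis Scl_inverse Scl_Nul hom_Obj)

lemma aspan_hom: "f:aspan C X Y S==>S <= H X Y==>X:Obj C==>Y:Obj C==>f:H X Y"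
 by (induction rule: aspan.induct) auto

lemma aspan_subset:
 "f:aspan C X Y S==>S <= aspan C X Y T==>f:aspan C X Y T"
 by (induction rule: aspan.induct) (auto intro: aspan.intros)

lemma aspan_Cmp_left:
 assumes "f:aspan C X Y S" "S <= H X Y" "g:H Y Z" "X:Obj C"
 shows "g**f:aspan C X Z (Cmp C g ` S)"
 using assms(1)
proof (induction rule: aspan.induct)
 case nul
 thus ?case using Cmp_Nul_right[OF assms(3,4)] by (auto intro: aspan.intros)
next
 case (base f)
 thus ?case by (auto intro: aspan.intros)
next
 case (add f f')
 thus ?case
  using Cmp_Add_right[OF assms(3), of f X f'] aspan_hom assms hom_Obj
  by (metis aspan.add)
qed

lemma aspan_Cmp_right:
 assumes "f:aspan C X Y S" "S <= H X Y" "g:H W X" "Y:Obj C"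
 shows "f**g:aspan C W Y ((%f. f**g) ` S)"
 using assms(1)
proof (induction rule: aspan.induct)
 case nul
 thus ?case using Cmp_Nul_left[OF assms(3,4)] by (auto intro: aspan.intros)
next
 case (base f)
 thus ?case by (auto intro: aspan.intros)
next
 case (add f f')
 thus ?case
  using Cmp_Add_left[OF _ _ assms(3), of f Y f'] aspan_hom assms hom_Obj
  by (metis aspan.add)
qed

text \<open>The image on points: the maps X -> \<open>trg f\<close> that factor through f. A diagram
  \<open>av\<close> of the abelianization represents the cokernel of Hom(-, src av) -> Hom(-, trg
  av), so \<open>fact av X\<close> consists of the points at X that are zero in it.\<close>

definition fact :: "('o, 'd) arr=>'o=>('o, 'd) arr set" where
 "fact f X = {f**h | h. h:H X (src f)}"

lemma factI: "f:H Y Z==>h:H X Y==>f**h:fact f X"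
 by (auto simp: fact_def hom_src)

lemma factE: assumes "g:fact f X" "f:H Y Z" obtains h where "h:H X Y" "g = f**h"
 using assms by (auto simp: fact_def hom_src)

lemma fact_Nul: "f:H Y Z==>X:Obj C==>Nul C X Z:fact f X"
 using factI[OF _ Nul_hom, of f Y Z X] Cmp_Nul_right hom_Obj by metis

lemma fact_Add: "f:H Y Z==>g:fact f X==>h:fact f X==>g+.h:fact f X"
 by (auto elim!: factE simp: Cmp_Add_right[symmetric] intro!: factI)

lemma fact_Scl: "f:H Y Z==>g:fact f X==>Scl C c g:fact f X"
 by (auto elim!: factE simp: Cmp_Scl_right[symmetric] intro!: factI)

lemma fact_dif: "f:H Y Z==>g:fact f X==>h:fact f X==>g-.h:fact f X"
 unfolding dif_def by (intro fact_Add fact_Scl)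

lemma fact_Cmp: "f:H Y Z==>g:fact f X==>h:H W X==>g**h:fact f W"
 by (auto elim!: factE simp: Cmp_assoc intro!: factI)

lemma aspan_fact:
 "g:aspan C X Z S==>S <= fact f X==>f:H Y Z==>X:Obj C==>g:fact f X"
 by (induction rule: aspan.induct) (auto intro: fact_Nul fact_Add)

subsection \<open>The abelianization\<close>

abbreviation "A == abelianized_principal C"

definition ar :: "('o, 'd) arr=>bool" where "ar av \<longleftrightarrow> av:H (src av) (trg av)"

text \<open>Modulo homotopy a morphism of diagrams is determined by its component g on the targets.
  Of the component on the sources only the existence matters, and that is the condition that
  \<open>g**av\<close> factors through \<open>bv\<close>.\<close>

definition adm :: "('o, 'd) arr=>('o, 'd) arr=>('o, 'd) arr=>bool" where
 "adm av bv g \<longleftrightarrow> g:H (trg av) (trg bv) & g**av:fact bv (src av)"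

definition pcls where
 "pcls av bv g = {(f', g'):diagram_maps C av bv. g'-.g:fact bv (trg av)}"

text \<open>The morphism of diagrams induced by a map \<open>g\<close> between the targets; the map between the
  sources is irrelevant modulo homotopy.\<close>

definition pm :: "('o, 'd) arr=>('o, 'd) arr=>('o, 'd) arr =>
  (('o, 'd) arr, (('o, 'd) arr \<times> ('o, 'd) arr) set) arr" where
 "pm av bv g = Arr av bv (pcls av bv g)"

lemma pm_sel [simp]: "src (pm av bv g) = av" "trg (pm av bv g) = bv" by (auto simp: pm_def)

lemma Obj_A: "av:Obj A \<longleftrightarrow> ar av"
 by (auto simp: abelianized_principal_def ar_def arrow_def hom_def)

lemma ar_Obj: "ar av==>src av:Obj C" "ar av==>trg av:Obj C"
 by (auto simp: ar_def hom_def)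

lemma diagram_maps_iff:
 assumes "ar av" "ar bv"
 shows "(f, g):diagram_maps C av bv \<longleftrightarrow> f:H (src av) (src bv) & g:H (trg av) (trg bv) & g**av = bv**f"
 using assms by (auto simp: diagram_maps_def ar_def hom_def)

lemma diagram_maps_adm:
 assumes "ar av" "ar bv"
 shows "adm av bv g \<longleftrightarrow> (EX f. (f, g):diagram_maps C av bv)"
 using assms by (auto simp: diagram_maps_iff adm_def fact_def)

lemma diagram_null_iff:
 assumes "ar av" "ar bv"
 shows "(f, g):diagram_null C av bv \<longleftrightarrow> (f, g):diagram_maps C av bv & g:fact bv (trg av)"
 using assms by (auto simp: diagram_null_def fact_def hom_def ar_def)

text \<open>A null pair is constrained, beyond commutativity, only through its second component;
  hence a coset depends on the second component of its representative alone.\<close>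

lemma diagram_class_eq:
 assumes a: "ar av" "ar bv" and x: "x:diagram_maps C av bv"
 shows "diagram_class C av bv x = pcls av bv (snd x)"
proof -
 obtain f g where [simp]: "x = (f, g)" by force
 have fg: "f:H (src av) (src bv)" "g:H (trg av) (trg bv)" "g**av = bv**f"
  using x a by (auto simp: diagram_maps_iff)
 have aH: "av:H (src av) (trg av)" "bv:H (src bv) (trg bv)" using a by (auto simp: ar_def)
 have "(f', g'):diagram_class C av bv x \<longleftrightarrow> (f', g'):pcls av bv (snd x)" for f' g'
  proof
  assume "(f', g'):diagram_class C av bv x"
  then obtain n1 n2 where n: "(n1, n2):diagram_null C av bv" "f' = f+.n1" "g' = g+.n2"
  by (auto simp: diagram_class_def)
  hence m: "n1:H (src av) (src bv)" "n2:H (trg av) (trg bv)" "n2**av = bv**n1" "n2:fact bv (trg av)"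
  using a by (auto simp: diagram_null_iff diagram_maps_iff)
  show "(f', g'):pcls av bv (snd x)"
  using m fg n a aH by (auto simp: pcls_def diagram_maps_iff dif_add Cmp_Add_left Cmp_Add_right)
  next
  assume "(f', g'):pcls av bv (snd x)"
  hence m: "f':H (src av) (src bv)" "g':H (trg av) (trg bv)" "g'**av = bv**f'"
  and z: "g'-.g:fact bv (trg av)"
  using a by (auto simp: pcls_def diagram_maps_iff)
  have "(f'-.f, g'-.g):diagram_null C av bv"
  using a m fg z aH by (auto simp: diagram_null_iff diagram_maps_iff Cmp_dif_left Cmp_dif_right)
  moreover have "f+.(f'-.f) = f'" "g+.(g'-.g) = g'" using add_dif m fg by auto
  ultimately show "(f', g'):diagram_class C av bv x"
  by (force simp: diagram_class_def)
  qed
 thus ?thesis by auto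
qed

text \<open>Translates equations in the abelianization into factorizations in \<open>C\<close>; all
  later equalities of morphisms of diagrams are decided by it.\<close>

lemma pm_eq_iff:
 assumes a: "ar av" "ar bv" and g: "adm av bv g" "adm av bv g'"
 shows "pm av bv g = pm av bv g' \<longleftrightarrow> g-.g':fact bv (trg av)"
proof
 have gH: "g:H (trg av) (trg bv)" "g':H (trg av) (trg bv)" and bH: "bv:H (src bv) (trg bv)"
  using g a by (auto simp: adm_def ar_def)
 { assume "pm av bv g = pm av bv g'"
  moreover obtain f where "(f, g):diagram_maps C av bv" using g a diagram_maps_adm by blast
  moreover have "g-.g:fact bv (trg av)" using gH bH fact_Nul hom_Obj dif_self by metis
  ultimately show "g-.g':fact bv (trg av)" by (auto simp: pm_def pcls_def) }
 { assume z: "g-.g':fact bv (trg av)"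
  have "h-.g:fact bv (trg av) \<longleftrightarrow> h-.g':fact bv (trg av)" if "h:H (trg av) (trg bv)" for h
  proof -
  have 1: "h-.g' = (h-.g)+.(g-.g')" using dif_trans that gH by metis
  have 2: "h-.g = (h-.g')-.(g-.g')"
  using dif_add[of "h-.g" _ _ "g-.g'"] 1 Add_commute dif_hom gH that by metis
  show ?thesis using 1 2 z fact_Add[OF bH] fact_dif[OF bH] by metis
  qed
  thus "pm av bv g = pm av bv g'"
  using a by (auto simp: pm_def pcls_def diagram_maps_iff) }
qed

lemma Mor_A:
 assumes "ar av" "ar bv"
 shows "u:Mor A av bv \<longleftrightarrow> (EX g. adm av bv g & u = pm av bv g)"
 using assms diagram_class_eq[OF assms]
 by (auto simp: abelianized_principal_def pm_def diagram_maps_adm) force+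

lemma Mor_AE:
 assumes "u:Mor A av bv" "ar av" "ar bv" obtains g where "adm av bv g" "u = pm av bv g"
 using assms Mor_A by blast

lemma arrow_A: "arrow A u \<longleftrightarrow> ar (src u) & ar (trg u) & (EX g. adm (src u) (trg u) g & u = pm (src u) (trg u) g)"
 using Mor_A by (auto simp: arrow_def Obj_A)

lemma arrow_AE:
 assumes "arrow A u" obtains av bv g where "ar av" "ar bv" "adm av bv g" "u = pm av bv g"
 using assms arrow_A by blast

lemma arrow_pm: "ar av==>ar bv==>adm av bv g==>arrow A (pm av bv g)"
 using arrow_A by auto

lemma adm_hom: "adm av bv g==>g:H (trg av) (trg bv)" by (simp add: adm_def)

text \<open>This makes the map that g induces on points well defined: zero points go to zero
  points.\<close>

lemma adm_fact_Cmp: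
 assumes "ar av" "ar bv" "adm av bv g" "z:fact av X"
 shows "g**z:fact bv X"
proof -
 have aH: "av:H (src av) (trg av)" "bv:H (src bv) (trg bv)" using assms by (auto simp: ar_def)
 obtain h where "h:H X (src av)" "z = av**h" using assms(4) aH factE by blast
 thus ?thesis using assms fact_Cmp[OF aH(2), of "g**av" "src av" h X] Cmp_assoc[OF adm_hom aH(1)]
  by (auto simp: adm_def)
qed

lemma adm_Cmp: "ar av==>ar bv==>ar ga==>adm av bv g==>adm bv ga g'==>adm av ga (g'**g)"
 using adm_fact_Cmp[of bv ga g' "g**av" "src av"] Cmp_assoc[of g' _ _ g "trg av" av "src av"]
 by (auto simp: adm_def ar_def)

lemma adm_Idm: "ar av==>adm av av (Idm C (trg av))"
 unfolding adm_def using ar_Obj factI[of av "src av" "trg av" "Idm C (src av)" "src av"]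
 by (auto simp: ar_def Cmp_Idm_left Cmp_Idm_right)

lemma adm_Nul: "ar av==>ar bv==>adm av bv (Nul C (trg av) (trg bv))"
 unfolding adm_def using ar_Obj fact_Nul[of bv "src bv" "trg bv" "src av"]
 by (auto simp: ar_def Cmp_Nul_left)

lemma pm_Idm: assumes "ar av" shows "Idm A av = pm av av (Idm C (trg av))"
proof -
 have "(Idm C (src av), Idm C (trg av)):diagram_maps C av av"
  using assms by (auto simp: diagram_maps_iff ar_Obj) (simp add: ar_def Cmp_Idm_left Cmp_Idm_right)
 thus ?thesis using diagram_class_eq[OF assms assms] by (simp add: abelianized_principal_def pm_def)
qed

lemma pm_Nul: assumes "ar av" "ar bv" shows "Nul A av bv = pm av bv (Nul C (trg av) (trg bv))"
 using assms dif_Nul diagram_null_iff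
 by (auto simp: abelianized_principal_def pm_def pcls_def diagram_maps_iff)

text \<open>Composition is a union of cosets over all pairs of representatives. The cosets coincide
  and the index sets are nonempty, so the union is the coset of the composite.\<close>

lemma pm_Cmp:
 assumes a: "ar av" "ar bv" "ar ga" and g: "adm av bv g" and g': "adm bv ga g'"
 shows "Cmp A (pm bv ga g') (pm av bv g) = pm av ga (g'**g)"
proof -
 have aH: "av:H (src av) (trg av)" "bv:H (src bv) (trg bv)" "ga:H (src ga) (trg ga)"
  using a by (auto simp: ar_def)
 have *: "diagram_class C av ga (Cmp C (fst y) (fst x), Cmp C (snd y) (snd x)) = pcls av ga (g'**g)"
  if x: "x:pcls av bv g" and y: "y:pcls bv ga g'" for x y
 proof -
  have xx: "fst x:H (src av) (src bv)" "snd x:H (trg av) (trg bv)" "snd x**av = bv**fst x"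
  "snd x-.g:fact bv (trg av)" "adm av bv (snd x)"
  using x a diagram_maps_adm by (auto simp: pcls_def diagram_maps_iff)
  have yy: "fst y:H (src bv) (src ga)" "snd y:H (trg bv) (trg ga)" "snd y**bv = ga**fst y"
  "snd y-.g':fact ga (trg bv)" "adm bv ga (snd y)"
  using y a diagram_maps_adm by (auto simp: pcls_def diagram_maps_iff)
  have "(fst y**fst x, snd y**snd x):diagram_maps C av ga"
  proof -
  have "(snd y**snd x)**av = snd y**(bv**fst x)"
  using Cmp_assoc[OF yy(2) xx(2) aH(1)] xx(3) by simp
  also have "... = ga**(fst y**fst x)"
  using Cmp_assoc[OF yy(2) aH(2) xx(1)] Cmp_assoc[OF aH(3) yy(1) xx(1)] yy(3) by simp
  finally show ?thesis using xx yy a by (auto simp: diagram_maps_iff)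
  qed
  hence "diagram_class C av ga (Cmp C (fst y) (fst x), Cmp C (snd y) (snd x)) = pcls av ga (snd y**snd x)"
  using diagram_class_eq a by simp
  also have "pm av ga (snd y**snd x) = pm av ga (g'**g)"
  proof (subst pm_eq_iff)
  have gH: "g:H (trg av) (trg bv)" "g':H (trg bv) (trg ga)" using g g' by (auto simp: adm_def)
  \<comment> \<open>The two representatives are exchanged one at a time.\<close>
  have "snd y**snd x-.g'**g = (snd y**snd x-.snd y**g)+.(snd y**g-.g'**g)"
  using dif_trans[OF Cmp_hom[OF yy(2) xx(2)] Cmp_hom[OF yy(2) gH(1)] Cmp_hom[OF gH(2) gH(1)]] by simp
  also have "... = snd y**(snd x-.g)+.(snd y-.g')**g"
  using xx yy gH by (simp add: Cmp_dif_left Cmp_dif_right)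
  also have "...:fact ga (trg av)"
  using adm_fact_Cmp[OF a(2,3) yy(5) xx(4)] fact_Cmp[OF aH(3) yy(4) gH(1)] fact_Add[OF aH(3)] by blast
  finally show "snd y**snd x-.g'**g:fact ga (trg av)" .
  qed (use a g g' xx yy adm_Cmp in auto)
  hence "pcls av ga (snd y**snd x) = pcls av ga (g'**g)" by (simp add: pm_def)
  finally show ?thesis .
 qed
 have ne: "pcls av bv g ~= {}" if h: "ar av" "ar bv" "adm av bv g" for av bv g
 proof -
  obtain f where f: "(f, g):diagram_maps C av bv" using diagram_maps_adm h by blast
  moreover have "g-.g:fact bv (trg av)"
  using h fact_Nul[of bv] ar_Obj dif_self[of g "trg av" "trg bv"] by (auto simp: adm_def ar_def)
  ultimately show ?thesis by (auto simp: pcls_def)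
 qed
 have "(\<Union>x\<in>pcls av bv g. \<Union>y\<in>pcls bv ga g'. diagram_class C av ga (Cmp C (fst y) (fst x), Cmp C (snd y) (snd x)))
  = pcls av ga (g'**g)"
  using * ne[OF a(1,2) g] ne[OF a(2,3) g'] by auto
 thus ?thesis by (simp add: abelianized_principal_def pm_def)
qed

text \<open>Equality of the identity with the zero morphism means that the identity of the target
  factors through \<open>av\<close>: the zero objects are the split epimorphisms of
  \<open>C\<close>.\<close>

lemma zero_object_A: "zero_object A av \<longleftrightarrow> ar av & Idm C (trg av):fact av (trg av)"
proof -
 have "ar av==>pm av av (Idm C (trg av)) = pm av av (Nul C (trg av) (trg av)) \<longleftrightarrow> Idm C (trg av):fact av (trg av)"
  using pm_eq_iff[of av av "Idm C (trg av)" "Nul C (trg av) (trg av)"]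
  by (simp add: adm_Idm adm_Nul ar_Obj dif_Nul[OF Idm_hom])
 thus ?thesis by (auto simp: zero_object_def Obj_A pm_Idm pm_Nul)
qed

lemma zero_object_hom: "zero_object C Z==>f:H Z X==>f = Nul C Z X"
 by (metis Cmp_Idm_right Cmp_Nul_right zero_object_def)

text \<open>The universal property gives uniqueness only for factorizations of maps that annihilate
  f; a composite of u with q does so by associativity.\<close>

lemma cokernel_epi:
 assumes "cokernel A f q" "u:Mor A (trg q) Z" "v:Mor A (trg q) Z" "ar Z"
  and "Cmp A u q = Cmp A v q"
 shows "u = v"
proof -
 have f: "arrow A f" "arrow A q" "src q = trg f" "Cmp A q f = Nul A (src f) (trg q)"
  using assms(1) by (auto simp: cokernel_def)
 obtain av bv g where 1: "ar av" "ar bv" "adm av bv g" "f = pm av bv g" using f(1) arrow_AE by blast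
 obtain ga h where 2: "ar ga" "adm bv ga h" "q = pm bv ga h" using f(2,3) 1 arrow_AE by (metis pm_sel)
 obtain x where 3: "adm ga Z x" "u = pm ga Z x" using assms(2,4) 2 Mor_AE by (metis pm_sel(2))
 have 4: "Cmp A u q = pm bv Z (x**h)" "adm bv Z (x**h)" using pm_Cmp adm_Cmp 1 2 3 assms(4) by auto
 have "Cmp A (Cmp A u q) f = Cmp A u (Cmp A q f)"
  using 4 1 2 3 assms(4) by (simp add: pm_Cmp adm_Cmp Cmp_assoc[OF adm_hom adm_hom adm_hom])
 also have "... = Nul A av Z"
  using f(4) 1 2 3 assms(4) by (simp add: pm_Nul pm_Cmp adm_Nul Cmp_Nul_right[OF adm_hom] ar_Obj)
 finally have "Cmp A (Cmp A u q) f = Nul A (src f) Z" using 1 by simp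
 moreover have "Cmp A u q:Mor A (trg f) Z" using 4 1 assms(4) Mor_A by auto
 moreover have "Z:Obj A" using assms(4) Obj_A by simp
 ultimately have "EX! w. w:Mor A (trg q) Z & Cmp A w q = Cmp A u q"
  using assms(1) unfolding cokernel_def by blast
 thus ?thesis using assms(2,3,5) by metis
qed

end

section \<open>Typed calculus of morphisms and factorizations\<close>

context linear_category begin

text \<open>Typing becomes equations on \<open>src\<close> and \<open>trg\<close>, so that the
  simplifier can compute the type of a composite with \<open>typs\<close> and then rewrite with
  \<open>cat\<close>.\<close>

lemma hom_iff: "f:H X Y \<longleftrightarrow> ar f & src f = X & trg f = Y"
 by (auto simp: ar_def hom_src hom_trg)

lemma ar_Cmp: "ar g==>ar f==>trg f = src g==>ar (g**f)"
 and src_Cmp: "ar g==>ar f==>trg f = src g==>src (g**f) = src f"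
 and trg_Cmp: "ar g==>ar f==>trg f = src g==>trg (g**f) = trg g"
 using Cmp_hom[of g "src g" "trg g" f "src f"] by (auto simp: hom_iff)

lemma ar_Idm: "X:Obj C==>ar (Idm C X)"
 and src_Idm: "X:Obj C==>src (Idm C X) = X"
 and trg_Idm: "X:Obj C==>trg (Idm C X) = X"
 using Idm_hom[of X] by (auto simp: hom_iff)

lemma ar_Nul: "X:Obj C==>Y:Obj C==>ar (Nul C X Y)"
 and src_Nul: "X:Obj C==>Y:Obj C==>src (Nul C X Y) = X"
 and trg_Nul: "X:Obj C==>Y:Obj C==>trg (Nul C X Y) = Y"
 using Nul_hom[of X Y] by (auto simp: hom_iff)

lemma ar_Add: "ar g==>ar f==>src f = src g==>trg f = trg g==>ar (g+.f)"
 and src_Add: "ar g==>ar f==>src f = src g==>trg f = trg g==>src (g+.f) = src g"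
 and trg_Add: "ar g==>ar f==>src f = src g==>trg f = trg g==>trg (g+.f) = trg g"
 using Add_hom[of g "src g" "trg g" f] by (auto simp: hom_iff)

lemma ar_dif: "ar g==>ar f==>src f = src g==>trg f = trg g==>ar (g-.f)"
 and src_dif: "ar g==>ar f==>src f = src g==>trg f = trg g==>src (g-.f) = src g"
 and trg_dif: "ar g==>ar f==>src f = src g==>trg f = trg g==>trg (g-.f) = trg g"
 using dif_hom[of g "src g" "trg g" f] by (auto simp: hom_iff)

lemma ar_Scl: "ar f==>ar (Scl C c f)"
 and src_Scl: "ar f==>src (Scl C c f) = src f"
 and trg_Scl: "ar f==>trg (Scl C c f) = trg f"
 using Scl_hom[of f "src f" "trg f" c] by (auto simp: hom_iff)

lemmas typs = hom_iff ar_Obj ar_Cmp src_Cmp trg_Cmp ar_Idm src_Idm trg_Idm ar_Nul src_Nul trg_Nul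
 ar_Add src_Add trg_Add ar_dif src_dif trg_dif ar_Scl src_Scl trg_Scl

lemma assoc: "ar f==>ar g==>ar h==>trg f = src g==>trg g = src h==>(h**g)**f = h**(g**f)"
 using Cmp_assoc[of h _ _ g _ f] by (simp add: hom_iff)

lemma Idm_l: "ar f==>trg f = Y==>Idm C Y**f = f" and Idm_r: "ar f==>src f = X==>f**Idm C X = f"
 using Cmp_Idm_left[of f] Cmp_Idm_right[of f] by (auto simp: hom_iff)

lemma Nul_l: "ar f==>trg f = Y==>Z:Obj C==>Nul C Y Z**f = Nul C (src f) Z"
 and Nul_r: "ar f==>src f = Y==>Z:Obj C==>f**Nul C Z Y = Nul C Z (trg f)"
 using Cmp_Nul_left[of f _ Y Z] Cmp_Nul_right[of f Y _ Z] by (auto simp: hom_iff)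

lemma Add_l: "ar f==>ar g==>ar h==>src g = trg f==>src h = trg f==>trg g = trg h ==>
  (g+.h)**f = g**f+.h**f"
 and dif_l: "ar f==>ar g==>ar h==>src g = trg f==>src h = trg f==>trg g = trg h ==>
  (g-.h)**f = g**f-.h**f"
 using Cmp_Add_left[of g "trg f" "trg g" h f "src f"] Cmp_dif_left[of g "trg f" "trg g" h f "src f"]
 by (auto simp: hom_iff)

lemma Add_r: "ar f==>ar g==>ar h==>trg g = src f==>trg h = src f==>src g = src h ==>
  f**(g+.h) = f**g+.f**h"
 and dif_r: "ar f==>ar g==>ar h==>trg g = src f==>trg h = src f==>src g = src h ==>
  f**(g-.h) = f**g-.f**h"
 using Cmp_Add_right[of f "src f" "trg f" g "src g" h] Cmp_dif_right[of f "src f" "trg f" g "src g" h]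
 by (auto simp: hom_iff)

lemma Scl_l: "ar f==>ar g==>src g = trg f==>Scl C c g**f = Scl C c (g**f)"
 and Scl_r: "ar f==>ar g==>src g = trg f==>g**Scl C c f = Scl C c (g**f)"
 using Cmp_Scl_left[of g "trg f" "trg g" f "src f" c] Cmp_Scl_right[of g "trg f" "trg g" f "src f" c]
 by (auto simp: hom_iff)

lemma Add_Nul_r: "ar f==>src f = X==>trg f = Y==>f+.Nul C X Y = f"
 and Add_Nul_l: "ar f==>src f = X==>trg f = Y==>Nul C X Y+.f = f"
 and dif_Nul_r: "ar f==>src f = X==>trg f = Y==>f-.Nul C X Y = f"
 using Add_Nul[of f X Y] Nul_Add[of f X Y] dif_Nul[of f X Y] by (auto simp: hom_iff)

lemmas cat = assoc Idm_l Idm_r Nul_l Nul_r Add_l dif_l Add_r dif_r Scl_l Scl_r Add_Nul_r Add_Nul_l dif_Nul_r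
 Scl_Nul

lemma assoc_reduce: "ar f==>ar g==>ar h==>trg f = src g==>trg g = src h==>h**g = k==>h**(g**f) = k**f"
 using assoc by metis

lemma fact_iff: "ar f==>x:fact f X \<longleftrightarrow> (EX h. ar h & src h = X & trg h = src f & x = f**h)"
 by (auto simp: fact_def hom_iff)

lemma fact_typ: "x:fact f X==>ar f==>ar x & src x = X & trg x = trg f"
 by (auto simp: fact_iff typs)

lemma fact_NulI: "ar f==>X:Obj C==>Y = trg f==>Nul C X Y:fact f X"
 using fact_Nul[of f] by (simp add: hom_iff)

lemma fact_comp: "ar f==>ar h==>src f = trg h==>X = src h==>f**h:fact f X"
 by (auto simp: fact_iff)

lemma fact_precomp: "ar f==>g:fact f X==>ar h==>trg h = X==>Y = src h==>g**h:fact f Y"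
 using fact_Cmp[of f "src f" "trg f" g X h "src h"] by (simp add: hom_iff)

lemma fact_add: "ar f==>g:fact f X==>h:fact f X==>g+.h:fact f X"
 and fact_sub: "ar f==>g:fact f X==>h:fact f X==>g-.h:fact f X"
 and fact_scl: "ar f==>g:fact f X==>Scl C c g:fact f X"
 using fact_Add[of f "src f" "trg f" g X h] fact_dif[of f "src f" "trg f" g X h]
  fact_Scl[of f "src f" "trg f" g X c] by (auto simp: hom_iff)

lemma fact_of_dif: "ar f==>h-.g:fact f X==>g:fact f X==>ar h==>src h = X==>trg h = trg f==>h:fact f X"
 using fact_add[of f g X "h-.g"] add_dif[of h X "trg f" g] fact_typ[of g f X] by (simp add: hom_iff)

lemma fact_of_dif': "ar f==>h-.g:fact f X==>h:fact f X==>ar g==>src g = X==>trg g = trg f==>g:fact f X"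
proof -
 assume a: "ar f" "h-.g:fact f X" "h:fact f X" "ar g" "src g = X" "trg g = trg f"
 have hh: "ar h" "src h = X" "trg h = trg f" using fact_typ a by auto
 have "g+.(h-.g) = h" using add_dif[of h X "trg f" g] a hh by (simp add: hom_iff)
 hence "h-.(h-.g) = g"
  using dif_add[of g X "trg f" "h-.g"] Add_commute[of "h-.g" X "trg f" g] a hh by (simp add: typs)
 thus ?thesis using fact_sub[OF a(1) a(3) a(2)] by simp
qed

lemma Scl_div: "ar f==>c ~= 0==>Scl C (inverse c) (Scl C c f) = f"
 using Scl_inverse[of f] by (simp add: hom_iff)

lemma fact_unscl: "ar f==>Scl C c x:fact f X==>c ~= 0==>ar x==>x:fact f X"
 using fact_scl[of f "Scl C c x" X "inverse c"] Scl_div by simp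

lemma aspan_Nul: "f:aspan C X Y S==>S <= {Nul C X Y}==>X:Obj C==>Y:Obj C==>f = Nul C X Y"
 by (induction rule: aspan.induct) (auto simp: Add_Nul_r typs)

lemma aspan_fact': "g:aspan C X Z S==>S <= fact f X==>ar f==>trg f = Z==>X:Obj C==>g:fact f X"
 using aspan_fact[of g X Z S f "src f"] by (simp add: hom_iff)

lemma Mor_pm: "ar av==>ar bv==>adm av bv g==>pm av bv g:Mor A av bv"
 using Mor_A by blast

lemma adm_iff: "ar av==>ar bv==>adm av bv g \<longleftrightarrow> ar g & src g = trg av & trg g = trg bv & g**av:fact bv (src av)"
 by (auto simp: adm_def hom_iff)

lemma adm_typ: "adm av bv g==>ar g" "adm av bv g==>src g = trg av" "adm av bv g==>trg g = trg bv"
 by (auto simp: adm_def hom_iff)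

lemma factors_through_pm:
 assumes "ar av" "ar bv" "ar zv" "adm av bv g" "adm zv bv x"
 shows "factors_through A (pm zv bv x) (pm av bv g) \<longleftrightarrow> (EX u. adm zv av u & x-.g**u:fact bv (trg zv))"
proof -
 have "u:Mor A zv av & Cmp A (pm av bv g) u = pm zv bv x \<longleftrightarrow> (EX v. u = pm zv av v & adm zv av v & x-.g**v:fact bv (trg zv))" for u
  using assms by (auto simp: Mor_A pm_Cmp adm_Cmp pm_eq_iff[symmetric])
 thus ?thesis by (auto simp: factors_through_def Bex_def)
qed

text \<open>The monomorphism is tested on the projective object over X: maps from it to
  \<open>av\<close> are the maps X -> \<open>trg av\<close> modulo \<open>fact av X\<close>, so
  cancellation of morphisms becomes injectivity on points.\<close>

lemma mono_fact:
 assumes m: "mono_arr A (pm av bv g)" "ar av" "ar bv" "adm av bv g" and z: "zero_object C z"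
  and x: "x:H X (trg av)" "g**x:fact bv X"
 shows "x:fact av X"
proof -
 let ?o = "Nul C z X"
 have X: "X:Obj C" "z:Obj C" using x z hom_Obj by (auto simp: zero_object_def)
 hence o: "ar ?o" "src ?o = z" "trg ?o = X" by (auto simp: typs)
 have a: "adm ?o av x" "adm ?o av (Nul C X (trg av))"
  using o X assms by (auto simp: adm_iff typs cat intro: fact_NulI)
 have "Cmp A (pm av bv g) (pm ?o av x) = Cmp A (pm av bv g) (pm ?o av (Nul C X (trg av)))"
  using o a assms X x adm_typ[OF m(4)] adm_Cmp[OF o(1) m(2,3) a(1) m(4)] adm_Cmp[OF o(1) m(2,3) a(2) m(4)]
  by (simp add: pm_Cmp pm_eq_iff cat typs)
 hence "pm ?o av x = pm ?o av (Nul C X (trg av))"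
  using m a o Mor_pm by (auto simp: mono_arr_def Obj_A)
 thus ?thesis using o a assms x X by (simp add: pm_eq_iff cat typs)
qed

end

text \<open>In the application D runs over the functors \<open>Dp\<close> of the connected path
  ideals and \<open>e\<close> over the inclusions. Between two generators there is, up to scalars,
  one map if s <= t and none otherwise. Generation, biproducts and split idempotents make every
  indecomposable object isomorphic to a generator.\<close>

locale poset_category = linear_category C for C :: "('k::field, 'o, 'd, 'z) lincat_scheme" +
 fixes D :: "'s::order=>'o" and e :: "'s=>'s=>('o, 'd) arr" and P :: "'s set"
 assumes fin: "finite P"
  and D_Obj: "s:P==>D s:Obj C"
  and e_hom: "s:P==>t:P==>s <= t==>e s t:H (D s) (D t)"
  and e_id: "s:P==>e s s = Idm C (D s)"
  and e_cmp: "s:P==>t:P==>u:P==>s <= t==>t <= u==>e t u**e s t = e s u"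
  and hom_D: "s:P==>t:P==>f:H (D s) (D t)==>f ~= Nul C (D s) (D t) ==>
  s <= t & (EX c. f = Scl C c (e s t))"
  and e_nz: "s:P==>t:P==>s <= t==>e s t ~= Nul C (D s) (D t)"
  and biprod: "X:Obj C==>Y:Obj C==>EX Z. direct_sum C Z X Y"
  and zero_ex: "EX Z. zero_object C Z"
  and gen: "X:Obj C==>Idm C X:aspan C X X (through C D P X X)"
  and split: "X:Obj C==>f:H X X==>f**f = f ==>
  EX Y:Obj C. EX a:H X Y. EX b:H Y X. a**b = Idm C Y & b**a = f"
begin

lemma through_hom: "through C D P X Y <= H X Y"
 by (auto simp: through_def)

text \<open>Expanding \<open>Idm C (src f)\<close> into composites through generators writes f as a
  sum of terms (f i) p in which i starts at a generator; so a factorization has to be tested on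
  points at generators only.\<close>

lemma gen_fact:
 assumes f: "ar f" and a: "ar a" "trg a = trg f"
  and *: "!!s x. s:P==>x:H (D s) (src f)==>f**x:fact a (D s)"
 shows "f:fact a (src f)"
proof -
 have O: "src f:Obj C" using f ar_Obj by auto
 have "f**Idm C (src f):aspan C (src f) (trg f) (Cmp C f ` through C D P (src f) (src f))"
  by (rule aspan_Cmp_left[OF gen[OF O] through_hom _ O]) (use f in "simp add: hom_iff")
 moreover have "Cmp C f ` through C D P (src f) (src f) <= fact a (src f)"
 proof
  fix y assume "y:Cmp C f ` through C D P (src f) (src f)"
  then obtain i p s where y: "y = f**(i**p)" "s:P" "p:H (src f) (D s)" "i:H (D s) (src f)"
  by (auto simp: through_def)
  hence "y = (f**i)**p" using f by (simp add: assoc hom_iff)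
  thus "y:fact a (src f)" using *[OF y(2,4)] fact_precomp[OF a(1), of "f**i" "D s" p] y
  by (simp add: hom_iff)
 qed
 ultimately show ?thesis using aspan_fact' a O f by (metis Idm_r)
qed

lemma biprodE:
 assumes "X:Obj C" "Y:Obj C"
 obtains Z i1 i2 p1 p2 where "Z:Obj C" "i1:H X Z" "i2:H Y Z" "p1:H Z X" "p2:H Z Y"
  "p1**i1 = Idm C X" "p2**i2 = Idm C Y" "p1**i2 = Nul C Y X" "p2**i1 = Nul C X Y"
  "i1**p1+.i2**p2 = Idm C Z"
 using biprod[OF assms] unfolding direct_sum_def hom_def by blast

text \<open>h is the map out of the biproduct with components f and g, so its image on points is the
  sum of the two images. As a diagram, h represents the quotient by both.\<close>

lemma pair_fact:
 assumes "ar f" "ar g" "trg f = trg g"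
 obtains h where "ar h" "trg h = trg f" "f:fact h (src f)" "g:fact h (src g)"
  "!!X x. x:fact h X \<longleftrightarrow> (EX a b. a:H X (src f) & b:H X (src g) & x = f**a+.g**b)"
proof -
 obtain Z i1 i2 p1 p2 where Z: "Z:Obj C" "i1:H (src f) Z" "i2:H (src g) Z" "p1:H Z (src f)" "p2:H Z (src g)"
  and eq: "p1**i1 = Idm C (src f)" "p2**i2 = Idm C (src g)" "p1**i2 = Nul C (src g) (src f)"
  "p2**i1 = Nul C (src f) (src g)" "i1**p1+.i2**p2 = Idm C Z"
  using biprodE[of "src f" "src g"] assms ar_Obj by blast
 define h where "h = f**p1+.g**p2"
 have h: "ar h" "trg h = trg f" "src h = Z" using Z assms by (auto simp: h_def typs)
 have hx: "h**x = f**(p1**x)+.g**(p2**x)" if "ar x" "trg x = Z" for x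
  using that Z assms by (simp add: h_def typs cat)
 have hi1: "h**i1 = f" using hx[of i1] Z assms eq by (simp add: typs cat)
 have hi2: "h**i2 = g" using hx[of i2] Z assms eq by (simp add: typs cat)
 show thesis
 proof (rule that[OF h(1,2)])
  show "f:fact h (src f)" using hi1 h Z by (auto simp: fact_iff typs)
  show "g:fact h (src g)" using hi2 h Z by (auto simp: fact_iff typs)
  show "x:fact h X \<longleftrightarrow> (EX a b. a:H X (src f) & b:H X (src g) & x = f**a+.g**b)" for X x
  proof
  assume "x:fact h X"
  then obtain y where y: "ar y" "src y = X" "trg y = Z" "x = h**y" using h by (auto simp: fact_iff)
  show "EX a b. a:H X (src f) & b:H X (src g) & x = f**a+.g**b"
  by (rule exI[of _ "p1**y"], rule exI[of _ "p2**y"]) (use y hx Z in "simp add: typs")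
  next
  assume "EX a b. a:H X (src f) & b:H X (src g) & x = f**a+.g**b"
  then obtain a b where ab: "a:H X (src f)" "b:H X (src g)" "x = f**a+.g**b" by blast
  have "h**(i1**a+.i2**b) = (h**i1)**a+.(h**i2)**b"
  using ab Z h by (simp add: typs cat)
  hence "x = h**(i1**a+.i2**b)" using ab hi1 hi2 by simp
  thus "x:fact h X" using ab Z h by (auto simp: typs intro!: fact_comp)
  qed
 qed
qed

text \<open>The diagram \<open>ga\<close> is the quotient of \<open>bv\<close> by the image of g.
  The identity and the zero map, as morphisms from \<open>bv\<close> to \<open>ga\<close>, agree
  after composition with g, so cancellation makes \<open>ga\<close> zero: every x is the image of a
  point under g plus a zero point of \<open>bv\<close>. Cancellation is a hypothesis so that
  cokernels, epimorphisms and isomorphisms share the proof.\<close>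

lemma epi_fact:
 assumes ep: "!!Z u v. ar Z==>u:Mor A bv Z==>v:Mor A bv Z==>Cmp A u (pm av bv g) = Cmp A v (pm av bv g)==>u = v"
  and ar: "ar av" "ar bv" "adm av bv g" and x: "x:H X (trg bv)"
 obtains a where "a:H X (trg av)" "x-.g**a:fact bv X"
proof -
 have g: "ar g" "src g = trg av" "trg g = trg bv" using ar adm_typ by auto
 obtain ga where ga: "ar ga" "trg ga = trg bv" "g:fact ga (trg av)" "bv:fact ga (src bv)"
  and gax: "!!X x. x:fact ga X \<longleftrightarrow> (EX a b. a:H X (trg av) & b:H X (src bv) & x = g**a+.bv**b)"
  using pair_fact[of g bv] g ar(2) by metis
 have u: "adm bv ga (Idm C (trg bv))" using ga ar by (simp add: adm_iff typs cat)
 have v: "adm bv ga (Nul C (trg bv) (trg bv))" using ga ar by (simp add: adm_iff typs cat fact_NulI)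
 have "Cmp A (pm bv ga (Idm C (trg bv))) (pm av bv g) = Cmp A (pm bv ga (Nul C (trg bv) (trg bv))) (pm av bv g)"
  using u v ga ar g adm_Cmp[OF ar(1,2) ga(1) ar(3) u] adm_Cmp[OF ar(1,2) ga(1) ar(3) v]
  by (simp add: pm_Cmp pm_eq_iff typs cat)
 hence "pm bv ga (Idm C (trg bv)) = pm bv ga (Nul C (trg bv) (trg bv))"
  using ep[OF ga(1)] Mor_pm ar ga u v by blast
 hence "Idm C (trg bv):fact ga (trg bv)"
  using u v ga ar by (simp add: pm_eq_iff typs cat)
 hence "Idm C (trg bv)**x:fact ga X" using fact_precomp[OF ga(1), of _ "trg bv" x X] x by (simp add: hom_iff)
 hence "x:fact ga X" using x by (simp add: typs cat)
 then obtain a b where ab: "a:H X (trg av)" "b:H X (src bv)" "x = g**a+.bv**b" using gax by blast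
 have "x-.g**a = bv**b" using ab dif_add[of "bv**b" X "trg bv" "g**a"] ar g by (simp add: typs)
 thus thesis using that ab ar by (auto simp: fact_iff typs)
qed

lemma cokernel_fact:
 assumes "cokernel A f (pm av bv g)" "ar av" "ar bv" "adm av bv g" "x:H X (trg bv)"
 obtains a where "a:H X (trg av)" "x-.g**a:fact bv X"
 by (rule epi_fact[OF _ assms(2-5)]) (use assms(1) cokernel_epi in "auto simp: Obj_A")

lemma epi_arr_fact:
 assumes "epi_arr A (pm av bv g)" "ar av" "ar bv" "adm av bv g" "x:H X (trg bv)"
 obtains a where "a:H X (trg av)" "x-.g**a:fact bv X"
 by (rule epi_fact[OF _ assms(2-5)]) (use assms(1) in "auto simp: Obj_A epi_arr_def")

lemma mono_fact':
 assumes "mono_arr A (pm av bv g)" "ar av" "ar bv" "adm av bv g" "x:H X (trg av)" "g**x:fact bv X"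
 shows "x:fact av X"
 using mono_fact assms zero_ex by blast

text \<open>Two maps equalized by g differ by a map that g sends to zero; by \<open>gen_fact\<close>
  this difference is zero as soon as its points at generators are.\<close>

lemma monoI:
 assumes ar: "ar av" "ar bv" "adm av bv g"
  and *: "!!s x. s:P==>x:H (D s) (trg av)==>g**x:fact bv (D s)==>x:fact av (D s)"
 shows "mono_arr A (pm av bv g)"
 unfolding mono_arr_def
proof (intro conjI ballI impI)
 show "arrow A (pm av bv g)" using ar arrow_pm by auto
 fix Z u v assume Z: "Z:Obj A" and u: "u:Mor A Z (src (pm av bv g))" and v: "v:Mor A Z (src (pm av bv g))"
  and eq: "Cmp A (pm av bv g) u = Cmp A (pm av bv g) v"
 have aZ: "ar Z" using Z Obj_A by simp
 obtain x where x: "adm Z av x" "u = pm Z av x" using u Mor_AE aZ ar by (metis pm_sel(1))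
 obtain y where y: "adm Z av y" "v = pm Z av y" using v Mor_AE aZ ar by (metis pm_sel(1))
 have t: "ar g" "src g = trg av" "trg g = trg bv" "ar x" "src x = trg Z" "trg x = trg av" "ar y" "src y = trg Z" "trg y = trg av"
  using adm_typ ar x y by auto
 have "g**x-.g**y:fact bv (trg Z)"
  using eq x y ar aZ adm_Cmp[OF aZ ar(1,2)] by (simp add: pm_Cmp pm_eq_iff)
 hence gxy: "g**(x-.y):fact bv (trg Z)" using t by (simp add: cat typs)
 have "x-.y:fact av (src (x-.y))"
 proof (rule gen_fact)
  fix s w assume s: "s:P" and w: "w:H (D s) (src (x-.y))"
  have "(g**(x-.y))**w:fact bv (D s)"
  using fact_precomp[OF ar(2) gxy, of w "D s"] w t by (simp add: typs)
  hence "g**((x-.y)**w):fact bv (D s)" using w t by (simp add: assoc typs)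
  thus "(x-.y)**w:fact av (D s)" using *[OF s, of "(x-.y)**w"] w t by (simp add: typs)
 qed (use t ar in "auto simp: typs")
 thus "u = v" using x y aZ ar t by (simp add: pm_eq_iff typs)
qed

text \<open>Pointwise solvability and \<open>gen_fact\<close>, applied to the map with components g
  and \<open>bv\<close>, give x = g u + bv v. That u respects the relations of \<open>zv\<close>
  follows from injectivity of g.\<close>

lemma factor_mono:
 assumes m: "mono_arr A (pm av bv g)" and ar: "ar av" "ar bv" "adm av bv g" and z: "ar zv" "adm zv bv x"
  and *: "!!s w. s:P==>w:H (D s) (trg zv)==>EX y:H (D s) (trg av). x**w-.g**y:fact bv (D s)"
 obtains u where "adm zv av u" "x-.g**u:fact bv (trg zv)"
proof -
 have g: "ar g" "src g = trg av" "trg g = trg bv" "ar x" "src x = trg zv" "trg x = trg bv" using ar z adm_typ by auto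
 obtain ga where ga: "ar ga" "trg ga = trg bv" "g:fact ga (trg av)" "bv:fact ga (src bv)"
  and gax: "!!X x. x:fact ga X \<longleftrightarrow> (EX a b. a:H X (trg av) & b:H X (src bv) & x = g**a+.bv**b)"
  using pair_fact[of g bv] g ar(2) by metis
 have "x:fact ga (src x)"
 proof (rule gen_fact)
  fix s w assume s: "s:P" and w: "w:H (D s) (src x)"
  obtain y where y: "y:H (D s) (trg av)" "x**w-.g**y:fact bv (D s)" using *[OF s] w g by auto
  then obtain b where b: "b:H (D s) (src bv)" "x**w-.g**y = bv**b" using ar by (auto simp: fact_iff hom_iff)
  have "x**w = g**y+.bv**b" using add_dif[of "x**w" "D s" "trg bv" "g**y"] b y w g by (simp add: typs)
  thus "x**w:fact ga (D s)" using gax y b by blast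
 qed (use g ga in auto)
 then obtain u v where uv: "u:H (trg zv) (trg av)" "v:H (trg zv) (src bv)" "x = g**u+.bv**v"
  using gax g by auto
 have xu: "x-.g**u = bv**v" using uv dif_add[of "bv**v" "trg zv" "trg bv" "g**u"] ar g by (simp add: typs)
 have "u**zv:fact av (src zv)"
 proof (rule mono_fact'[OF m ar])
  show "u**zv:H (src zv) (trg av)" using uv z by (simp add: typs)
  have "x**zv-.g**(u**zv) = bv**(v**zv)"
  using arg_cong[OF xu, of "%t. t**zv"] uv z g ar by (simp add: typs cat)
  hence "x**zv-.g**(u**zv):fact bv (src zv)" using ar uv z by (simp add: typs fact_comp)
  moreover have "x**zv:fact bv (src zv)" using z ar by (simp add: adm_iff)
  ultimately show "g**(u**zv):fact bv (src zv)"
  using fact_of_dif'[OF ar(2)] uv z g ar by (simp add: typs)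
 qed
 hence "adm zv av u" using uv z ar by (simp add: adm_iff hom_iff)
 moreover have "x-.g**u:fact bv (trg zv)" using xu ar uv by (simp add: typs fact_comp)
 ultimately show thesis by (rule that)
qed

text \<open>Surjectivity on points lets the identity be lifted along g by
  \<open>factor_mono\<close>. The lift is a right inverse, and because g is mono also a left
  inverse.\<close>

lemma mono_iso:
 assumes m: "mono_arr A (pm av bv g)" and ar: "ar av" "ar bv" "adm av bv g"
  and *: "!!s w. s:P==>w:H (D s) (trg bv)==>EX y:H (D s) (trg av). w-.g**y:fact bv (D s)"
 shows "iso_arr A (pm av bv g)"
proof -
 have g: "ar g" "src g = trg av" "trg g = trg bv" using ar adm_typ by auto
 obtain u where u: "adm bv av u" "Idm C (trg bv)-.g**u:fact bv (trg bv)"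
 proof (rule factor_mono[OF m ar ar(2) adm_Idm[OF ar(2)]])
  fix s w assume "s:P" "w:H (D s) (trg bv)"
  thus "EX y:H (D s) (trg av). Idm C (trg bv)**w-.g**y:fact bv (D s)"
  using * by (auto simp: Cmp_Idm_left)
 qed
 have ut: "ar u" "src u = trg bv" "trg u = trg av" using u adm_typ by auto
 have b0: "Nul C (trg bv) (trg bv):fact bv (trg bv)" using ar by (simp add: fact_NulI typs)
 have gu: "g**u-.Idm C (trg bv):fact bv (trg bv)"
 proof -
  have "g**u:H (trg bv) (trg bv)" "Idm C (trg bv):H (trg bv) (trg bv)" using ut g ar by (auto simp: typs)
  hence "(Idm C (trg bv)-.g**u)+.(g**u-.Idm C (trg bv)) = Nul C (trg bv) (trg bv)"
  using dif_trans dif_self by metis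
  hence "(g**u-.Idm C (trg bv)) = Nul C (trg bv) (trg bv)-.(Idm C (trg bv)-.g**u)"
  using dif_add[of "g**u-.Idm C (trg bv)" "trg bv" "trg bv" "Idm C (trg bv)-.g**u"] ut g ar by (simp add: typs)
  thus ?thesis using fact_sub[OF ar(2) b0 u(2)] by simp
 qed
 have "u**g-.Idm C (trg av):fact av (trg av)"
 proof (rule mono_fact'[OF m ar])
  show "u**g-.Idm C (trg av):H (trg av) (trg av)" using ut g ar by (simp add: typs)
  have "g**(u**g-.Idm C (trg av)) = (g**u-.Idm C (trg bv))**g"
  using ut g ar by (simp add: typs cat)
  thus "g**(u**g-.Idm C (trg av)):fact bv (trg av)"
  using fact_precomp[OF ar(2) gu g(1)] g by simp
 qed
 thus ?thesis
  unfolding iso_arr_def using u gu ar ut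
  by (intro conjI bexI[of _ "pm bv av u"]) (auto simp: arrow_pm pm_Cmp pm_Idm pm_eq_iff adm_Cmp adm_Idm Mor_pm)
qed

lemma iso_surj:
 assumes "iso_arr A (pm av bv g)" and ar: "ar av" "ar bv" "adm av bv g" and x: "x:H X (trg bv)"
 obtains y where "y:H X (trg av)" "x-.g**y:fact bv X"
proof (rule epi_fact[OF _ ar x])
 fix Z u v assume Z: "ar Z" and u: "u:Mor A bv Z" and v: "v:Mor A bv Z"
  and eq: "Cmp A u (pm av bv g) = Cmp A v (pm av bv g)"
 obtain w where w: "w:Mor A bv av" "Cmp A (pm av bv g) w = Idm A bv" using assms(1) by (auto simp: iso_arr_def)
 obtain w0 where w0: "adm bv av w0" "w = pm bv av w0" using w ar Mor_AE by blast
 obtain u0 where u0: "adm bv Z u0" "u = pm bv Z u0" using u ar Z Mor_AE by blast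
 obtain v0 where v0: "adm bv Z v0" "v = pm bv Z v0" using v ar Z Mor_AE by blast
 have as: "Cmp A (Cmp A (pm bv Z y) (pm av bv g)) w = pm bv Z y" if y: "adm bv Z y" for y
 proof -
  have "Cmp A (Cmp A (pm bv Z y) (pm av bv g)) w = Cmp A (pm bv Z y) (Cmp A (pm av bv g) w)"
  using y w0 ar Z by (simp add: pm_Cmp adm_Cmp Cmp_assoc[OF adm_hom adm_hom adm_hom])
  also have "... = pm bv Z y" using w y ar Z adm_typ[OF y] by (simp add: pm_Idm pm_Cmp adm_Idm Idm_r)
  finally show ?thesis .
 qed
 show "u = v" using as[OF u0(1)] as[OF v0(1)] eq u0 v0 by metis
qed (use that in blast)

end

subsection \<open>Categories generated by a linearized poset\<close>

context linear_category begin

lemma aspan_mono: "f:aspan C X Y S==>S <= T==>f:aspan C X Y T"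
 by (rule aspan_subset) (auto intro: aspan.base)

text \<open>Isomorphic objects differ by a zero summand; in this way an isomorphism enters the
  relation \<open>summand\<close> of the left preorder.\<close>

lemma direct_sumI_inverse:
 assumes f: "f:H X Y" and g: "g:H Y X" and gf: "g**f = Idm C X" and fg: "f**g = Idm C Y"
  and Z: "zero_object C Z"
 shows "direct_sum C Y X Z"
proof -
 have ZO: "Z:Obj C" and Z0: "Idm C Z = Nul C Z Z" using Z by (auto simp: zero_object_def)
 have XY: "X:Obj C" "Y:Obj C" using f hom_Obj by auto
 have "Mor C X Y = H X Y" "Mor C Y X = H Y X" "Mor C Z Y = H Z Y" "Mor C Y Z = H Y Z"
  using XY ZO by (auto simp: hom_def)
 moreover have "f**g+.Nul C Z Y**Nul C Y Z = Idm C Y"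
  using XY ZO f g fg by (simp add: cat typs)
 moreover have "Nul C Y Z**Nul C Z Y = Idm C Z" "g**Nul C Z Y = Nul C Z X" "Nul C Y Z**f = Nul C X Z"
  using XY ZO Z0 f g by (simp_all add: cat typs)
 moreover have "Nul C Z Y:H Z Y" "Nul C Y Z:H Y Z" using XY ZO by auto
 ultimately show ?thesis
  unfolding direct_sum_def using f g gf XY ZO
  by (intro conjI bexI[of _ f] bexI[of _ "Nul C Z Y"] bexI[of _ g] bexI[of _ "Nul C Y Z"]) simp_all
qed

end

context poset_category begin

text \<open>B is isomorphic to the generator \<open>D h\<close>, and \<open>b s\<close> is the basis
  vector of Hom(D s, B) that corresponds to \<open>e s h\<close>. The identity functor and the
  members of a cell are isomorphic to generators but not equal to them.\<close>

definition rep :: "'o=>'s=>('s=>('o, 'd) arr)=>bool" where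
 "rep B h b \<longleftrightarrow> h:P & (EX a:H (D h) B. EX a':H B (D h). a'**a = Idm C (D h) & a**a' = Idm C B & b = (%s. a**e s h))"

lemma rep_D: "h:P==>rep (D h) h (%s. Idm C (D h)**e s h)"
 unfolding rep_def using D_Obj by (auto simp: typs cat intro!: bexI[of _ "Idm C (D h)"])

lemma e_typ: "s:P==>t:P==>s <= t==>ar (e s t) & src (e s t) = D s & trg (e s t) = D t"
 using e_hom by (simp add: hom_iff)

lemma rep_P: "rep B h b==>h:P" by (simp add: rep_def)

lemma rep_Obj: "rep B h b==>B:Obj C" by (auto simp: rep_def dest: hom_Obj)

lemma rep_b: assumes "rep B h b" "s:P" "s <= h" shows "ar (b s)" "src (b s) = D s" "trg (b s) = B"
 using assms e_typ by (auto simp: rep_def typs)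

lemma rep_hom:
 assumes "rep B h b" "s:P" "x:H (D s) B" "x ~= Nul C (D s) B"
 obtains c where "s <= h" "c ~= 0" "x = Scl C c (b s)"
proof -
 obtain a a' where a: "h:P" "a:H (D h) B" "a':H B (D h)" "a'**a = Idm C (D h)" "a**a' = Idm C B"
  "b = (%s. a**e s h)" using assms(1) by (auto simp: rep_def)
 have x: "x = a**(a'**x)"
  using a assms assoc[of x a' a] by (simp add: typs Idm_l)
 hence "a'**x ~= Nul C (D s) (D h)" using assms(2-4) a D_Obj by (auto simp: typs cat)
 then obtain c where c: "s <= h" "a'**x = Scl C c (e s h)"
  using hom_D[OF assms(2) a(1), of "a'**x"] a assms by (auto simp: typs)
 have "x = Scl C c (b s)" using x c a e_typ[OF assms(2) a(1) c(1)] by (simp add: typs cat)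
 moreover have "c ~= 0"
 proof
  assume "c = 0"
  hence "a'**x = Nul C (D s) (D h)" using c e_hom[OF assms(2) a(1) c(1)] Scl_0 by simp
  thus False using \<open>a'**x ~= Nul C (D s) (D h)\<close> by simp
 qed
 ultimately show thesis using that c by blast
qed

lemma rep_nz:
 assumes "rep B h b" "s:P" "s <= h" shows "b s ~= Nul C (D s) B"
proof
 assume n: "b s = Nul C (D s) B"
 obtain a a' where a: "h:P" "a:H (D h) B" "a':H B (D h)" "a'**a = Idm C (D h)" "a**a' = Idm C B"
  "b = (%s. a**e s h)" using assms(1) by (auto simp: rep_def)
 have "a'**b s = e s h" using a e_typ[OF assms(2) a(1) assms(3)] assoc[of "e s h" a a'] by (simp add: hom_iff Idm_l)
 moreover have "a'**b s = Nul C (D s) (D h)" using n a assms D_Obj by (simp add: typs cat)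
 ultimately show False using e_nz assms a by metis
qed

lemma rep_cmp:
 assumes "rep B h b" "s:P" "t:P" "s <= t" "t <= h" shows "b t**e s t = b s"
 using assms e_typ[of s t] e_typ[of t h] e_cmp[of s t h] by (auto simp: rep_def typs cat)

lemma rep_inv:
 assumes "rep B h b" obtains b' where "b':H B (D h)" "b h**b' = Idm C B"
proof -
 obtain a a' where a: "h:P" "a:H (D h) B" "a':H B (D h)" "a'**a = Idm C (D h)" "a**a' = Idm C B"
  "b = (%s. a**e s h)" using assms(1) by (auto simp: rep_def)
 thus thesis using that[of a'] e_id[of h] by (simp add: hom_iff cat)
qed

lemma rep_scl_nz:
 assumes "rep B h b" "s:P" "s <= h" "Scl C c (b s) = Nul C (D s) B" shows "c = 0"
 using Scl_eq_Nul[of "b s" "D s" B c] assms rep_nz rep_b by (auto simp: hom_iff)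

text \<open>A finite biproduct reduced to what presentations consume: the projections enter through
  the spanning of the identity, and maps out of Z with prescribed components exist.\<close>

definition is_sum :: "'i set=>('i=>'o)=>'o=>('i=>('o, 'd) arr)=>('i=>('o, 'd) arr)=>bool" where
 "is_sum K X Z io pp \<longleftrightarrow> Z:Obj C & (ALL k:K. io k:H (X k) Z & pp k:H Z (X k)) &
  Idm C Z:aspan C Z Z {io k**pp k | k. k:K} &
  (ALL W:Obj C. ALL fz. (ALL k:K. fz k:H (X k) W) --> (EX f:H Z W. ALL k:K. f**io k = fz k))"

lemma is_sumD:
 assumes "is_sum K X Z io pp"
 shows "Z:Obj C" "!!k. k:K==>io k:H (X k) Z & pp k:H Z (X k)"
  "Idm C Z:aspan C Z Z {io k**pp k | k. k:K}"
  "!!W fz. W:Obj C==>(!!k. k:K==>fz k:H (X k) W)==>EX f:H Z W. ALL k:K. f**io k = fz k"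
 using assms by (auto simp: is_sum_def)

lemma finite_sum:
 assumes "finite K" "!!k. k:K==>X k:Obj C"
 shows "EX Z io pp. is_sum K X Z io pp"
 using assms
proof (induction K rule: finite_induct)
 case empty
 obtain Z where Z: "zero_object C Z" using zero_ex by blast
 hence "Z:Obj C" "Idm C Z = Nul C Z Z" by (auto simp: zero_object_def)
 thus ?case by (intro exI[of _ Z]) (auto intro: aspan.nul simp: is_sum_def)
next
 case (insert k K)
 obtain Z io pp where "is_sum K X Z io pp" using insert.IH insert.prems by auto
 note Z = is_sumD(1)[OF this] and iopp = is_sumD(2)[OF this] and span = is_sumD(3)[OF this]
  and univ = is_sumD(4)[OF this]
 obtain Y i1 i2 p1 p2 where Y: "Y:Obj C" "i1:H Z Y" "i2:H (X k) Y" "p1:H Y Z" "p2:H Y (X k)"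
  and eq: "p1**i1 = Idm C Z" "p2**i2 = Idm C (X k)" "p1**i2 = Nul C (X k) Z"
  "p2**i1 = Nul C Z (X k)" "i1**p1+.i2**p2 = Idm C Y"
  by (rule biprodE[OF Z insert.prems[OF insertI1]])
 define io' where "io' j = (if j = k then i2 else i1**io j)" for j
 define pp' where "pp' j = (if j = k then p2 else pp j**p1)" for j
 show ?case
  unfolding is_sum_def
 proof (rule exI[of _ Y], rule exI[of _ io'], rule exI[of _ pp'], intro conjI ballI allI impI)
  show "Y:Obj C" by fact
  show "io' j:H (X j) Y" "pp' j:H Y (X j)" if "j:insert k K" for j
  using that Y iopp by (auto simp: io'_def pp'_def typs)
  let ?T = "{io' j**pp' j | j. j:insert k K}"
  have "(i1**Idm C Z)**p1:aspan C Y Y ((%f. f**p1) ` (Cmp C i1 ` {io j**pp j | j. j:K}))"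
  by (rule aspan_Cmp_right[OF aspan_Cmp_left[OF span]])
  (use Y Z iopp in "auto simp: typs")
  hence "i1**p1:aspan C Y Y ((%f. f**p1) ` (Cmp C i1 ` {io j**pp j | j. j:K}))"
  using Y by (simp add: hom_iff Idm_r)
  moreover have "(%f. f**p1) ` (Cmp C i1 ` {io j**pp j | j. j:K}) <= ?T"
  proof safe
  fix j assume j: "j:K"
  hence "(i1**(io j**pp j))**p1 = io' j**pp' j"
  using insert.hyps(2) iopp[OF j] Y by (auto simp: io'_def pp'_def typs cat)
  thus "EX j'. (i1**(io j**pp j))**p1 = io' j'**pp' j' & j':insert k K" using j by blast
  qed
  ultimately have 1: "i1**p1:aspan C Y Y ?T"
  by (rule aspan_mono)
  have "i2**p2 = io' k**pp' k" by (simp add: io'_def pp'_def)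
  hence 2: "i2**p2:aspan C Y Y ?T" by (intro aspan.base) blast
  show "Idm C Y:aspan C Y Y ?T" using aspan.add[OF 1 2] eq(5) by simp
  fix W fz assume W: "W:Obj C" and fz: "ALL j:insert k K. fz j:H (X j) W"
  obtain f where f: "f:H Z W" "ALL j:K. f**io j = fz j" using univ[OF W, of fz] fz by blast
  let ?g = "f**p1+.fz k**p2"
  have "?g**io' j = fz j" if j: "j:insert k K" for j
  proof (cases "j = k")
  case True
  thus ?thesis using f fz Y eq W Z insert.prems[of k] by (simp add: io'_def typs cat)
  next
  case False
  hence jK: "j:K" using j by simp
  have a: "p1**(i1**io j) = io j" "p2**(i1**io j) = Nul C (X j) (X k)"
  using assoc[of "io j" i1 p1] assoc[of "io j" i1 p2] eq iopp[OF jK] Y insert.prems[of k]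
  by (auto simp: hom_iff cat)
  show ?thesis using False f fz Y a W Z iopp[OF jK] insert.prems[of k] insert.prems[of j] jK
  by (simp add: io'_def typs cat)
  qed
  moreover have "?g:H Y W" using f fz Y by (simp add: typs)
  ultimately show "EX f:H Y W. ALL j:insert k K. f**io' j = fz j" by blast
 qed
qed

text \<open>The subfunctor of \<open>Hom(-, B)\<close> generated by the generators \<open>D t\<close>, \<open>t \<in> T\<close>, is presented by \<open>w\<close>;
  its inclusion is given by \<open>g\<close>.\<close>

definition presents :: "'o=>('s=>('o, 'd) arr)=>'s set=>('o, 'd) arr=>('o, 'd) arr=>bool" where
 "presents B b T w g \<longleftrightarrow> ar w & ar g & src g = trg w & trg g = B & g**w = Nul C (src w) B &
  (ALL s:P. ALL x:H (D s) (trg w). g**x = Nul C (D s) B --> x:fact w (D s)) &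
  (ALL t:T. b t:fact g (D t)) &
  (ALL s:P. ALL x:H (D s) (trg w). g**x ~= Nul C (D s) B --> (EX t:T. s <= t))"

text \<open>g has the components \<open>b t\<close> on the direct sum of the \<open>D t\<close>.
  Since \<open>b t**e s t\<close> is the same map \<open>b s\<close> for every t above s, the kernel
  of g on points is generated by the differences of the corresponding maps into the sum; w has these
  differences as components.\<close>

lemma presents_ex:
 assumes r: "rep B h b" and T: "T <= {t\<in>P. t <= h}"
 obtains w g where "presents B b T w g"
proof -
 have "T <= P" using T by blast
 hence fT: "finite T" using fin by (rule finite_subset)
 have TP: "t:P" "t <= h" if "t:T" for t using T that by auto
 have B: "B:Obj C" by (rule rep_Obj[OF r])
 obtain Z io pp where "is_sum T D Z io pp" using finite_sum[OF fT, of D] TP D_Obj by blast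
 note Z = is_sumD(1)[OF this] and iopp = is_sumD(2)[OF this] and span = is_sumD(3)[OF this]
  and univ = is_sumD(4)[OF this]
 have "b j:H (D j) B" if "j:T" for j using rep_b[OF r] TP that by (simp add: hom_iff)
 from univ[OF B, of b, OF this] obtain g where g: "g:H Z B" and gio: "ALL j:T. g**io j = b j"
  by blast
 have g: "g:H Z B" "!!j. j:T==>g**io j = b j" using g gio by blast+
 \<comment> \<open>One relation for each generator s together with two members t and u of T above
   it.\<close>
 define K where "K = {(s, t, u). s:P & t:T & u:T & s <= t & s <= u}"
 have fK: "finite K" by (rule finite_subset[of _ "P \<times> T \<times> T"]) (use fin fT in "auto simp: K_def")
 have "D (fst k):Obj C" if "k:K" for k using that D_Obj by (auto simp: K_def)
 then obtain W io2 pp2 where "is_sum K (%k. D (fst k)) W io2 pp2"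
  using finite_sum[OF fK, of "%k. D (fst k)"] by blast
 note W = is_sumD(1)[OF this] and iopp2 = is_sumD(2)[OF this] and span2 = is_sumD(3)[OF this]
  and univ2 = is_sumD(4)[OF this]
 define fz where "fz = (%(s, t, u). io t**e s t-.io u**e s u)"
 have fz: "fz k:H (D (fst k)) Z & g**fz k = Nul C (D (fst k)) B" if k: "k:K" for k
 proof -
  obtain s t u where [simp]: "k = (s, t, u)" by (cases k)
  have stu: "s:P" "t:T" "u:T" "s <= t" "s <= u" "t:P" "u:P" using k TP by (auto simp: K_def)
  note st = iopp[OF stu(2)] iopp[OF stu(3)] e_typ[OF stu(1,6,4)] e_typ[OF stu(1,7,5)]
  have ty: "fz k:H (D s) Z" using st by (simp add: fz_def typs)
  have "g**fz k = (g**io t)**e s t-.(g**io u)**e s u"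
  using st g(1) by (simp add: fz_def typs cat)
  also have "... = b s-.b s" using stu g TP rep_cmp[OF r] by simp
  also have "... = Nul C (D s) B" using dif_self[of "b s" "D s" B] rep_b[OF r, of s] stu TP[of t]
  by (auto simp: hom_iff)
  finally show ?thesis using ty by simp
 qed
 have "fz k:H (D (fst k)) Z" if "k:K" for k using fz[OF that] by simp
 from univ2[OF Z, of fz, OF this] obtain w where w: "w:H W Z" and wio: "ALL j:K. w**io2 j = fz j"
  by blast
 have w: "w:H W Z" "!!j. j:K==>w**io2 j = fz j" using w wio by blast+
 have gw: "g**w = Nul C W B"
 proof -
  have "(g**w)**Idm C W:aspan C W B (Cmp C (g**w) ` {io2 j**pp2 j | j. j:K})"
  by (rule aspan_Cmp_left[OF span2]) (use W g w iopp2 in "auto simp: typs")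
  moreover have "Cmp C (g**w) ` {io2 j**pp2 j | j. j:K} <= {Nul C W B}"
  proof safe
  fix j assume j: "j:K"
  have dj: "D (fst j):Obj C" using j iopp2 hom_Obj by blast
  have "(g**w)**(io2 j**pp2 j) = g**((w**io2 j)**pp2 j)" using j iopp2[OF j] g w(1) by (simp add: typs cat)
  also have "... = (g**fz j)**pp2 j"
  using assoc[of "pp2 j" "fz j" g] w(2)[OF j] fz[OF j] iopp2[OF j] g(1) by (simp add: hom_iff)
  finally show "(g**w)**(io2 j**pp2 j) = Nul C W B" using fz[OF j] iopp2[OF j] dj B by (simp add: typs cat)
  qed
  ultimately have "(g**w)**Idm C W = Nul C W B" by (rule aspan_Nul) (use W B in auto)
  thus ?thesis using g(1) w(1) by (simp add: typs cat)
 qed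
 \<comment> \<open>Stated as an alternative so that both clauses of \<open>presents\<close> can be
   read off: either x is a relation killed by g, or s lies below a member of T and the kernel
   condition makes x a relation.\<close>
 have el: "(x:fact w (D s) & g**x = Nul C (D s) B) \<or> ((EX t:T. s <= t) & (g**x = Nul C (D s) B --> x:fact w (D s)))"
  if s: "s:P" and x: "x:H (D s) Z" for s x
 proof -
  have "Idm C Z**x:aspan C (D s) Z ((%f. f**x) ` {io j**pp j | j. j:T})"
  by (rule aspan_Cmp_right[OF span _ x Z]) (use iopp in "auto simp: typs")
  hence xs: "x:aspan C (D s) Z ((%f. f**x) ` {io j**pp j | j. j:T})"
  using x by (simp add: Cmp_Idm_left)
  have Ds: "D s:Obj C" using s D_Obj by simp
  show ?thesis
  proof (cases "EX t:T. s <= t")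
  case False
  have "(%f. f**x) ` {io j**pp j | j. j:T} <= {Nul C (D s) Z}"
  proof safe
  fix j assume j: "j:T"
  have "pp j**x = Nul C (D s) (D j)" using hom_D[OF s TP(1)[OF j], of "pp j**x"] False j iopp[OF j] x
  by (auto simp: typs)
  thus "(io j**pp j)**x = Nul C (D s) Z" using iopp[OF j] x Ds by (simp add: typs cat)
  qed
  hence "x = Nul C (D s) Z" using aspan_Nul[OF xs] Ds Z by simp
  thus ?thesis using fact_NulI[of w "D s" Z] w(1) g(1) Ds by (simp add: typs cat)
  next
  case True
  then obtain t0 where t0: "t0:T" "s <= t0" "t0:P" using TP by auto
  \<comment> \<open>Modulo the relations every map from \<open>D s\<close> into the sum is a
    multiple of the one through a fixed summand \<open>t0\<close>.\<close>
  let ?y = "io t0**e s t0"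
  have yt: "ar ?y" "src ?y = D s" "trg ?y = Z" using t0 iopp e_typ s by (auto simp: typs)
  have "EX c. x-.Scl C c ?y:fact w (D s)"
  proof -
  have "y:H (D s) Z & (EX c. y-.Scl C c ?y:fact w (D s))"
  if "y:aspan C (D s) Z ((%f. f**x) ` {io j**pp j | j. j:T})" for y using that
  proof (induction rule: aspan.induct)
  case nul
  have "Nul C (D s) Z-.Scl C 0 ?y = Nul C (D s) Z"
  using Scl_0[of ?y "D s" Z] yt Ds Z by (simp add: typs cat)
  hence "Nul C (D s) Z-.Scl C 0 ?y:fact w (D s)"
  using fact_NulI[of w "D s" Z] w(1) Ds by (simp add: hom_iff)
  thus ?case using Ds Z by blast
  next
  case (base y)
  then obtain j where j: "j:T" "y = (io j**pp j)**x" by auto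
  have yy: "y:H (D s) Z" using j iopp[OF j(1)] x by (simp add: typs)
  show ?case
  proof (cases "pp j**x = Nul C (D s) (D j)")
  case True
  hence "y = Nul C (D s) Z" using j iopp[OF j(1)] x Ds by (simp add: typs cat)
  moreover have "Nul C (D s) Z-.Scl C 0 ?y = Nul C (D s) Z"
  using Scl_0[of ?y "D s" Z] yt Ds Z by (simp add: typs cat)
  ultimately have "y-.Scl C 0 ?y:fact w (D s)"
  using fact_NulI[of w "D s" Z] w(1) Ds by (simp add: hom_iff)
  thus ?thesis using yy by blast
  next
  case False
  then obtain c where c: "s <= j" "pp j**x = Scl C c (e s j)"
  using hom_D[OF s TP(1)[OF j(1)], of "pp j**x"] iopp[OF j(1)] x by (auto simp: typs)
  have k: "(s, j, t0):K" using s j t0 c by (auto simp: K_def)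
  have ej: "ar (e s j)" "src (e s j) = D s" "trg (e s j) = D j" using e_typ s TP j c by auto
  have "y = Scl C c (io j**e s j)" using j c iopp[OF j(1)] x ej by (simp add: typs cat)
  moreover have "Scl C c (io j**e s j)-.Scl C c ?y = Scl C c (fz (s, j, t0))"
  using yt iopp[OF j(1)] ej unfolding fz_def dif_def
  by (simp add: typs Scl_Add[of _ "D s" Z] Scl_Scl[of _ "D s" Z])
  moreover have "fz (s, j, t0):fact w (D s)"
  using w(2)[OF k] w(1) iopp2[OF k] fact_comp[of w "io2 (s, j, t0)" "D s"] by (simp add: typs)
  ultimately have "y-.Scl C c ?y:fact w (D s)" using fact_scl w(1) by (simp add: hom_iff)
  thus ?thesis using yy by blast
  qed
  next
  case (add y y')
  then obtain c c' where c: "y-.Scl C c ?y:fact w (D s)" "y'-.Scl C c' ?y:fact w (D s)"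
  and yy: "y:H (D s) Z" "y':H (D s) Z" by auto
  have m: "Scl C (-c) ?y:H (D s) Z" "Scl C (-c') ?y:H (D s) Z" using yt by (auto simp: typs)
  have "(y+.y')-.Scl C (c + c') ?y = (y+.y')+.(Scl C (-c) ?y+.Scl C (-c') ?y)"
  using yt Scl_add[of ?y "D s" Z "-c" "-c'"] unfolding dif_def
  by (simp add: Scl_Scl[of _ "D s" Z] typs)
  also have "... = (y+.Scl C (-c) ?y)+.(y'+.Scl C (-c') ?y)"
  proof -
  have "(y+.y')+.(Scl C (-c) ?y+.Scl C (-c') ?y) = y+.((y'+.Scl C (-c) ?y)+.Scl C (-c') ?y)"
  using yy m by (simp add: Add_assoc[of _ "D s" Z] Add_hom)
  also have "y'+.Scl C (-c) ?y = Scl C (-c) ?y+.y'" by (rule Add_commute[OF yy(2) m(1)])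
  also have "y+.((Scl C (-c) ?y+.y')+.Scl C (-c') ?y) = (y+.Scl C (-c) ?y)+.(y'+.Scl C (-c') ?y)"
  using yy m by (simp add: Add_assoc[of _ "D s" Z] Add_hom)
  finally show ?thesis .
  qed
  also have "... = (y-.Scl C c ?y)+.(y'-.Scl C c' ?y)"
  using yt unfolding dif_def by (simp add: Scl_Scl[of _ "D s" Z] typs)
  also have "...:fact w (D s)" using fact_add c w(1) by (simp add: hom_iff)
  finally show ?case using yy by blast
  qed
  thus ?thesis using xs by blast
  qed
  then obtain c where c: "x-.Scl C c ?y:fact w (D s)" by blast
  \<comment> \<open>The multiple c of \<open>?y\<close> is sent by g to
    \<open>Scl C c (b s)\<close>, so an element of the kernel has c = 0 and is itself a
    relation.\<close>
  have "x:fact w (D s)" if gx: "g**x = Nul C (D s) B"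
  proof -
  obtain v where v: "ar v" "src v = D s" "trg v = W" "x-.Scl C c ?y = w**v"
  using c w(1) by (auto simp: fact_iff hom_iff)
  have "g**(w**v) = Nul C (D s) B" using gw v w(1) g(1) B assoc[of v w g] by (simp add: hom_iff Nul_l)
  hence "g**(x-.Scl C c ?y) = Nul C (D s) B" using v by simp
  hence "g**x = g**Scl C c ?y"
  using dif_eq_Nul[of "g**x" "D s" B "g**Scl C c ?y"] x g(1) yt by (simp add: typs cat)
  also have "... = Scl C c ((g**io t0)**e s t0)" using g(1) yt iopp[OF t0(1)] e_typ[OF s t0(3,2)]
  by (simp add: typs cat)
  also have "... = Scl C c (b s)" using g(2) t0 rep_cmp[OF r s t0(3,2)] TP by simp
  finally have "c = 0" using rep_scl_nz[OF r s] gx t0 TP(2)[OF t0(1)] by auto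
  hence "x-.Scl C c ?y = x" using Scl_0[of ?y "D s" Z] yt x by (simp add: typs cat)
  thus ?thesis using c by simp
  qed
  thus ?thesis using True by simp
  qed
 qed
 have "presents B b T w g"
  unfolding presents_def
 proof (intro conjI ballI impI)
  show "g**w = Nul C (src w) B" using gw w by (simp add: hom_iff)
  show "b t:fact g (D t)" if "t:T" for t
  using g(2)[OF that] g(1) iopp[OF that] fact_comp[of g "io t" "D t"] by (simp add: hom_iff)
  show "x:fact w (D s)" if "s:P" "x:H (D s) (trg w)" "g**x = Nul C (D s) B" for s x
  using el[of s x] that w by (auto simp: hom_iff)
  show "EX t:T. s <= t" if "s:P" "x:H (D s) (trg w)" "g**x ~= Nul C (D s) B" for s x
  using el[of s x] that w by (auto simp: hom_iff)
 qed (use g w in "auto simp: hom_iff")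
 thus thesis by (rule that)
qed

text \<open>Composing \<open>b t\<close> with \<open>e s t\<close> gives \<open>b s\<close>, which
  spans Hom(D s, B). So at each generator the image of g is everything or zero, according to whether
  s lies below T.\<close>

lemma presents_fact:
 assumes r: "rep B h b" and p: "presents B b T w g" and T: "T <= {t\<in>P. t <= h}" and s: "s:P"
 shows "x:fact g (D s) \<longleftrightarrow> x:H (D s) B & (x ~= Nul C (D s) B --> (EX t:T. s <= t))"
proof
 assume x: "x:fact g (D s)"
 then obtain y where "ar y" "src y = D s" "trg y = src g" "x = g**y" using p by (auto simp: presents_def fact_iff)
 thus "x:H (D s) B & (x ~= Nul C (D s) B --> (EX t:T. s <= t))" using p s by (auto simp: presents_def typs)
next
 assume x: "x:H (D s) B & (x ~= Nul C (D s) B --> (EX t:T. s <= t))"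
 have g: "ar g" "trg g = B" using p by (auto simp: presents_def)
 show "x:fact g (D s)"
 proof (cases "x = Nul C (D s) B")
  case True
  thus ?thesis using g s D_Obj fact_NulI by auto
 next
  case False
  then obtain t where t: "t:T" "s <= t" using x by auto
  hence tP: "t:P" "t <= h" using T by auto
  obtain c where c: "x = Scl C c (b s)" using rep_hom[OF r s] x False by metis
  have "b t:fact g (D t)" using p t by (auto simp: presents_def)
  hence "b t**e s t:fact g (D s)" using fact_precomp[OF g(1), of "b t" "D t" "e s t"] e_typ[OF s tP(1) t(2)] by simp
  thus ?thesis using rep_cmp[OF r s tP(1) t(2) tP(2)] c fact_scl g by simp
 qed
qed

end

section \<open>Indecomposable projectives, their radicals and simple tops\<close>

context poset_category begin

text \<open>Names the choice made inside \<open>proj_object\<close>, so that the projective on X is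
  \<open>Nul C z0 X\<close>.\<close>

definition z0 :: 'o where "z0 = (SOME Z. zero_object C Z)"

abbreviation pr :: "'o=>('o, 'd) arr" where "pr == proj_object C"

lemma z0: "zero_object C z0" "z0:Obj C"
 using someI_ex[OF zero_ex] by (auto simp: z0_def zero_object_def)

lemma pr_typs: "X:Obj C==>ar (pr X)" "X:Obj C==>src (pr X) = z0" "X:Obj C==>trg (pr X) = X"
 using z0 by (auto simp: proj_object_def z0_def[symmetric] typs)

lemma fact_pr: "X:Obj C==>x:fact (pr X) W \<longleftrightarrow> W:Obj C & x = Nul C W X"
 using pr_typs[of X] z0
 by (auto simp: proj_object_def z0_def[symmetric] fact_iff typs cat intro!: exI[of _ "Nul C W z0"])

lemma adm_from_pr: "X:Obj C==>ar bv==>adm (pr X) bv g \<longleftrightarrow> g:H X (trg bv)"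
proof -
 assume a: "X:Obj C" "ar bv"
 have "g**pr X = Nul C z0 (trg bv)" if "g:H X (trg bv)"
  using that a z0 by (simp add: proj_object_def z0_def[symmetric] typs cat)
 thus ?thesis using a pr_typs[OF a(1)] fact_NulI[OF a(2) z0(2)] by (auto simp: adm_def)
qed

lemma adm_to_pr: "X:Obj C==>ar av==>adm av (pr X) g \<longleftrightarrow> g:H (trg av) X & g**av = Nul C (src av) X"
 using pr_typs[of X] ar_Obj[of av] by (auto simp: adm_def fact_pr)

text \<open>In the quotient of the projective on B by the image of g the zero points are the maps
  that factor through g. Hence the quotient is the diagram g itself, with the identity of B as
  projection.\<close>

lemma pr_cokernel:
 assumes "ar w" "ar g" "src g = trg w" "trg g = B" "g**w = Nul C (src w) B"
 shows "cokernel A (pm w (pr B) g) (pm (pr B) g (Idm C B))"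
proof -
 have B: "B:Obj C" using assms typs by auto
 note p = pr_typs[OF B]
 have a1: "adm w (pr B) g" using assms B by (simp add: adm_to_pr hom_iff)
 have a2: "adm (pr B) g (Idm C B)" using assms B by (auto simp: adm_from_pr)
 have gg: "g:fact g (trg w)" using assms fact_comp[of g "Idm C (trg w)"] by (simp add: typs cat)
 show ?thesis
  unfolding cokernel_def
 proof (intro conjI ballI impI)
  show "arrow A (pm w (pr B) g)" "arrow A (pm (pr B) g (Idm C B))" using a1 a2 assms p arrow_pm by auto
  have "adm w g (Idm C B**g)" using adm_Cmp[OF assms(1) p(1) assms(2) a1 a2] .
  thus "Cmp A (pm (pr B) g (Idm C B)) (pm w (pr B) g) =
  Nul A (src (pm w (pr B) g)) (trg (pm (pr B) g (Idm C B)))"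
  using a1 a2 assms p gg adm_Nul[of w g] B by (simp add: pm_Cmp pm_Nul pm_eq_iff cat typs)
 next
  fix Z f assume Z: "Z:Obj A" and f: "f:Mor A (trg (pm w (pr B) g)) Z"
  and n: "Cmp A f (pm w (pr B) g) = Nul A (src (pm w (pr B) g)) Z"
  have aZ: "ar Z" using Z Obj_A by simp
  obtain f0 where f0: "adm (pr B) Z f0" "f = pm (pr B) Z f0" using f Mor_AE aZ p by (metis pm_sel(2))
  have f0t: "ar f0" "src f0 = B" "trg f0 = trg Z" using adm_typ[OF f0(1)] p by auto
  have "f0**g:fact Z (trg w)"
  using n f0 assms aZ p a1 adm_Cmp[OF assms(1) p(1) aZ a1 f0(1)] adm_Nul[OF assms(1) aZ] f0t
  by (simp add: pm_Cmp pm_Nul pm_eq_iff typs cat)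
  hence af: "adm g Z f0" using f0t assms aZ by (simp add: adm_iff)
  show "EX! u. u:Mor A (trg (pm (pr B) g (Idm C B))) Z & Cmp A u (pm (pr B) g (Idm C B)) = f"
  proof (rule ex1I[of _ "pm g Z f0"])
  show "pm g Z f0:Mor A (trg (pm (pr B) g (Idm C B))) Z & Cmp A (pm g Z f0) (pm (pr B) g (Idm C B)) = f"
  using af aZ assms a2 p f0 f0t by (simp add: Mor_pm pm_Cmp cat)
  fix u assume u: "u:Mor A (trg (pm (pr B) g (Idm C B))) Z & Cmp A u (pm (pr B) g (Idm C B)) = f"
  then obtain u0 where u0: "adm g Z u0" "u = pm g Z u0" using Mor_AE aZ assms(2) by (metis pm_sel(2))
  have u0t: "ar u0" "src u0 = B" "trg u0 = trg Z" using adm_typ[OF u0(1)] assms by auto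
  have "pm (pr B) Z u0 = pm (pr B) Z f0"
  using u u0 f0 aZ assms a2 p u0t by (simp add: pm_Cmp cat)
  hence "u0-.f0:fact Z B"
  using pm_eq_iff[OF p(1) aZ _ f0(1), of u0] u0t B aZ p by (simp add: adm_from_pr hom_iff)
  thus "u = pm g Z f0" using u0 af assms aZ by (simp add: pm_eq_iff)
  qed
 qed simp_all
qed

text \<open>With all generators strictly below h, the diagram w presents the candidate for the
  radical of the projective on B.\<close>

context
 fixes B h b w g
 assumes r: "rep B h b" and p: "presents B b {t\<in>P. t < h} w g"
begin

lemma rad_typs: "B:Obj C" "ar w" "ar g" "src g = trg w" "trg g = B" "g**w = Nul C (src w) B" "h:P"
 using p rep_Obj[OF r] rep_P[OF r] by (auto simp: presents_def)

lemma rad_fact: "s:P==>x:fact g (D s) \<longleftrightarrow> x:H (D s) B & (x = Nul C (D s) B \<or> s < h)"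
proof -
 assume s: "s:P"
 have T: "{t\<in>P. t < h} <= {t\<in>P. t <= h}" by auto
 show ?thesis using presents_fact[OF r p T s, of x] s by auto
qed

lemma rad_adm: "adm w (pr B) g"
 using rad_typs by (simp add: adm_to_pr hom_iff)

lemma rad_mono: "mono_arr A (pm w (pr B) g)"
proof (rule monoI[OF rad_typs(2) pr_typs(1)[OF rad_typs(1)] rad_adm])
 fix s x assume "s:P" "x:H (D s) (trg w)" "g**x:fact (pr B) (D s)"
 thus "x:fact w (D s)" using p rad_typs by (auto simp: presents_def fact_pr)
qed

text \<open>The question is whether the subobject has a point at \<open>D h\<close> with nonzero
  image in B. Such an image is a nonzero multiple of the isomorphism \<open>b h\<close>, and the
  subobject is everything; otherwise all images of its points come from generators strictly below
  h.\<close>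

lemma rad_dichotomy:
 assumes m: "mono_arr A m" "trg m = pr B"
 shows "iso_arr A m \<or> factors_through A m (pm w (pr B) g)"
proof -
 note prB = pr_typs[OF rad_typs(1)]
 obtain av k where al: "ar av" "adm av (pr B) k" "m = pm av (pr B) k"
  using arrow_AE m by (metis mono_arr_def pm_sel(2))
 note mm = m(1)[unfolded al(3)]
 have k: "ar k" "src k = trg av" "trg k = B" using adm_typ[OF al(2)] prB by auto
 show ?thesis
 proof (cases "EX y:H (D h) (trg av). k**y ~= Nul C (D h) B")
  case True
  then obtain y where y: "y:H (D h) (trg av)" "k**y ~= Nul C (D h) B" by blast
  have "k**y:H (D h) B" using y k by (simp add: typs)
  then obtain c where c: "c ~= 0" "k**y = Scl C c (b h)"
  using rep_hom[OF r rad_typs(7)] y by metis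
  note bh = rep_b[OF r rad_typs(7) order_refl]
  obtain b' where b': "b':H B (D h)" "b h**b' = Idm C B" using rep_inv[OF r] by blast
  \<comment> \<open>A right inverse of k, made from the point y that hits a multiple of
    \<open>b h\<close>.\<close>
  let ?u = "Scl C (inverse c) (y**b')"
  have "k**(y**b') = Scl C c (Idm C B)" using assoc[of b' y k] c b' bh k y by (simp add: hom_iff Scl_l)
  hence ku: "k**?u = Idm C B"
  using k y b' c rad_typs(1) by (simp add: typs Scl_r Scl_div)
  have ut: "ar ?u" "src ?u = B" "trg ?u = trg av" using y b' by (auto simp: typs)
  have "iso_arr A (pm av (pr B) k)"
  proof (rule mono_iso[OF mm al(1) prB(1) al(2)])
  fix s v assume s: "s:P" and v: "v:H (D s) (trg (pr B))"
  have "v-.k**(?u**v) = Nul C (D s) B"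
  using v ku ut k prB assoc[of v ?u k] dif_self[of v "D s" B] by (simp add: hom_iff Idm_l)
  thus "EX z:H (D s) (trg av). v-.k**z:fact (pr B) (D s)"
  using ut v prB s D_Obj rad_typs by (intro bexI[of _ "?u**v"]) (auto simp: fact_pr hom_iff ar_Cmp src_Cmp trg_Cmp)
  qed
  thus ?thesis using al by simp
 next
  case False
  obtain u where "adm av w u" "k-.g**u:fact (pr B) (trg av)"
  proof (rule factor_mono[OF rad_mono rad_typs(2) prB(1) rad_adm al(1,2)])
  fix s v assume s: "s:P" and v: "v:H (D s) (trg av)"
  have kv: "k**v:H (D s) B" using k v by (simp add: typs)
  have "k**v:fact g (D s)"
  proof (cases "k**v = Nul C (D s) B")
  case True
  thus ?thesis using rad_fact[OF s] kv by simp
  next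
  case F: False
  hence "s <= h" using rep_hom[OF r s kv] by metis
  moreover have "s ~= h" using False F v by auto
  ultimately have "s < h" by simp
  thus ?thesis using rad_fact[OF s] kv by simp
  qed
  then obtain y where y: "ar y" "src y = D s" "trg y = src g" "k**v = g**y" using rad_typs by (auto simp: fact_iff)
  have "k**v-.g**y = Nul C (D s) B" using y(4) dif_self kv by metis
  thus "EX y:H (D s) (trg w). k**v-.g**y:fact (pr B) (D s)"
  using y rad_typs s D_Obj by (intro bexI[of _ y]) (auto simp: fact_pr hom_iff)
  qed
  thus ?thesis using factors_through_pm[OF rad_typs(2) prB(1) al(1) rad_adm al(2)] al by auto
 qed
qed

lemma rad_not_iso: "~ iso_arr A (pm w (pr B) g)"
proof
 assume i: "iso_arr A (pm w (pr B) g)"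
 note prB = pr_typs[OF rad_typs(1)] and bh = rep_b[OF r rad_typs(7) order_refl]
 have bH: "b h:H (D h) (trg (pr B))" using bh prB by (simp add: hom_iff)
 obtain y where y: "y:H (D h) (trg w)" "b h-.g**y:fact (pr B) (D h)"
  using iso_surj[OF i rad_typs(2) prB(1) rad_adm bH] by blast
 hence "b h = g**y" using rad_typs bH prB dif_eq_Nul[of "b h" "D h" B "g**y"] by (auto simp: fact_pr typs)
 hence "b h:fact g (D h)" using y rad_typs by (simp add: hom_iff fact_comp)
 thus False using rad_fact[OF rad_typs(7)] rep_nz[OF r rad_typs(7)] by auto
qed

lemma rad_maximal: "maximal_sub A (pr B) (pm w (pr B) g)"
 unfolding maximal_sub_def using rad_mono rad_not_iso rad_dichotomy by auto

lemma maximal_rad: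
 assumes "maximal_sub A (pr B) m" shows "factors_through A (pm w (pr B) g) m"
proof -
 have "mono_arr A m" "trg m = pr B" "~ iso_arr A m" using assms by (auto simp: maximal_sub_def)
 hence "factors_through A m (pm w (pr B) g)" using rad_dichotomy by blast
 thus ?thesis using assms rad_mono rad_not_iso unfolding maximal_sub_def by auto
qed

lemma rad_radical: "radical A (pr B) (pm w (pr B) g)"
 unfolding radical_def using rad_mono rad_maximal maximal_rad by auto

text \<open>The same dichotomy inside the quotient: a subobject without a nonzero image at
  \<open>D h\<close> has zero points only, because everything strictly below h already lies in
  \<open>fact g\<close>.\<close>

lemma rad_simple: "simple_object A g"
 unfolding simple_object_def
proof (intro conjI allI impI)
 note bh = rep_b[OF r rad_typs(7) order_refl] and t = rad_typs
 show "g:Obj A" using t Obj_A by simp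
 show "~ zero_object A g"
 proof
  assume "zero_object A g"
  hence "Idm C B:fact g B" using t by (simp add: zero_object_A)
  hence "Idm C B**b h:fact g (D h)" using fact_precomp[of g "Idm C B" B "b h" "D h"] t bh by simp
  thus False using rad_fact[OF t(7)] rep_nz[OF r t(7)] bh by (auto simp: Idm_l)
 qed
 fix m assume m: "mono_arr A m & trg m = g"
 obtain av k where al: "ar av" "adm av g k" "m = pm av g k"
  using arrow_AE m by (metis mono_arr_def pm_sel(2))
 have mm: "mono_arr A (pm av g k)" using m al by simp
 have k: "ar k" "src k = trg av" "trg k = B" using adm_typ[OF al(2)] t by auto
 show "zero_object A (src m) \<or> iso_arr A m"
 proof (cases "EX y:H (D h) (trg av). k**y ~= Nul C (D h) B")
  case True
  then obtain y where y: "y:H (D h) (trg av)" "k**y ~= Nul C (D h) B" by blast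
  have "k**y:H (D h) B" using y k by (simp add: typs)
  then obtain c where c: "c ~= 0" "k**y = Scl C c (b h)"
  using rep_hom[OF r t(7)] y by metis
  obtain b' where b': "b':H B (D h)" "b h**b' = Idm C B" using rep_inv[OF r] by blast
  let ?u = "Scl C (inverse c) (y**b')"
  have "k**(y**b') = Scl C c (Idm C B)" using assoc[of b' y k] c b' bh k y by (simp add: hom_iff Scl_l)
  hence ku: "k**?u = Idm C B"
  using k y b' c t(1) by (simp add: typs Scl_r Scl_div)
  have ut: "ar ?u" "src ?u = B" "trg ?u = trg av" using y b' by (auto simp: typs)
  have "iso_arr A (pm av g k)"
  proof (rule mono_iso[OF mm al(1) t(3) al(2)])
  fix s v assume s: "s:P" and v: "v:H (D s) (trg g)"
  have "v-.k**(?u**v) = Nul C (D s) B"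
  using v ku ut k t assoc[of v ?u k] dif_self[of v "D s" B] by (simp add: hom_iff Idm_l)
  thus "EX z:H (D s) (trg av). v-.k**z:fact g (D s)"
  using ut v s D_Obj t by (intro bexI[of _ "?u**v"]) (auto simp: fact_NulI hom_iff ar_Cmp src_Cmp trg_Cmp)
  qed
  thus ?thesis using al by simp
 next
  case False
  have "Idm C (trg av):fact av (src (Idm C (trg av)))"
  proof (rule gen_fact)
  fix s v assume s: "s:P" and v: "v:H (D s) (src (Idm C (trg av)))"
  hence v: "v:H (D s) (trg av)" using al by (simp add: typs)
  have kv: "k**v:H (D s) B" using k v by (simp add: typs)
  have "k**v:fact g (D s)"
  proof (cases "k**v = Nul C (D s) B")
  case True
  thus ?thesis using rad_fact[OF s] kv by simp
  next
  case F: False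
  hence "s <= h" using rep_hom[OF r s kv] by metis
  moreover have "s ~= h" using False F v by auto
  ultimately have "s < h" by simp
  thus ?thesis using rad_fact[OF s] kv by simp
  qed
  hence "v:fact av (D s)" using mono_fact'[OF mm al(1) t(3) al(2) v] by simp
  thus "Idm C (trg av)**v:fact av (D s)" using v by (simp add: hom_iff Idm_l)
  qed (use al in "simp_all add: typs")
  thus ?thesis using al by (simp add: zero_object_A typs)
 qed
qed

lemma rad_top: "simple_top A (pr B) g"
 unfolding simple_top_def
 using rad_simple rad_radical pr_cokernel[OF rad_typs(2,3,4,5,6)] pm_sel by blast

text \<open>\<open>simple_top\<close> admits any radical and any cokernel, so the points of S are
  determined from the universal properties and not from the diagram g. Points coming from below h
  die in S, and if those at h died too, S would be zero.\<close>

lemma top_elements: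
 assumes S: "simple_top A (pr B) S"
 shows "ar S" "!!t x. t:P==>t ~= h==>x:H (D t) (trg S)==>x:fact S (D t)"
  "EX x:H (D h) (trg S). x \<notin> fact S (D h)"
proof -
 note prB = pr_typs[OF rad_typs(1)] and t = rad_typs
 obtain ra q where rq: "radical A (pr B) ra" "cokernel A ra q" "trg q = S" and si: "simple_object A S"
  using S by (auto simp: simple_top_def)
 show aS: "ar S" using si Obj_A by (simp add: simple_object_def)
 obtain rh r0 where ro: "ar rh" "adm rh (pr B) r0" "ra = pm rh (pr B) r0"
  using rq(1) arrow_AE unfolding radical_def mono_arr_def by (metis pm_sel(2))
 have "arrow A q" "src q = pr B" using rq ro by (auto simp: cokernel_def)
 then obtain q0 where q0: "adm (pr B) S q0" "q = pm (pr B) S q0"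
  using rq(3) arrow_AE by (metis pm_sel)
 have qt: "ar q0" "src q0 = B" "trg q0 = trg S" using adm_typ[OF q0(1)] prB by auto
 have rt: "ar r0" "src r0 = trg rh" "trg r0 = B" using adm_typ[OF ro(2)] prB by auto
 have qr: "q0**r0:fact S (trg rh)"
 proof -
  have "Cmp A q ra = Nul A rh S" using rq ro by (simp add: cokernel_def)
  thus ?thesis using q0 ro aS prB qt rt adm_Cmp[OF ro(1) prB(1) aS ro(2) q0(1)] adm_Nul[OF ro(1) aS]
  by (simp add: pm_Cmp pm_Nul pm_eq_iff typs cat)
 qed
 \<comment> \<open>The point x is a map from the projective on \<open>D s\<close>. It factors
   through g, hence through every maximal subobject, hence through the radical \<open>ra\<close>,
   which \<open>q0\<close> annihilates.\<close>
 have kill: "q0**x:fact S (D s)" if s: "s:P" "s < h" and x: "x:H (D s) B" for s x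
 proof -
  have Ds: "D s:Obj C" using s D_Obj by simp
  note prD = pr_typs[OF Ds]
  have xg: "x:fact g (D s)" using rad_fact[OF s(1)] x s by simp
  then obtain i where i: "ar i" "src i = D s" "trg i = trg w" "x = g**i" using t by (auto simp: fact_iff)
  have ax: "adm (pr (D s)) (pr B) x" using x prB Ds by (simp add: adm_from_pr)
  have "factors_through A (pm (pr (D s)) (pr B) x) m" if m: "maximal_sub A (pr B) m" for m
  proof -
  obtain av k where al: "ar av" "adm av (pr B) k" "m = pm av (pr B) k"
  using m arrow_AE unfolding maximal_sub_def mono_arr_def by (metis pm_sel(2))
  have k: "ar k" "src k = trg av" "trg k = B" using adm_typ[OF al(2)] prB by auto
  obtain u where u: "adm w av u" "g-.k**u:fact (pr B) (trg w)"
  using maximal_rad[OF m] al factors_through_pm[OF al(1) prB(1) t(2) al(2) rad_adm] by auto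
  have ut: "ar u" "src u = trg w" "trg u = trg av" using adm_typ[OF u(1)] by auto
  have "g = k**u" using u t k ut dif_eq_Nul[of g "trg w" B "k**u"] by (auto simp: fact_pr typs)
  hence "x = k**(u**i)" using i k ut by (simp add: assoc)
  hence "x-.k**(u**i) = Nul C (D s) B" using dif_self x by metis
  hence "x-.k**(u**i):fact (pr B) (trg (pr (D s)))" using prD t Ds by (simp add: fact_pr)
  moreover have "adm (pr (D s)) av (u**i)" using ut i al Ds by (simp add: adm_from_pr typs)
  ultimately show ?thesis using factors_through_pm[OF al(1) prB(1) prD(1) al(2) ax] al by auto
  qed
  moreover have "arrow A (pm (pr (D s)) (pr B) x)" using ax prB prD arrow_pm by simp
  ultimately have "factors_through A (pm (pr (D s)) (pr B) x) (pm rh (pr B) r0)"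
  using rq(1) ro(3) unfolding radical_def by auto
  then obtain y where y: "adm (pr (D s)) rh y" "x-.r0**y:fact (pr B) (trg (pr (D s)))"
  using factors_through_pm[OF ro(1) prB(1) prD(1) ro(2) ax] by auto
  have yt: "ar y" "src y = D s" "trg y = trg rh" using adm_typ[OF y(1)] prD by auto
  have "x = r0**y" using y x rt yt prD t dif_eq_Nul[of x "D s" B "r0**y"] by (auto simp: fact_pr typs)
  hence "q0**x = (q0**r0)**y" using qt rt yt by (simp add: assoc)
  thus ?thesis using fact_precomp[OF aS qr yt(1,3), of "D s"] yt by simp
 qed
 have surj: "EX a:H (D s) B. x-.q0**a:fact S (D s)" if "x:H (D s) (trg S)" for s x
  using cokernel_fact[OF rq(2)[unfolded q0(2)] prB(1) aS q0(1) that] prB by metis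
 show *: "x:fact S (D s)" if s: "s:P" "s ~= h" and x: "x:H (D s) (trg S)" for s x
 proof -
  obtain a where a: "a:H (D s) B" "x-.q0**a:fact S (D s)" using surj[OF x] by blast
  have "q0**a:fact S (D s)"
  proof (cases "a = Nul C (D s) B")
  case True
  thus ?thesis using qt aS s D_Obj fact_NulI[OF aS] by (simp add: cat)
  next
  case False
  hence "s <= h" using rep_hom[OF r s(1) a(1)] by metis
  thus ?thesis using kill[of s a] s a by simp
  qed
  thus ?thesis using fact_of_dif[OF aS a(2)] x by (simp add: hom_iff)
 qed
 show "EX x:H (D h) (trg S). x \<notin> fact S (D h)"
 proof (rule ccontr)
  assume n: "~ ?thesis"
  have "Idm C (trg S):fact S (src (Idm C (trg S)))"
  proof (rule gen_fact)
  fix s v assume s: "s:P" and v: "v:H (D s) (src (Idm C (trg S)))"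
  hence v: "v:H (D s) (trg S)" using aS by (simp add: typs)
  hence "v:fact S (D s)" using * s n by (cases "s = h") auto
  thus "Idm C (trg S)**v:fact S (D s)" using v by (simp add: hom_iff Idm_l)
  qed (use aS in "simp_all add: typs")
  hence "zero_object A S" using aS by (simp add: zero_object_A typs)
  thus False using si by (simp add: simple_object_def)
 qed
qed

end

lemma simple_top_rep:
 assumes r: "rep B h b" and S: "simple_top A (pr B) S"
 shows "ar S" "!!t x. t:P==>t ~= h==>x:H (D t) (trg S)==>x:fact S (D t)"
  "EX x:H (D h) (trg S). x \<notin> fact S (D h)"
proof -
 have T: "{t\<in>P. t < h} <= {t\<in>P. t <= h}" by auto
 obtain w g where p: "presents B b {t\<in>P. t < h} w g" using presents_ex[OF r T] by blast
 show "ar S" "!!t x. t:P==>t ~= h==>x:H (D t) (trg S)==>x:fact S (D t)"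
  "EX x:H (D h) (trg S). x \<notin> fact S (D h)"
  using top_elements[OF r p S] by blast+
qed

lemma endo_rep:
 assumes r: "rep B h b" and f: "f:H B B" obtains c where "f = Scl C c (Idm C B)"
proof -
 have BO: "B:Obj C" using rep_Obj[OF r] .
 note bh = rep_b[OF r rep_P[OF r] order_refl]
 obtain b' where b': "b':H B (D h)" "b h**b' = Idm C B" using rep_inv[OF r] by blast
 have fb: "f**b h:H (D h) B" using f bh by (simp add: typs)
 have f': "f = (f**b h)**b'" using f b' bh by (simp add: typs cat)
 show thesis
 proof (cases "f**b h = Nul C (D h) B")
  case True
  hence "f = Nul C B B" using f' b' BO by (simp add: typs cat)
  thus thesis using that[of 0] Scl_0[OF Idm_hom[OF BO]] by simp
 next
  case False
  then obtain c where c: "f**b h = Scl C c (b h)" using rep_hom[OF r rep_P[OF r] fb] by metis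
  hence "f = Scl C c (Idm C B)" using f' b' bh by (simp add: typs cat)
  thus thesis by (rule that)
 qed
qed

lemma rep_Idm_nz: assumes r: "rep B h b" shows "Idm C B ~= Nul C B B"
proof
 assume n: "Idm C B = Nul C B B"
 note bh = rep_b[OF r rep_P[OF r] order_refl]
 have "b h = Idm C B**b h" using bh by (simp add: Idm_l)
 also have "... = Nul C (D h) B" using n bh rep_Obj[OF r] by (simp add: Nul_l)
 finally show False using rep_nz[OF r rep_P[OF r]] by simp
qed

text \<open>Endomorphisms of B are scalars, so the idempotent of a summand is zero or the identity,
  and one of the two summands vanishes.\<close>

lemma indecomposable_rep:
 assumes r: "rep B h b" shows "indecomposable C B"
 unfolding indecomposable_def
proof (intro conjI allI impI)
 show BO: "B:Obj C" using rep_Obj[OF r] .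
 show "~ zero_object C B" using rep_Idm_nz[OF r] by (simp add: zero_object_def)
 fix X Y assume "direct_sum C B X Y"
 then obtain i1 i2 p1 p2 where d: "X:Obj C" "Y:Obj C" "i1:H X B" "i2:H Y B" "p1:H B X" "p2:H B Y"
  "p1**i1 = Idm C X" "p2**i2 = Idm C Y" "i1**p1+.i2**p2 = Idm C B"
  unfolding direct_sum_def hom_def by blast
 have z: "zero_object C X" if "i:H X B" "p:H B X" "p**i = Idm C X" "i**p = Nul C B B" "X:Obj C" for i p X
 proof -
  have "p**((i**p)**i) = (p**i)**(p**i)" using that(1,2) by (simp add: typs assoc)
  hence "Idm C X = p**((i**p)**i)" using that(3,5) by (simp add: typs cat)
  also have "... = Nul C X X" unfolding that(4) using that BO by (simp add: typs cat)
  finally show ?thesis using that by (simp add: zero_object_def)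
 qed
 have "i1**p1:H B B" using d by (simp add: typs)
 then obtain c where c: "i1**p1 = Scl C c (Idm C B)" using endo_rep[OF r] by blast
 show "zero_object C X \<or> zero_object C Y"
 proof (cases "c = 0")
  case True
  hence "i1**p1 = Nul C B B" using c Scl_0[OF Idm_hom[OF BO]] by simp
  thus ?thesis using z d by blast
 next
  case False
  have "i1**p1 = (i1**p1)**(i1**p1)"
  proof -
  have "(i1**p1)**(i1**p1) = i1**((p1**i1)**p1)" using d(1-6) by (simp add: typs assoc)
  thus ?thesis using d by (simp add: typs Idm_l)
  qed
  hence "Scl C c (Idm C B) = Scl C c (Scl C c (Idm C B))" using c BO by (simp add: typs cat)
  hence "Idm C B = Scl C c (Idm C B)" using Scl_div[OF ar_Idm[OF BO] False] Scl_div[OF ar_Scl[OF ar_Idm[OF BO]] False] by metis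
  hence i1p1: "i1**p1 = Idm C B" using c by simp
  have "i2**p2 = Idm C B-.i1**p1" using d dif_add[of "i2**p2" B B "i1**p1"] by (simp add: typs)
  also have "... = Nul C B B" using i1p1 dif_self BO Idm_hom by metis
  finally show ?thesis using z d by blast
 qed
qed

text \<open>Some composite \<open>D s\<close> -> X -> \<open>D s\<close> must be nonzero. It is then
  a nonzero scalar, so \<open>D s\<close> splits off X, and indecomposability leaves no room for a
  complement.\<close>

lemma indecomposable_ex_rep:
 assumes X: "indecomposable C X" obtains h b where "rep X h b"
proof -
 have XO: "X:Obj C" and nz: "~ zero_object C X" using X by (auto simp: indecomposable_def)
 have "EX s:P. EX a:H X (D s). EX b:H (D s) X. a**b ~= Nul C (D s) (D s)"
 proof (rule ccontr)
  assume n: "~ ?thesis"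
  \<comment> \<open>Induction from the top of the poset. In the expansion of
    \<open>Idm C X**b\<close> a term i p b can be nonzero only if p b leads to a generator above t,
    strictly so because composites at t itself vanish; and there i is zero by induction.\<close>
  have *: "b = Nul C (D t) X" if "t:P" "b:H (D t) X" for t b
  using that
  proof (induction "card {s\<in>P. t < s}" arbitrary: t b rule: less_induct)
  case less
  have Dt: "D t:Obj C" using less D_Obj by simp
  have "Idm C X**b:aspan C (D t) X ((%f. f**b) ` through C D P X X)"
  by (rule aspan_Cmp_right[OF gen[OF XO] through_hom less.prems(2) XO])
  hence "b:aspan C (D t) X ((%f. f**b) ` through C D P X X)"
  using less.prems by (simp add: hom_iff Idm_l)
  moreover have "(%f. f**b) ` through C D P X X <= {Nul C (D t) X}"
  proof
  fix y assume "y:(%f. f**b) ` through C D P X X"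
  then obtain i p s where y: "y = (i**p)**b" "s:P" "p:H X (D s)" "i:H (D s) X"
  by (auto simp: through_def)
  have pb: "p**b:H (D t) (D s)" using y less.prems by (simp add: typs)
  have y2: "y = i**(p**b)" using y less.prems by (simp add: typs assoc)
  have "p**b = Nul C (D t) (D s) \<or> i = Nul C (D s) X"
  proof (cases "p**b = Nul C (D t) (D s)")
  case False
  hence "t <= s" using hom_D[OF less.prems(1) y(2) pb] by blast
  moreover have "t ~= s" using False n y less.prems by blast
  ultimately have ts: "t < s" by simp
  have "{u\<in>P. s < u} \<subset> {u\<in>P. t < u}" using ts y by (auto dest: less_trans)
  hence "card {u\<in>P. s < u} < card {u\<in>P. t < u}" using fin by (intro psubset_card_mono) auto
  thus ?thesis using less.hyps y by blast
  qed simp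
  hence "y = Nul C (D t) X" using y2 y pb Dt XO by (auto simp: typs cat)
  thus "y:{Nul C (D t) X}" by simp
  qed
  ultimately show ?case by (rule aspan_Nul) (use Dt XO in auto)
  qed
  obtain Z where Z: "zero_object C Z" using zero_ex by blast
  hence ZO: "Z:Obj C" by (simp add: zero_object_def)
  have "Idm C X:fact (Nul C Z X) (src (Idm C X))"
  proof (rule gen_fact)
  fix s x assume s: "s:P" and x: "x:H (D s) (src (Idm C X))"
  hence "x = Nul C (D s) X" using * XO by (simp add: typs)
  thus "Idm C X**x:fact (Nul C Z X) (D s)"
  using XO ZO s D_Obj by (simp add: typs cat fact_NulI)
  qed (use XO ZO in "simp_all add: typs")
  then obtain k where "k:H X Z" "Idm C X = Nul C Z X**k" using XO ZO by (auto simp: fact_iff typs)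
  hence "Idm C X = Nul C X X" using XO by (simp add: typs cat)
  thus False using nz XO by (simp add: zero_object_def)
 qed
 then obtain s a b where s: "s:P" and ab: "a:H X (D s)" "b:H (D s) X" "a**b ~= Nul C (D s) (D s)" by blast
 have Ds: "D s:Obj C" using s D_Obj by simp
 obtain c where c: "a**b = Scl C c (Idm C (D s))"
  using hom_D[OF s s, of "a**b"] ab e_id[OF s] by (auto simp: typs)
 have c0: "c ~= 0" using c ab(3) Scl_0[OF Idm_hom[OF Ds]] by auto
 define a1 where "a1 = Scl C (inverse c) a"
 have a1: "a1:H X (D s)" "a1**b = Idm C (D s)"
  using ab c c0 Ds by (auto simp: a1_def typs cat Scl_div)
 have bb: "ar b" "src b = D s" "trg b = X" "ar a1" "src a1 = X" "trg a1 = D s" using ab a1 by (auto simp: hom_iff)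
 have red: "a1**(b**y) = y" if "ar y" "trg y = D s" for y
  using assoc_reduce[of y b a1 "Idm C (D s)"] that bb a1 by (simp add: Idm_l)
 \<comment> \<open>The complementary idempotent; splitting it produces the complement Y of
   \<open>D s\<close> in X.\<close>
 define f where "f = Idm C X-.b**a1"
 have f: "f:H X X" using bb XO by (simp add: f_def typs)
 have a1f: "a1**f = Nul C X (D s)"
  using bb XO red[of a1] dif_self[of a1 X "D s"] by (simp add: f_def typs cat)
 have fb: "f**b = Nul C (D s) X"
  using bb XO a1 dif_self[of b "D s" X] by (simp add: f_def typs cat)
 have ff: "f**f = f"
 proof -
  have "f**f = f-.b**(a1**f)" using bb XO f unfolding f_def by (simp add: typs cat)
  thus ?thesis using a1f bb f XO Ds by (simp add: typs cat)
 qed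
 obtain Y a2 b2 where Y: "Y:Obj C" "a2:H X Y" "b2:H Y X" "a2**b2 = Idm C Y" "b2**a2 = f"
  using split[OF XO f ff] by blast
 have a1b2: "a1**b2 = Nul C Y (D s)"
 proof -
  have "a1**b2 = (a1**f)**b2"
  using Y a1 f assoc[of b2 f a1] assoc[of b2 a2 b2] by (simp add: hom_iff Idm_r)
  thus ?thesis using a1f Y Ds by (simp add: typs cat)
 qed
 have a2b: "a2**b = Nul C (D s) Y"
 proof -
  have "a2**b = a2**(f**b)"
  using Y bb f assoc[of b a2 b2] assoc[of "a2**b" b2 a2] by (simp add: hom_iff ar_Cmp src_Cmp trg_Cmp Idm_l)
  thus ?thesis using fb Y Ds by (simp add: typs cat)
 qed
 have sum: "b**a1+.b2**a2 = Idm C X"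
  using Y(5) bb XO add_dif[of "Idm C X" X X "b**a1"] by (simp add: f_def typs)
 have "direct_sum C X (D s) Y"
  unfolding direct_sum_def
 proof (intro conjI)
  have "i:Mor C A B" if "i:H A B" for i A B using that by (simp add: hom_def)
  thus "EX i1:Mor C (D s) X. EX i2:Mor C Y X. EX p1:Mor C X (D s). EX p2:Mor C X Y.
  p1**i1 = Idm C (D s) & p2**i2 = Idm C Y & p1**i2 = Nul C Y (D s) & p2**i1 = Nul C (D s) Y &
  i1**p1+.i2**p2 = Idm C X"
  using Y ab a1 a1b2 a2b sum
  by (intro bexI[of _ b] bexI[of _ b2] bexI[of _ a1] bexI[of _ a2]) simp_all
 qed (use Ds Y XO in simp_all)
 hence "zero_object C (D s) \<or> zero_object C Y" using X by (auto simp: indecomposable_def)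
 moreover have "~ zero_object C (D s)" using rep_Idm_nz[OF rep_D[OF s]] by (simp add: zero_object_def)
 ultimately have "zero_object C Y" by simp
 hence "b2 = Nul C Y X" using Y zero_object_hom by blast
 hence "b2**a2 = Nul C X X" using Y XO by (simp add: typs cat)
 hence "b**a1 = Idm C X" using sum bb XO by (simp add: typs cat)
 hence "rep X s (%t. b**e t s)" unfolding rep_def using s ab a1 by blast
 thus thesis by (rule that)
qed

end

subsection \<open>Duflo involutions\<close>

text \<open>In the application i, j and m are I, J and the whole algebra; the unit is given through
  \<open>rep\<close> as it is only isomorphic to \<open>D m\<close>. The last four hypotheses carry
  the ideal theory: \<open>cell\<close> reflects that a product of ideals lies in its right factor,
  \<open>vanish\<close> that I V equals I times the intersection of V and J, and \<open>full\<close>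
  with \<open>faithful\<close> that tensoring with I loses nothing on maps out of Dp_J.\<close>

locale duflo_setting = poset_category C D e P
 for C :: "('k::field, 'o, 'd) two_cat" and D :: "'s::order=>'o" and e and P +
 fixes i j m :: 's and u :: "'s=>('o, 'd) arr"
 assumes i: "i:P" and j: "j:P" and top: "!!s. s:P==>s <= m" and unit: "rep (Unit C) m u"
  and HObj_Unit: "X:Obj C==>HObj C (Unit C) X = X"
  and HArr_hom: "ta:H F F'==>av:H X Y==>HArr C ta av:H (HObj C F X) (HObj C F' Y)"
  and HArr_Idm: "F:Obj C==>X:Obj C==>HArr C (Idm C F) (Idm C X) = Idm C (HObj C F X)"
  and HArr_Cmp: "ta:H F F'==>ta':H F' F''==>av:H X Y==>bv:H Y Z ==>
  HArr C (ta'**ta) (bv**av) = HArr C ta' bv**HArr C ta av"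
  and HArr_Add_right: "F:Obj C==>av:H X Y==>bv:H X Y ==>
  HArr C (Idm C F) (av+.bv) = HArr C (Idm C F) av+.HArr C (Idm C F) bv"
  and HArr_Add_left: "X:Obj C==>av:H F F'==>bv:H F F' ==>
  HArr C (av+.bv) (Idm C X) = HArr C av (Idm C X)+.HArr C bv (Idm C X)"
  and HArr_Scl_right: "F:Obj C==>av:H X Y==>HArr C (Idm C F) (Scl C c av) = Scl C c (HArr C (Idm C F) av)"
  and HArr_Scl_left: "X:Obj C==>av:H F F'==>HArr C (Scl C c av) (Idm C X) = Scl C c (HArr C av (Idm C X))"
  and cell: "g:P==>h:P==>t:P==>x:H (D g) (HObj C (D h) (D t))==>y:H (HObj C (D h) (D t)) (D g) ==>
  y**x ~= Nul C (D g) (D g)==>g <= t"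
  and vanish: "g:P==>~ g <= j==>Idm C (HObj C (D i) (D g)):aspan C (HObj C (D i) (D g)) (HObj C (D i) (D g))
  {HArr C (Idm C (D i)) (e c g)**x | c x. c:P & c < g & x:H (HObj C (D i) (D g)) (HObj C (D i) (D c))}"
  and full: "s:P==>x:H (HObj C (D i) (D j)) (HObj C (D i) (D s))==>EX y:H (D j) (D s). x = HArr C (Idm C (D i)) y"
  and faithful: "s:P==>y:H (D j) (D s) ==>
  HArr C (Idm C (D i)) y = Nul C (HObj C (D i) (D j)) (HObj C (D i) (D s))==>y = Nul C (D j) (D s)"
begin

lemma HObj_Obj: "F:Obj C==>X:Obj C==>HObj C F X:Obj C"
 using HArr_hom[OF Idm_hom Idm_hom, of F X] hom_Obj by blast

lemma act_hom: "F:Obj C==>av:H X Y==>act C F av:H (HObj C F X) (HObj C F Y)"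
 unfolding act_def by (rule HArr_hom[OF Idm_hom])

lemma act_typs:
 assumes "F:Obj C" "ar av"
 shows "ar (act C F av)" "src (act C F av) = HObj C F (src av)" "trg (act C F av) = HObj C F (trg av)"
 using act_hom[OF assms(1), of av "src av" "trg av"] assms(2) by (auto simp: hom_iff)

lemma act_Cmp:
 assumes "F:Obj C" "ar av" "ar bv" "trg av = src bv"
 shows "act C F (bv**av) = act C F bv**act C F av"
proof -
 have F: "Idm C F:H F F" using assms by auto
 show ?thesis
  using HArr_Cmp[OF F F, of av "src av" "trg av" bv "trg bv"] Cmp_Idm_left[OF F] assms by (simp add: act_def hom_iff)
qed

lemma act_Idm: "F:Obj C==>X:Obj C==>act C F (Idm C X) = Idm C (HObj C F X)"
 by (simp add: act_def HArr_Idm)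

lemma act_Nul: "F:Obj C==>X:Obj C==>Y:Obj C==>act C F (Nul C X Y) = Nul C (HObj C F X) (HObj C F Y)"
 using HArr_Scl_right[OF _ Nul_hom, of F X Y 0] Scl_0[OF act_hom[OF _ Nul_hom], of F X Y]
 by (simp add: act_def Scl_Nul)

lemma act_span:
 assumes F: "F:Obj C" and f: "f:aspan C X Y S" and S: "S <= H X Y" and X: "X:Obj C" "Y:Obj C"
 shows "act C F f:aspan C (HObj C F X) (HObj C F Y) (act C F ` S)"
 using f
proof (induction rule: aspan.induct)
 case nul
 thus ?case using act_Nul F X by (auto intro: aspan.nul)
next
 case (add f g)
 hence "f:H X Y" "g:H X Y" using aspan_hom S X by auto
 hence "act C F (f+.g) = act C F f+.act C F g" using HArr_Add_right[OF F] by (simp add: act_def)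
 thus ?case using add by (auto intro: aspan.add)
qed (auto intro: aspan.base)

text \<open>Naturality in the left factor; it transports statements about the action of
  \<open>D i\<close> to every 1-morphism isomorphic to it.\<close>

definition whisker :: "('o, 'd) arr=>'o=>('o, 'd) arr" where "whisker ta X = HArr C ta (Idm C X)"

lemma whisker_typs:
 assumes "ar ta" "X:Obj C"
 shows "ar (whisker ta X)" "src (whisker ta X) = HObj C (src ta) X" "trg (whisker ta X) = HObj C (trg ta) X"
 using HArr_hom[of ta "src ta" "trg ta" "Idm C X" X X] assms unfolding whisker_def
 by (auto simp: hom_iff ar_Idm src_Idm trg_Idm)

lemma whisker_Cmp:
 assumes "ar ta" "ar ta'" "trg ta = src ta'" "X:Obj C"
 shows "whisker (ta'**ta) X = whisker ta' X**whisker ta X"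
proof -
 have X: "Idm C X:H X X" using assms by auto
 show ?thesis
  using HArr_Cmp[OF _ _ X X, of ta "src ta" "trg ta" ta' "trg ta'"] Cmp_Idm_left[OF X] assms by (simp add: whisker_def hom_iff)
qed

lemma whisker_Idm: "F:Obj C==>X:Obj C==>whisker (Idm C F) X = Idm C (HObj C F X)"
 by (simp add: whisker_def HArr_Idm)

lemma whisker_natural:
 assumes "ar ta" "ar av"
 shows "whisker ta (trg av)**act C (src ta) av = act C (trg ta) av**whisker ta (src av)"
proof -
 have t: "ta:H (src ta) (trg ta)" "av:H (src av) (trg av)" using assms by (auto simp: hom_iff)
 have o: "src ta:Obj C" "trg ta:Obj C" "src av:Obj C" "trg av:Obj C" using assms ar_Obj by auto
 have "HArr C (ta**Idm C (src ta)) (Idm C (trg av)**av) = whisker ta (trg av)**act C (src ta) av"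
  using HArr_Cmp[OF Idm_hom[OF o(1)] t(1) t(2) Idm_hom[OF o(4)]] by (simp add: whisker_def act_def)
 moreover have "HArr C (Idm C (trg ta)**ta) (av**Idm C (src av)) = act C (trg ta) av**whisker ta (src av)"
  using HArr_Cmp[OF t(1) Idm_hom[OF o(2)] Idm_hom[OF o(3)] t(2)] by (simp add: whisker_def act_def)
 ultimately show ?thesis using t by (simp add: Cmp_Idm_left Cmp_Idm_right)
qed

lemma whisker_span:
 assumes X: "X:Obj C" and f: "f:aspan C F F' S" and S: "S <= H F F'" and F: "F:Obj C" "F':Obj C"
 shows "whisker f X:aspan C (HObj C F X) (HObj C F' X) ((%ta. whisker ta X) ` S)"
 using f
proof (induction rule: aspan.induct)
 case nul
 have "whisker (Nul C F F') X:H (HObj C F X) (HObj C F' X)" unfolding whisker_def using F X by (intro HArr_hom) auto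
 hence "whisker (Nul C F F') X = Nul C (HObj C F X) (HObj C F' X)"
  using HArr_Scl_left[OF X Nul_hom[OF F], of 0] Scl_0 F by (simp add: whisker_def Scl_Nul)
 thus ?case by (auto intro: aspan.nul)
next
 case (add f g)
 hence "f:H F F'" "g:H F F'" using aspan_hom S F by auto
 hence "whisker (f+.g) X = whisker f X+.whisker g X" using HArr_Add_left[OF X] by (simp add: whisker_def)
 thus ?case using add by (auto intro: aspan.add)
qed (auto intro: aspan.base)

text \<open>\<open>cell\<close> concerns a generator as left factor. For general F the identity of F
  is a sum of maps through generators; whiskered with \<open>D t\<close>, it splits y x into terms
  each of which goes through some \<open>HObj C (D s) (D t)\<close>, and one of them is
  nonzero.\<close>

lemma retract_le:
 assumes F: "F:Obj C" and g: "g:P" and t: "t:P" and x: "x:H (D g) (HObj C F (D t))"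
  and y: "y:H (HObj C F (D t)) (D g)" and yx: "y**x ~= Nul C (D g) (D g)"
 shows "g <= t"
proof (rule ccontr)
 assume ngt: "~ g <= t"
 let ?X = "HObj C F (D t)"
 have O: "D g:Obj C" "D t:Obj C" "?X:Obj C" using g t D_Obj F HObj_Obj by auto
 have 1: "whisker (Idm C F) (D t):aspan C ?X ?X ((%ta. whisker ta (D t)) ` through C D P F F)"
  by (rule whisker_span[OF O(2) gen[OF F] through_hom F F])
 have sub: "(%ta. whisker ta (D t)) ` through C D P F F <= H ?X ?X"
  using through_hom O by (force simp: whisker_def intro!: HArr_hom)
 have 2: "y**Idm C ?X:aspan C ?X (D g) (Cmp C y ` (%ta. whisker ta (D t)) ` through C D P F F)"
  using aspan_Cmp_left[OF 1 sub y O(3)] whisker_Idm F O by simp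
 have sub2: "Cmp C y ` (%ta. whisker ta (D t)) ` through C D P F F <= H ?X (D g)"
  using sub y by auto
 have "y**Idm C ?X**x:aspan C (D g) (D g) ((%f. f**x) ` Cmp C y ` (%ta. whisker ta (D t)) ` through C D P F F)"
  by (rule aspan_Cmp_right[OF 2 sub2 x O(1)])
 moreover have "(%f. f**x) ` Cmp C y ` (%ta. whisker ta (D t)) ` through C D P F F <= {Nul C (D g) (D g)}"
 proof
  fix z assume "z:(%f. f**x) ` Cmp C y ` (%ta. whisker ta (D t)) ` through C D P F F"
  then obtain a p s where z: "z = (y**whisker (a**p) (D t))**x" "s:P" "p:H F (D s)" "a:H (D s) F"
  by (auto simp: through_def)
  have ap: "ar a" "src a = D s" "trg a = F" "ar p" "src p = F" "trg p = D s" using z by (auto simp: hom_iff)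
  have xy: "ar x" "src x = D g" "trg x = ?X" "ar y" "src y = ?X" "trg y = D g" using x y by (auto simp: hom_iff)
  let ?a = "whisker a (D t)" and ?p = "whisker p (D t)"
  have w: "ar ?a" "src ?a = HObj C (D s) (D t)" "trg ?a = ?X" "ar ?p" "src ?p = ?X" "trg ?p = HObj C (D s) (D t)"
  using whisker_typs[OF _ O(2)] ap by auto
  have "z = (y**?a)**(?p**x)" using z(1) ap w xy O by (simp add: whisker_Cmp assoc ar_Cmp src_Cmp trg_Cmp)
  moreover have "(y**?a)**(?p**x) = Nul C (D g) (D g)"
  proof (rule ccontr)
  assume "(y**?a)**(?p**x) ~= Nul C (D g) (D g)"
  hence "g <= t" by (rule cell[OF g z(2) t, rotated 2]) (use w xy in "auto simp: hom_iff ar_Cmp src_Cmp trg_Cmp")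
  thus False using ngt by simp
  qed
  ultimately show "z:{Nul C (D g) (D g)}" by simp
 qed
 ultimately have "y**Idm C ?X**x = Nul C (D g) (D g)" by (rule aspan_Nul) (use O in auto)
 thus False using yx x y by (simp add: hom_iff Idm_r)
qed

lemma rep_iso: "rep X g b==>isomorphic C X (D g)"
 unfolding rep_def isomorphic_def iso_arr_def arrow_def
 by (metis (no_types, lifting) hom_def hom_iff mem_Collect_eq)

lemma iso_rep: assumes "isomorphic C X (D g)" "g:P" shows "EX b. rep X g b"
proof -
 obtain f k where "f:H X (D g)" "k:H (D g) X" "k**f = Idm C X" "f**k = Idm C (D g)"
  using assms(1) unfolding isomorphic_def iso_arr_def arrow_def hom_def by auto
 thus ?thesis using assms(2) unfolding rep_def by blast
qed

lemma rep_inverse: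
 assumes "rep X g b"
 obtains a a' where "a:H (D g) X" "a':H X (D g)" "a'**a = Idm C (D g)" "a**a' = Idm C X"
 using assms unfolding rep_def by blast

text \<open>By \<open>retract_le\<close>, comparability both ways in the left preorder gives g <= i
  and i <= g, so antisymmetry of the poset makes the cell an isomorphism class. For isomorphic
  objects the unit serves as H.\<close>

lemma left_cell_class: "left_cell C (iso_class C (D i))"
proof -
 have UO: "Unit C:Obj C" using unit rep_Obj by auto
 have Di: "D i:Obj C" using i D_Obj by simp
 obtain Z where Z: "zero_object C Z" using zero_ex by blast
 have "G:iso_class C (D i) \<longleftrightarrow> indecomposable C G & left_ge C G (D i) & left_ge C (D i) G" for G
 proof
  assume "G:iso_class C (D i)"
  hence G: "G:Obj C" "isomorphic C G (D i)" by (auto simp: iso_class_def)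
  obtain b where b: "rep G i b" using iso_rep[OF G(2) i] by blast
  obtain a a' where a: "a:H (D i) G" "a':H G (D i)" "a'**a = Idm C (D i)" "a**a' = Idm C G"
  using rep_inverse[OF b] by blast
  have "direct_sum C (D i) G Z" using direct_sumI_inverse[OF a(2,1,4,3) Z] .
  moreover have "direct_sum C G (D i) Z" using direct_sumI_inverse[OF a Z] .
  ultimately show "indecomposable C G & left_ge C G (D i) & left_ge C (D i) G"
  using indecomposable_rep[OF b] UO HObj_Unit G Di unfolding left_ge_def summand_def by metis
 next
  assume G: "indecomposable C G & left_ge C G (D i) & left_ge C (D i) G"
  obtain g b where b: "rep G g b" using indecomposable_ex_rep G by blast
  have GO: "G:Obj C" and gP: "g:P" using b rep_Obj rep_P by auto
  have Dg: "D g:Obj C" using gP D_Obj by simp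
  obtain a a' where a: "a:H (D g) G" "a':H G (D g)" "a'**a = Idm C (D g)" "a**a' = Idm C G"
  using rep_inverse[OF b] by blast
  have retr: "EX F:Obj C. EX x:H X (HObj C F Y). EX y:H (HObj C F Y) X. y**x = Idm C X" if "left_ge C X Y" for X Y
  using that unfolding left_ge_def summand_def direct_sum_def hom_def by blast
  have "g <= i"
  proof -
  obtain F x y where F: "F:Obj C" and x: "x:H G (HObj C F (D i))" and y: "y:H (HObj C F (D i)) G"
  and yx: "y**x = Idm C G" using retr G by blast
  have e1: "(a'**y)**(x**a) = a'**((y**x)**a)" using a(1,2) x y by (simp add: typs assoc)
  have "(a'**y)**(x**a) = Idm C (D g)" unfolding e1 yx using a by (simp add: hom_iff Idm_l)
  hence "(a'**y)**(x**a) ~= Nul C (D g) (D g)" using rep_Idm_nz[OF rep_D[OF gP]] by simp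
  thus ?thesis using retract_le[OF F gP i Cmp_hom[OF x a(1)] Cmp_hom[OF a(2) y]] by blast
  qed
  moreover have "i <= g"
  proof -
  obtain F x y where F: "F:Obj C" and x: "x:H (D i) (HObj C F G)" and y: "y:H (HObj C F G) (D i)"
  and yx: "y**x = Idm C (D i)" using retr G by blast
  \<comment> \<open>G is only isomorphic to \<open>D g\<close>; the action of F on that isomorphism
    moves the retraction to \<open>HObj C F (D g)\<close>.\<close>
  have aH: "act C F a:H (HObj C F (D g)) (HObj C F G)" "act C F a':H (HObj C F G) (HObj C F (D g))"
  using act_hom F a by auto
  have aa: "act C F a**act C F a' = Idm C (HObj C F G)"
  using act_Cmp[OF F, of a' a] a act_Idm[OF F GO] by (simp add: hom_iff)
  have e1: "(y**act C F a)**(act C F a'**x) = y**((act C F a**act C F a')**x)"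
  using aH x y by (simp add: typs assoc)
  have "(y**act C F a)**(act C F a'**x) = Idm C (D i)" unfolding e1 aa using x yx by (simp add: hom_iff Idm_l)
  hence "(y**act C F a)**(act C F a'**x) ~= Nul C (D i) (D i)" using rep_Idm_nz[OF rep_D[OF i]] by simp
  thus ?thesis using retract_le[OF F i gP Cmp_hom[OF aH(2) x] Cmp_hom[OF y aH(1)]] by blast
  qed
  ultimately have "g = i" by simp
  thus "G:iso_class C (D i)" using rep_iso[OF b] GO by (simp add: iso_class_def)
 qed
 hence "iso_class C (D i) = {G. indecomposable C G & left_ge C G (D i) & left_ge C (D i) G}" by blast
 moreover have "indecomposable C (D i)" using indecomposable_rep[OF rep_D[OF i]] .
 ultimately show ?thesis unfolding left_cell_def by blast
qed

text \<open>It has to be shown that the identity of F applied to \<open>trg S\<close> factors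
  through F S, and this is tested on the images F x of points. A point x away from g already factors
  through S. At g, \<open>vanish\<close> expands the identity of D i D g through the maps
  \<open>e c g\<close> with c < g, and \<open>x**e c g\<close> is a point away from g.\<close>

lemma act_zero:
 assumes F: "rep F i f" and S: "ar S" and g: "g:P" "~ g <= j"
  and *: "!!t x. t:P==>t ~= g==>x:H (D t) (trg S)==>x:fact S (D t)"
 shows "zero_object A (act C F S)"
proof -
 have FO: "F:Obj C" using F rep_Obj by auto
 have Di: "D i:Obj C" using i D_Obj by simp
 have SO: "src S:Obj C" "trg S:Obj C" using S ar_Obj by auto
 obtain ta' ta where th: "ta':H (D i) F" "ta:H F (D i)" "ta**ta' = Idm C (D i)" "ta'**ta = Idm C F"
  using rep_inverse[OF F] by blast
 have tt: "ar ta" "src ta = F" "trg ta = D i" "ar ta'" "src ta' = D i" "trg ta' = F" using th by (auto simp: hom_iff)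
 note FS = act_typs[OF FO S]
 have el: "act C F x:fact (act C F S) (HObj C F (D s))" if s: "s:P" and x: "x:H (D s) (trg S)" for s x
 proof (cases "s = g")
  case False
  then obtain y where y: "ar y" "src y = D s" "trg y = src S" "x = S**y" using * s x S by (auto simp: fact_iff)
  hence "act C F x = act C F S**act C F y" using act_Cmp[OF FO y(1) S] by simp
  thus ?thesis using y act_typs[OF FO y(1)] FS by (simp add: fact_comp)
 next
  case True
  have Dg: "D g:Obj C" using g D_Obj by simp
  note x' = x[unfolded True]
  have xt: "ar x" "src x = D g" "trg x = trg S" using x' by (auto simp: hom_iff)
  let ?X = "HObj C (D i) (D g)" and ?G = "HObj C F (D g)"
  let ?t = "whisker ta (D g)" and ?t' = "whisker ta' (D g)"
  have wt: "ar ?t" "src ?t = ?G" "trg ?t = ?X" "ar ?t'" "src ?t' = ?X" "trg ?t' = ?G"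
  using whisker_typs[OF _ Dg] tt by auto
  have t't: "?t'**?t = Idm C ?G" using whisker_Cmp[OF tt(1,4) _ Dg] th(4) tt whisker_Idm[OF FO Dg] by simp
  let ?S = "{HArr C (Idm C (D i)) (e c g)**x | c x. c:P & c < g & x:H (HObj C (D i) (D g)) (HObj C (D i) (D c))}"
  have XO: "?X:Obj C" "?G:Obj C" using wt ar_Obj by metis+
  have SH: "?S <= H ?X ?X"
  proof
  fix z assume "z:?S"
  then obtain c y where "z = HArr C (Idm C (D i)) (e c g)**y" "c:P" "c < g" "y:H ?X (HObj C (D i) (D c))" by blast
  thus "z:H ?X ?X" using act_hom[OF Di e_hom[OF _ g(1) less_imp_le], of c] by (auto simp: act_def)
  qed
  \<comment> \<open>\<open>vanish\<close> is about \<open>D i\<close>, so the source of F x is moved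
    along the isomorphism of F with \<open>D i\<close>; \<open>nat\<close> below moves
    \<open>e c g\<close> back.\<close>
  let ?k = "act C F x**?t'"
  note Fx = act_typs[OF FO xt(1)]
  have kt: "?k:H ?X (HObj C F (trg S))" using Fx xt wt by (simp add: typs)
  have 1: "?k**Idm C ?X:aspan C ?X (HObj C F (trg S)) (Cmp C ?k ` ?S)"
  by (rule aspan_Cmp_left[OF vanish[OF g] SH kt XO(1)])
  have "Cmp C ?k ` ?S <= fact (act C F S) ?X"
  proof
  fix z assume "z:Cmp C ?k ` ?S"
  then obtain c y where z: "z = ?k**(act C (D i) (e c g)**y)" "c:P" "c < g" "y:H ?X (HObj C (D i) (D c))"
  by (auto simp: act_def)
  have ec: "ar (e c g)" "src (e c g) = D c" "trg (e c g) = D g" using e_typ[OF z(2) g(1)] z by auto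
  have Dc: "D c:Obj C" using z D_Obj by simp
  have ect: "ar (act C (D i) (e c g))" "src (act C (D i) (e c g)) = HObj C (D i) (D c)" "trg (act C (D i) (e c g)) = ?X"
  using act_typs[OF Di ec(1)] ec by auto
  have ecF: "ar (act C F (e c g))" "src (act C F (e c g)) = HObj C F (D c)" "trg (act C F (e c g)) = ?G"
  using act_typs[OF FO ec(1)] ec by auto
  have wc: "ar (whisker ta' (D c))" "src (whisker ta' (D c)) = HObj C (D i) (D c)" "trg (whisker ta' (D c)) = HObj C F (D c)"
  using whisker_typs[OF tt(4) Dc] tt by auto
  have nat: "?t'**act C (D i) (e c g) = act C F (e c g)**whisker ta' (D c)"
  using whisker_natural[OF tt(4) ec(1)] tt ec by simp
  have yt: "ar y" "src y = ?X" "trg y = HObj C (D i) (D c)" using z by (auto simp: hom_iff)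
  have "z = act C F x**((?t'**act C (D i) (e c g))**y)"
  using z(1) Fx xt wt ect yt by (simp add: assoc typs)
  also have "... = (act C F x**act C F (e c g))**(whisker ta' (D c)**y)"
  unfolding nat using Fx xt ecF wc yt by (simp add: assoc typs)
  also have "act C F x**act C F (e c g) = act C F (x**e c g)" using act_Cmp[OF FO ec(1) xt(1)] ec xt by simp
  finally have zz: "z = act C F (x**e c g)**(whisker ta' (D c)**y)" .
  have "x**e c g:fact S (D c)" using *[of c "x**e c g"] z xt ec by (simp add: typs less_imp_neq)
  then obtain v where v: "ar v" "src v = D c" "trg v = src S" "x**e c g = S**v" using S by (auto simp: fact_iff)
  hence "act C F (x**e c g) = act C F S**act C F v" using act_Cmp[OF FO v(1) S] by simp
  hence "act C F (x**e c g):fact (act C F S) (HObj C F (D c))"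
  using v act_typs[OF FO v(1)] FS by (simp add: fact_comp)
  thus "z:fact (act C F S) ?X" unfolding zz
  using wc yt by (intro fact_precomp[OF FS(1)]) (auto simp: typs)
  qed
  hence "?k**Idm C ?X:fact (act C F S) ?X"
  using aspan_fact'[OF 1] FS XO by simp
  hence "?k:fact (act C F S) ?X" using kt by (simp add: hom_iff Idm_r)
  hence "?k**?t:fact (act C F S) ?G" using fact_precomp[OF FS(1)] wt by metis
  moreover have "?k**?t = act C F x" using Fx xt wt t't by (simp add: assoc Idm_r)
  ultimately show ?thesis using True by simp
 qed
 have "Idm C (HObj C F (trg S)):aspan C (HObj C F (trg S)) (HObj C F (trg S)) (act C F ` through C D P (trg S) (trg S))"
  using act_span[OF FO gen[OF SO(2)] through_hom SO(2) SO(2)] act_Idm[OF FO SO(2)] by simp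
 moreover have "act C F ` through C D P (trg S) (trg S) <= fact (act C F S) (HObj C F (trg S))"
 proof
  fix z assume "z:act C F ` through C D P (trg S) (trg S)"
  then obtain a p s where z: "z = act C F (a**p)" "s:P" "p:H (trg S) (D s)" "a:H (D s) (trg S)"
  by (auto simp: through_def)
  have ap: "ar a" "src a = D s" "trg a = trg S" "ar p" "src p = trg S" "trg p = D s" using z by (auto simp: hom_iff)
  have "z = act C F a**act C F p" using z(1) act_Cmp[OF FO ap(4,1)] ap by simp
  thus "z:fact (act C F S) (HObj C F (trg S))"
  using fact_precomp[OF FS(1) el[OF z(2,4)], of "act C F p" "HObj C F (trg S)"] act_typs[OF FO ap(4)] ap by simp
 qed
 ultimately have "Idm C (HObj C F (trg S)):fact (act C F S) (HObj C F (trg S))"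
  using aspan_fact' FS HObj_Obj[OF FO SO(2)] by blast
 thus ?thesis using FS by (simp add: zero_object_A)
qed

text \<open>\<open>full\<close> passes from generators to all objects: the identity of X is a sum of
  maps through generators, and D i is additive.\<close>

lemma full_i:
 assumes X: "X:Obj C" and k: "k:H (HObj C (D i) (D j)) (HObj C (D i) X)"
 shows "EX y:H (D j) X. k = act C (D i) y"
proof -
 have Di: "D i:Obj C" and Dj: "D j:Obj C" using i j D_Obj by auto
 let ?J = "HObj C (D i) (D j)" and ?X = "HObj C (D i) X"
 have XO: "?X:Obj C" "?J:Obj C" using HObj_Obj Di Dj X by auto
 have 0: "act C (D i) ` through C D P X X <= H ?X ?X" using act_hom[OF Di] through_hom by blast
 have 1: "Idm C ?X:aspan C ?X ?X (act C (D i) ` through C D P X X)"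
  using act_span[OF Di gen[OF X] through_hom X X] act_Idm[OF Di X] by simp
 have "Idm C ?X**k:aspan C ?J ?X ((%f. f**k) ` act C (D i) ` through C D P X X)"
  by (rule aspan_Cmp_right[OF 1 0 k XO(1)])
 hence "k:aspan C ?J ?X ((%f. f**k) ` act C (D i) ` through C D P X X)"
  using k by (simp add: hom_iff Idm_l)
 thus ?thesis
 proof (induction rule: aspan.induct)
  case nul
  thus ?case using act_Nul[OF Di Dj X] Dj X by (metis Nul_hom)
 next
  case (base f)
  then obtain a p s where z: "f = act C (D i) (a**p)**k" "s:P" "p:H X (D s)" "a:H (D s) X"
  by (auto simp: through_def)
  have ap: "ar a" "src a = D s" "trg a = X" "ar p" "src p = X" "trg p = D s" using z by (auto simp: hom_iff)
  note at = act_typs[OF Di ap(1)] act_typs[OF Di ap(4)]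
  have "act C (D i) p**k:H ?J (HObj C (D i) (D s))" using at ap k by (simp add: typs)
  then obtain y where y: "y:H (D j) (D s)" "act C (D i) p**k = act C (D i) y"
  using full[OF z(2)] by (auto simp: act_def)
  have yt: "ar y" "src y = D j" "trg y = D s" using y by (auto simp: hom_iff)
  have "f = act C (D i) a**(act C (D i) p**k)" using z(1) act_Cmp[OF Di ap(4,1)] ap at k by (simp add: hom_iff assoc)
  hence "f = act C (D i) (a**y)" using y act_Cmp[OF Di yt(1) ap(1)] yt ap by simp
  thus ?case using yt ap by (intro bexI[of _ "a**y"]) (auto simp: typs)
 next
  case (add f g)
  then obtain y y' where "y:H (D j) X" "y':H (D j) X" "f = act C (D i) y" "g = act C (D i) y'" by blast
  thus ?case using HArr_Add_right[OF Di, of y "D j" X y'] by (intro bexI[of _ "y+.y'"]) (auto simp: act_def)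
 qed
qed

lemma faithful_i:
 assumes y: "y:H (D j) X" and n: "act C (D i) y = Nul C (HObj C (D i) (D j)) (HObj C (D i) X)"
 shows "y = Nul C (D j) X"
proof -
 have Di: "D i:Obj C" and Dj: "D j:Obj C" using i j D_Obj by auto
 have X: "X:Obj C" using y hom_Obj by auto
 have "Idm C X**y:aspan C (D j) X ((%f. f**y) ` through C D P X X)"
  by (rule aspan_Cmp_right[OF gen[OF X] through_hom y X])
 moreover have "(%f. f**y) ` through C D P X X <= {Nul C (D j) X}"
 proof
  fix z assume "z:(%f. f**y) ` through C D P X X"
  then obtain a p s where z: "z = (a**p)**y" "s:P" "p:H X (D s)" "a:H (D s) X"
  by (auto simp: through_def)
  have ap: "ar a" "src a = D s" "trg a = X" "ar p" "src p = X" "trg p = D s" "ar y" "src y = D j" "trg y = X"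
  using z y by (auto simp: hom_iff)
  have "act C (D i) (p**y) = act C (D i) p**act C (D i) y" using act_Cmp[OF Di, of y p] ap by simp
  also have "... = Nul C (HObj C (D i) (D j)) (HObj C (D i) (D s))"
  unfolding n using act_typs[OF Di ap(4)] ap HObj_Obj Di Dj by (simp add: Nul_r)
  finally have "p**y = Nul C (D j) (D s)" using faithful[OF z(2), of "p**y"] ap by (simp add: act_def typs)
  thus "z:{Nul C (D j) X}" using z(1) ap Dj X by (simp add: assoc Nul_r)
 qed
 ultimately have "Idm C X**y = Nul C (D j) X" by (rule aspan_Nul) (use Dj X in auto)
 thus ?thesis using y by (simp add: hom_iff Idm_l)
qed

text \<open>If F S were zero, the arrow D i S would have a section. By \<open>full_i\<close> the
  section turns D i x into D i y for some y, so D i x = D i (S y), and \<open>faithful_i\<close>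
  yields x = S y, a zero point of S.\<close>

lemma act_nonzero:
 assumes F: "rep F i f" and S: "ar S" and x: "x:H (D j) (trg S)" "x \<notin> fact S (D j)"
 shows "~ zero_object A (act C F S)"
proof
 assume z: "zero_object A (act C F S)"
 have FO: "F:Obj C" using F rep_Obj by auto
 have Di: "D i:Obj C" and Dj: "D j:Obj C" using i j D_Obj by auto
 have SO: "src S:Obj C" "trg S:Obj C" using S ar_Obj by auto
 obtain ta' ta where th: "ta':H (D i) F" "ta:H F (D i)" "ta**ta' = Idm C (D i)" "ta'**ta = Idm C F"
  using rep_inverse[OF F] by blast
 have tt: "ar ta" "src ta = F" "trg ta = D i" "ar ta'" "src ta' = D i" "trg ta' = F" using th by (auto simp: hom_iff)
 note FS = act_typs[OF FO S] and IS = act_typs[OF Di S]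
 have xt: "ar x" "src x = D j" "trg x = trg S" using x by (auto simp: hom_iff)
 have "Idm C (HObj C F (trg S)):fact (act C F S) (HObj C F (trg S))"
  using z FS by (simp add: zero_object_A)
 then obtain h where h: "ar h" "src h = HObj C F (trg S)" "trg h = HObj C F (src S)" "Idm C (HObj C F (trg S)) = act C F S**h"
  using FS by (auto simp: fact_iff)
 let ?ts = "whisker ta (src S)" and ?tt = "whisker ta (trg S)" and ?tt' = "whisker ta' (trg S)"
 have w: "ar ?ts" "src ?ts = HObj C F (src S)" "trg ?ts = HObj C (D i) (src S)"
  "ar ?tt" "src ?tt = HObj C F (trg S)" "trg ?tt = HObj C (D i) (trg S)"
  "ar ?tt'" "src ?tt' = HObj C (D i) (trg S)" "trg ?tt' = HObj C F (trg S)"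
  using whisker_typs[OF tt(1) SO(1)] whisker_typs[OF tt(1) SO(2)] whisker_typs[OF tt(4) SO(2)] tt by auto
 have nat: "?tt**act C F S = act C (D i) S**?ts" using whisker_natural[OF tt(1) S] tt by simp
 have inv: "?tt**?tt' = Idm C (HObj C (D i) (trg S))"
  using whisker_Cmp[OF tt(4,1) _ SO(2)] th(3) tt whisker_Idm[OF Di SO(2)] by simp
 \<comment> \<open>The section h of F S, carried over to \<open>D i\<close> by whiskering with the
   isomorphism.\<close>
 let ?h = "?ts**(h**?tt')"
 have "act C (D i) S**?h = (?tt**act C F S)**(h**?tt')" unfolding nat using IS w h by (simp add: assoc typs)
 also have "... = ?tt**((act C F S**h)**?tt')" using FS w h(1-3) by (simp add: assoc typs)
 also have "... = Idm C (HObj C (D i) (trg S))" using h(4) w inv by (simp add: Idm_l flip: h(4))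
 finally have Sh: "act C (D i) S**?h = Idm C (HObj C (D i) (trg S))" .
 have ht: "ar ?h" "src ?h = HObj C (D i) (trg S)" "trg ?h = HObj C (D i) (src S)" using w h by (auto simp: typs)
 note Ix = act_typs[OF Di xt(1)]
 have "?h**act C (D i) x:H (HObj C (D i) (D j)) (HObj C (D i) (src S))" using ht Ix xt by (simp add: hom_iff ar_Cmp src_Cmp trg_Cmp)
 then obtain y where y: "y:H (D j) (src S)" "?h**act C (D i) x = act C (D i) y" using full_i[OF SO(1)] by blast
 have yt: "ar y" "src y = D j" "trg y = src S" using y by (auto simp: hom_iff)
 have "act C (D i) x = (act C (D i) S**?h)**act C (D i) x" unfolding Sh using Ix xt by (simp add: Idm_l)
 also have "... = act C (D i) S**(?h**act C (D i) x)" using IS Ix ht xt by (simp add: assoc)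
 also have "... = act C (D i) (S**y)" unfolding y(2) using act_Cmp[OF Di yt(1) S] yt by simp
 finally have eq: "act C (D i) x = act C (D i) (S**y)" .
 have Sy: "S**y:H (D j) (trg S)" using S yt by (simp add: typs)
 have "act C (D i) (x-.S**y) = act C (D i) x-.act C (D i) (S**y)"
  using HArr_Add_right[OF Di x(1), of "Scl C (-1) (S**y)"] HArr_Scl_right[OF Di Sy, of "-1"] Sy
  by (simp add: act_def dif_def Scl_hom)
 also have "... = Nul C (HObj C (D i) (D j)) (HObj C (D i) (trg S))"
  using eq dif_self act_hom[OF Di x(1)] by metis
 finally have "x-.S**y = Nul C (D j) (trg S)" using faithful_i x(1) Sy by blast
 hence "x = S**y" using dif_eq_Nul x(1) Sy by blast
 thus False using x(2) S yt by (simp add: fact_comp)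
qed

end

section \<open>Existence and uniqueness of the Duflo involution\<close>

context duflo_setting begin

lemma iso_class_rep: "F:iso_class C (D i)==>EX f. rep F i f"
 using iso_rep i by (auto simp: iso_class_def)

lemma Di_class: "D i:iso_class C (D i)"
 using rep_iso[OF rep_D[OF i]] D_Obj[OF i] by (simp add: iso_class_def)

lemma iso_Idm: "ar av==>isomorphic A av av"
 unfolding isomorphic_def iso_arr_def using adm_Idm[of av]
 by (intro exI[of _ "pm av av (Idm C (trg av))"])
  (auto simp: arrow_pm pm_Idm pm_Cmp Mor_pm typs cat intro!: bexI[of _ "pm av av (Idm C (trg av))"])

lemma unit_typs: "Unit C:Obj C" "s:P==>ar (u s)" "s:P==>src (u s) = D s" "s:P==>trg (u s) = Unit C"
 using rep_Obj[OF unit] rep_b[OF unit] top by auto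

lemma unit_hom:
 assumes "s:P" "x:H (D s) (Unit C)" "x ~= Nul C (D s) (Unit C)"
 obtains c where "c ~= 0" "x = Scl C c (u s)"
 using rep_hom[OF unit assms] by blast

lemma unit_cmp: "s:P==>t:P==>s <= t==>u t**e s t = u s"
 using rep_cmp[OF unit] top by blast

lemma unit_nz: "s:P==>u s ~= Nul C (D s) (Unit C)"
 using rep_nz[OF unit] top by blast

lemma D_hom:
 assumes "s:P" "t:P" "x:H (D s) (D t)" "x ~= Nul C (D s) (D t)"
 obtains c where "s <= t" "c ~= 0" "x = Scl C c (e s t)"
 using hom_D[OF assms(1-3)] assms(4) Scl_0[OF e_hom[OF assms(1,2)]] by metis

text \<open>K is the projective on \<open>D j\<close>, embedded by \<open>u j\<close>; the quotient
  is the diagram \<open>u j\<close>, in which all points at h <= j vanish. Its simple subquotients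
  therefore sit at h not below j, and \<open>act_zero\<close> kills them.\<close>

lemma duflo_j: "duflo_involution C (iso_class C (D i)) (D j)"
 unfolding duflo_involution_def Let_def
proof (intro conjI left_cell_class indecomposable_rep[OF rep_D[OF j]])
 have Dj: "D j:Obj C" using j D_Obj by simp
 note uj = unit_typs(2-4)[OF j] and U = unit_typs(1)
 note pj = pr_typs[OF Dj] and pU = pr_typs[OF U]
 let ?k = "pm (pr (D j)) (pr (Unit C)) (u j)" and ?q = "pm (pr (Unit C)) (u j) (Idm C (Unit C))"
 have ak: "adm (pr (D j)) (pr (Unit C)) (u j)" using pU uj Dj U by (simp add: adm_from_pr hom_iff)
 have mk: "mono_arr A ?k"
 proof (rule monoI[OF pj(1) pU(1) ak])
  fix s x assume s: "s:P" and x: "x:H (D s) (trg (pr (D j)))" and ux: "u j**x:fact (pr (Unit C)) (D s)"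
  have Ds: "D s:Obj C" using s D_Obj by simp
  have x': "x:H (D s) (D j)" using x pj by simp
  have "x = Nul C (D s) (D j)"
  proof (rule ccontr)
  assume "x ~= Nul C (D s) (D j)"
  then obtain c where c: "s <= j" "c ~= 0" "x = Scl C c (e s j)" using D_hom[OF s j x'] by blast
  have "u j**x = Scl C c (u s)" using c uj e_typ[OF s j c(1)] unit_cmp[OF s j c(1)] by (simp add: Scl_r)
  hence "Scl C c (u s) = Nul C (D s) (Unit C)" using ux U by (simp add: fact_pr)
  thus False using rep_scl_nz[OF unit s top[OF s]] c by blast
  qed
  thus "x:fact (pr (D j)) (D s)" using Dj Ds by (simp add: fact_pr)
 qed
 have ck: "cokernel A ?k ?q"
  using pr_cokernel[of "pr (D j)" "u j" "Unit C"] pj uj U Dj z0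
  by (simp add: proj_object_def z0_def[symmetric] Nul_r)
 have 1: "ALL F:iso_class C (D i). ALL X S. indecomposable C X & simple_at C X S & subquotient A S (trg ?q) --> zero_object A (act C F S)"
 proof (intro ballI allI impI)
  fix F X S assume F: "F:iso_class C (D i)"
  and XS: "indecomposable C X & simple_at C X S & subquotient A S (trg ?q)"
  obtain f where f: "rep F i f" using iso_class_rep[OF F] by blast
  obtain h b where b: "rep X h b" using indecomposable_ex_rep XS by blast
  have h: "h:P" using rep_P[OF b] .
  have S: "simple_top A (pr X) S" using XS by (simp add: simple_at_def)
  note st = simple_top_rep[OF b S]
  \<comment> \<open>A nonzero point of the simple object lifts along \<open>ep\<close> to a
    subobject of the quotient, where points at an h below j are zero.\<close>
  have "~ h <= j"
  proof
  assume hj: "h <= j"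
  obtain m ep where m: "mono_arr A m" "trg m = u j" "epi_arr A ep" "src ep = src m" "trg ep = S"
  using XS by (auto simp: subquotient_def)
  obtain zv m0 where ze: "ar zv" "adm zv (u j) m0" "m = pm zv (u j) m0"
  using m arrow_AE unfolding mono_arr_def by (metis pm_sel(2))
  obtain e0 where e0: "adm zv S e0" "ep = pm zv S e0"
  using m ze arrow_AE unfolding epi_arr_def by (metis pm_sel)
  obtain y where y: "y:H (D h) (trg S)" "y \<notin> fact S (D h)" using st(3) by blast
  obtain a where a: "a:H (D h) (trg zv)" "y-.e0**a:fact S (D h)"
  using epi_arr_fact[OF m(3)[unfolded e0] ze(1) st(1) e0(1) y(1)] by blast
  have m0: "ar m0" "src m0 = trg zv" "trg m0 = Unit C" using adm_typ[OF ze(2)] uj by auto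
  have "m0**a:fact (u j) (D h)"
  proof (cases "m0**a = Nul C (D h) (Unit C)")
  case True
  thus ?thesis using uj h D_Obj by (simp add: fact_NulI)
  next
  case False
  have "m0**a:H (D h) (Unit C)" using m0 a by (simp add: typs)
  then obtain c where c: "m0**a = Scl C c (u h)" using unit_hom[OF h _ False] by blast
  have "u h = u j**e h j" using unit_cmp[OF h j hj] by simp
  hence "u h:fact (u j) (D h)" using fact_comp[OF uj(1), of "e h j"] e_typ[OF h j hj] uj by simp
  thus ?thesis using c fact_scl uj by simp
  qed
  hence "a:fact zv (D h)" using mono_fact'[OF m(1)[unfolded ze(3)] ze(1) uj(1) ze(2) a(1)] by simp
  hence "e0**a:fact S (D h)" using adm_fact_Cmp[OF ze(1) st(1) e0(1)] by simp
  hence "y:fact S (D h)" using fact_of_dif[OF st(1) a(2)] y(1) by (simp add: hom_iff)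
  thus False using y by simp
  qed
  thus "zero_object A (act C F S)" using act_zero[OF f st(1) h _ st(2)] by blast
 qed
 have T: "{t\<in>P. t < j} <= {t\<in>P. t <= j}" by auto
 \<comment> \<open>A concrete model of the simple object at j is needed as witness: the diagram that
   divides out all generators strictly below j.\<close>
 obtain w g where p: "presents (D j) (%s. Idm C (D j)**e s j) {t\<in>P. t < j} w g"
  using presents_ex[OF rep_D[OF j] T] by blast
 note rt = rad_top[OF rep_D[OF j] p] rad_typs[OF rep_D[OF j] p]
 have 2: "EX T S. simple_top A (src ?k) T & simple_at C (D j) S & isomorphic A T S"
  using rt iso_Idm[OF rt(4)] unfolding simple_at_def pm_sel by blast
 have 3: "ALL F:iso_class C (D i). ALL S. simple_at C (D j) S --> ~ zero_object A (act C F S)"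
 proof (intro ballI allI impI)
  fix F S assume F: "F:iso_class C (D i)" and S: "simple_at C (D j) S"
  obtain f where f: "rep F i f" using iso_class_rep[OF F] by blast
  note st = simple_top_rep[OF rep_D[OF j] S[unfolded simple_at_def]]
  show "~ zero_object A (act C F S)" using st(3) act_nonzero[OF f st(1)] by blast
 qed
 show "EX k q. mono_arr A k & trg k = pr (Unit C) & cokernel A k q &
  (ALL F:iso_class C (D i). ALL X S. indecomposable C X & simple_at C X S & subquotient A S (trg q) --> zero_object A (act C F S)) &
  (EX T S. simple_top A (src k) T & simple_at C (D j) S & isomorphic A T S) &
  (ALL F:iso_class C (D i). ALL S. simple_at C (D j) S --> ~ zero_object A (act C F S))"
  using mk ck 1 2 3 by (intro exI[of _ ?k] exI[of _ ?q]) simp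
qed

lemma cokernel_factor:
 assumes "cokernel A f q" "ar Z" "v:Mor A (trg f) Z" "Cmp A v f = Nul A (src f) Z"
 obtains x where "x:Mor A (trg q) Z" "Cmp A x q = v"
proof -
 have "ALL Z:Obj A. ALL g:Mor A (trg f) Z. Cmp A g f = Nul A (src f) Z -->
  (EX! u. u:Mor A (trg q) Z & Cmp A u q = g)"
  using assms(1) by (simp add: cokernel_def)
 moreover have "Z:Obj A" using assms(2) Obj_A by simp
 ultimately have "EX! u. u:Mor A (trg q) Z & Cmp A u q = v" using assms(3,4) by blast
 thus thesis using that by blast
qed

text \<open>On points a monomorphism into the unit projective is the kernel of its cokernel. The
  projection of the unit projective onto the diagram \<open>k0\<close> annihilates the subobject and
  so factors through \<open>q0\<close>; whatever dies in \<open>xi\<close> therefore dies in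
  \<open>k0\<close>, that is, comes from the subobject.\<close>

lemma cokernel_kernel:
 assumes c: "cokernel A (pm ke (pr (Unit C)) k0) (pm (pr (Unit C)) xi q0)"
  and ke: "ar ke" "adm ke (pr (Unit C)) k0" and xi: "ar xi" "adm (pr (Unit C)) xi q0"
 shows "x:fact k0 X==>q0**x:fact xi X"
  "x:H X (Unit C)==>q0**x:fact xi X==>x:fact k0 X"
proof -
 note U = unit_typs(1)
 note pU = pr_typs[OF U]
 have kt: "ar k0" "src k0 = trg ke" "trg k0 = Unit C" "k0**ke = Nul C (src ke) (Unit C)"
  using ke U by (auto simp: adm_to_pr hom_iff)
 have qt: "ar q0" "src q0 = Unit C" "trg q0 = trg xi" using xi U by (auto simp: adm_from_pr hom_iff)
 have "Cmp A (pm (pr (Unit C)) xi q0) (pm ke (pr (Unit C)) k0) = Nul A ke xi" using c by (simp add: cokernel_def)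
 hence qk: "q0**k0:fact xi (trg ke)"
  using ke xi pU kt qt adm_Cmp[OF ke(1) pU(1) xi(1) ke(2) xi(2)] adm_Nul[OF ke(1) xi(1)]
  by (simp add: pm_Cmp pm_Nul pm_eq_iff typs cat)
 show "q0**x:fact xi X" if x: "x:fact k0 X"
 proof -
  obtain y where y: "ar y" "src y = X" "trg y = trg ke" "x = k0**y" using x kt by (auto simp: fact_iff)
  hence "q0**x = (q0**k0)**y" using kt qt by (simp add: assoc)
  thus ?thesis using fact_precomp[OF xi(1) qk, of y X] y by simp
 qed
 show "x:fact k0 X" if x: "x:H X (Unit C)" "q0**x:fact xi X"
 proof -
  have ag: "adm (pr (Unit C)) k0 (Idm C (Unit C))" using kt U by (auto simp: adm_from_pr)
  have kk: "k0:fact k0 (trg ke)" using fact_comp[OF kt(1), of "Idm C (trg ke)" "trg ke"] kt ke by (simp add: typs cat)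
  have "Cmp A (pm (pr (Unit C)) k0 (Idm C (Unit C))) (pm ke (pr (Unit C)) k0) = Nul A ke k0"
  using ke kt pU ag kk adm_Cmp[OF ke(1) pU(1) kt(1) ke(2) ag] adm_Nul[OF ke(1) kt(1)] U
  by (simp add: pm_Cmp pm_Nul pm_eq_iff typs cat)
  moreover have "pm (pr (Unit C)) k0 (Idm C (Unit C)):Mor A (pr (Unit C)) k0"
  using Mor_pm[OF pU(1) kt(1) ag] .
  ultimately obtain v where v: "v:Mor A xi k0"
  "Cmp A v (pm (pr (Unit C)) xi q0) = pm (pr (Unit C)) k0 (Idm C (Unit C))"
  using c kt(1) unfolding cokernel_def Obj_A[symmetric] pm_sel by blast
  obtain v0 where v0: "adm xi k0 v0" "v = pm xi k0 v0" using v Mor_AE xi kt by blast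
  have vt: "ar v0" "src v0 = trg xi" "trg v0 = Unit C" using adm_typ[OF v0(1)] kt by auto
  have d: "v0**q0-.Idm C (Unit C):fact k0 (Unit C)"
  using v v0 kt pU xi ag adm_Cmp[OF pU(1) xi(1) kt(1) xi(2) v0(1)] by (simp add: pm_Cmp pm_eq_iff)
  have xt: "ar x" "src x = X" "trg x = Unit C" using x by (auto simp: hom_iff)
  have "(v0**q0-.Idm C (Unit C))**x:fact k0 X" using fact_precomp[OF kt(1) d, of x X] xt by simp
  hence d2: "v0**(q0**x)-.x:fact k0 X" using vt qt xt U by (simp add: typs cat)
  have "v0**(q0**x):fact k0 X" using adm_fact_Cmp[OF xi(1) kt(1) v0(1) x(2)] .
  thus ?thesis using fact_of_dif'[OF kt(1) d2] xt kt by simp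
 qed
qed

text \<open>Let K be the subobject and let g be the index of its top. Vanishing on the quotient by K
  puts the point \<open>u j\<close> into K, the simple top forces a maximal point of K above j to be
  g, and non-vanishing on the simple object at g gives g <= j.\<close>

lemma duflo_unique:
 assumes G: "duflo_involution C (iso_class C (D i)) G"
 shows "isomorphic C G (D j)"
proof -
 note U = unit_typs(1)
 note pU = pr_typs[OF U]
 obtain k q T S where G1: "indecomposable C G" and k: "mono_arr A k" "trg k = pr (Unit C)" "cokernel A k q"
  and c1: "!!X S. indecomposable C X==>simple_at C X S==>subquotient A S (trg q)==>zero_object A (act C (D i) S)"
  and c2: "simple_top A (src k) T" "simple_at C G S" "isomorphic A T S"
  and c3: "!!S. simple_at C G S==>~ zero_object A (act C (D i) S)"
  using G Di_class unfolding duflo_involution_def Let_def by blast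
 obtain g b where gb: "rep G g b" using indecomposable_ex_rep G1 by blast
 have gP: "g:P" using rep_P[OF gb] .
 obtain ke k0 where ke: "ar ke" "adm ke (pr (Unit C)) k0" "k = pm ke (pr (Unit C)) k0"
  using k arrow_AE unfolding mono_arr_def by (metis pm_sel(2))
 have "arrow A q" "src q = pr (Unit C)" using k by (auto simp: cokernel_def)
 then obtain xi q0 where xi: "ar xi" "adm (pr (Unit C)) xi q0" "q = pm (pr (Unit C)) xi q0"
  using arrow_AE by (metis pm_sel(1))
 have kt: "ar k0" "src k0 = trg ke" "trg k0 = Unit C" "k0**ke = Nul C (src ke) (Unit C)"
  using ke U by (auto simp: adm_to_pr hom_iff)
 have qt: "ar q0" "src q0 = Unit C" "trg q0 = trg xi" using xi U by (auto simp: adm_from_pr hom_iff)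
 note ck = cokernel_kernel[OF k(3)[unfolded ke(3) xi(3)] ke(1,2) xi(1,2)]
 note mk = k(1)[unfolded ke(3)]
 have k_inj: "y:fact ke X" if "y:H X (trg ke)" "k0**y = Nul C X (Unit C)" for y X
  using mono_fact'[OF mk ke(1) pU(1) ke(2) that(1)] that U hom_Obj[OF that(1)] by (simp add: fact_pr)
 have k_down: "u s:fact k0 (D s)" if "s:P" "t:P" "s <= t" "u t:fact k0 (D t)" for s t
  using fact_precomp[OF kt(1) that(4), of "e s t" "D s"] e_typ[OF that(1-3)] unit_cmp[OF that(1-3)] by simp
 have Dj: "D j:Obj C" using j D_Obj by simp
 note uj = unit_typs(2-4)[OF j]

 \<comment> \<open>Otherwise the simple object at j would be a subquotient of the quotient by K,
   although \<open>D i\<close> does not kill it.\<close>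
 have claim1: "u j:fact k0 (D j)"
 proof (rule ccontr)
  assume nj: "u j \<notin> fact k0 (D j)"
  \<comment> \<open>The generators below j whose points lie in K. By assumption j is not among the
    members of K, so dividing these out of the projective on \<open>D j\<close> keeps its
    top.\<close>
  define V where "V = {t\<in>P. t < j & u t:fact k0 (D t)}"
  have V: "V <= {t\<in>P. t <= j}" and L: "{t\<in>P. t < j} <= {t\<in>P. t <= j}" by (auto simp: V_def)
  obtain wV gV where pV: "presents (D j) (%s. Idm C (D j)**e s j) V wV gV"
  using presents_ex[OF rep_D[OF j] V] by blast
  obtain wL gL where pL: "presents (D j) (%s. Idm C (D j)**e s j) {t\<in>P. t < j} wL gL"
  using presents_ex[OF rep_D[OF j] L] by blast
  note fV = presents_fact[OF rep_D[OF j] pV V] and fL = presents_fact[OF rep_D[OF j] pL L]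
  have tV: "ar gV" "trg gV = D j" and tL: "ar gL" "trg gL = D j" using pV pL by (auto simp: presents_def)
  have ge: "gV**x:fact gV (D s)" if "x:H (D s) (src gV)" for s x
  using that tV by (simp add: hom_iff fact_comp)
  \<comment> \<open>The map from the projective on \<open>D j\<close> to the quotient by K. Its
    kernel on points is generated by V, so it descends to a monomorphism on
    \<open>gV\<close>.\<close>
  let ?m = "q0**u j"
  have mt: "ar ?m" "src ?m = D j" "trg ?m = trg xi" using uj qt by (auto simp: typs)
  have am: "adm gV xi ?m"
  proof -
  have "?m**gV:fact xi (src (?m**gV))"
  proof (rule gen_fact)
  fix s x assume s: "s:P" and x: "x:H (D s) (src (?m**gV))"
  have x': "x:H (D s) (src gV)" using x mt tV by (simp add: typs)
  have gx: "gV**x:H (D s) (D j)" using fV[OF s] ge[OF x'] by blast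
  have "u j**(gV**x):fact k0 (D s)"
  proof (cases "gV**x = Nul C (D s) (D j)")
  case True
  thus ?thesis using uj kt s D_Obj by (simp add: Nul_r fact_NulI)
  next
  case False
  then obtain t where t: "t:V" "s <= t" using fV[OF s] ge[OF x'] by blast
  obtain c where c: "s <= j" "gV**x = Scl C c (e s j)" using D_hom[OF s j gx False] by blast
  have "u s:fact k0 (D s)" using k_down[OF s _ t(2)] t by (auto simp: V_def)
  thus ?thesis using c uj e_typ[OF s j c(1)] unit_cmp[OF s j c(1)] fact_scl[OF kt(1)] by (simp add: Scl_r)
  qed
  hence "q0**(u j**(gV**x)):fact xi (D s)" using ck(1) by blast
  thus "(?m**gV)**x:fact xi (D s)" using qt uj tV x' by (simp add: hom_iff assoc ar_Cmp src_Cmp trg_Cmp)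
  qed (use mt tV xi in "simp_all add: typs")
  thus ?thesis using mt tV xi by (simp add: adm_iff typs)
  qed
  have mm: "mono_arr A (pm gV xi ?m)"
  proof (rule monoI[OF tV(1) xi(1) am])
  fix s x assume s: "s:P" and x: "x:H (D s) (trg gV)" and mx: "?m**x:fact xi (D s)"
  have x': "x:H (D s) (D j)" using x tV by simp
  have ux: "u j**x:H (D s) (Unit C)" using uj x' by (simp add: typs)
  have "q0**(u j**x):fact xi (D s)" using mx qt uj x' by (simp add: hom_iff assoc)
  hence uk: "u j**x:fact k0 (D s)" using ck(2) ux by blast
  show "x:fact gV (D s)"
  proof (cases "x = Nul C (D s) (D j)")
  case True
  thus ?thesis using fV[OF s] x' by simp
  next
  case False
  then obtain c where c: "s <= j" "c ~= 0" "x = Scl C c (e s j)" using D_hom[OF s j x'] by blast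
  have "u j**x = Scl C c (u s)" using c uj e_typ[OF s j c(1)] unit_cmp[OF s j c(1)] by (simp add: Scl_r)
  hence us: "u s:fact k0 (D s)" using uk fact_unscl[OF kt(1) _ c(2)] unit_typs(2)[OF s] by simp
  hence "s ~= j" using nj by blast
  hence "s:V" using us c s by (simp add: V_def)
  thus ?thesis using fV[OF s] x' by blast
  qed
  qed
  \<comment> \<open>\<open>gL\<close> divides out everything strictly below j, so it is a further
    quotient of \<open>gV\<close>, and the simple object at j becomes a subquotient.\<close>
  have ae: "adm gV gL (Idm C (D j))"
  proof -
  have "gV:fact gL (src gV)"
  proof (rule gen_fact)
  fix s x assume s: "s:P" and x: "x:H (D s) (src gV)"
  show "gV**x:fact gL (D s)" using fL[OF s] fV[OF s] ge[OF x] by (auto simp: V_def)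
  qed (use tV tL in simp_all)
  thus ?thesis using tV tL Dj by (simp add: adm_iff typs cat)
  qed
  have ee: "epi_arr A (pm gV gL (Idm C (D j)))"
  unfolding epi_arr_def
  proof (intro conjI ballI impI)
  show "arrow A (pm gV gL (Idm C (D j)))" using arrow_pm tV tL ae by simp
  fix Z v v' assume Z: "Z:Obj A" and v: "v:Mor A (trg (pm gV gL (Idm C (D j)))) Z"
  and v': "v':Mor A (trg (pm gV gL (Idm C (D j)))) Z"
  and eq: "Cmp A v (pm gV gL (Idm C (D j))) = Cmp A v' (pm gV gL (Idm C (D j)))"
  have aZ: "ar Z" using Z Obj_A by simp
  obtain x where x: "adm gL Z x" "v = pm gL Z x" using v Mor_AE aZ tL by (metis pm_sel(2))
  obtain x' where x': "adm gL Z x'" "v' = pm gL Z x'" using v' Mor_AE aZ tL by (metis pm_sel(2))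
  have xt: "ar x" "src x = D j" "trg x = trg Z" "ar x'" "src x' = D j" "trg x' = trg Z"
  using adm_typ[OF x(1)] adm_typ[OF x'(1)] tL by auto
  have "adm gV Z x" "adm gV Z x'"
  using adm_Cmp[OF tV(1) tL(1) aZ ae x(1)] adm_Cmp[OF tV(1) tL(1) aZ ae x'(1)] xt by (auto simp: Idm_r)
  thus "v = v'" using eq x x' aZ tV tL ae xt by (simp add: pm_Cmp Idm_r pm_eq_iff)
  qed
  have sL: "simple_at C (D j) gL" using rad_top[OF rep_D[OF j] pL] by (simp add: simple_at_def)
  have "subquotient A gL (trg q)"
  unfolding subquotient_def using mm ee xi by (intro exI[of _ "pm gV xi ?m"] exI[of _ "pm gV gL (Idm C (D j))"]) simp
  hence z: "zero_object A (act C (D i) gL)" using c1 indecomposable_rep[OF rep_D[OF j]] sL by blast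
  note st = simple_top_rep[OF rep_D[OF j] sL[unfolded simple_at_def]]
  show False using st(3) act_nonzero[OF rep_D[OF i] st(1)] z by blast
 qed

 have claim2: "j <= g"
 proof -
  define K where "K = {t\<in>P. u t:fact k0 (D t)}"
  have Kf: "finite {t\<in>K. j <= t}" "{t\<in>K. j <= t} ~= {}" using claim1 j fin by (auto simp: K_def)
  \<comment> \<open>Since h lies above j, maximality among the members of K above j is maximality in
    K (\<open>hmax\<close>); hence K without h is still closed downwards.\<close>
  obtain h where h: "h:K" "j <= h" and hm: "!!t. t:K==>j <= t==>h <= t==>t = h"
  using finite_has_maximal[OF Kf] by force
  have hP: "h:P" and uh: "u h:fact k0 (D h)" using h by (auto simp: K_def)
  have hmax: "t = h" if "t:K" "h <= t" for t using hm[OF that(1) _ that(2)] h(2) that(2) by auto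
  have M: "K - {h} <= {t\<in>P. t <= m}" using top by (auto simp: K_def)
  obtain w n where pn: "presents (Unit C) u (K - {h}) w n" using presents_ex[OF unit M] by blast
  note fn = presents_fact[OF unit pn M]
  have nt: "ar w" "ar n" "src n = trg w" "trg n = Unit C" "n**w = Nul C (src w) (Unit C)"
  using pn by (auto simp: presents_def)
  have n_inj: "x:fact w (D s)" if "s:P" "x:H (D s) (trg w)" "n**x = Nul C (D s) (Unit C)" for s x
  using pn that by (auto simp: presents_def)
  have an: "adm w (pr (Unit C)) n" using nt U by (simp add: adm_to_pr hom_iff)
  have ne: "n**x:fact n (D s)" if "x:H (D s) (trg w)" for s x
  using that nt by (simp add: hom_iff fact_comp)
  have un: "u s:fact n (D s)" if "s:K" "s ~= h" for s
  proof -
  have s: "s:P" using that by (simp add: K_def)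
  show ?thesis using fn[OF s] that unit_typs(2-4)[of s] s by (auto simp: hom_iff)
  qed
  obtain v where v: "adm w ke v" "n-.k0**v:fact (pr (Unit C)) (trg w)"
  proof (rule factor_mono[OF mk ke(1) pU(1) ke(2) nt(1) an])
  fix s x assume s: "s:P" and x: "x:H (D s) (trg w)"
  have nx: "n**x:H (D s) (Unit C)" using fn[OF s] ne[OF x] by blast
  have "n**x:fact k0 (D s)"
  proof (cases "n**x = Nul C (D s) (Unit C)")
  case True
  thus ?thesis using kt s D_Obj by (simp add: fact_NulI)
  next
  case False
  then obtain t where t: "t:K - {h}" "s <= t" using fn[OF s] ne[OF x] by blast
  obtain c where c: "n**x = Scl C c (u s)" using unit_hom[OF s nx False] by blast
  have "u s:fact k0 (D s)" using k_down[OF s _ t(2)] t by (auto simp: K_def)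
  thus ?thesis using c fact_scl[OF kt(1)] by simp
  qed
  then obtain y where y: "ar y" "src y = D s" "trg y = trg ke" "n**x = k0**y" using kt by (auto simp: fact_iff)
  have "n**x-.k0**y = Nul C (D s) (Unit C)" using y(4) dif_self nx by metis
  thus "EX y:H (D s) (trg ke). n**x-.k0**y:fact (pr (Unit C)) (D s)"
  using y U s D_Obj by (intro bexI[of _ y]) (auto simp: fact_pr hom_iff)
  qed
  have vt: "ar v" "src v = trg w" "trg v = trg ke" using adm_typ[OF v(1)] by auto
  have nkv: "n = k0**v" using v(2) U vt kt nt dif_eq_Nul[of n "trg w" "Unit C" "k0**v"] by (simp add: fact_pr typs)
  have kvx: "k0**(v**x) = n**x" if "ar x" "trg x = trg w" for x
  using nkv that vt kt by (simp add: assoc)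
  have mv: "mono_arr A (pm w ke v)"
  proof (rule monoI[OF nt(1) ke(1) v(1)])
  fix s x assume s: "s:P" and x: "x:H (D s) (trg w)" and vx: "v**x:fact ke (D s)"
  have "k0**(v**x):fact (pr (Unit C)) (D s)" using adm_fact_Cmp[OF ke(1) pU(1) ke(2) vx] .
  hence "n**x = Nul C (D s) (Unit C)" using kvx[of x] x U by (simp add: fact_pr hom_iff)
  thus "x:fact w (D s)" using n_inj[OF s x] by simp
  qed
  \<comment> \<open>By maximality of h no other member of K lies above it, so the subobject
    presented by K without h has no nonzero image at \<open>D h\<close>.\<close>
  have n0: "n**x = Nul C (D h) (Unit C)" if xw: "x:H (D h) (trg w)" for x
  proof (rule ccontr)
  assume "n**x ~= Nul C (D h) (Unit C)"
  then obtain t where "t:K - {h}" "h <= t" using fn[OF hP] ne[OF xw] by blast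
  thus False using hmax by blast
  qed
  obtain y where y: "ar y" "src y = D h" "trg y = trg ke" "u h = k0**y" using uh kt by (auto simp: fact_iff)
  have inj2: "y1-.y2:fact ke X" if "y1:H X (trg ke)" "y2:H X (trg ke)" "k0**y1 = k0**y2" for y1 y2 X
  proof (rule k_inj)
  show "y1-.y2:H X (trg ke)" using that by blast
  have "k0**y2:H X (Unit C)" using that kt by (simp add: typs)
  thus "k0**(y1-.y2) = Nul C X (Unit C)"
  using that kt dif_self[of "k0**y2" X "Unit C"] by (simp add: hom_iff dif_r)
  qed
  have k_el: "k0**z = Nul C (D s) (Unit C) \<or> (EX c. c ~= 0 & k0**z = Scl C c (u s) & s:K)"
  if s: "s:P" and z: "z:H (D s) (trg ke)" for s z
  proof (cases "k0**z = Nul C (D s) (Unit C)")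
  case False
  have "k0**z:H (D s) (Unit C)" using z kt by (simp add: typs)
  then obtain c where c: "c ~= 0" "k0**z = Scl C c (u s)" using unit_hom[OF s _ False] by blast
  have "k0**z:fact k0 (D s)" using z kt by (simp add: hom_iff fact_comp)
  hence "u s:fact k0 (D s)" using c fact_unscl[OF kt(1)] unit_typs(2)[OF s] by simp
  thus ?thesis using c s by (auto simp: K_def)
  qed simp
  \<comment> \<open>A subobject of K that contains this one either has a nonzero image at
    \<open>D h\<close>, and then reaches every point of K, or adds nothing to it.\<close>
  have maxM: "maximal_sub A ke (pm w ke v)"
  unfolding maximal_sub_def
  proof (intro conjI allI impI)
  show "mono_arr A (pm w ke v)" "trg (pm w ke v) = ke" using mv by simp_all
  show "~ iso_arr A (pm w ke v)"
  proof
  assume isom: "iso_arr A (pm w ke v)"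
  have yH: "y:H (D h) (trg ke)" using y by (simp add: hom_iff)
  obtain x where x: "x:H (D h) (trg w)" "y-.v**x:fact ke (D h)"
  using iso_surj[OF isom nt(1) ke(1) v(1) yH] by blast
  have "k0**(y-.v**x):fact (pr (Unit C)) (D h)" using adm_fact_Cmp[OF ke(1) pU(1) ke(2) x(2)] .
  hence "u h-.n**x = Nul C (D h) (Unit C)"
  using y kt vt x kvx[of x] U by (simp add: fact_pr dif_r hom_iff ar_Cmp src_Cmp trg_Cmp)
  hence "u h = Nul C (D h) (Unit C)" using n0[OF x(1)] unit_typs(2-4)[of h] hP by (simp add: dif_Nul_r)
  thus False using unit_nz[OF hP] by simp
  qed
  fix n' assume n': "mono_arr A n' & trg n' = ke & factors_through A (pm w ke v) n'"
  obtain nb n1 where nu: "ar nb" "adm nb ke n1" "n' = pm nb ke n1"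
  using n' arrow_AE unfolding mono_arr_def by (metis pm_sel(2))
  have n1: "ar n1" "src n1 = trg nb" "trg n1 = trg ke" using adm_typ[OF nu(2)] by auto
  have mn: "mono_arr A (pm nb ke n1)" using n' nu by simp
  obtain z0 where z0: "adm w nb z0" "v-.n1**z0:fact ke (trg w)"
  using n' nu factors_through_pm[OF nu(1) ke(1) nt(1) nu(2) v(1)] by auto
  have zt: "ar z0" "src z0 = trg w" "trg z0 = trg nb" using adm_typ[OF z0(1)] by auto
  have "k0**(v-.n1**z0):fact (pr (Unit C)) (trg w)" using adm_fact_Cmp[OF ke(1) pU(1) ke(2) z0(2)] .
  hence nz: "n = k0**(n1**z0)"
  using vt kt n1 zt nkv U dif_eq_Nul[of n "trg w" "Unit C" "k0**(n1**z0)"]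
  by (simp add: fact_pr dif_r hom_iff ar_Cmp src_Cmp trg_Cmp)
  show "iso_arr A n' \<or> factors_through A n' (pm w ke v)"
  proof (cases "EX y':H (D h) (trg nb). k0**(n1**y') ~= Nul C (D h) (Unit C)")
  case True
  then obtain y' where y': "y':H (D h) (trg nb)" "k0**(n1**y') ~= Nul C (D h) (Unit C)" by blast
  have "n1**y':H (D h) (trg ke)" using y' n1 by (simp add: typs)
  then obtain c' where c': "c' ~= 0" "k0**(n1**y') = Scl C c' (u h)" using k_el[OF hP] y' by blast
  have y't: "ar y'" "src y' = D h" "trg y' = trg nb" using y' by (auto simp: hom_iff)
  have "iso_arr A (pm nb ke n1)"
  proof (rule mono_iso[OF mn nu(1) ke(1) nu(2)])
  fix s z assume s: "s:P" and z: "z:H (D s) (trg ke)"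
  have Ds: "D s:Obj C" using s D_Obj by simp
  have "EX a:H (D s) (trg nb). k0**(n1**a) = k0**z"
  proof (cases "k0**z = Nul C (D s) (Unit C)")
  case True
  have "k0**(n1**Nul C (D s) (trg nb)) = Nul C (D s) (Unit C)"
  using n1 kt nu Ds by (simp add: Nul_r)
  thus ?thesis using True nu Ds ar_Obj by (intro bexI[of _ "Nul C (D s) (trg nb)"]) auto
  next
  case False
  then obtain c where c: "c ~= 0" "k0**z = Scl C c (u s)" "s:K" using k_el[OF s z] by blast
  show ?thesis
  proof (cases "s = h")
  case True
  \<comment> \<open>The point y' hits \<open>u h\<close> with coefficient c', so it is rescaled to
    hit it with coefficient c.\<close>
  have "k0**(n1**Scl C (c * inverse c') y') = Scl C (c * inverse c') (Scl C c' (u h))"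
  using c' y't n1 kt by (simp add: typs Scl_r flip: c'(2))
  also have "... = Scl C (c * inverse c' * c') (u h)"
  using unit_typs(2-4)[of h] hP Scl_Scl[of "u h" "D h" "Unit C" "c * inverse c'" c'] by (simp add: hom_iff)
  also have "c * inverse c' * c' = c" using c'(1) by (simp add: mult.assoc)
  finally show ?thesis using c True y't by (intro bexI[of _ "Scl C (c * inverse c') y'"]) (auto simp: typs)
  next
  case False
  then obtain x where x: "ar x" "src x = D s" "trg x = trg w" "u s = n**x"
  using un[OF c(3)] nt by (auto simp: fact_iff)
  have "k0**(n1**Scl C c (z0**x)) = Scl C c (n**x)"
  using nz x n1 kt zt by (simp add: typs Scl_r assoc)
  thus ?thesis using c x zt by (intro bexI[of _ "Scl C c (z0**x)"]) (auto simp: typs)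
  qed
  qed
  then obtain a where a: "a:H (D s) (trg nb)" "k0**(n1**a) = k0**z" by blast
  hence "z-.n1**a:fact ke (D s)" using inj2[OF z, of "n1**a"] n1 by (simp add: typs)
  thus "EX a:H (D s) (trg nb). z-.n1**a:fact ke (D s)" using a by blast
  qed
  thus ?thesis using nu by simp
  next
  case nohit: False
  obtain a where "adm nb w a" "n1-.v**a:fact ke (trg nb)"
  proof (rule factor_mono[OF mv nt(1) ke(1) v(1) nu(1,2)])
  fix s z assume s: "s:P" and z: "z:H (D s) (trg nb)"
  have Ds: "D s:Obj C" using s D_Obj by simp
  have nzH: "n1**z:H (D s) (trg ke)" using z n1 by (simp add: typs)
  have "EX a:H (D s) (trg w). n**a = k0**(n1**z)"
  proof (cases "k0**(n1**z) = Nul C (D s) (Unit C)")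
  case True
  have "n**Nul C (D s) (trg w) = Nul C (D s) (Unit C)" using nt Ds by (simp add: Nul_r)
  thus ?thesis using True nt Ds ar_Obj by (intro bexI[of _ "Nul C (D s) (trg w)"]) auto
  next
  case False
  then obtain c where c: "c ~= 0" "k0**(n1**z) = Scl C c (u s)" "s:K" using k_el[OF s nzH] by blast
  have "s ~= h" using nohit z False by blast
  then obtain x where x: "ar x" "src x = D s" "trg x = trg w" "u s = n**x"
  using un[OF c(3)] nt by (auto simp: fact_iff)
  thus ?thesis using c nt by (intro bexI[of _ "Scl C c x"]) (auto simp: typs Scl_r)
  qed
  then obtain a where a: "a:H (D s) (trg w)" "n**a = k0**(n1**z)" by blast
  hence "n1**z-.v**a:fact ke (D s)" using inj2[OF nzH, of "v**a"] vt kvx[of a] by (simp add: typs)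
  thus "EX a:H (D s) (trg w). n1**z-.v**a:fact ke (D s)" using a by blast
  qed
  thus ?thesis using nu factors_through_pm[OF nt(1) ke(1) nu(1) v(1) nu(2)] by auto
  qed
  qed
  obtain ra qq where rq: "radical A ke ra" "cokernel A ra qq" "trg qq = T" and siT: "simple_object A T"
  using c2(1) ke(3) by (auto simp: simple_top_def)
  have aT: "ar T" using siT Obj_A by (simp add: simple_object_def)
  obtain rh r0 where ro: "ar rh" "adm rh ke r0" "ra = pm rh ke r0"
  using rq(1) arrow_AE unfolding radical_def mono_arr_def by (metis pm_sel(2))
  have "arrow A qq" "src qq = ke" using rq ro by (auto simp: cokernel_def)
  then obtain t0 where t0: "adm ke T t0" "qq = pm ke T t0" using rq(3) arrow_AE by (metis pm_sel)
  have rt: "ar r0" "src r0 = trg rh" "trg r0 = trg ke" using adm_typ[OF ro(2)] by auto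
  have tt: "ar t0" "src t0 = trg ke" "trg t0 = trg T" using adm_typ[OF t0(1)] by auto
  have "factors_through A ra (pm w ke v)" using rq(1) maxM by (auto simp: radical_def)
  then obtain z where z: "adm rh w z" "r0-.v**z:fact ke (trg rh)"
  using ro factors_through_pm[OF nt(1) ke(1) ro(1) v(1) ro(2)] by auto
  have zt: "ar z" "src z = trg rh" "trg z = trg w" using adm_typ[OF z(1)] by auto
  have "k0**(r0-.v**z):fact (pr (Unit C)) (trg rh)" using adm_fact_Cmp[OF ke(1) pU(1) ke(2) z(2)] .
  hence krn: "k0**r0 = n**z"
  using kt rt vt zt kvx[of z] U nt dif_eq_Nul[of "k0**r0" "trg rh" "Unit C" "n**z"]
  by (simp add: fact_pr dif_r hom_iff ar_Cmp src_Cmp trg_Cmp)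
  \<comment> \<open>The radical of K lies in the maximal subobject, so \<open>k0\<close>, read as a
    map into the quotient n of the unit projective, annihilates the radical and factors through the
    top T.\<close>
  have ak: "adm ke n k0" using ke(1) nt kt fact_NulI[OF nt(2)] by (simp add: adm_iff typs)
  have krf: "k0**r0:fact n (trg rh)" unfolding krn using nt zt by (simp add: fact_comp)
  have "Cmp A (pm ke n k0) ra = Nul A rh n"
  using krf ro ke(1) nt ak adm_Cmp[OF ro(1) ke(1) nt(2) ro(2) ak] adm_Nul[OF ro(1) nt(2)] kt rt
  by (simp add: pm_Cmp pm_Nul pm_eq_iff typs cat)
  hence n1: "Cmp A (pm ke n k0) ra = Nul A (src ra) n" using ro by simp
  have n2: "pm ke n k0:Mor A (trg ra) n" using Mor_pm[OF ke(1) nt(2) ak] ro by simp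
  obtain x where x: "x:Mor A T n" "Cmp A x qq = pm ke n k0"
  using cokernel_factor[OF rq(2) nt(2) n2 n1] rq(3) by metis
  obtain x0 where x0: "adm T n x0" "x = pm T n x0" using x Mor_AE aT nt by blast
  have xt: "ar x0" "src x0 = trg T" "trg x0 = Unit C" using adm_typ[OF x0(1)] nt by auto
  have xk: "x0**t0-.k0:fact n (trg ke)"
  using x x0 t0 aT ke(1) nt ak adm_Cmp[OF ke(1) aT nt(2) t0(1) x0(1)] by (simp add: pm_Cmp pm_eq_iff)
  \<comment> \<open>The point y over \<open>u h\<close> survives in the top: otherwise
    \<open>u h\<close> would factor through n, which has zero image at \<open>D h\<close>.\<close>
  have t0y: "t0**y \<notin> fact T (D h)"
  proof
  assume "t0**y:fact T (D h)"
  hence 1: "x0**(t0**y):fact n (D h)" using adm_fact_Cmp[OF aT nt(2) x0(1)] by simp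
  have "(x0**t0-.k0)**y:fact n (D h)" using fact_precomp[OF nt(2) xk y(1,3)] y by simp
  hence "x0**(t0**y)-.u h:fact n (D h)" using xt tt y kt by (simp add: dif_l assoc typs)
  hence "u h:fact n (D h)" using fact_of_dif'[OF nt(2) _ 1] unit_typs(2-4)[of h] hP nt by simp
  then obtain a where a: "ar a" "src a = D h" "trg a = trg w" "u h = n**a" using nt by (auto simp: fact_iff)
  hence "u h = Nul C (D h) (Unit C)" using n0[of a] by (simp add: hom_iff)
  thus False using unit_nz[OF hP] by simp
  qed
  note st = simple_top_rep[OF gb c2(2)[unfolded simple_at_def]]
  obtain f where f: "iso_arr A f" "src f = T" "trg f = S" using c2(3) by (auto simp: isomorphic_def)
  obtain f0 where f0: "adm T S f0" "f = pm T S f0" using f arrow_AE unfolding iso_arr_def by (metis pm_sel)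
  obtain f' where f': "f':Mor A S T" "Cmp A f' f = Idm A T" using f unfolding iso_arr_def by auto
  obtain f'0 where f'0: "adm S T f'0" "f' = pm S T f'0" using f' Mor_AE st(1) aT by blast
  have ft: "ar f0" "src f0 = trg T" "trg f0 = trg S" "ar f'0" "src f'0 = trg S" "trg f'0 = trg T"
  using adm_typ[OF f0(1)] adm_typ[OF f'0(1)] by auto
  have ff: "f'0**f0-.Idm C (trg T):fact T (trg T)"
  using f' f0 f'0 st(1) aT adm_Cmp[OF aT st(1) aT f0(1) f'0(1)] adm_Idm[OF aT]
  by (simp add: pm_Cmp pm_Idm pm_eq_iff)
  have tyt: "ar (t0**y)" "src (t0**y) = D h" "trg (t0**y) = trg T" using tt y by (auto simp: typs)
  have "f0**(t0**y) \<notin> fact S (D h)"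
  proof
  assume "f0**(t0**y):fact S (D h)"
  hence 1: "f'0**(f0**(t0**y)):fact T (D h)" using adm_fact_Cmp[OF st(1) aT f'0(1)] by simp
  have "(f'0**f0-.Idm C (trg T))**(t0**y):fact T (D h)"
  using fact_precomp[OF aT ff tyt(1,3)] tyt by simp
  hence "f'0**(f0**(t0**y))-.t0**y:fact T (D h)"
  using ft tyt aT by (simp add: dif_l assoc[of "t0**y"] Idm_l typs)
  hence "t0**y:fact T (D h)" using fact_of_dif'[OF aT _ 1] tyt by simp
  thus False using t0y by simp
  qed
  moreover have "f0**(t0**y):H (D h) (trg S)" using ft tyt by (simp add: hom_iff ar_Cmp src_Cmp trg_Cmp)
  \<comment> \<open>The isomorphism of T with the simple object at g carries the surviving point to
    a nonzero point at h, and that object has nonzero points at g only.\<close>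
  ultimately have "h = g" using st(2)[OF hP] by blast
  thus ?thesis using h by simp
 qed

 have claim3: "g <= j"
 proof (rule ccontr)
  assume "~ g <= j"
  note st = simple_top_rep[OF gb c2(2)[unfolded simple_at_def]]
  have "zero_object A (act C (D i) S)" using act_zero[OF rep_D[OF i] st(1) gP \<open>~ g <= j\<close> st(2)] by blast
  thus False using c3[OF c2(2)] by simp
 qed
 have "g = j" using claim2 claim3 by simp
 thus ?thesis using rep_iso[OF gb] by simp
qed

end

subsection \<open>Paths in a tree quiver\<close>

locale tree_paths =
 fixes Q :: "('v, 'a) pre_digraph"
 assumes tree: "tree_quiver Q"
begin

sublocale fin_digraph Q
 using tree by (simp add: tree_quiver_def)

lemma double_sel:
 "verts (double_quiver Q) = verts Q" "arcs (double_quiver Q) = arcs Q \<times> UNIV"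
 "tail (double_quiver Q) (a, True) = tail Q a" "tail (double_quiver Q) (a, False) = head Q a"
 "head (double_quiver Q) (a, True) = head Q a" "head (double_quiver Q) (a, False) = tail Q a"
 by (simp_all add: double_quiver_def)

lemma wf_double: "wf_digraph (double_quiver Q)"
 by unfold_locales (auto simp: double_quiver_def split: if_splits)

lemma double_forward:
 assumes "awalk u p v"
 shows "pre_digraph.awalk (double_quiver Q) u (map (%a. (a, True)) p) v"
  "pre_digraph.awalk_verts (double_quiver Q) u (map (%a. (a, True)) p) = awalk_verts u p"
 using assms
proof (induction p arbitrary: u)
 interpret DQ: wf_digraph "double_quiver Q" by (rule wf_double)
 {
  case Nil
  case 1
  thus ?case by (auto simp: awalk_Nil_iff DQ.awalk_Nil_iff double_sel)
 next
  case Nil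
  case 2
  thus ?case by simp
 next
  case (Cons a p)
  case 1
  thus ?case using Cons by (auto simp: awalk_Cons_iff DQ.awalk_Cons_iff double_sel arc_to_ends_def)
 next
  case (Cons a p)
  case 2
  thus ?case using Cons by (auto simp: awalk_Cons_iff double_sel)
 }
qed

lemma double_backward:
 assumes "awalk u p v"
 shows "pre_digraph.awalk (double_quiver Q) v (rev (map (%a. (a, False)) p)) u &
  pre_digraph.awalk_verts (double_quiver Q) v (rev (map (%a. (a, False)) p)) = rev (awalk_verts u p)"
 using assms
proof (induction p arbitrary: u)
 interpret DQ: wf_digraph "double_quiver Q" by (rule wf_double)
 case Nil
 thus ?case by (auto simp: awalk_Nil_iff DQ.awalk_Nil_iff double_sel)
next
 interpret DQ: wf_digraph "double_quiver Q" by (rule wf_double)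
 case (Cons a p)
 let ?r = "rev (map (%a. (a, False)) p)"
 have a: "a:arcs Q" "tail Q a = u" "awalk (head Q a) p v" using Cons.prems by (auto simp: awalk_Cons_iff)
 have IH: "DQ.awalk v ?r (head Q a)" "DQ.awalk_verts v ?r = rev (awalk_verts (head Q a) p)"
  using Cons.IH[OF a(3)] by auto
 have one: "DQ.awalk (head Q a) [(a, False)] u"
  using a tail_in_verts[OF a(1)] by (simp add: DQ.awalk_Cons_iff DQ.awalk_Nil_iff double_sel arc_to_ends_def)
 have w: "DQ.awalk v (?r @ [(a, False)]) u" using DQ.awalk_appendI[OF IH(1) one] .
 have "DQ.awalk_verts v (?r @ [(a, False)]) = DQ.awalk_verts v ?r @ tl (DQ.awalk_verts (head Q a) [(a, False)])"
  using DQ.awalk_verts_append[OF w] IH(1) by (auto dest: DQ.awlast_of_awalk)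
 thus ?case using w IH a by (simp add: double_sel)
qed

lemma no_cycle:
 assumes "pre_digraph.awalk (double_quiver Q) u p u" "distinct (tl (pre_digraph.awalk_verts (double_quiver Q) u p))"
  "distinct (map fst p)" shows "p = []"
 using tree assms unfolding tree_quiver_def pre_digraph.cycle_def by blast

text \<open>A nontrivial oriented closed walk contains an oriented cycle, and this is a cycle of the
  underlying graph since its arrows are distinct.\<close>

lemma acyclic: assumes "awalk u p u" shows "p = []"
proof (rule ccontr)
 assume "p ~= []"
 hence "closed_w p" using assms by (auto simp: closed_w_def)
 then obtain c where "cycle c" using closed_w_imp_cycle by blast
 then obtain w where c: "awalk w c w" "distinct (tl (awalk_verts w c))" "distinct c" "c ~= []"
  by (auto simp: cycle_conv)
 have "map fst (map (%a. (a, True)) c) = c" by (simp add: comp_def)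
 hence "map (%a. (a, True)) c = []"
  using no_cycle[of w "map (%a. (a, True)) c"] double_forward[OF c(1)] c(2,3) by simp
 thus False using c(4) by simp
qed

lemma distinct_verts: assumes "awalk u p v" shows "distinct (awalk_verts u p)"
proof (rule ccontr)
 assume "~ distinct (awalk_verts u p)"
 then obtain q r s w where "0 < length r" "awalk w r w" using awalk_not_distinct_decomp[OF assms] by blast
 thus False using acyclic by auto
qed

text \<open>In a pair of distinct walks of least total length the two meet at their endpoints only,
  so p run forwards and p' run backwards form a cycle of the underlying graph.\<close>

lemma unique_walk:
 assumes "awalk u p v" "awalk u p' v" shows "p = p'"
 using assms
proof (induction "length p + length p'" arbitrary: u p p' v rule: less_induct)
 case less
 show ?case
 proof (rule ccontr)
  assume ne: "p ~= p'"
  have "p ~= [] & p' ~= []"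
  using ne less.prems acyclic by (metis awalk_empty_ends)
  hence pn: "p ~= []" and p'n: "p' ~= []" by auto
  \<comment> \<open>A common inner vertex splits both walks into shorter pairs with equal ends,
    which coincide by induction.\<close>
  have disj: "w = u \<or> w = v" if w: "w:set (awalk_verts u p)" "w:set (awalk_verts u p')" for w
  proof (rule ccontr)
  assume nw: "~ (w = u \<or> w = v)"
  obtain q r where q: "p = q @ r" "awalk u q w" "awalk w r v" using awalk_decomp[OF less.prems(1) w(1)] by blast
  obtain q' r' where q': "p' = q' @ r'" "awalk u q' w" "awalk w r' v" using awalk_decomp[OF less.prems(2) w(2)] by blast
  have nn: "q ~= []" "r ~= []" "q' ~= []" "r' ~= []" using q q' nw by (auto simp: awalk_Nil_iff)
  have "q = q'" using less.hyps[of q q'] q q' nn by auto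
  moreover have "r = r'" using less.hyps[of r r'] q q' nn by auto
  ultimately show False using q q' ne by simp
  qed
  have vp: "awalk_verts u p ~= []" "hd (awalk_verts u p) = u" "last (awalk_verts u p) = v"
  and vp': "awalk_verts u p' ~= []" "hd (awalk_verts u p') = u" "last (awalk_verts u p') = v"
  using less.prems by auto
  note d = distinct_verts[OF less.prems(1)] and d' = distinct_verts[OF less.prems(2)]
  interpret DQ: wf_digraph "double_quiver Q" by (rule wf_double)
  let ?f = "map (%a. (a, True)) p" and ?b = "rev (map (%a. (a, False)) p')"
  note f = double_forward[OF less.prems(1)] and b = double_backward[OF less.prems(2)]
  have w: "DQ.awalk u (?f @ ?b) u" using DQ.awalk_appendI[OF f(1)] b by blast
  have lf: "last (DQ.awalk_verts u ?f) = v" using f by auto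
  have "DQ.awalk_verts u (?f @ ?b) = awalk_verts u p @ tl (rev (awalk_verts u p'))"
  using DQ.awalk_verts_append[OF w] f b lf by simp
  hence vs: "tl (DQ.awalk_verts u (?f @ ?b)) = tl (awalk_verts u p) @ tl (rev (awalk_verts u p'))"
  using vp by simp
  have un: "u \<notin> set (tl (awalk_verts u p))" using d vp by (cases "awalk_verts u p") auto
  have tr: "tl (rev (awalk_verts u p')) = rev (butlast (awalk_verts u p'))"
  using vp' by (metis butlast_rev rev_rev_ident)
  have vn: "v \<notin> set (butlast (awalk_verts u p'))"
  using d' vp' by (metis append_butlast_last_id distinct_append disjoint_insert(1) list.simps(15))
  have sub: "set (tl (awalk_verts u p)) <= set (awalk_verts u p)" "set (butlast (awalk_verts u p')) <= set (awalk_verts u p')"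
  by (auto intro: list.set_sel(2) dest: in_set_butlastD)
  have "set (tl (awalk_verts u p)) \<inter> set (butlast (awalk_verts u p')) = {}"
  using disj un vn sub by blast
  hence dist: "distinct (tl (DQ.awalk_verts u (?f @ ?b)))"
  unfolding vs tr using d d' by (auto simp: distinct_tl distinct_butlast)
  have dp: "distinct p" "distinct p'" using distinct_verts_imp_distinct less.prems d d' by blast+
  \<comment> \<open>A common arrow has both its ends among u and v, so by acyclicity it is the whole
    of either walk.\<close>
  have "set p \<inter> set p' = {}"
  proof (rule ccontr)
  assume "set p \<inter> set p' ~= {}"
  then obtain a where a: "a:set p" "a:set p'" by blast
  have single: "x = [a]" if x: "awalk u x v" "a:set x" and ht: "tail Q a:{u, v}" "head Q a:{u, v}" for x
  proof -
  obtain y z where yz: "x = y @ a # z" using x(2) by (auto simp: in_set_conv_decomp)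
  have w1: "awalk u y (tail Q a)" "awalk (tail Q a) (a # z) v" "awalk (head Q a) z v" "a:arcs Q"
  using x(1) unfolding yz by (auto simp: awalk_Cons_iff)
  have "tail Q a ~= v" using acyclic w1(2) by auto
  hence 1: "y = []" using ht w1(1) acyclic by auto
  have "awalk u (y @ [a]) (head Q a)" using w1 x(1) unfolding yz by (auto simp: awalk_Cons_iff awalk_Nil_iff)
  hence "head Q a ~= u" using acyclic[of u "y @ [a]"] by blast
  hence "z = []" using ht w1(3) acyclic by auto
  thus ?thesis using 1 yz by simp
  qed
  have "tail Q a:set (awalk_verts u x) & head Q a:set (awalk_verts u x)" if x: "awalk u x v" "a:set x" for x
  using x by (metis awalk_verts_arc1 awalk_verts_arc2 awalkE')
  hence "tail Q a:{u, v}" "head Q a:{u, v}" using disj a less.prems by blast+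
  thus False using single[OF less.prems(1) a(1)] single[OF less.prems(2) a(2)] ne by simp
  qed
  moreover have "map fst (?f @ ?b) = p @ rev p'" by (simp add: comp_def rev_map)
  ultimately have "distinct (map fst (?f @ ?b))" using dp by simp
  thus False using no_cycle[OF w dist] pn by simp
 qed
qed

abbreviation "P == paths Q"
abbreviation tgt :: "'v \<times> 'a list=>'v" where "tgt == path_target Q"
abbreviation pc :: "'v \<times> 'a list=>'v \<times> 'a list=>'v \<times> 'a list" (infixl \<open>\<cdot>\<close> 70) where "q \<cdot> p == path_comp q p"

lemma paths_iff: "p:P \<longleftrightarrow> awalk (fst p) (snd p) (tgt p)"
 by (cases p) (auto simp: paths_def path_target_def)

lemma path_eqI: "p:P==>q:P==>fst p = fst q==>tgt p = tgt q==>p = q"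
 using unique_walk by (auto simp: paths_iff prod_eq_iff)

lemma finite_paths: "finite P"
proof -
 have "inj_on (%p. (fst p, tgt p)) P" using path_eqI by (auto intro: inj_onI)
 moreover have "(%p. (fst p, tgt p)) ` P <= verts Q \<times> verts Q" by (auto simp: paths_iff)
 ultimately show ?thesis by (meson finite_SigmaI finite_subset finite_verts inj_on_finite)
qed

lemma comp_fst [simp]: "fst (q \<cdot> p) = fst p" by (simp add: path_comp_def)

lemma comp_tgt: "p:P==>q:P==>tgt p = fst q==>tgt (q \<cdot> p) = tgt q"
 by (simp add: path_target_def path_comp_def awlast_append)

lemma comp_paths: "p:P==>q:P==>tgt p = fst q==>q \<cdot> p:P"
 using awalk_appendI[of "fst p" "snd p" "tgt p" "snd q" "tgt q"] comp_tgt[of p q]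
 unfolding paths_iff by (simp add: path_comp_def)

lemma comp_assoc: "(r \<cdot> q) \<cdot> p = r \<cdot> (q \<cdot> p)"
 by (simp add: path_comp_def)

lemma triv_paths: "v:verts Q==>(v, []):P" "tgt (v, []) = v"
 by (auto simp: paths_iff path_target_def awalk_Nil_iff)

lemma path_verts: "p:P==>fst p:verts Q" "p:P==>tgt p:verts Q"
 by (auto simp: paths_iff)

lemma comp_triv: "p \<cdot> (fst p, []) = p" "(w, []) \<cdot> p = p"
 by (auto simp: path_comp_def prod_eq_iff)

text \<open>Sets of paths closed under composition on both sides correspond to the ideals of the path algebra.\<close>

definition pideal :: "('v \<times> 'a list) set=>bool" where
 "pideal U \<longleftrightarrow> U <= P & (ALL p:U. ALL q:P. tgt p = fst q --> q \<cdot> p:U) & (ALL p:U. ALL q:P. tgt q = fst p --> p \<cdot> q:U)"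

definition conn :: "('v \<times> 'a list) set=>bool" where
 "conn U \<longleftrightarrow> pideal U & U ~= {} & (ALL V W. pideal V --> pideal W --> V \<inter> W = {} --> V \<union> W = U --> V = {} \<or> W = {})"

definition pmul :: "('v \<times> 'a list) set=>('v \<times> 'a list) set=>('v \<times> 'a list) set" where
 "pmul U V = {x \<cdot> y | x y. x:U & y:V & tgt y = fst x}"

definition pgen :: "('v \<times> 'a list) set=>('v \<times> 'a list) set" where
 "pgen X = {a \<cdot> (g \<cdot> b) | a g b. a:P & g:X & b:P & tgt b = fst g & tgt g = fst a}"

lemma pmulI: "x:U==>y:V==>tgt y = fst x==>x \<cdot> y:pmul U V"
 unfolding pmul_def by blast

lemma pgenI: "a:P==>g:X==>b:P==>tgt b = fst g==>tgt g = fst a==>a \<cdot> (g \<cdot> b):pgen X"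
 unfolding pgen_def by blast

lemma pidealD:
 assumes "pideal U"
 shows "U <= P" "!!p. p:U==>p:P" "!!p q. p:U==>q:P==>tgt p = fst q==>q \<cdot> p:U"
  "!!p q. p:U==>q:P==>tgt q = fst p==>p \<cdot> q:U"
 using assms by (auto simp: pideal_def)

lemma pideal_Int: "pideal U==>pideal V==>pideal (U \<inter> V)"
 by (auto simp: pideal_def)

lemma pideal_Un: "pideal U==>pideal V==>pideal (U \<union> V)"
 by (auto simp: pideal_def)

lemma pideal_P: "pideal P" by (auto simp: pideal_def comp_paths)

lemma pideal_finite: "pideal U==>finite U"
 using finite_paths finite_subset pidealD(1) by blast

lemma pideal_pmul: assumes "pideal U" "pideal V" shows "pideal (pmul U V)"
 unfolding pideal_def
proof (intro conjI ballI impI)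
 show "pmul U V <= P" using assms pidealD(2) comp_paths by (fastforce simp: pmul_def)
 fix p q assume p: "p:pmul U V" and q: "q:P"
 obtain x y where x: "p = x \<cdot> y" "x:U" "y:V" "tgt y = fst x" using p by (auto simp: pmul_def)
 have xy: "x:P" "y:P" using x assms pidealD(2) by auto
 show "q \<cdot> p:pmul U V" if "tgt p = fst q"
 proof -
  have "q \<cdot> x:U" using pidealD(3)[OF assms(1) x(2) q] that x comp_tgt[OF xy(2,1)] by simp
  thus ?thesis using pmulI[of "q \<cdot> x" U y V] x by (simp add: comp_assoc)
 qed
 show "p \<cdot> q:pmul U V" if "tgt q = fst p"
 proof -
  have "y \<cdot> q:V" using pidealD(4)[OF assms(2) x(3) q] that x by simp
  thus ?thesis using pmulI[of x U "y \<cdot> q" V] x that comp_tgt[OF q xy(2)] by (simp add: comp_assoc)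
 qed
qed

lemma pmul_sub: "pideal U==>pideal V==>pmul U V <= U" "pideal U==>pideal V==>pmul U V <= V"
 using pidealD by (auto simp: pmul_def)

lemma pmul_mono: "V <= W==>pmul U V <= pmul U W"
 by (auto simp: pmul_def)

text \<open>The fibre of f over a value and its complement are both closed under multiplication, so
  one of them is empty. Applied to the coefficients of a bimodule map, this makes them
  constant.\<close>

lemma conn_const:
 assumes U: "conn U"
  and l: "!!p q. p:U==>q:P==>tgt p = fst q==>f (q \<cdot> p) = f p"
  and r: "!!p q. p:U==>q:P==>tgt q = fst p==>f (p \<cdot> q) = f p"
  and p: "p:U" "q:U"
 shows "f p = f q"
proof -
 let ?V = "{x\<in>U. f x = f p}" and ?W = "{x\<in>U. f x ~= f p}"
 have pU: "pideal U" using U by (simp add: conn_def)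
 have "pideal ?V" "pideal ?W" using pU l r by (auto simp: pideal_def)
 moreover have "?V \<inter> ?W = {}" "?V \<union> ?W = U" by auto
 ultimately have "?V = {} \<or> ?W = {}" using U unfolding conn_def by blast
 hence "?W = {}" using p by blast
 thus ?thesis using p by (metis (mono_tags, lifting) empty_Collect_eq)
qed

text \<open>An arrow is a multiple of the trivial paths at both its ends, so the trivial paths at
  adjacent vertices lie in the same part; connectedness of Q spreads this over all vertices.\<close>

lemma conn_P: "conn P"
 unfolding conn_def
proof (intro conjI allI impI pideal_P)
 have ne: "verts Q ~= {}" and sc: "!!u v. u:verts Q==>v:verts Q==>u \<rightarrow>\<^sup>*\<^bsub>mk_symmetric Q\<^esub> v"
  using tree by (auto simp: tree_quiver_def connected_def strongly_connected_def)
 thus "P ~= {}" using triv_paths by blast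
 fix V W assume V: "pideal V" and W: "pideal W" and d: "V \<inter> W = {}" and un: "V \<union> W = P"
 have tri: "p:U \<longleftrightarrow> (fst p, []):U" "p:U \<longleftrightarrow> (tgt p, []):U" if U: "U = V \<or> U = W" and p: "p:P" for U p
 proof -
  have pU: "pideal V" "pideal W" "pideal U" using V W U by auto
  have t: "(fst p, []):P" "(tgt p, []):P" using triv_paths path_verts p by auto
  have "p:X" if "(fst p, []):X" "pideal X" for X
  using pidealD(3)[OF that(2,1) p] triv_paths by (simp add: comp_triv)
  moreover have "p:X" if "(tgt p, []):X" "pideal X" for X
  using pidealD(4)[OF that(2,1) p] by (simp add: comp_triv)
  ultimately show "p:U \<longleftrightarrow> (fst p, []):U" "p:U \<longleftrightarrow> (tgt p, []):U"
  using t d un U V W p by blast+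
 qed
 show "V = {} \<or> W = {}"
 proof (rule ccontr)
  assume "~ (V = {} \<or> W = {})"
  then obtain p q where pq: "p:V" "q:W" by blast
  hence PP: "p:P" "q:P" using un by auto
  have vv: "fst p:verts Q" "fst q:verts Q" using path_verts PP by auto
  have "(fst p, fst q):(arcs_ends (mk_symmetric Q))\<^sup>*" by (rule reachable_rtranclI[OF sc[OF vv]])
  hence "(fst q, []):V"
  proof (induction rule: rtrancl_induct)
  case base
  thus ?case using tri(1)[of V p] pq PP by simp
  next
  case (step x y)
  then obtain a where a: "a:arcs Q" "(x = tail Q a & y = head Q a) \<or> (x = head Q a & y = tail Q a)"
  by (auto simp: parcs_mk_symmetric arcs_ends_conv)
  have aw: "awalk (tail Q a) [a] (head Q a)" using a(1) arc_implies_awalk by auto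
  have "(tail Q a, [a]):P" "tgt (tail Q a, [a]) = head Q a"
  using aw by (auto simp: paths_def path_target_def)
  thus ?case using tri[of V "(tail Q a, [a])"] a step by auto
  qed
  thus False using tri(1)[of W q] pq PP d by auto
 qed
qed

lemma pideal_pgen: assumes "X <= P" shows "pideal (pgen X)"
 unfolding pideal_def
proof (intro conjI ballI impI)
 have el: "a \<cdot> (g \<cdot> b):P & tgt (a \<cdot> (g \<cdot> b)) = tgt a"
  if "a:P" "g:X" "b:P" "tgt b = fst g" "tgt g = fst a" for a g b
  using that assms comp_paths[of b g] comp_tgt[of b g] comp_paths[of "g \<cdot> b" a] comp_tgt[of "g \<cdot> b" a] by auto
 show "pgen X <= P" using el by (auto simp: pgen_def)
 fix p q assume p: "p:pgen X" and q: "q:P"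
 obtain a g b where x: "p = a \<cdot> (g \<cdot> b)" "a:P" "g:X" "b:P" "tgt b = fst g" "tgt g = fst a"
  using p by (auto simp: pgen_def)
 show "q \<cdot> p:pgen X" if "tgt p = fst q"
 proof -
  have "q \<cdot> a:P" using comp_paths[OF x(2) q] el[OF x(2-6)] that x by simp
  moreover have "tgt p = tgt a" using el[OF x(2-6)] x(1) by simp
  ultimately show ?thesis using pgenI[of "q \<cdot> a" g X b] x by (simp add: comp_assoc)
 qed
 show "p \<cdot> q:pgen X" if "tgt q = fst p"
 proof -
  have "b \<cdot> q:P" "tgt (b \<cdot> q) = tgt b" using comp_paths[OF q x(4)] comp_tgt[OF q x(4)] that x by auto
  thus ?thesis using pgenI[of a g X "b \<cdot> q"] x by (simp add: comp_assoc)
 qed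
qed

lemma pgen_superset: assumes "X <= P" shows "X <= pgen X"
proof
 fix g assume g: "g:X"
 hence gP: "g:P" using assms by auto
 have "g = (tgt g, []) \<cdot> (g \<cdot> (fst g, []))" by (simp add: comp_triv)
 thus "g:pgen X" using pgenI[of "(tgt g, [])" g X "(fst g, [])"] g gP triv_paths path_verts by simp
qed

lemma pgen_least: "X <= U==>pideal U==>pgen X <= U"
proof
 fix p assume X: "X <= U" and U: "pideal U" and "p:pgen X"
 then obtain a g b where x: "p = a \<cdot> (g \<cdot> b)" "a:P" "g:X" "b:P" "tgt b = fst g" "tgt g = fst a"
  by (auto simp: pgen_def)
 have g: "g:U" using x X by blast
 hence g: "g:U" "g:P" using pidealD(2)[OF U] by blast+
 have "g \<cdot> b:U" using pidealD(4)[OF U g(1) x(4,5)] .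
 thus "p:U" using pidealD(3)[OF U _ x(2), of "g \<cdot> b"] comp_tgt[OF x(4) g(2)] x by simp
qed

text \<open>Two generators with a common multiple contribute sources lying on a common path, so
  connectedness is inherited by the ideal generated by the sources.\<close>

context
 fixes G assumes G: "G <= P" and cI: "conn (pgen G)"
  and min: "!!G'. G' \<subset> G==>pgen G' ~= pgen G"
begin

definition srcs :: "('v \<times> 'a list) set" where "srcs = (%v. (v, [])) ` fst ` G"

lemma srcs_P: "srcs <= P" using G path_verts triv_paths by (auto simp: srcs_def)

lemma pgen_srcs: "p:pgen srcs \<longleftrightarrow> (EX a b g. a:P & b:P & g:G & tgt b = fst g & fst a = fst g & p = a \<cdot> b)"
proof
 assume "p:pgen srcs"
 then obtain a v b where x: "p = a \<cdot> ((v, []) \<cdot> b)" "a:P" "(v, []):srcs" "b:P" "tgt b = v" "tgt (v, []) = fst a"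
  unfolding pgen_def by (force simp: srcs_def)
 then obtain g where "g:G" "fst g = v" by (auto simp: srcs_def)
 thus "EX a b g. a:P & b:P & g:G & tgt b = fst g & fst a = fst g & p = a \<cdot> b"
  using x triv_paths(2)[of v] by (intro exI[of _ a] exI[of _ b] exI[of _ g]) (simp add: comp_triv)
next
 assume "EX a b g. a:P & b:P & g:G & tgt b = fst g & fst a = fst g & p = a \<cdot> b"
 then obtain a b g where x: "a:P" "b:P" "g:G" "tgt b = fst g" "fst a = fst g" "p = a \<cdot> b" by blast
 have "p = a \<cdot> ((fst g, []) \<cdot> b)" using x by (simp add: comp_triv)
 moreover have "(fst g, []):srcs" using x by (simp add: srcs_def)
 ultimately show "p:pgen srcs" using pgenI[of a "(fst g, [])" srcs b] x triv_paths(2)[of "fst g"] by simp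
qed

text \<open>The factor x is a multiple of some generator h, hence so is g. Minimality of G forces h
  = g, and comparing lengths leaves nothing for y.\<close>

lemma gen_minimal:
 assumes g: "g:G" and gx: "g = x \<cdot> y" "x:pgen G" "y:P" "tgt y = fst x"
 shows "y = (fst g, [])"
proof -
 obtain a h b where x: "x = a \<cdot> (h \<cdot> b)" "a:P" "h:G" "b:P" "tgt b = fst h" "tgt h = fst a"
  using gx(2) by (auto simp: pgen_def)
 have by': "b \<cdot> y:P" "tgt (b \<cdot> y) = fst h" using comp_paths[OF gx(3) x(4)] comp_tgt[OF gx(3) x(4)] gx(4) x by auto
 have ge: "g = a \<cdot> (h \<cdot> (b \<cdot> y))" using gx(1) x(1) by (simp add: comp_assoc)
 have "h = g"
 proof (rule ccontr)
  assume hg: "h ~= g"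
  have "g:pgen (G - {g})" using pgenI[of a h "G - {g}" "b \<cdot> y"] ge x by' hg by simp
  hence "G <= pgen (G - {g})" using pgen_superset[of "G - {g}"] G by blast
  hence "pgen G <= pgen (G - {g})" using pgen_least pideal_pgen G by (metis Diff_subset subset_trans)
  moreover have "pgen (G - {g}) <= pgen G" by (auto simp: pgen_def)
  ultimately show False using min[of "G - {g}"] g by blast
 qed
 hence "length (snd g) = length (snd a) + length (snd g) + length (snd b) + length (snd y)"
  using arg_cong[OF ge, of "%p. length (snd p)"] by (simp add: path_comp_def)
 hence "snd y = []" by simp
 moreover have "fst y = fst g" using gx by (simp add: path_comp_def)
 ultimately show ?thesis by (simp add: prod_eq_iff)
qed

lemma pmul_srcs: "pmul (pgen G) (pgen srcs) = pgen G"
proof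
 note pI = pideal_pgen[OF G] and pJ = pideal_pgen[OF srcs_P]
 show "pmul (pgen G) (pgen srcs) <= pgen G" using pmul_sub(1)[OF pI pJ] .
 have "G <= pmul (pgen G) (pgen srcs)"
 proof
  fix g assume g: "g:G"
  have "(fst g, []):pgen srcs" using pgen_superset[OF srcs_P] g by (auto simp: srcs_def)
  thus "g:pmul (pgen G) (pgen srcs)"
  using pmulI[of g "pgen G" "(fst g, [])" "pgen srcs"] g pgen_superset[OF G] triv_paths(2)[of "fst g"]
  by (auto simp: comp_triv)
 qed
 thus "pgen G <= pmul (pgen G) (pgen srcs)" using pgen_least pideal_pmul[OF pI pJ] by blast
qed

text \<open>A generator g lies in I W only with a right factor in W, and by
  \<open>gen_minimal\<close> this factor is the trivial path at the source of g. With
  \<open>pmul_srcs\<close>, J is the least W such that I W = I.\<close>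

lemma srcs_least:
 assumes W: "pideal W" and s: "pgen G <= pmul (pgen G) W" shows "pgen srcs <= W"
proof (rule pgen_least[OF _ W])
 show "srcs <= W"
 proof
  fix p assume "p:srcs"
  then obtain g where g: "g:G" "p = (fst g, [])" by (auto simp: srcs_def)
  have "g:pmul (pgen G) W" using g s pgen_superset[OF G] by blast
  then obtain x y where xy: "g = x \<cdot> y" "x:pgen G" "y:W" "tgt y = fst x" by (auto simp: pmul_def)
  have "y = (fst g, [])" using gen_minimal[OF g(1) xy(1,2) _ xy(4)] pidealD(2)[OF W xy(3)] by simp
  thus "p:W" using xy g by simp
 qed
qed

text \<open>Regroup (a g b) y as (a g)(b y): the right factor now ends at the source of the
  generator g, so it lies in J, and it remains in W.\<close>

lemma pmul_Int_srcs:
 assumes W: "pideal W" shows "pmul (pgen G) W = pmul (pgen G) (pgen srcs \<inter> W)"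
proof
 note pI = pideal_pgen[OF G]
 show "pmul (pgen G) W <= pmul (pgen G) (pgen srcs \<inter> W)"
 proof
  fix p assume "p:pmul (pgen G) W"
  then obtain x y where xy: "p = x \<cdot> y" "x:pgen G" "y:W" "tgt y = fst x" by (auto simp: pmul_def)
  obtain a g b where x: "x = a \<cdot> (g \<cdot> b)" "a:P" "g:G" "b:P" "tgt b = fst g" "tgt g = fst a"
  using xy(2) by (auto simp: pgen_def)
  have gP: "g:P" and yP: "y:P" using x G xy pidealD(2)[OF W] by auto
  have tb: "tgt y = fst b" using xy x by simp
  have by': "b \<cdot> y:W" "b \<cdot> y:P" "tgt (b \<cdot> y) = fst g"
  using pidealD(3)[OF W xy(3) x(4)] comp_paths[OF yP x(4)] comp_tgt[OF yP x(4)] tb x by auto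
  have "b \<cdot> y:pgen srcs"
  unfolding pgen_srcs using by' x(3) triv_paths path_verts(1)[OF gP]
  by (intro exI[of _ "(fst g, [])"] exI[of _ "b \<cdot> y"] exI[of _ g]) (simp add: comp_triv)
  moreover have "a \<cdot> g:pgen G" using pidealD(3)[OF pI _ x(2,6)] pgen_superset[OF G] x(3) by blast
  moreover have "p = (a \<cdot> g) \<cdot> (b \<cdot> y)" using xy x by (simp add: comp_assoc)
  ultimately show "p:pmul (pgen G) (pgen srcs \<inter> W)" using pmulI[of "a \<cdot> g" "pgen G" "b \<cdot> y" "pgen srcs \<inter> W"] by' by simp
 qed
 show "pmul (pgen G) (pgen srcs \<inter> W) <= pmul (pgen G) W" by (rule pmul_mono) auto
qed

text \<open>A disjoint decomposition of J into V and W decomposes I = I J into I V and I W, again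
  disjointly, so one product is empty. But a nonempty part X contains the trivial path at the source
  of some generator g, and then g itself lies in I X.\<close>

lemma conn_srcs: "conn (pgen srcs)"
 unfolding conn_def
proof (intro conjI allI impI)
 note pI = pideal_pgen[OF G] and pJ = pideal_pgen[OF srcs_P]
 show "pideal (pgen srcs)" by (rule pJ)
 have "pgen G ~= {}" using cI by (simp add: conn_def)
 then obtain g0 where g0: "g0:G" by (auto simp: pgen_def)
 thus "pgen srcs ~= {}" using pgen_superset[OF srcs_P] by (auto simp: srcs_def)
 fix V W assume V: "pideal V" and W: "pideal W" and d: "V \<inter> W = {}" and un: "V \<union> W = pgen srcs"
 have sJ: "(fst g, []):pgen srcs" if "g:G" for g using that pgen_superset[OF srcs_P] by (auto simp: srcs_def)
 have *: "pmul (pgen G) V \<inter> pmul (pgen G) W = {}"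
 proof (rule ccontr)
  assume "pmul (pgen G) V \<inter> pmul (pgen G) W ~= {}"
  then obtain p where "p:pmul (pgen G) V" "p:pmul (pgen G) W" by blast
  thus False using pmul_sub(2)[OF pI V] pmul_sub(2)[OF pI W] d by blast
 qed
 have "pmul (pgen G) V \<union> pmul (pgen G) W = pmul (pgen G) (V \<union> W)" by (auto simp: pmul_def)
 hence "pmul (pgen G) V \<union> pmul (pgen G) W = pgen G" using un pmul_srcs by simp
 hence "pmul (pgen G) V = {} \<or> pmul (pgen G) W = {}"
  using cI * pideal_pmul[OF pI V] pideal_pmul[OF pI W] unfolding conn_def by blast
 moreover have "X = {}" if X: "pmul (pgen G) X = {}" and XY: "X \<union> Y = pgen srcs" "X \<inter> Y = {}" and Y: "pideal Y" for X Y
 proof (rule ccontr)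
  assume "X ~= {}"
  then obtain p where p: "p:X" by blast
  then obtain a b g where x: "a:P" "b:P" "g:G" "tgt b = fst g" "fst a = fst g" "p = a \<cdot> b"
  using XY(1) pgen_srcs by blast
  \<comment> \<open>The path p runs through the source of g, so it is a multiple of the trivial path
    there and belongs to the same part.\<close>
  have "(fst g, []) \<notin> Y"
  proof
  assume e: "(fst g, []):Y"
  have "a:Y" using pidealD(3)[OF Y e x(1)] x(5) triv_paths(2)[of "fst g"] comp_triv(1)[of a] by simp
  hence "p:Y" using pidealD(4)[OF Y _ x(2), of a] x by simp
  thus False using p XY by blast
  qed
  hence "(fst g, []):X" using sJ[OF x(3)] XY by blast
  hence "g:pmul (pgen G) X"
  using pmulI[of g "pgen G" "(fst g, [])" X] x(3) pgen_superset[OF G] triv_paths(2)[of "fst g"]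
  by (auto simp: comp_triv)
  thus False using X by simp
 qed
 ultimately show "V = {} \<or> W = {}" using un d V W by (metis Int_commute Un_commute)
qed

end

end

subsection \<open>Ideals of the path algebra\<close>

context tree_paths begin

abbreviation R :: "(('v, 'a) path=>'k::field) ring" where "R == path_algebra Q"

abbreviation amul :: "(('v, 'a) path=>'k::field)=>(('v, 'a) path=>'k)=>(('v, 'a) path=>'k)" (infixl \<open>*.\<close> 70)
 where "x *. y == x \<otimes>\<^bsub>R\<^esub> y"

definition ideal_of :: "('v, 'a) path set=>(('v, 'a) path=>'k::field) set" where
 "ideal_of U = {x. {p. x p ~= 0} <= U}"

definition restr :: "('v, 'a) path set=>(('v, 'a) path=>'k::field)=>(('v, 'a) path=>'k)" where
 "restr U x = (%p. if p:U then x p else 0)"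

lemma carrier_R: "carrier R = ideal_of P"
 using finite_paths finite_subset by (auto simp: path_algebra_def ideal_of_def)

lemma add_R: "x \<oplus>\<^bsub>R\<^esub> y = (%p. x p + y p)" and zero_R: "\<zero>\<^bsub>R\<^esub> = (%p. 0)"
 by (simp_all add: path_algebra_def)

definition splits :: "('v, 'a) path=>(('v, 'a) path \<times> ('v, 'a) path) set" where
 "splits r = {(q, p). q:P & p:P & tgt p = fst q & q \<cdot> p = r}"

lemma mult_R: "(x *. y) r = (\<Sum>(q, p)\<in>splits r. x q * y p)"
 by (simp add: path_algebra_def splits_def path_source_def)

lemma finite_splits: "finite (splits r)"
 by (rule finite_subset[of _ "P \<times> P"]) (auto simp: splits_def finite_paths)

lemma splits_P: "splits r ~= {}==>r:P"
 using comp_paths by (auto simp: splits_def)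

lemma ideal_of_iff: "x:ideal_of U \<longleftrightarrow> (ALL p. p \<notin> U --> x p = 0)"
 by (auto simp: ideal_of_def)

lemma ideal_of_zero: "(%p. 0):ideal_of U"
 and ideal_of_add: "x:ideal_of U==>y:ideal_of U==>(%p. x p + y p):ideal_of U"
 and ideal_of_scl: "x:ideal_of U==>(%p. c * x p):ideal_of U"
 and restr_ideal: "restr U x:ideal_of U"
 and restr_id: "x:ideal_of U==>restr U x = x"
 unfolding ideal_of_iff restr_def fun_eq_iff by simp_all

lemma ideal_of_elem: "(path_elem p :: ('v, 'a) path=>'k::field):ideal_of U \<longleftrightarrow> p:U"
 by (simp add: ideal_of_def path_elem_def)

lemma ideal_of_mono: "U <= V==>ideal_of U <= ideal_of V"
 unfolding ideal_of_def by blast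

lemma mult_carrier: "x *. y:carrier R"
proof -
 have "r:P" if "(x *. y) r ~= 0" for r
  using that splits_P[of r] by (cases "splits r = {}") (auto simp: mult_R)
 thus ?thesis by (auto simp: carrier_R ideal_of_def)
qed

lemma span_induct [consumes 2, case_names zero elem add]:
 fixes x :: "('v, 'a) path=>'k::field"
 assumes x: "x:ideal_of U" and U: "U <= P"
  and zero: "Q' (%p. 0)"
  and elem: "!!c p. p:U==>Q' (%q. c * path_elem p q)"
  and add: "!!x y. x:ideal_of U==>y:ideal_of U==>Q' x==>Q' y==>Q' (%p. x p + y p)"
 shows "Q' x"
proof -
 have "{p. x p ~= 0} <= P" using x U by (simp add: ideal_of_def)
 hence "finite {p. x p ~= 0}" by (rule finite_subset[OF _ finite_paths])
 moreover have "Q' x" if "finite S" "{p. x p ~= 0} = S" "x:ideal_of U" for S and x :: "('v, 'a) path=>'k"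
  using that
 proof (induction S arbitrary: x rule: finite_induct)
  case empty
  hence "x = (%p. 0)" by (simp add: fun_eq_iff)
  thus ?case using zero by simp
 next
  case (insert p S)
  let ?y = "%q. x p * path_elem p q" and ?z = "%q. if q = p then 0 else x q"
  have p: "p:U" using insert.prems unfolding ideal_of_def by blast
  have z: "?z:ideal_of U" using insert.prems(2) unfolding ideal_of_iff by simp
  have "x p ~= 0" using insert.prems(1) by blast
  have "{q. ?z q ~= 0} = {q. x q ~= 0} - {p}" by auto
  hence "{q. ?z q ~= 0} = S" unfolding insert.prems(1) using insert.hyps(2) by simp
  hence "Q' ?z" using insert.IH[OF _ z] by blast
  moreover have "?y:ideal_of U" using p unfolding ideal_of_iff path_elem_def by simp
  moreover have "Q' ?y" using elem[OF p] .
  ultimately have "Q' (%q. ?y q + ?z q)" using add z by blast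
  moreover have "(%q. ?y q + ?z q) = x" by (auto simp: path_elem_def)
  ultimately show ?case by simp
 qed
 ultimately show ?thesis using x by blast
qed

lemma mult_add_l: "(%p. x p + y p) *. z = (%p. (x *. z) p + (y *. z) p)"
 and mult_add_r: "z *. (%p. x p + y p) = (%p. (z *. x) p + (z *. y) p)"
 and mult_scl_l: "(%p. c * x p) *. z = (%p. c * (x *. z) p)"
 and mult_scl_r: "z *. (%p. c * x p) = (%p. c * (z *. x) p)"
 and mult_zero_l: "(%p. 0) *. z = (%p. 0)" and mult_zero_r: "z *. (%p. 0) = (%p. 0)"
 by (auto simp: mult_R fun_eq_iff sum.distrib[symmetric] sum_distrib_left algebra_simps case_prod_beta
  intro!: sum.cong)

lemma mult_elem:
 assumes "p:P" "q:P"
 shows "path_elem q *. path_elem p = (if tgt p = fst q then path_elem (q \<cdot> p) else (%p. 0 :: 'k::field))"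
proof
 fix r
 have "(\<Sum>(q', p')\<in>splits r. path_elem q q' * path_elem p p' :: 'k) =
  (\<Sum>x\<in>splits r. if x = (q, p) then 1 else 0)"
  by (rule sum.cong) (simp_all add: path_elem_def case_prod_beta prod_eq_iff[of _ "(q, p)"])
 also have "... = (if (q, p):splits r then 1 else 0)" using finite_splits by simp
 also have "... = (if tgt p = fst q then path_elem (q \<cdot> p) else (%p. 0)) r"
  using assms by (auto simp: splits_def path_elem_def)
 finally show "(path_elem q *. path_elem p) r = (if tgt p = fst q then path_elem (q \<cdot> p) else (%p. 0 :: 'k)) r"
  by (simp add: mult_R)
qed

lemma one_R: "\<one>\<^bsub>R\<^esub> = (%p. if snd p = [] & fst p:verts Q then 1 else (0 :: 'k::field))"
proof
 fix p
 have "\<one>\<^bsub>R\<^esub> p = (\<Sum>v\<in>verts Q. if v = fst p then (if snd p = [] then 1 else 0) else (0 :: 'k))"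
  unfolding path_algebra_def monoid.simps
  by (rule sum.cong) (auto simp: vertex_idem_def path_elem_def prod_eq_iff)
 thus "\<one>\<^bsub>R\<^esub> p = (if snd p = [] & fst p:verts Q then 1 else (0 :: 'k))" by simp
qed

lemma one_carrier: "\<one>\<^bsub>R\<^esub>:carrier R"
 using triv_paths by (auto simp: carrier_R one_R ideal_of_def split: if_splits)

lemma one_mult: assumes "x:carrier R" shows "\<one>\<^bsub>R\<^esub> *. x = x" "x *. \<one>\<^bsub>R\<^esub> = x"
proof -
 show "\<one>\<^bsub>R\<^esub> *. x = x"
 proof
  fix r
  show "(\<one>\<^bsub>R\<^esub> *. x) r = x r"
  proof (cases "r:P")
  case True
  have "(\<one>\<^bsub>R\<^esub> *. x) r = (\<Sum>y\<in>splits r. if y = ((tgt r, []), r) then x r else 0)"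
  unfolding mult_R one_R
  proof (rule sum.cong, goal_cases)
  case (2 y)
  obtain q p where y: "y = (q, p)" by (cases y)
  have qp: "q:P" "p:P" "tgt p = fst q" "q \<cdot> p = r" using 2 y by (auto simp: splits_def)
  show ?case
  proof (cases "snd q = []")
  case True
  hence pr: "p = r" using qp by (auto simp: path_comp_def prod_eq_iff)
  have "fst q = tgt r" using qp(3) unfolding pr by simp
  hence "q = (tgt r, [])" using True by (simp add: prod_eq_iff)
  thus ?thesis using pr y path_verts(2)[OF qp(2)] by simp
  qed (use y in auto)
  qed simp
  also have "((tgt r, []), r):splits r" using True triv_paths path_verts comp_triv by (auto simp: splits_def)
  hence "(\<Sum>y\<in>splits r. if y = ((tgt r, []), r) then x r else 0) = x r" using finite_splits by simp
  finally show ?thesis .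
  next
  case False
  hence "splits r = {}" using splits_P by blast
  moreover have "x r = 0" using False assms unfolding carrier_R ideal_of_iff by blast
  ultimately show ?thesis by (simp add: mult_R)
  qed
 qed
 show "x *. \<one>\<^bsub>R\<^esub> = x"
 proof
  fix r
  show "(x *. \<one>\<^bsub>R\<^esub>) r = x r"
  proof (cases "r:P")
  case True
  have "(x *. \<one>\<^bsub>R\<^esub>) r = (\<Sum>y\<in>splits r. if y = (r, (fst r, [])) then x r else 0)"
  unfolding mult_R one_R
  proof (rule sum.cong, goal_cases)
  case (2 y)
  obtain q p where y: "y = (q, p)" by (cases y)
  have qp: "q:P" "p:P" "tgt p = fst q" "q \<cdot> p = r" using 2 y by (auto simp: splits_def)
  show ?case
  proof (cases "snd p = []")
  case True
  hence "tgt p = fst p" by (simp add: path_target_def)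
  hence qr: "q = r" using qp True by (auto simp: path_comp_def prod_eq_iff)
  hence "p = (fst r, [])" using True qp \<open>tgt p = fst p\<close> by (simp add: prod_eq_iff)
  thus ?thesis using qr y path_verts(1)[OF qp(1)] by simp
  qed (use y in auto)
  qed simp
  also have "(r, (fst r, [])):splits r" using True triv_paths path_verts comp_triv by (auto simp: splits_def)
  hence "(\<Sum>y\<in>splits r. if y = (r, (fst r, [])) then x r else 0) = x r" using finite_splits by simp
  finally show ?thesis .
  next
  case False
  hence "splits r = {}" using splits_P by blast
  moreover have "x r = 0" using False assms unfolding carrier_R ideal_of_iff by blast
  ultimately show ?thesis by (simp add: mult_R)
  qed
 qed
qed

text \<open>Checked on triples of paths and then extended by linearity in one factor after the
  other.\<close>

lemma mult_assoc_R:
 fixes x y z :: "('v, 'a) path=>'k::field"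
 assumes x: "x:carrier R" and y: "y:carrier R" and z: "z:carrier R"
 shows "(x *. y) *. z = x *. (y *. z)"
proof -
 have 1: "(path_elem p *. path_elem q) *. path_elem r = (path_elem p *. (path_elem q *. path_elem r) :: ('v, 'a) path=>'k)"
  if "p:P" "q:P" "r:P" for p q r
  using that comp_paths comp_tgt by (simp add: mult_elem mult_zero_l mult_zero_r comp_assoc)
 have 2: "(path_elem p *. path_elem q) *. z = path_elem p *. (path_elem q *. z)" if "p:P" "q:P" for p q
  using z unfolding carrier_R
  by (rule span_induct) (simp_all add: mult_zero_r mult_scl_r mult_add_r 1 that)
 have 3: "(path_elem p *. y) *. z = path_elem p *. (y *. z)" if "p:P" for p
  using y unfolding carrier_R
  by (rule span_induct) (simp_all add: mult_zero_r mult_scl_r mult_add_r mult_zero_l mult_scl_l mult_add_l 2 that)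
 show ?thesis
  using x unfolding carrier_R
  by (rule span_induct) (simp_all add: mult_zero_l mult_scl_l mult_add_l 3)
qed

lemma ring_R: "ring (path_algebra Q :: (('v, 'a) path=>'k::field) ring)"
proof (rule ringI)
 show "abelian_group (R :: (('v, 'a) path=>'k) ring)"
 proof (rule abelian_groupI)
  fix x :: "('v, 'a) path=>'k" assume "x:carrier R"
  thus "EX y:carrier R. y \<oplus>\<^bsub>R\<^esub> x = \<zero>\<^bsub>R\<^esub>"
  by (intro bexI[of _ "%p. - x p"]) (auto simp: add_R zero_R carrier_R ideal_of_def)
 qed (auto simp: carrier_R add_R zero_R ideal_of_zero ideal_of_add algebra_simps)
 show "monoid (R :: (('v, 'a) path=>'k) ring)"
  by (rule monoidI) (auto simp: mult_carrier one_carrier one_mult mult_assoc_R)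
qed (auto simp: add_R mult_add_l mult_add_r)

lemma mult_ideal_of:
 fixes x y :: "('v, 'a) path=>'k::field"
 assumes "!!p q. p:U==>q:V==>p:P==>q:P==>tgt q = fst p==>p \<cdot> q:W"
  and "x:ideal_of U" "y:ideal_of V"
 shows "x *. y:ideal_of W"
proof -
 have "r:W" if "(x *. y) r ~= 0" for r
 proof -
  have "EX a:splits r. (case a of (q, p)=>x q * y p) ~= 0"
  using that sum.not_neutral_contains_not_neutral unfolding mult_R by metis
  then obtain q p where qp: "(q, p):splits r" "x q ~= 0" "y p ~= 0" by auto
  hence "q:P" "p:P" "tgt p = fst q" "q \<cdot> p = r" by (auto simp: splits_def)
  moreover have "q:U" "p:V" using qp assms(2,3) unfolding ideal_of_iff by blast+
  ultimately show ?thesis using assms(1) by blast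
 qed
 thus ?thesis unfolding ideal_of_iff by blast
qed

lemma ideal_ideal_of:
 assumes U: "pideal U"
 shows "ideal (ideal_of U) (R :: (('v, 'a) path=>'k::field) ring)"
proof (rule idealI)
 show "ring (R :: (('v, 'a) path=>'k) ring)" by (rule ring_R)
 interpret ring "R :: (('v, 'a) path=>'k) ring" by (rule ring_R)
 show "subgroup (ideal_of U) (add_monoid (R :: (('v, 'a) path=>'k) ring))"
 proof (rule group.subgroupI)
  show "Group.group (add_monoid (R :: (('v, 'a) path=>'k) ring))" by (rule add.group_axioms)
  show "ideal_of U <= carrier (add_monoid R)" using ideal_of_mono[OF pidealD(1)[OF U]] by (simp add: carrier_R)
  show "ideal_of U ~= {}" using ideal_of_zero by blast
 next
  fix a :: "('v, 'a) path=>'k" assume a: "a:ideal_of U"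
  have c: "a:carrier R" "(%p. - a p):carrier R" using a ideal_of_mono[OF pidealD(1)[OF U]]
  by (auto simp: carrier_R ideal_of_def)
  have "\<ominus>\<^bsub>R\<^esub> a = (%p. - a p)" by (rule minus_equality) (use c in "auto simp: add_R zero_R")
  thus "inv\<^bsub>add_monoid R\<^esub> a:ideal_of U" using a by (simp add: a_inv_def ideal_of_def)
 next
  fix a b :: "('v, 'a) path=>'k" assume "a:ideal_of U" "b:ideal_of U"
  thus "a \<otimes>\<^bsub>add_monoid R\<^esub> b:ideal_of U" using ideal_of_add by (simp add: add_R)
 qed
 fix a x :: "('v, 'a) path=>'k" assume a: "a:ideal_of U" and x: "x:carrier R"
 show "x *. a:ideal_of U"
  by (rule mult_ideal_of[OF _ x[unfolded carrier_R] a]) (use pidealD[OF U] in auto)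
 show "a *. x:ideal_of U"
  by (rule mult_ideal_of[OF _ a x[unfolded carrier_R]]) (use pidealD[OF U] in auto)
qed

lemma elem_carrier: "p:P==>path_elem p:carrier R"
 by (simp add: carrier_R ideal_of_elem)

text \<open>Multiplication by the two trivial paths isolates the paths from \<open>fst r\<close> to
  \<open>tgt r\<close>, and in a tree quiver r is the only one.\<close>

lemma corner:
 fixes x :: "('v, 'a) path=>'k::field"
 assumes x: "x:carrier R" and r: "r:P"
 shows "path_elem (tgt r, []) *. (x *. path_elem (fst r, [])) = (%q. x r * path_elem r q)"
proof -
 have t: "(tgt r, []):P" "(fst r, []):P" using triv_paths path_verts r by auto
 show ?thesis using x unfolding carrier_R
 proof (rule span_induct)
  fix c :: 'k and p assume p: "p:P"
  have "path_elem (tgt r, []) *. (path_elem p *. path_elem (fst r, []))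
  = (if fst p = fst r & tgt p = tgt r then path_elem p else (%q. 0 :: 'k))"
  proof (cases "fst p = fst r")
  case True
  hence "path_elem p *. path_elem (fst r, []) = (path_elem p :: ('v, 'a) path=>'k)"
  using mult_elem[OF t(2) p, where ?'k = 'k] triv_paths(2)[of "fst r"] comp_triv(1)[of p] by simp
  thus ?thesis using mult_elem[OF p t(1), where ?'k = 'k] True by (simp add: comp_triv(2))
  next
  case False
  hence "path_elem p *. path_elem (fst r, []) = (%q. 0 :: 'k)"
  using mult_elem[OF t(2) p, where ?'k = 'k] triv_paths(2)[of "fst r"] by auto
  thus ?thesis using False by (simp add: mult_zero_r)
  qed
  also have "... = (%q. path_elem p r * path_elem r q)"
  using path_eqI[OF p r] by (auto simp: path_elem_def)
  finally show "path_elem (tgt r, []) *. ((%q. c * path_elem p q) *. path_elem (fst r, [])) =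
  (%q. c * path_elem p r * path_elem r q)"
  by (simp add: mult_scl_l mult_scl_r mult.assoc)
 qed (simp_all add: mult_zero_l mult_zero_r mult_add_l mult_add_r distrib_right)
qed

lemma ideal_scl:
 fixes I :: "(('v, 'a) path=>'k::field) set"
 assumes "ideal I R" "x:I" shows "(%p. c * x p):I"
proof -
 interpret ideal I "R :: (('v, 'a) path=>'k) ring" by (rule assms(1))
 have x: "x:carrier R" using assms(2) by (rule a_Hcarr)
 have c: "(%p. c * \<one>\<^bsub>R\<^esub> p):carrier R" using one_carrier ideal_of_scl by (auto simp: carrier_R)
 have "(%p. c * \<one>\<^bsub>R\<^esub> p) *. x = (%p. c * x p)" using one_mult(1)[OF x] by (simp add: mult_scl_l)
 thus ?thesis using I_l_closed[OF assms(2) c] by simp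
qed

text \<open>By \<open>corner\<close> each path that occurs in an element of I with nonzero
  coefficient lies itself in I, so I is spanned by its paths.\<close>

lemma ideal_pideal:
 fixes I :: "(('v, 'a) path=>'k::field) set"
 assumes I: "ideal I R"
 obtains U where "pideal U" "I = ideal_of U"
proof -
 interpret ideal I "R :: (('v, 'a) path=>'k) ring" by (rule I)
 let ?U = "{p\<in>P. path_elem p:I}"
 have "pideal ?U"
  unfolding pideal_def
 proof (intro conjI ballI impI)
  fix p q assume p: "p:?U" and q: "q:P"
  have e: "path_elem p:I" "path_elem q:carrier R" using p q by (simp_all add: elem_carrier)
  show "q \<cdot> p:?U" if "tgt p = fst q"
  using I_l_closed[OF e] mult_elem[of p q, where ?'k = 'k] that p q comp_paths by simp
  show "p \<cdot> q:?U" if "tgt q = fst p"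
  using I_r_closed[OF e] mult_elem[of q p, where ?'k = 'k] that p q comp_paths by simp
 qed auto
 moreover have "I = ideal_of ?U"
 proof
  show "I <= ideal_of ?U"
  proof
  fix x assume x: "x:I"
  have xc: "x:carrier R" using x by (rule a_Hcarr)
  have "path_elem r:I & r:P" if r: "x r ~= 0" for r
  proof -
  have rP: "r:P" using r xc unfolding carrier_R ideal_of_iff by blast
  have t: "path_elem (tgt r, []):carrier R" "path_elem (fst r, []):carrier R"
  using triv_paths(1) path_verts rP by (simp_all add: elem_carrier)
  have "(%q. x r * path_elem r q):I"
  using I_l_closed[OF I_r_closed[OF x t(2)] t(1)] corner[OF xc rP] by simp
  hence "(%q. inverse (x r) * (x r * path_elem r q)):I" by (rule ideal_scl[OF I])
  moreover have "(%q. inverse (x r) * (x r * path_elem r q)) = path_elem r"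
  using r by (simp add: path_elem_def fun_eq_iff)
  ultimately show ?thesis using rP by simp
  qed
  thus "x:ideal_of ?U" unfolding ideal_of_iff by blast
  qed
  show "ideal_of ?U <= I"
  proof
  fix x :: "('v, 'a) path=>'k" assume "x:ideal_of ?U"
  thus "x:I"
  proof (rule span_induct)
  show "?U <= P" by auto
  show "(%p. 0):I" using additive_subgroup.zero_closed[OF additive_subgroup_axioms] by (simp add: zero_R)
  show "(%q. c * path_elem p q):I" if "p:?U" for c p using that ideal_scl[OF I] by auto
  show "(%p. x p + y p):I" if "x:I" "y:I" for x y using additive_subgroup.a_closed[OF additive_subgroup_axioms that] by (simp add: add_R)
  qed
  qed
 qed
 ultimately show thesis by (rule that)
qed

lemma ideal_of_inj: "(ideal_of U :: (('v, 'a) path=>'k::field) set) = ideal_of V==>U = V"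
 using ideal_of_elem[where ?'k = 'k] by blast

lemma Idl_elem:
 assumes X: "X <= P"
 shows "Idl\<^bsub>R\<^esub> (path_elem ` X) = (ideal_of (pgen X) :: (('v, 'a) path=>'k::field) set)"
proof
 interpret ring "R :: (('v, 'a) path=>'k) ring" by (rule ring_R)
 have Xc: "path_elem ` X <= carrier (R :: (('v, 'a) path=>'k) ring)" using X elem_carrier by blast
 have "path_elem ` X <= (ideal_of (pgen X) :: (('v, 'a) path=>'k) set)"
  using pgen_superset[OF X] ideal_of_elem by blast
 thus "Idl\<^bsub>R\<^esub> (path_elem ` X) <= (ideal_of (pgen X) :: (('v, 'a) path=>'k) set)"
  by (rule genideal_minimal[OF ideal_ideal_of[OF pideal_pgen[OF X]]])
 have I: "ideal (Idl\<^bsub>R\<^esub> (path_elem ` X)) (R :: (('v, 'a) path=>'k) ring)" by (rule genideal_ideal[OF Xc])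
 obtain V where V: "pideal V" "Idl\<^bsub>R\<^esub> (path_elem ` X) = (ideal_of V :: (('v, 'a) path=>'k) set)"
  using ideal_pideal[OF I] by blast
 have "X <= V" using genideal_self[OF Xc] ideal_of_elem unfolding V(2) by blast
 hence "pgen X <= V" using pgen_least V by blast
 thus "(ideal_of (pgen X) :: (('v, 'a) path=>'k) set) <= Idl\<^bsub>R\<^esub> (path_elem ` X)"
  unfolding V(2) by (rule ideal_of_mono)
qed

text \<open>Restricting coefficients to V and to W turns a disjoint decomposition of U into a direct
  decomposition of its ideal.\<close>

lemma indecomposable_conn:
 assumes I: "indecomposable_ideal (R :: (('v, 'a) path=>'k::field) ring) (ideal_of U)" and U: "pideal U"
 shows "conn U"
 unfolding conn_def
proof (intro conjI allI impI U)
 have z: "ideal_of {} = {\<zero>\<^bsub>R\<^esub> :: ('v, 'a) path=>'k}" by (auto simp: ideal_of_def zero_R)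
 show "U ~= {}" using I z by (auto simp: indecomposable_ideal_def)
 fix V W assume V: "pideal V" "pideal W" "V \<inter> W = {}" "V \<union> W = U"
 have "ideal_of V \<inter> ideal_of W = {\<zero>\<^bsub>R\<^esub> :: ('v, 'a) path=>'k}"
 proof -
  have "ideal_of V \<inter> ideal_of W <= (ideal_of {} :: (('v, 'a) path=>'k) set)" using V(3) unfolding ideal_of_def by blast
  thus ?thesis using z ideal_of_zero by (auto simp: zero_R)
 qed
 moreover have "ideal_of V <+>\<^bsub>R\<^esub> ideal_of W = (ideal_of U :: (('v, 'a) path=>'k) set)"
 proof
  show "ideal_of V <+>\<^bsub>R\<^esub> ideal_of W <= (ideal_of U :: (('v, 'a) path=>'k) set)"
  proof
  fix z :: "('v, 'a) path=>'k" assume "z:ideal_of V <+>\<^bsub>R\<^esub> ideal_of W"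
  then obtain x y where "z = (%p. x p + y p)" "x:ideal_of V" "y:ideal_of W"
  unfolding set_add_def' add_R by blast
  moreover have "ideal_of V <= (ideal_of U :: (('v, 'a) path=>'k) set)" "ideal_of W <= (ideal_of U :: (('v, 'a) path=>'k) set)"
  using V(4) by (auto intro!: ideal_of_mono)
  ultimately show "z:ideal_of U" using ideal_of_add by blast
  qed
  show "ideal_of U <= ideal_of V <+>\<^bsub>R\<^esub> (ideal_of W :: (('v, 'a) path=>'k) set)"
  proof
  fix x :: "('v, 'a) path=>'k" assume x: "x:ideal_of U"
  have "x p = restr V x p + restr W x p" for p
  proof (cases "p:U")
  case True
  then consider "p:V" "p \<notin> W" | "p:W" "p \<notin> V" using V by blast
  thus ?thesis by cases (simp_all add: restr_def)
  next
  case False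
  hence "x p = 0" "p \<notin> V" "p \<notin> W" using x V(4) unfolding ideal_of_iff by blast+
  thus ?thesis by (simp add: restr_def)
  qed
  hence "x = restr V x \<oplus>\<^bsub>R\<^esub> restr W x" unfolding add_R by (rule ext)
  thus "x:ideal_of V <+>\<^bsub>R\<^esub> ideal_of W" unfolding set_add_def' using restr_ideal by blast
  qed
 qed
 ultimately have "ideal_of V = {\<zero>\<^bsub>R\<^esub> :: ('v, 'a) path=>'k} \<or> ideal_of W = {\<zero>\<^bsub>R\<^esub> :: ('v, 'a) path=>'k}"
  using I ideal_ideal_of[OF V(1), where ?'k = 'k] ideal_ideal_of[OF V(2), where ?'k = 'k]
  unfolding indecomposable_ideal_def by blast
 thus "V = {} \<or> W = {}" unfolding z[symmetric] using ideal_of_inj by blast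
qed

end

subsection \<open>Endofunctors\<close>

text \<open>Additive categories with split idempotents. The endofunctor category inherits all three
  conditions, so one locale serves modules and functors alike.\<close>

locale additive_category = linear_category C for C :: "('k::field, 'o, 'd, 'z) lincat_scheme" +
 assumes has_zero: "EX Z. zero_object C Z"
  and has_biprod: "X:Obj C==>Y:Obj C==>EX Z. direct_sum C Z X Y"
  and has_split: "X:Obj C==>f:hom C X X==>Cmp C f f = f ==>
  EX Y:Obj C. EX a:hom C X Y. EX b:hom C Y X. Cmp C a b = Idm C Y & Cmp C b a = f"

locale endo = linear_category C for C :: "('k::field, 'o, 'd) lincat"
begin

abbreviation "E == endofunctor_cat C"

lemma lfunD:
 assumes "linear_functor C F"
 shows "X:Obj C==>fobj F X:Obj C" "X:Obj C==>farr F (Idm C X) = Idm C (fobj F X)"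
  "f:H X Y==>farr F f:H (fobj F X) (fobj F Y)"
  "f:H X Y==>g:H Y Z==>farr F (g**f) = farr F g**farr F f"
  "f:H X Y==>h:H X Y==>farr F (f+.h) = farr F f+.farr F h"
  "f:H X Y==>farr F (Scl C c f) = Scl C c (farr F f)"
 using assms by (auto simp: linear_functor_def hom_def)

lemma lfunI:
 assumes "!!X. X:Obj C==>fobj F X:Obj C" "!!X. X:Obj C==>farr F (Idm C X) = Idm C (fobj F X)"
  "!!f X Y. f:H X Y==>farr F f:H (fobj F X) (fobj F Y)"
  "!!f g X Y Z. f:H X Y==>g:H Y Z==>farr F (g**f) = farr F g**farr F f"
  "!!f h X Y. f:H X Y==>h:H X Y==>farr F (f+.h) = farr F f+.farr F h"
  "!!f X Y c. f:H X Y==>farr F (Scl C c f) = Scl C c (farr F f)"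
 shows "linear_functor C F"
 unfolding linear_functor_def
proof (intro conjI ballI allI)
 fix X Y f assume a: "X:Obj C" "Y:Obj C" "f:Mor C X Y"
 hence f: "f:H X Y" by (simp add: hom_def)
 show "farr F f:Mor C (fobj F X) (fobj F Y)" using assms(3)[OF f] by (simp add: hom_def)
 show "farr F (Scl C c f) = Scl C c (farr F f)" for c using assms(6)[OF f] .
 show "farr F (f+.g) = farr F f+.farr F g" if "g:Mor C X Y" for g
  using assms(5)[OF f] that a by (simp add: hom_def)
 show "farr F (g**f) = farr F g**farr F f" if "Z:Obj C" "g:Mor C Y Z" for g Z
  using assms(4)[OF f] that a by (simp add: hom_def)
qed (use assms(1,2) in auto)

lemma Obj_E: "F:Obj E \<longleftrightarrow> linear_functor C F"
 by (simp add: endofunctor_cat_def)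

lemma homE_iff:
 "et:hom E F G \<longleftrightarrow> linear_functor C F & linear_functor C G & src et = F & trg et = G &
  dat et:extensional (Obj C) & (ALL X:Obj C. dat et X:H (fobj F X) (fobj G X)) &
  (ALL X Y f. f:H X Y --> dat et Y**farr F f = farr G f**dat et X)"
proof (cases et)
 case (Arr a b d)
 have "X:Obj C==>linear_functor C F==>fobj F X:Obj C" for F X using lfunD by blast
 thus ?thesis unfolding Arr hom_def endofunctor_cat_def by auto
qed

lemma homE_D:
 assumes "et:hom E F G"
 shows "linear_functor C F" "linear_functor C G" "src et = F" "trg et = G" "dat et:extensional (Obj C)"
  "X:Obj C==>dat et X:H (fobj F X) (fobj G X)"
  "f:H X Y==>dat et Y**farr F f = farr G f**dat et X"
 using assms unfolding homE_iff by blast+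

lemma homE_eqI:
 assumes "et:hom E F G" "ta:hom E F G" "!!X. X:Obj C==>dat et X = dat ta X"
 shows "et = ta"
proof -
 have "dat et = dat ta" using homE_D(5)[OF assms(1)] homE_D(5)[OF assms(2)] assms(3) by (rule extensionalityI)
 thus ?thesis using homE_D(3,4)[OF assms(1)] homE_D(3,4)[OF assms(2)] by (simp add: arr.expand)
qed

lemma homE_I:
 assumes "linear_functor C F" "linear_functor C G" "!!X. X:Obj C==>d X:H (fobj F X) (fobj G X)"
  "!!f X Y. f:H X Y==>X:Obj C==>Y:Obj C==>d Y**farr F f = farr G f**d X"
 shows "Arr F G (\<lambda>X\<in>Obj C. d X):hom E F G"
 using assms hom_Obj unfolding homE_iff by auto

lemma E_sel:
 "Idm E F = Arr F F (\<lambda>X\<in>Obj C. Idm C (fobj F X))"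
 "Cmp E bv av = Arr (src av) (trg bv) (\<lambda>X\<in>Obj C. dat bv X**dat av X)"
 "Nul E F G = Arr F G (\<lambda>X\<in>Obj C. Nul C (fobj F X) (fobj G X))"
 "Add E av av' = Arr (src av) (trg av) (\<lambda>X\<in>Obj C. dat av X+.dat av' X)"
 "Scl E c av = Arr (src av) (trg av) (\<lambda>X\<in>Obj C. Scl C c (dat av X))"
 by (simp_all add: endofunctor_cat_def)

lemma typs_functor:
 assumes "linear_functor C F" "ar f"
 shows "ar (farr F f)" "src (farr F f) = fobj F (src f)" "trg (farr F f) = fobj F (trg f)"
 using lfunD(3)[OF assms(1), of f "src f" "trg f"] assms(2) by (auto simp: hom_iff)

lemma linear_category_E: "linear_category E"
proof
 fix f X Y assume f: "f:hom E X Y"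
 show "src f = X" "trg f = Y" using homE_D[OF f] by auto
next
 fix X assume "X:Obj E"
 hence X: "linear_functor C X" by (simp add: Obj_E)
 show "Idm E X:hom E X X" unfolding E_sel
 proof (rule homE_I[OF X X])
  fix f A B assume f: "f:H A B"
  show "Idm C (fobj X B)**farr X f = farr X f**Idm C (fobj X A)"
  using Cmp_Idm_left[OF lfunD(3)[OF X f]] Cmp_Idm_right[OF lfunD(3)[OF X f]] by simp
 qed (use lfunD(1)[OF X] in blast)
next
 fix g Y Z f X assume g: "g:hom E Y Z" and f: "f:hom E X Y"
 note gD = homE_D[OF g] and fD = homE_D[OF f]
 have "Arr X Z (\<lambda>A\<in>Obj C. dat g A**dat f A):hom E X Z"
 proof (rule homE_I[OF fD(1) gD(2)])
  fix h A B assume h: "h:H A B" and AB: "A:Obj C" "B:Obj C"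
  have "(dat g B**dat f B)**farr X h = dat g B**(farr Y h**dat f A)"
  using fD(7)[OF h] Cmp_assoc[OF gD(6)[OF AB(2)] fD(6)[OF AB(2)] lfunD(3)[OF fD(1) h]] by simp
  also have "... = (farr Z h**dat g A)**dat f A"
  using gD(7)[OF h] Cmp_assoc[OF gD(6)[OF AB(2)] lfunD(3)[OF fD(2) h] fD(6)[OF AB(1)]] by simp
  also have "... = farr Z h**(dat g A**dat f A)"
  using Cmp_assoc[OF lfunD(3)[OF gD(2) h] gD(6)[OF AB(1)] fD(6)[OF AB(1)]] by simp
  finally show "(dat g B**dat f B)**farr X h = farr Z h**(dat g A**dat f A)" .
 qed (use gD(6) fD(6) in blast)
 thus gf: "Cmp E g f:hom E X Z" using fD(3) gD(4) by (simp add: E_sel)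
next
 fix X Y assume "X:Obj E" "Y:Obj E"
 hence XY: "linear_functor C X" "linear_functor C Y" by (auto simp: Obj_E)
 show "Nul E X Y:hom E X Y" unfolding E_sel
 proof (rule homE_I[OF XY])
  fix f A B assume f: "f:H A B" and AB: "A:Obj C" "B:Obj C"
  show "Nul C (fobj X B) (fobj Y B)**farr X f = farr Y f**Nul C (fobj X A) (fobj Y A)"
  using Cmp_Nul_left[OF lfunD(3)[OF XY(1) f] lfunD(1)[OF XY(2) AB(2)]]
  Cmp_Nul_right[OF lfunD(3)[OF XY(2) f] lfunD(1)[OF XY(1) AB(1)]] by simp
 qed (use lfunD(1)[OF XY(1)] lfunD(1)[OF XY(2)] in blast)
next
 fix f g X Y assume f: "f:hom E X Y" and g: "g:hom E X Y"
 note gD = homE_D[OF g] and fD = homE_D[OF f]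
 have "Arr X Y (\<lambda>A\<in>Obj C. dat f A+.dat g A):hom E X Y"
 proof (rule homE_I[OF fD(1,2)])
  fix h A B assume h: "h:H A B" and AB: "A:Obj C" "B:Obj C"
  show "(dat f B+.dat g B)**farr X h = farr Y h**(dat f A+.dat g A)"
  using Cmp_Add_left[OF fD(6)[OF AB(2)] gD(6)[OF AB(2)] lfunD(3)[OF fD(1) h]]
  Cmp_Add_right[OF lfunD(3)[OF fD(2) h] fD(6)[OF AB(1)] gD(6)[OF AB(1)]] fD(7)[OF h] gD(7)[OF h] by simp
 qed (use fD(6) gD(6) in blast)
 thus "Add E f g:hom E X Y" using fD by (simp add: E_sel)
next
 fix f X Y c assume f: "f:hom E X Y"
 note fD = homE_D[OF f]
 have "Arr X Y (\<lambda>A\<in>Obj C. Scl C c (dat f A)):hom E X Y"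
 proof (rule homE_I[OF fD(1,2)])
  fix h A B assume h: "h:H A B" and AB: "A:Obj C" "B:Obj C"
  show "Scl C c (dat f B)**farr X h = farr Y h**Scl C c (dat f A)"
  using Cmp_Scl_left[OF fD(6)[OF AB(2)] lfunD(3)[OF fD(1) h]]
  Cmp_Scl_right[OF lfunD(3)[OF fD(2) h] fD(6)[OF AB(1)]] fD(7)[OF h] by simp
 qed (use fD(6) in blast)
 thus "Scl E c f:hom E X Y" using fD by (simp add: E_sel)
next
 fix h Y Z g X f W assume h: "h:hom E Y Z" and g: "g:hom E X Y" and f: "f:hom E W X"
 note hD = homE_D[OF h] and gD = homE_D[OF g] and fD = homE_D[OF f]
 show "Cmp E (Cmp E h g) f = Cmp E h (Cmp E g f)"
  using Cmp_assoc[OF hD(6) gD(6) fD(6)] fD(3) hD(4) by (auto simp: E_sel intro!: restrict_ext)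
next
 fix f X Y assume f: "f:hom E X Y"
 note fD = homE_D[OF f]
 have ex: "f = Arr X Y (\<lambda>A\<in>Obj C. dat f A)"
  using fD(3,4,5) by (cases f) (simp add: extensional_restrict)
 have "Cmp E (Idm E Y) f = Arr X Y (\<lambda>A\<in>Obj C. dat f A)"
  using fD(3) Cmp_Idm_left[OF fD(6)] by (simp add: E_sel cong: restrict_cong)
 thus "Cmp E (Idm E Y) f = f" using ex by simp
 have "Cmp E f (Idm E X) = Arr X Y (\<lambda>A\<in>Obj C. dat f A)"
  using fD(4) Cmp_Idm_right[OF fD(6)] by (simp add: E_sel cong: restrict_cong)
 thus "Cmp E f (Idm E X) = f" using ex by simp
 have "Add E f (Nul E X Y) = Arr X Y (\<lambda>A\<in>Obj C. dat f A)"
  using fD(3,4) Add_Nul[OF fD(6)] by (simp add: E_sel cong: restrict_cong)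
 thus "Add E f (Nul E X Y) = f" using ex by simp
 have "Scl E 1 f = Arr X Y (\<lambda>A\<in>Obj C. dat f A)"
  using fD(3,4) Scl_1[OF fD(6)] by (simp add: E_sel cong: restrict_cong)
 thus "Scl E 1 f = f" using ex by simp
 show "Scl E 0 f = Nul E X Y" using fD Scl_0[OF fD(6)] by (auto simp: E_sel)
 show "Scl E a (Scl E b f) = Scl E (a * b) f" for a b using Scl_Scl[OF fD(6)] by (auto simp: E_sel)
 show "Scl E (a + b) f = Add E (Scl E a f) (Scl E b f)" for a b using Scl_add[OF fD(6)] by (auto simp: E_sel)
 fix g assume g: "g:hom E X Y"
 note gD = homE_D[OF g]
 show "Add E f g = Add E g f" using fD gD Add_commute[OF fD(6) gD(6)] by (auto simp: E_sel)
 show "Scl E a (Add E f g) = Add E (Scl E a f) (Scl E a g)" for a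
  using Scl_Add[OF fD(6) gD(6)] by (auto simp: E_sel)
 show "Add E (Add E f g) h = Add E f (Add E g h)" if h: "h:hom E X Y" for h
  using Add_assoc[OF fD(6) gD(6) homE_D(6)[OF h]] by (auto simp: E_sel)
next
 fix g Y Z h f X assume g: "g:hom E Y Z" and h: "h:hom E Y Z" and f: "f:hom E X Y"
 note hD = homE_D[OF h] and gD = homE_D[OF g] and fD = homE_D[OF f]
 show "Cmp E (Add E g h) f = Add E (Cmp E g f) (Cmp E h f)"
  using Cmp_Add_left[OF gD(6) hD(6) fD(6)] gD by (auto simp: E_sel)
 show "Cmp E (Scl E a g) f = Scl E a (Cmp E g f)" "Cmp E g (Scl E a f) = Scl E a (Cmp E g f)" for a
  using Cmp_Scl_left[OF gD(6) fD(6)] Cmp_Scl_right[OF gD(6) fD(6)] by (auto simp: E_sel)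
next
 fix g Y Z f X h assume g: "g:hom E Y Z" and f: "f:hom E X Y" and h: "h:hom E X Y"
 note hD = homE_D[OF h] and gD = homE_D[OF g] and fD = homE_D[OF f]
 show "Cmp E g (Add E f h) = Add E (Cmp E g f) (Cmp E g h)"
  using Cmp_Add_right[OF gD(6) fD(6) hD(6)] by (auto simp: E_sel)
qed

end

locale additive_endo = endo C + additive_category C for C :: "('k::field, 'o, 'd) lincat"
begin

lemma zero_E: "EX Z. zero_object E Z"
proof -
 obtain Z where Z: "zero_object C Z" using has_zero by blast
 hence ZO: "Z:Obj C" and Z0: "Idm C Z = Nul C Z Z" by (auto simp: zero_object_def)
 let ?F = "Functor (%X. Z) (%f. Nul C Z Z)"
 have zz: "Nul C Z Z**Nul C Z Z = Nul C Z Z" "Nul C Z Z+.Nul C Z Z = Nul C Z Z"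
  using ZO by (auto simp: Nul_l Add_Nul_r typs)
 have "linear_functor C ?F" by (rule lfunI) (use ZO Z0 zz in "auto simp: Scl_Nul")
 hence "zero_object E ?F" using Z0 by (simp add: zero_object_def Obj_E E_sel)
 thus ?thesis by blast
qed

text \<open>Biproducts are chosen objectwise. On a morphism f the sum acts by the diagonal matrix
  with entries F f and G f, which makes injections and projections natural.\<close>

lemma biprod_E:
 assumes F: "F:Obj E" and G: "G:Obj E" shows "EX Z. direct_sum E Z F G"
proof -
 have lF: "linear_functor C F" and lG: "linear_functor C G" using F G by (auto simp: Obj_E)
 note FD = lfunD[OF lF] and GD = lfunD[OF lG]
 note Ft = typs_functor[OF lF] and Gt = typs_functor[OF lG]
 \<comment> \<open>Bundles the biproduct data at one object, so that they can be chosen for all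
   objects simultaneously.\<close>
 define bp where "bp X Z i1 i2 p1 p2 \<longleftrightarrow> Z:Obj C & i1:H (fobj F X) Z & i2:H (fobj G X) Z &
  p1:H Z (fobj F X) & p2:H Z (fobj G X) & p1**i1 = Idm C (fobj F X) & p2**i2 = Idm C (fobj G X) &
  p1**i2 = Nul C (fobj G X) (fobj F X) & p2**i1 = Nul C (fobj F X) (fobj G X) &
  i1**p1+.i2**p2 = Idm C Z" for X Z i1 i2 p1 p2
 have "EX Z i1 i2 p1 p2. bp X Z i1 i2 p1 p2" if "X:Obj C" for X
  using has_biprod[OF FD(1)[OF that] GD(1)[OF that]] unfolding direct_sum_def bp_def hom_def by blast
 then obtain Z i1 i2 p1 p2 where bp: "!!X. X:Obj C==>bp X (Z X) (i1 X) (i2 X) (p1 X) (p2 X)" by metis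
 have t: "Z X:Obj C" "ar (i1 X)" "src (i1 X) = fobj F X" "trg (i1 X) = Z X"
  "ar (i2 X)" "src (i2 X) = fobj G X" "trg (i2 X) = Z X"
  "ar (p1 X)" "src (p1 X) = Z X" "trg (p1 X) = fobj F X"
  "ar (p2 X)" "src (p2 X) = Z X" "trg (p2 X) = fobj G X"
  "p1 X**i1 X = Idm C (fobj F X)" "p2 X**i2 X = Idm C (fobj G X)"
  "p1 X**i2 X = Nul C (fobj G X) (fobj F X)" "p2 X**i1 X = Nul C (fobj F X) (fobj G X)"
  "i1 X**p1 X+.i2 X**p2 X = Idm C (Z X)" if "X:Obj C" for X
  using bp[OF that] by (auto simp: bp_def hom_iff)
 have r: "p1 X**(i1 X**y) = y" "p2 X**(i1 X**y) = Nul C (src y) (fobj G X)"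
  if "X:Obj C" "ar y" "trg y = fobj F X" for X y
  using that t[OF that(1)] assoc[of y "i1 X" "p1 X"] assoc[of y "i1 X" "p2 X"] GD(1)[OF that(1)]
  by (auto simp: Idm_l Nul_l)
 have r': "p2 X**(i2 X**y) = y" "p1 X**(i2 X**y) = Nul C (src y) (fobj F X)"
  if "X:Obj C" "ar y" "trg y = fobj G X" for X y
  using that t[OF that(1)] assoc[of y "i2 X" "p1 X"] assoc[of y "i2 X" "p2 X"] FD(1)[OF that(1)]
  by (auto simp: Idm_l Nul_l)
 let ?S = "Functor Z (%f. i1 (trg f)**(farr F f**p1 (src f))+.i2 (trg f)**(farr G f**p2 (src f)))"
 have lS: "linear_functor C ?S"
 proof (rule lfunI)
  fix X assume X: "X:Obj C"
  show "fobj ?S X:Obj C" using t[OF X] by simp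
  show "farr ?S (Idm C X) = Idm C (fobj ?S X)"
  using t[OF X] X FD(2)[OF X] GD(2)[OF X] by (simp add: typs Idm_l)
 next
  fix f X Y assume f: "f:H X Y"
  have XY: "X:Obj C" "Y:Obj C" using f hom_Obj by auto
  have ft: "ar f" "src f = X" "trg f = Y" using f by (auto simp: hom_iff)
  note tt = t[OF XY(1)] t[OF XY(2)] Ft[OF ft(1)] Gt[OF ft(1)]
  show "farr ?S f:H (fobj ?S X) (fobj ?S Y)" using tt ft by (simp add: typs)
  show "farr ?S (Scl C c f) = Scl C c (farr ?S f)" for c
  using tt ft FD(6)[OF f] GD(6)[OF f] Scl_Add[of "i1 Y**(farr F f**p1 X)" "Z X" "Z Y" "i2 Y**(farr G f**p2 X)" c]
  by (simp add: typs Scl_l Scl_r)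
  show "farr ?S (f+.h) = farr ?S f+.farr ?S h" if h: "h:H X Y" for h
  proof -
  have ht: "ar h" "src h = X" "trg h = Y" using h by (auto simp: hom_iff)
  note hh = Ft[OF ht(1)] Gt[OF ht(1)]
  let ?a = "i1 Y**(farr F f**p1 X)" and ?a' = "i1 Y**(farr F h**p1 X)"
  let ?b = "i2 Y**(farr G f**p2 X)" and ?b' = "i2 Y**(farr G h**p2 X)"
  have H: "?a:H (Z X) (Z Y)" "?a':H (Z X) (Z Y)" "?b:H (Z X) (Z Y)" "?b':H (Z X) (Z Y)"
  using tt hh ft ht by (auto simp: typs)
  have "farr ?S (f+.h) = (?a+.?a')+.(?b+.?b')"
  using tt hh ft ht FD(5)[OF f h] GD(5)[OF f h] by (simp add: typs Add_l Add_r)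
  also have "... = ?a+.((?a'+.?b)+.?b')" using H by (simp add: Add_assoc[of _ "Z X" "Z Y"] Add_hom)
  also have "?a'+.?b = ?b+.?a'" by (rule Add_commute[OF H(2,3)])
  also have "?a+.((?b+.?a')+.?b') = (?a+.?b)+.(?a'+.?b')"
  using H by (simp add: Add_assoc[of _ "Z X" "Z Y"] Add_hom)
  finally show ?thesis using ft ht by simp
  qed
  fix g W assume g: "g:H Y W"
  have W: "W:Obj C" using g hom_Obj by auto
  have gt: "ar g" "src g = Y" "trg g = W" using g by (auto simp: hom_iff)
  note gg = Ft[OF gt(1)] Gt[OF gt(1)] t[OF W]
  have n: "fobj F X:Obj C" "fobj F W:Obj C" "fobj G X:Obj C" "fobj G W:Obj C" "fobj F Y:Obj C" "fobj G Y:Obj C"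
  using FD(1) GD(1) XY W by auto
  show "farr ?S (g**f) = farr ?S g**farr ?S f"
  using tt gg ft gt FD(4)[OF f g] GD(4)[OF f g] n XY W
  by (simp add: typs Add_l Add_r assoc r r' Nul_l Nul_r Add_Nul_r Add_Nul_l)
 qed
 have mor: "et:Mor E A B" if "et:hom E A B" for et A B using that by (simp add: hom_def)
 have 1: "Arr F ?S (\<lambda>X\<in>Obj C. i1 X):hom E F ?S"
 proof (rule homE_I[OF lF lS])
  fix X show "X:Obj C==>i1 X:H (fobj F X) (fobj ?S X)" using t by (simp add: hom_iff)
  fix f Y assume f: "f:H X Y" and XY: "X:Obj C" "Y:Obj C"
  have ft: "ar f" "src f = X" "trg f = Y" using f by (auto simp: hom_iff)
  show "i1 Y**farr F f = farr ?S f**i1 X"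
  using t[OF XY(1)] t[OF XY(2)] Ft[OF ft(1)] Gt[OF ft(1)] ft FD(1)[OF XY(1)] FD(1)[OF XY(2)] GD(1)[OF XY(2)] GD(1)[OF XY(1)]
  by (simp add: typs Add_l assoc Nul_r Idm_r Add_Nul_r)
 qed
 have 2: "Arr G ?S (\<lambda>X\<in>Obj C. i2 X):hom E G ?S"
 proof (rule homE_I[OF lG lS])
  fix X show "X:Obj C==>i2 X:H (fobj G X) (fobj ?S X)" using t by (simp add: hom_iff)
  fix f Y assume f: "f:H X Y" and XY: "X:Obj C" "Y:Obj C"
  have ft: "ar f" "src f = X" "trg f = Y" using f by (auto simp: hom_iff)
  show "i2 Y**farr G f = farr ?S f**i2 X"
  using t[OF XY(1)] t[OF XY(2)] Ft[OF ft(1)] Gt[OF ft(1)] ft FD(1)[OF XY(1)] FD(1)[OF XY(2)] GD(1)[OF XY(2)] GD(1)[OF XY(1)]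
  by (simp add: typs Add_l assoc Nul_r Idm_r Add_Nul_l)
 qed
 have 3: "Arr ?S F (\<lambda>X\<in>Obj C. p1 X):hom E ?S F"
 proof (rule homE_I[OF lS lF])
  fix X show "X:Obj C==>p1 X:H (fobj ?S X) (fobj F X)" using t by (simp add: hom_iff)
  fix f Y assume f: "f:H X Y" and XY: "X:Obj C" "Y:Obj C"
  have ft: "ar f" "src f = X" "trg f = Y" using f by (auto simp: hom_iff)
  show "p1 Y**farr ?S f = farr F f**p1 X"
  using t[OF XY(1)] t[OF XY(2)] Ft[OF ft(1)] Gt[OF ft(1)] ft FD(1)[OF XY(2)] r[OF XY(2)] r'[OF XY(2)]
  by (simp add: typs Add_r Add_Nul_r)
 qed
 have 4: "Arr ?S G (\<lambda>X\<in>Obj C. p2 X):hom E ?S G"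
 proof (rule homE_I[OF lS lG])
  fix X show "X:Obj C==>p2 X:H (fobj ?S X) (fobj G X)" using t by (simp add: hom_iff)
  fix f Y assume f: "f:H X Y" and XY: "X:Obj C" "Y:Obj C"
  have ft: "ar f" "src f = X" "trg f = Y" using f by (auto simp: hom_iff)
  show "p2 Y**farr ?S f = farr G f**p2 X"
  using t[OF XY(1)] t[OF XY(2)] Ft[OF ft(1)] Gt[OF ft(1)] ft GD(1)[OF XY(2)] r[OF XY(2)] r'[OF XY(2)]
  by (simp add: typs Add_r Add_Nul_l)
 qed
 have "direct_sum E ?S F G"
  unfolding direct_sum_def
 proof (intro conjI)
  show "F:Obj E" "G:Obj E" "?S:Obj E" using F G lS by (auto simp: Obj_E)
  show "EX i1:Mor E F ?S. EX i2:Mor E G ?S. EX p1:Mor E ?S F. EX p2:Mor E ?S G.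
  Cmp E p1 i1 = Idm E F & Cmp E p2 i2 = Idm E G & Cmp E p1 i2 = Nul E G F & Cmp E p2 i1 = Nul E F G &
  Add E (Cmp E i1 p1) (Cmp E i2 p2) = Idm E ?S"
  by (rule bexI[OF _ mor[OF 1]], rule bexI[OF _ mor[OF 2]], rule bexI[OF _ mor[OF 3]], rule bexI[OF _ mor[OF 4]])
  (auto simp: E_sel t intro!: restrict_ext)
 qed
 thus ?thesis by blast
qed

text \<open>The idempotent is split objectwise. Naturality of \<open>et\<close> makes the images
  into a functor, on which f acts as a (F f) b.\<close>

lemma split_E:
 assumes F: "F:Obj E" and et: "et:hom E F F" and idem: "Cmp E et et = et"
 shows "EX Y:Obj E. EX a:hom E F Y. EX b:hom E Y F. Cmp E a b = Idm E Y & Cmp E b a = et"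
proof -
 have lF: "linear_functor C F" using F by (auto simp: Obj_E)
 note FD = lfunD[OF lF] and hD = homE_D[OF et]
 note Ft = typs_functor[OF lF]
 have id: "dat et X**dat et X = dat et X" if "X:Obj C" for X
 proof -
  have "dat (Cmp E et et) X = dat et X" using idem by simp
  thus ?thesis using that by (simp add: E_sel)
 qed
 have "EX Y a b. Y:Obj C & a:H (fobj F X) Y & b:H Y (fobj F X) & a**b = Idm C Y & b**a = dat et X"
  if "X:Obj C" for X
  using has_split[OF FD(1)[OF that] hD(6)[OF that] id[OF that]] by blast
 then obtain Y a b where yab: "!!X. X:Obj C==>Y X:Obj C & a X:H (fobj F X) (Y X) & b X:H (Y X) (fobj F X) &
  a X**b X = Idm C (Y X) & b X**a X = dat et X" by metis
 have t: "Y X:Obj C" "ar (a X)" "src (a X) = fobj F X" "trg (a X) = Y X"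
  "ar (b X)" "src (b X) = Y X" "trg (b X) = fobj F X" "a X**b X = Idm C (Y X)" "b X**a X = dat et X"
  if "X:Obj C" for X using yab[OF that] by (auto simp: hom_iff)
 have ba: "b X**(a X**y) = dat et X**y" if "X:Obj C" "ar y" "trg y = fobj F X" for X y
  using t[OF that(1)] that assoc[of y "a X" "b X"] by simp
 have he: "dat et X**b X = b X" "a X**dat et X = a X" if "X:Obj C" for X
  using t[OF that] assoc[of "b X" "a X" "b X"] assoc[of "a X" "b X" "a X"] by (auto simp: Idm_l Idm_r)
 have aH: "a X**(dat et X**y) = a X**y" if "X:Obj C" "ar y" "trg y = fobj F X" for X y
  using t[OF that(1)] that assoc[of y "dat et X" "a X"] he[OF that(1)] hD(6)[OF that(1)] by (simp add: hom_iff)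
 have het: "ar (dat et X)" "src (dat et X) = fobj F X" "trg (dat et X) = fobj F X" if "X:Obj C" for X
  using hD(6)[OF that] by (auto simp: hom_iff)
 have nat: "dat et (trg f)**(farr F f**y) = farr F f**(dat et (src f)**y)" if "ar f" "ar y" "trg y = fobj F (src f)" for f y
 proof -
  have f: "f:H (src f) (trg f)" using that by (simp add: hom_iff)
  hence O: "src f:Obj C" "trg f:Obj C" using hom_Obj by auto
  have "(dat et (trg f)**farr F f)**y = (farr F f**dat et (src f))**y" using hD(7)[OF f] by simp
  thus ?thesis using that het[OF O(1)] het[OF O(2)] Ft[OF that(1)] by (simp add: assoc)
 qed
 let ?S = "Functor Y (%f. a (trg f)**(farr F f**b (src f)))"
 have lS: "linear_functor C ?S"
 proof (rule lfunI)
  fix X assume X: "X:Obj C"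
  show "fobj ?S X:Obj C" using t[OF X] by simp
  show "farr ?S (Idm C X) = Idm C (fobj ?S X)" using t[OF X] X FD(2)[OF X] by (simp add: typs Idm_l)
 next
  fix f X Z assume f: "f:H X Z"
  have XZ: "X:Obj C" "Z:Obj C" using f hom_Obj by auto
  have ft: "ar f" "src f = X" "trg f = Z" using f by (auto simp: hom_iff)
  note tt = t[OF XZ(1)] t[OF XZ(2)] Ft[OF ft(1)]
  show "farr ?S f:H (fobj ?S X) (fobj ?S Z)" using tt ft by (simp add: typs)
  show "farr ?S (Scl C c f) = Scl C c (farr ?S f)" for c
  using tt ft FD(6)[OF f] by (simp add: typs Scl_l Scl_r)
  show "farr ?S (f+.h) = farr ?S f+.farr ?S h" if h: "h:H X Z" for h
  proof -
  have ht: "ar h" "src h = X" "trg h = Z" using h by (auto simp: hom_iff)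
  show ?thesis using tt Ft[OF ht(1)] ft ht FD(5)[OF f h] by (simp add: typs Add_l Add_r)
  qed
  fix g W assume g: "g:H Z W"
  have W: "W:Obj C" using g hom_Obj by auto
  have gt: "ar g" "src g = Z" "trg g = W" using g by (auto simp: hom_iff)
  note gg = Ft[OF gt(1)] t[OF W]
  \<comment> \<open>The factor b a in the middle is the idempotent; it moves past
    \<open>farr F g\<close> by naturality and is absorbed by a.\<close>
  have "farr ?S g**farr ?S f = a W**(farr F g**(dat et Z**(farr F f**b X)))"
  using tt gg ft gt ba[OF XZ(2)] by (simp add: typs assoc)
  also have "... = a W**(dat et W**(farr F g**(farr F f**b X)))"
  using nat[OF gt(1), of "farr F f**b X"] tt ft gt by (simp add: typs)
  also have "... = a W**(farr F g**(farr F f**b X))" using aH[OF W] tt gg ft gt by (simp add: typs)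
  finally show "farr ?S (g**f) = farr ?S g**farr ?S f"
  using tt gg ft gt FD(4)[OF f g] by (simp add: typs assoc)
 qed
 have 1: "Arr F ?S (\<lambda>X\<in>Obj C. a X):hom E F ?S"
 proof (rule homE_I[OF lF lS])
  fix X show "X:Obj C==>a X:H (fobj F X) (fobj ?S X)" using t by (simp add: hom_iff)
  fix f Z assume f: "f:H X Z" and XZ: "X:Obj C" "Z:Obj C"
  have ft: "ar f" "src f = X" "trg f = Z" using f by (auto simp: hom_iff)
  note tt = t[OF XZ(1)] t[OF XZ(2)] Ft[OF ft(1)] het[OF XZ(1)] het[OF XZ(2)]
  have "farr ?S f**a X = a Z**(farr F f**dat et X)" using tt ft by (simp add: typs assoc)
  also have "... = a Z**(dat et Z**farr F f)" using hD(7)[OF f] by simp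
  finally show "a Z**farr F f = farr ?S f**a X" using aH[OF XZ(2), of "farr F f"] tt ft by simp
 qed
 have 2: "Arr ?S F (\<lambda>X\<in>Obj C. b X):hom E ?S F"
 proof (rule homE_I[OF lS lF])
  fix X show "X:Obj C==>b X:H (fobj ?S X) (fobj F X)" using t by (simp add: hom_iff)
  fix f Z assume f: "f:H X Z" and XZ: "X:Obj C" "Z:Obj C"
  have ft: "ar f" "src f = X" "trg f = Z" using f by (auto simp: hom_iff)
  note tt = t[OF XZ(1)] t[OF XZ(2)] Ft[OF ft(1)] het[OF XZ(1)] het[OF XZ(2)]
  have "b Z**farr ?S f = dat et Z**(farr F f**b X)" using tt ft ba[OF XZ(2)] by (simp add: typs)
  also have "... = farr F f**(dat et X**b X)" using nat[OF ft(1), of "b X"] ft tt by simp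
  finally show "b Z**farr ?S f = farr F f**b X" using he(1)[OF XZ(1)] by simp
 qed
 have ex: "et = Arr F F (\<lambda>A\<in>Obj C. dat et A)" using hD(3,4,5) by (cases et) (simp add: extensional_restrict)
 show ?thesis
 proof (rule bexI[OF _ _], rule bexI[OF _ 1], rule bexI[OF _ 2], rule conjI)
  show "?S:Obj E" using lS by (simp add: Obj_E)
  show "Cmp E (Arr F ?S (\<lambda>X\<in>Obj C. a X)) (Arr ?S F (\<lambda>X\<in>Obj C. b X)) = Idm E ?S"
  by (auto simp: E_sel t intro!: restrict_ext)
  have "Cmp E (Arr ?S F (\<lambda>X\<in>Obj C. b X)) (Arr F ?S (\<lambda>X\<in>Obj C. a X)) = Arr F F (\<lambda>A\<in>Obj C. dat et A)"
  by (auto simp: E_sel t intro!: restrict_ext)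
  thus "Cmp E (Arr ?S F (\<lambda>X\<in>Obj C. b X)) (Arr F ?S (\<lambda>X\<in>Obj C. a X)) = et" using ex by simp
 qed
qed

end

sublocale additive_endo \<subseteq> E: additive_category "endofunctor_cat C"
 by (intro additive_category.intro linear_category_E additive_category_axioms.intro zero_E)
  (use biprod_E split_E in blast)+

section \<open>Horizontal composition of functors and transformations\<close>

context endo begin

definition hcomp :: "('o, 'd) endofunctor=>('o, 'd) endofunctor=>('o, 'd) endofunctor" where
 "hcomp F G = Functor (fobj F \<circ> fobj G) (farr F \<circ> farr G)"

text \<open>Of the two equal formulas for the horizontal composite, the one used in
  \<open>dual_projection_2cat\<close>.\<close>

definition harr where
 "harr bv av = Arr (hcomp (src bv) (src av)) (hcomp (trg bv) (trg av))
  (\<lambda>M\<in>Obj C. dat bv (fobj (trg av) M)**farr (src bv) (dat av M))"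

lemma hcomp_sel: "fobj (hcomp F G) X = fobj F (fobj G X)" "farr (hcomp F G) f = farr F (farr G f)"
 by (auto simp: hcomp_def)

lemma hcomp_linear: "linear_functor C F==>linear_functor C G==>linear_functor C (hcomp F G)"
 by (rule lfunI) (auto simp: hcomp_sel lfunD(1,2) lfunD(4)[OF _ lfunD(3) lfunD(3)]
  lfunD(3,4) lfunD(5)[OF _ lfunD(3) lfunD(3)] lfunD(5)
  lfunD(6)[OF _ lfunD(3)] lfunD(6))

lemma harr_hom:
 assumes b: "bv:hom E F F'" and a: "av:hom E G G'"
 shows "harr bv av:hom E (hcomp F G) (hcomp F' G')"
proof -
 note bD = homE_D[OF b] and aD = homE_D[OF a]
 have "Arr (hcomp F G) (hcomp F' G') (\<lambda>M\<in>Obj C. dat bv (fobj G' M)**farr F (dat av M)):hom E (hcomp F G) (hcomp F' G')"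
 proof (rule homE_I[OF hcomp_linear[OF bD(1) aD(1)] hcomp_linear[OF bD(2) aD(2)]])
  fix X assume X: "X:Obj C"
  have GX: "fobj G' X:Obj C" using lfunD(1)[OF aD(2) X] .
  show "dat bv (fobj G' X)**farr F (dat av X):H (fobj (hcomp F G) X) (fobj (hcomp F' G') X)"
  unfolding hcomp_sel by (rule Cmp_hom[OF bD(6)[OF GX] lfunD(3)[OF bD(1) aD(6)[OF X]]])
 next
  fix f X Y assume f: "f:H X Y" and XY: "X:Obj C" "Y:Obj C"
  have GX: "fobj G' X:Obj C" "fobj G' Y:Obj C" using lfunD(1)[OF aD(2)] XY by auto
  note h1 = bD(6)[OF GX(1)] bD(6)[OF GX(2)] lfunD(3)[OF bD(1) aD(6)[OF XY(1)]] lfunD(3)[OF bD(1) aD(6)[OF XY(2)]]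
  note Gf = lfunD(3)[OF aD(1) f] and G'f = lfunD(3)[OF aD(2) f]
  have "(dat bv (fobj G' Y)**farr F (dat av Y))**farr F (farr G f) = dat bv (fobj G' Y)**farr F (dat av Y**farr G f)"
  using Cmp_assoc[OF h1(2,4) lfunD(3)[OF bD(1) Gf]] lfunD(4)[OF bD(1) Gf aD(6)[OF XY(2)]] by simp
  also have "dat av Y**farr G f = farr G' f**dat av X" using aD(7)[OF f] .
  also have "dat bv (fobj G' Y)**farr F (farr G' f**dat av X) = (dat bv (fobj G' Y)**farr F (farr G' f))**farr F (dat av X)"
  using Cmp_assoc[OF h1(2) lfunD(3)[OF bD(1) G'f] h1(3)] lfunD(4)[OF bD(1) aD(6)[OF XY(1)] G'f] by simp
  also have "... = farr F' (farr G' f)**(dat bv (fobj G' X)**farr F (dat av X))"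
  using bD(7)[OF G'f] Cmp_assoc[OF lfunD(3)[OF bD(2) G'f] h1(1,3)] by simp
  finally show "(dat bv (fobj G' Y)**farr F (dat av Y))**farr (hcomp F G) f =
  farr (hcomp F' G') f**(dat bv (fobj G' X)**farr F (dat av X))" by (simp add: hcomp_sel)
 qed
 thus ?thesis using bD(3,4) aD(3,4) by (simp add: harr_def)
qed

lemma harr_Idm:
 assumes "F:Obj E" "G:Obj E" shows "harr (Idm E F) (Idm E G) = Idm E (hcomp F G)"
proof -
 have l: "linear_functor C F" "linear_functor C G" using assms by (auto simp: Obj_E)
 show ?thesis using lfunD(1,2)[OF l(1)] lfunD(1)[OF l(2)]
  by (auto simp: harr_def E_sel hcomp_sel typs Idm_l intro!: restrict_ext)
qed

text \<open>Interchange law: after expanding both sides, the two middle factors are exchanged by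
  naturality of \<open>bv\<close> along the component of \<open>av'\<close>.\<close>

lemma harr_Cmp:
 assumes b: "bv:hom E F F'" and b': "bv':hom E F' F''" and a: "av:hom E G G'" and a': "av':hom E G' G''"
 shows "harr (Cmp E bv' bv) (Cmp E av' av) = Cmp E (harr bv' av') (harr bv av)"
proof -
 interpret EE: linear_category E by (rule linear_category_E)
 note bD = homE_D[OF b] and aD = homE_D[OF a] and bD' = homE_D[OF b'] and aD' = homE_D[OF a']
 have "harr (Cmp E bv' bv) (Cmp E av' av):hom E (hcomp F G) (hcomp F'' G'')"
  by (rule harr_hom[OF EE.Cmp_hom[OF b' b] EE.Cmp_hom[OF a' a]])
 moreover have "Cmp E (harr bv' av') (harr bv av):hom E (hcomp F G) (hcomp F'' G'')"
  by (rule EE.Cmp_hom[OF harr_hom[OF b' a'] harr_hom[OF b a]])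
 ultimately show ?thesis
 proof (rule homE_eqI)
  fix X assume X: "X:Obj C"
  have O: "fobj G X:Obj C" "fobj G' X:Obj C" "fobj G'' X:Obj C"
  using lfunD(1)[OF aD(1) X] lfunD(1)[OF aD(2) X] lfunD(1)[OF aD'(2) X] by auto
  note h = aD(6)[OF X] aD'(6)[OF X]
  note Fa = lfunD(3)[OF bD(1) h(1)] lfunD(3)[OF bD(1) h(2)] lfunD(3)[OF bD(2) h(2)]
  note be = bD(6)[OF O(2)] bD(6)[OF O(3)] bD'(6)[OF O(3)]
  have t: "dat (Cmp E bv' bv) (fobj G'' X) = dat bv' (fobj G'' X)**dat bv (fobj G'' X)"
  "dat (Cmp E av' av) X = dat av' X**dat av X" using X O by (auto simp: E_sel)
  have s: "src (Cmp E bv' bv) = F" "trg (Cmp E av' av) = G''" using bD(3) aD'(4) by (auto simp: E_sel)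
  have "dat (harr (Cmp E bv' bv) (Cmp E av' av)) X =
  (dat bv' (fobj G'' X)**dat bv (fobj G'' X))**farr F (dat av' X**dat av X)"
  using X by (simp add: harr_def s t)
  also have "... = dat bv' (fobj G'' X)**((dat bv (fobj G'' X)**farr F (dat av' X))**farr F (dat av X))"
  using lfunD(4)[OF bD(1) h] Fa be by (simp add: hom_iff assoc ar_Cmp src_Cmp trg_Cmp)
  also have "dat bv (fobj G'' X)**farr F (dat av' X) = farr F' (dat av' X)**dat bv (fobj G' X)"
  using bD(7)[OF h(2)] .
  also have "dat bv' (fobj G'' X)**((farr F' (dat av' X)**dat bv (fobj G' X))**farr F (dat av X)) =
  (dat bv' (fobj G'' X)**farr F' (dat av' X))**(dat bv (fobj G' X)**farr F (dat av X))"
  using Fa be by (simp add: hom_iff assoc ar_Cmp src_Cmp trg_Cmp)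
  also have "... = dat (Cmp E (harr bv' av') (harr bv av)) X"
  using X bD aD bD' aD' by (simp add: E_sel harr_def)
  finally show "dat (harr (Cmp E bv' bv) (Cmp E av' av)) X = dat (Cmp E (harr bv' av') (harr bv av)) X" .
 qed
qed

lemma harr_Idm_left:
 assumes F: "linear_functor C F" and a: "av:hom E G G'" and X: "X:Obj C"
 shows "dat (harr (Idm E F) av) X = farr F (dat av X)"
proof -
 note aD = homE_D[OF a]
 have "fobj G' X:Obj C" using lfunD(1)[OF aD(2) X] .
 thus ?thesis using X aD(4) lfunD(3)[OF F aD(6)[OF X]] by (simp add: harr_def E_sel hom_iff Idm_l)
qed

lemma harr_Idm_right:
 assumes G: "linear_functor C G" and b: "bv:hom E F F'" and X: "X:Obj C"
 shows "dat (harr bv (Idm E G)) X = dat bv (fobj G X)"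
proof -
 note bD = homE_D[OF b]
 have O: "fobj G X:Obj C" using lfunD(1)[OF G X] .
 thus ?thesis using X bD(3) lfunD(2)[OF bD(1) O] bD(6)[OF O] by (simp add: harr_def E_sel hom_iff Idm_r)
qed

lemma harr_linear_right:
 assumes F: "F:Obj E" and a: "av:hom E G G'" and b: "bv:hom E G G'"
 shows "harr (Idm E F) (Add E av bv) = Add E (harr (Idm E F) av) (harr (Idm E F) bv)"
  "harr (Idm E F) (Scl E c av) = Scl E c (harr (Idm E F) av)"
proof -
 interpret EE: linear_category E by (rule linear_category_E)
 have lF: "linear_functor C F" using F by (simp add: Obj_E)
 note I = EE.Idm_hom[OF F]
 note aD = homE_D[OF a] and bD = homE_D[OF b]
 have ab: "Add E av bv:hom E G G'" "Scl E c av:hom E G G'" using a b by auto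
 have H: "harr (Idm E F) (Add E av bv):hom E (hcomp F G) (hcomp F G')"
  "Add E (harr (Idm E F) av) (harr (Idm E F) bv):hom E (hcomp F G) (hcomp F G')"
  "harr (Idm E F) (Scl E c av):hom E (hcomp F G) (hcomp F G')"
  "Scl E c (harr (Idm E F) av):hom E (hcomp F G) (hcomp F G')"
  using harr_hom[OF I] a b ab by auto
 have s: "dat (Add E ga de) X = dat ga X+.dat de X" "dat (Scl E c ga) X = Scl C c (dat ga X)" if "X:Obj C" for X ga de
  using that by (auto simp: E_sel)
 show "harr (Idm E F) (Add E av bv) = Add E (harr (Idm E F) av) (harr (Idm E F) bv)"
  by (rule homE_eqI[OF H(1,2)])
  (simp add: harr_Idm_left[OF lF ab(1)] s  harr_Idm_left[OF lF a] harr_Idm_left[OF lF b] lfunD(5)[OF lF aD(6) bD(6)])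
 show "harr (Idm E F) (Scl E c av) = Scl E c (harr (Idm E F) av)"
  by (rule homE_eqI[OF H(3,4)])
  (simp add: harr_Idm_left[OF lF ab(2)] s harr_Idm_left[OF lF a] lfunD(6)[OF lF aD(6)])
qed

lemma harr_linear_left:
 assumes G: "G:Obj E" and a: "av:hom E F F'" and b: "bv:hom E F F'"
 shows "harr (Add E av bv) (Idm E G) = Add E (harr av (Idm E G)) (harr bv (Idm E G))"
  "harr (Scl E c av) (Idm E G) = Scl E c (harr av (Idm E G))"
proof -
 interpret EE: linear_category E by (rule linear_category_E)
 have lG: "linear_functor C G" using G by (simp add: Obj_E)
 note I = EE.Idm_hom[OF G]
 have ab: "Add E av bv:hom E F F'" "Scl E c av:hom E F F'" using a b by auto
 have H: "harr (Add E av bv) (Idm E G):hom E (hcomp F G) (hcomp F' G)"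
  "Add E (harr av (Idm E G)) (harr bv (Idm E G)):hom E (hcomp F G) (hcomp F' G)"
  "harr (Scl E c av) (Idm E G):hom E (hcomp F G) (hcomp F' G)"
  "Scl E c (harr av (Idm E G)):hom E (hcomp F G) (hcomp F' G)"
  using harr_hom[OF _ I] a b ab by auto
 have O: "fobj G X:Obj C" if "X:Obj C" for X using lfunD(1)[OF lG that] .
 have s: "dat (Add E ga de) X = dat ga X+.dat de X" "dat (Scl E c ga) X = Scl C c (dat ga X)" if "X:Obj C" for X ga de
  using that by (auto simp: E_sel)
 show "harr (Add E av bv) (Idm E G) = Add E (harr av (Idm E G)) (harr bv (Idm E G))"
  by (rule homE_eqI[OF H(1,2)])
  (simp add: harr_Idm_right[OF lG ab(1)] s O  harr_Idm_right[OF lG a] harr_Idm_right[OF lG b])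
 show "harr (Scl E c av) (Idm E G) = Scl E c (harr av (Idm E G))"
  by (rule homE_eqI[OF H(3,4)])
  (simp add: harr_Idm_right[OF lG ab(2)] s O harr_Idm_right[OF lG a])
qed

end

section \<open>Additive closures and objects generated by a family\<close>

context additive_category begin

definition generated :: "('s=>'o)=>'s set=>'o=>bool" where
 "generated D P X \<longleftrightarrow> X:Obj C & Idm C X:aspan C X X (through C D P X X)"

lemma through_H: "through C D P X Y <= H X Y"
 by (auto simp: through_def)

lemma span_through_Cmp:
 assumes f: "f:aspan C X Y (through C D P X Y)" and g: "g:H Y Z" and h: "h:H W X"
 shows "g**(f**h):aspan C W Z (through C D P W Z)"
proof -
 have O: "X:Obj C" "Y:Obj C" "Z:Obj C" "W:Obj C" using g h hom_Obj by auto
 have 1: "f**h:aspan C W Y ((%f. f**h) ` through C D P X Y)"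
  by (rule aspan_Cmp_right[OF f through_H h O(2)])
 have s1: "(%f. f**h) ` through C D P X Y <= H W Y" using through_H h by blast
 have 2: "g**(f**h):aspan C W Z (Cmp C g ` (%f. f**h) ` through C D P X Y)"
  by (rule aspan_Cmp_left[OF 1 s1 g O(4)])
 have "Cmp C g ` (%f. f**h) ` through C D P X Y <= through C D P W Z"
 proof
  fix y assume "y:Cmp C g ` (%f. f**h) ` through C D P X Y"
  then obtain i p s where y: "y = g**((i**p)**h)" "s:P" "p:H X (D s)" "i:H (D s) Y"
  by (auto simp: through_def)
  have "y = (g**i)**(p**h)" using y g h by (simp add: typs assoc)
  moreover have "g**i:H (D s) Z" "p**h:H W (D s)" using y g h by auto
  ultimately show "y:through C D P W Z" using y(2) unfolding through_def by blast
 qed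
 thus ?thesis using 2 by (rule aspan_mono[rotated])
qed

lemma generated_retract:
 assumes "generated D P X" "i:H Y X" "p:H X Y" "p**i = Idm C Y"
 shows "generated D P Y"
proof -
 have "p**(Idm C X**i):aspan C Y Y (through C D P Y Y)"
  using span_through_Cmp[of "Idm C X" X X D P p Y i Y] assms by (simp add: generated_def)
 thus ?thesis using assms hom_Obj by (auto simp: generated_def Cmp_Idm_left)
qed

lemma generated_zero: "zero_object C X==>generated D P X"
 by (auto simp: generated_def zero_object_def intro: aspan.nul)

lemma generated_sum:
 assumes d: "direct_sum C Z X Y" and X: "generated D P X" and Y: "generated D P Y"
 shows "generated D P Z"
proof -
 obtain i1 i2 p1 p2 where Z: "Z:Obj C" "i1:H X Z" "i2:H Y Z" "p1:H Z X" "p2:H Z Y"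
  "i1**p1+.i2**p2 = Idm C Z"
  using d unfolding direct_sum_def hom_def by blast
 have "i1**(Idm C X**p1):aspan C Z Z (through C D P Z Z)"
  by (rule span_through_Cmp[OF _ Z(2,4)]) (use X in "simp add: generated_def")
 moreover have "i2**(Idm C Y**p2):aspan C Z Z (through C D P Z Z)"
  by (rule span_through_Cmp[OF _ Z(3,5)]) (use Y in "simp add: generated_def")
 ultimately have "i1**p1+.i2**p2:aspan C Z Z (through C D P Z Z)"
  using Z aspan.add[of "i1**p1" C Z Z _ "i2**p2"] by (simp add: Cmp_Idm_left)
 thus ?thesis using Z by (simp add: generated_def)
qed

lemma add_closure_generated:
 assumes S: "!!X. X:S==>X:Obj C==>generated D P X" and X: "X:add_closure C S"
 shows "generated D P X"
 using X
proof (induction rule: add_closure.induct)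
 case (summand Z X)
 then obtain Y i p where "i:H X Z" "p:H Z X" "p**i = Idm C X"
  unfolding summand_def direct_sum_def hom_def by blast
 thus ?case using generated_retract summand by blast
qed (use S generated_zero generated_sum in blast)+

text \<open>The expansion of the identity exhibits X as a retract of a member Z of the additive
  closure. \<open>summand\<close> asks for a complement, and this is obtained by splitting the
  idempotent \<open>Idm C Z-.a**b\<close>.\<close>

lemma generated_add_closure:
 assumes S: "D ` P <= S" and X: "generated D P X"
 shows "X:add_closure C S"
proof -
 have XO: "X:Obj C" and sp: "Idm C X:aspan C X X (through C D P X X)"
  using X by (auto simp: generated_def)
 \<comment> \<open>Every element of the span factors through one member of the closure; for a sum,
   the biproduct of the two middle objects is taken.\<close>
 have "f:H X X & (EX Z:add_closure C S. EX a:H X Z. EX b:H Z X. f = b**a)"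
  if "f:aspan C X X (through C D P X X)" for f using that
 proof (induction rule: aspan.induct)
  case nul
  obtain Z where Z: "zero_object C Z" using has_zero by blast
  have ZO: "Z:Obj C" using Z by (simp add: zero_object_def)
  have "Nul C X X = Nul C Z X**Nul C X Z" using ZO XO by (simp add: Nul_l typs)
  thus ?case using Z ZO XO Nul_hom by (blast intro: add_closure.zero)
 next
  case (base f)
  then obtain i p s where f: "f = i**p" "s:P" "p:H X (D s)" "i:H (D s) X" by (auto simp: through_def)
  hence "D s:add_closure C S" using S hom_Obj by (blast intro: add_closure.base)
  thus ?case using f by blast
 next
  case (add f g)
  then obtain Z a b Z' a' b' where f: "f:H X X" "Z:add_closure C S" "a:H X Z" "b:H Z X" "f = b**a"
  and g: "g:H X X" "Z':add_closure C S" "a':H X Z'" "b':H Z' X" "g = b'**a'" by blast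
  have O: "Z:Obj C" "Z':Obj C" using f g hom_Obj by auto
  obtain W where W: "direct_sum C W Z Z'" using has_biprod[OF O] by blast
  have Wc: "W:add_closure C S" by (rule add_closure.sum[OF f(2) g(2) W])
  obtain i1 i2 p1 p2 where w: "W:Obj C" "i1:H Z W" "i2:H Z' W" "p1:H W Z" "p2:H W Z'"
  "p1**i1 = Idm C Z" "p2**i2 = Idm C Z'" "p1**i2 = Nul C Z' Z" "p2**i1 = Nul C Z Z'"
  using W unfolding direct_sum_def hom_def by blast
  let ?a = "i1**a+.i2**a'" and ?b = "b**p1+.b'**p2"
  have t: "ar a" "src a = X" "trg a = Z" "ar b" "src b = Z" "trg b = X" "ar a'" "src a' = X" "trg a' = Z'"
  "ar b'" "src b' = Z'" "trg b' = X" "ar i1" "src i1 = Z" "trg i1 = W" "ar i2" "src i2 = Z'" "trg i2 = W"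
  "ar p1" "src p1 = W" "trg p1 = Z" "ar p2" "src p2 = W" "trg p2 = Z'"
  using f g w by (auto simp: hom_iff)
  have r: "p1**(i1**a) = a" "p2**(i1**a) = Nul C X Z'" "p1**(i2**a') = Nul C X Z" "p2**(i2**a') = a'"
  using assoc[of a i1 p1] assoc[of a i1 p2] assoc[of a' i2 p1] assoc[of a' i2 p2] t w O by (auto simp: Idm_l Nul_l)
  have "?b**?a = f+.g" using t r O XO f(5) g(5) by (simp add: typs Add_l Add_r assoc Nul_r Add_Nul_r Add_Nul_l)
  moreover have "?a:H X W" "?b:H W X" using t by (auto simp: typs)
  ultimately show ?case using Wc Add_hom[OF f(1) g(1)]
  by (intro conjI bexI[of _ W] bexI[of _ ?a] bexI[of _ ?b]) simp_all
 qed
 then obtain Z a b where Z: "Z:add_closure C S" and ab: "a:H X Z" "b:H Z X" "Idm C X = b**a"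
  using sp by blast
 have ZO: "Z:Obj C" using ab hom_Obj by auto
 have t: "ar a" "src a = X" "trg a = Z" "ar b" "src b = Z" "trg b = X" using ab by (auto simp: hom_iff)
 define f where "f = Idm C Z-.a**b"
 have fH: "f:H Z Z" using ZO t by (simp add: f_def typs)
 hence ft: "ar f" "src f = Z" "trg f = Z" by (auto simp: hom_iff)
 have ba: "b**a = Idm C X" using ab by simp
 have baa: "b**(a**b) = b" using assoc[of b a b] t ba by (simp add: Idm_l)
 have bf: "b**f = Nul C Z X"
  unfolding f_def using t ZO baa dif_self[of b Z X] by (simp add: typs dif_r Idm_r)
 have fa: "f**a = Nul C X Z"
  unfolding f_def using t ZO ba dif_self[of a X Z] by (simp add: typs dif_l assoc Idm_r Idm_l)
 have ff: "f**f = f"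
 proof -
  have "f**f = Idm C Z**f-.(a**b)**f"
  unfolding f_def[THEN arg_cong[where f = "%x. x**f"]]
  by (rule dif_l) (use ft t ZO in "simp_all add: typs")
  also have "... = f-.a**(b**f)" using ft t by (simp add: assoc Idm_l)
  finally show ?thesis using bf ft t ZO XO by (simp add: Nul_r dif_Nul_r)
 qed
 obtain Y c d where Y: "Y:Obj C" "c:H Z Y" "d:H Y Z" "c**d = Idm C Y" "d**c = f"
  using has_split[OF ZO fH ff] by blast
 have ct: "ar c" "src c = Z" "trg c = Y" "ar d" "src d = Y" "trg d = Z" using Y by (auto simp: hom_iff)
 have fd: "f**d = d" using assoc[of d c d] Y ct by (simp add: Idm_r)
 have bd: "b**d = Nul C Y X"
 proof -
  have "b**d = (b**f)**d" using assoc[of d f b] fd ct ft t by simp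
  thus ?thesis using bf ct XO by (simp add: Nul_l)
 qed
 have cf: "c**f = c" using assoc[of c d c] Y ct by (simp add: Idm_l)
 have ca: "c**a = Nul C X Y"
 proof -
  have "c**a = c**(f**a)" using assoc[of a f c] cf ct ft t by simp
  thus ?thesis using fa ct XO by (simp add: Nul_r)
 qed
 have sum: "a**b+.d**c = Idm C Z" using Y(5) add_dif[of "Idm C Z" Z Z "a**b"] t ZO by (simp add: f_def typs)
 have "direct_sum C Z X Y"
  unfolding direct_sum_def
 proof (intro conjI)
  have "i:Mor C A B" if "i:H A B" for i A B using that by (simp add: hom_def)
  thus "EX i1:Mor C X Z. EX i2:Mor C Y Z. EX p1:Mor C Z X. EX p2:Mor C Z Y.
  p1**i1 = Idm C X & p2**i2 = Idm C Y & p1**i2 = Nul C Y X & p2**i1 = Nul C X Y &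
  i1**p1+.i2**p2 = Idm C Z"
  using Y ab ba bd ca sum
  by (intro bexI[of _ a] bexI[of _ d] bexI[of _ b] bexI[of _ c]) simp_all
 qed (use XO Y ZO in simp_all)
 hence "summand C X Z" unfolding summand_def by blast
 thus ?thesis by (rule add_closure.summand[OF Z])
qed

end

subsection \<open>Modules\<close>

lemmas amv = assoc_mult_mat_vec and mvc = mult_mat_vec_carrier and amd = add_mult_distrib_mat_vec
 and mad = mult_add_distrib_mat_vec

notation mult_mat_vec (infixl \<open>*v\<close> 70) and smult_vec (infixl \<open>.*\<close> 70)

lemma mat_assoc: "dim_col A = dim_row B==>dim_col B = dim_row D==>A * B * D = A * (B * (D :: 'k::field mat))"
 by (rule assoc_mult_mat[of A "dim_row A" "dim_col A" B "dim_col B" D "dim_col D"]) auto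

lemma mat_vec_assoc: "dim_col A = dim_row B==>dim_vec v = dim_col B==>(A * B) *v v = A *v (B *v (v :: 'k::field vec))"
 by (rule amv[OF _ _ carrier_vecI, of A "dim_row A" "dim_col A" B "dim_col B" v]) auto

lemma mat_mult_unit: "A:carrier_mat n m==>j < m==>A *v unit_vec m j = col A j" for A :: "'k::field mat"
 by (intro eq_vecI) (auto simp: scalar_prod_right_unit)

lemma mat_eq_unit:
 assumes "A:carrier_mat n m" "B:carrier_mat n m" "!!j. j < m==>A *v unit_vec m j = B *v unit_vec m j"
 shows "A = (B :: 'k::field mat)"
proof (rule eq_matI)
 fix i j assume ij: "i < dim_row B" "j < dim_col B"
 hence "col A j = col B j" using assms mat_mult_unit by (metis carrier_matD(2))
 hence "col A j $ i = col B j $ i" by simp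
 thus "A $$ (i, j) = B $$ (i, j)" using ij assms by (simp add: col_def)
qed (use assms in auto)

lemma vec_induct [consumes 1, case_names zero unit add]:
 fixes v :: "'k::field vec"
 assumes v: "v:carrier_vec n" and z: "Q' (0\<^sub>v n)" and u: "!!c i. i < n==>Q' (c .* unit_vec n i)"
  and a: "!!x y. x:carrier_vec n==>y:carrier_vec n==>Q' x==>Q' y==>Q' (x + y)"
 shows "Q' v"
proof -
 have "Q' v" if "finite S" "S = {i. i < n & v $ i ~= 0}" "v:carrier_vec n" for S and v :: "'k vec"
  using that
 proof (induction S arbitrary: v rule: finite_induct)
  case empty
  hence "v = 0\<^sub>v n" by (intro eq_vecI) auto
  thus ?case using z by simp
 next
  case (insert i S)
  have i: "i < n" using insert.prems by blast
  let ?w = "vec n (%j. if j = i then 0 else v $ j)"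
  have "{j. j < n & ?w $ j ~= 0} = {j. j < n & v $ j ~= 0} - {i}" by (auto split: if_splits)
  hence "S = {j. j < n & ?w $ j ~= 0}" using insert.prems(1) insert.hyps(2) by auto
  hence "Q' ?w" using insert.IH[of ?w] by simp
  moreover have "Q' ((v $ i) .* unit_vec n i)" using u[OF i] .
  ultimately have "Q' ((v $ i) .* unit_vec n i + ?w)" using a[of "(v $ i) .* unit_vec n i" ?w] by simp
  moreover have "(v $ i) .* unit_vec n i + ?w = v"
  using insert.prems(2) i by (intro eq_vecI) (auto simp: unit_vec_def)
  ultimately show ?case by simp
 qed
 thus ?thesis using v by auto
qed

text \<open>Linear algebra on a space W of functions, evaluated on a finite set X: the points
  \<open>xs i\<close> give coordinates, and the functions \<open>fs i\<close> are dual to evaluation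
  at these points. It serves both the splitting of idempotent matrices and the construction of
  tensor products.\<close>

lemma dual_basis:
 fixes W :: "('x=>'k::field) set"
 assumes X: "finite X" and z: "(%x. 0):W"
  and a': "ALL f:W. ALL g:W. (%x. f x + g x):W" and s': "ALL f:W. ALL c. (%x. c * f x):W"
 shows "EX (d::nat) xs fs. (ALL i<d. xs i:X & fs i:W) & (ALL i<d. ALL j<d. fs i (xs j) = (if i = j then 1 else 0)) &
  (ALL f:W. ALL x:X. f x = (\<Sum>i<d. f (xs i) * fs i x))"
 using X
proof (induction X rule: finite_induct)
 case empty
 show ?case by (rule exI[of _ 0]) simp
next
 case (insert x X)
 have a: "(%x. f x + g x):W" if "f:W" "g:W" for f g using a' that by blast
 have s: "(%x. c * f x):W" if "f:W" for f c using s' that by blast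
 have comb: "(%y. \<Sum>i<n. c i * fs i y):W" if "!!i. i < n==>fs i:W" for c fs and n :: nat
  using that by (induction n) (auto intro!: z a s)
 obtain d :: nat and xs fs where h: "!!i. i < d==>xs i:X & fs i:W"
  and del: "!!i j. i < d==>j < d==>fs i (xs j) = (if i = j then 1 else 0)"
  and ex: "!!f y. f:W==>y:X==>f y = (\<Sum>i<d. f (xs i) * fs i y)"
  using insert.IH by blast
 have rW: "(%y. f y + - 1 * (\<Sum>i<d. f (xs i) * fs i y)):W" if "f:W" for f
  by (rule a[OF that s[OF comb]]) (use h in blast)
 show ?case
 proof (cases "ALL f:W. f x = (\<Sum>i<d. f (xs i) * fs i x)")
  case True
  thus ?thesis using h del ex by (intro exI[of _ d] exI[of _ xs] exI[of _ fs]) auto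
 next
  case False
  then obtain f0 where f0: "f0:W" "f0 x ~= (\<Sum>i<d. f0 (xs i) * fs i x)" by blast
  \<comment> \<open>If the expansion of some \<open>f0\<close> fails at the new point x, the
    remainder r vanishes on X but not at x. Normalized to g it is the new basis function, and the
    old ones are corrected so as to vanish at x.\<close>
  define r where "r = (%y. f0 y + - 1 * (\<Sum>i<d. f0 (xs i) * fs i y))"
  have r: "r:W" "r x ~= 0" "!!y. y:X==>r y = 0" using rW[OF f0(1)] f0 ex by (auto simp: r_def)
  define g where "g = (%y. inverse (r x) * r y)"
  have g: "g:W" "g x = 1" "!!y. y:X==>g y = 0" using s[OF r(1)] r by (auto simp: g_def)
  define xs' where "xs' i = (if i < d then xs i else x)" for i
  define fs' where "fs' i = (if i < d then (%y. fs i y + (- fs i x) * g y) else g)" for i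
  have h': "xs' i:insert x X & fs' i:W" if "i < Suc d" for i
  using that h g(1) a[OF _ s[OF g(1)], of "fs i" "- fs i x"] by (simp add: xs'_def fs'_def)
  have del': "fs' i (xs' j) = (if i = j then 1 else 0)" if "i < Suc d" "j < Suc d" for i j
  using that del[of i j] g h by (auto simp: xs'_def fs'_def)
  have ex': "f y = (\<Sum>i<Suc d. f (xs' i) * fs' i y)" if f: "f:W" and y: "y:insert x X" for f y
  proof -
  have S: "(\<Sum>i<d. f (xs' i) * fs' i y) = (\<Sum>i<d. f (xs i) * fs i y) - (\<Sum>i<d. f (xs i) * fs i x) * g y" for y
  by (simp add: xs'_def fs'_def algebra_simps sum.distrib sum_subtractf sum_distrib_left sum_distrib_right)
  show ?thesis
  proof (cases "y = x")
  case True
  thus ?thesis using S[of x] g(2) by (simp add: xs'_def fs'_def)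
  next
  case False
  thus ?thesis using S[of y] y g(3)[of y] ex[OF f, of y] by (simp add: xs'_def fs'_def)
  qed
  qed
  show ?thesis using h' del' ex' by (intro exI[of _ "Suc d"] exI[of _ xs'] exI[of _ fs']) blast
 qed
qed

text \<open>W is the column space of M, its vectors read as functions of the row index. B has a
  basis of W as columns, \<open>A0\<close> reads off coordinates at the rows \<open>xs i\<close>,
  and \<open>A0 * M\<close> is the other factor.\<close>

lemma idempotent_mat_split:
 fixes M :: "'k::field mat"
 assumes M: "M:carrier_mat n n" and MM: "M * M = M"
 obtains r A B where "A:carrier_mat r n" "B:carrier_mat n r" "A * B = 1\<^sub>m r" "B * A = M"
proof -
 define W where "W = {%i. if i < n then (M *v v) $ i else 0 | v. v:carrier_vec n}"
 have WI: "(%i. if i < n then (M *v v) $ i else 0):W" if "v:carrier_vec n" for v using that by (auto simp: W_def)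
 have z: "(%i. 0):W" using WI[of "0\<^sub>v n"] M by (simp add: fun_eq_iff cong: if_cong)
 have a: "(%i. f i + g i):W" if f: "f:W" and g: "g:W" for f g
 proof -
  obtain v w where v: "v:carrier_vec n" "f = (%i. if i < n then (M *v v) $ i else 0)"
  and w: "w:carrier_vec n" "g = (%i. if i < n then (M *v w) $ i else 0)" using f g by (auto simp: W_def)
  have "(%i. f i + g i) = (%i. if i < n then (M *v (v + w)) $ i else 0)"
  using v w M by (auto simp: fun_eq_iff mad)
  thus ?thesis using WI[of "v + w"] v w by simp
 qed
 have s: "(%i. c * f i):W" if f: "f:W" for f c
 proof -
  obtain v where v: "v:carrier_vec n" "f = (%i. if i < n then (M *v v) $ i else 0)" using f by (auto simp: W_def)
  have "(%i. c * f i) = (%i. if i < n then (M *v (c .* v)) $ i else 0)"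
  using v M by (auto simp: fun_eq_iff mult_mat_vec)
  thus ?thesis using WI[of "c .* v"] v by simp
 qed
 have "ALL f:W. ALL g:W. (%x. f x + g x):W" "ALL f:W. ALL c. (%x. c * f x):W" using a s by blast+
 from dual_basis[OF finite_lessThan[of n] z this] obtain r :: nat and xs fs
  where hh: "(ALL i<r. xs i:{..<n} & fs i:W) & (ALL i<r. ALL j<r. fs i (xs j) = (if i = j then 1 else 0)) &
  (ALL f:W. ALL x:{..<n}. f x = (\<Sum>i<r. f (xs i) * fs i x))" by (elim exE)
 have h: "!!i. i < r==>xs i < n & fs i:W" using hh by simp
 have del: "!!i j. i < r==>j < r==>fs i (xs j) = (if i = j then 1 else 0)" using hh by simp
 have ex: "!!f y. f:W==>y < n==>f y = (\<Sum>i<r. f (xs i) * fs i y)" using hh by blast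
 define B where "B = mat n r (%(i, j). fs j i)"
 define A0 :: "'k mat" where "A0 = mat r n (%(i, j). if j = xs i then 1 else 0)"
 have c: "B:carrier_mat n r" "A0:carrier_mat r n" by (auto simp: B_def A0_def)
 have A0D: "(A0 * D) $$ (i, j) = D $$ (xs i, j)" if "D:carrier_mat n k" "i < r" "j < k" for D i j k
 proof -
  have "(A0 * D) $$ (i, j) = (\<Sum>l<n. (if l = xs i then 1 else 0) * D $$ (l, j))"
  using that c by (simp add: scalar_prod_def A0_def atLeast0LessThan)
  also have "... = (\<Sum>l<n. if l = xs i then D $$ (l, j) else 0)" by (rule sum.cong) auto
  finally show ?thesis using h[OF that(2)] by simp
 qed
 have A0B: "A0 * B = 1\<^sub>m r"
  by (rule eq_matI) (use c A0D[OF c(1)] h del in "auto simp: B_def")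
 have MB: "M * B = B"
 proof (rule mat_eq_unit)
  show "M * B:carrier_mat n r" "B:carrier_mat n r" using M c by auto
  fix j assume j: "j < r"
  obtain v where v: "v:carrier_vec n" "fs j = (%i. if i < n then (M *v v) $ i else 0)" using h[OF j] by (auto simp: W_def)
  have "B *v unit_vec r j = M *v v"
  using mat_mult_unit[OF c(1) j] v M j by (auto simp: B_def intro!: eq_vecI)
  moreover have "M *v (M *v v) = M *v v" using mat_vec_assoc[of M M v] MM M v by simp
  ultimately show "(M * B) *v unit_vec r j = B *v unit_vec r j" using mat_vec_assoc[of M B "unit_vec r j"] M c by simp
 qed
 have "B * (A0 * M) = M"
 proof (rule eq_matI)
  fix i j assume ij: "i < dim_row M" "j < dim_col M"
  have "M *v unit_vec n j = col M j" using mat_mult_unit[OF M] ij M by auto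
  hence "(%i. if i < n then M $$ (i, j) else 0) = (%i. if i < n then (M *v unit_vec n j) $ i else 0)"
  using M ij by (auto simp: fun_eq_iff)
  hence "(%i. if i < n then M $$ (i, j) else 0):W" using WI[of "unit_vec n j"] by simp
  from ex[OF this, of i] have "M $$ (i, j) = (\<Sum>l<r. M $$ (xs l, j) * fs l i)" using ij M h by simp
  moreover have "(B * D) $$ (i, j) = (\<Sum>l<r. fs l i * D $$ (l, j))" if "D:carrier_mat r n" for D
  using ij M that by (simp add: scalar_prod_def atLeast0LessThan B_def)
  from this[of "A0 * M"] have "(B * (A0 * M)) $$ (i, j) = (\<Sum>l<r. fs l i * (A0 * M) $$ (l, j))" using M c by simp
  hence "(B * (A0 * M)) $$ (i, j) = (\<Sum>l<r. fs l i * M $$ (xs l, j))"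
  using A0D[OF M] ij M by (simp del: index_mult_mat)
  ultimately show "(B * (A0 * M)) $$ (i, j) = M $$ (i, j)" by (simp add: mult.commute)
 qed (use M c in auto)
 moreover have "(A0 * M) * B = 1\<^sub>m r" using mat_assoc[of A0 M B] M c MB A0B by simp
 ultimately show thesis using that[of "A0 * M" r B] M c by auto
qed

section \<open>The category of modules over the path algebra\<close>

context tree_paths begin

lemma lmodD:
 fixes M :: "('v, 'a, 'k::field) module_obj"
 assumes "left_module Q M"
 shows "a:carrier R==>snd M a:carrier_mat (fst M) (fst M)"
  "a:carrier R==>dim_row (snd M a) = fst M" "a:carrier R==>dim_col (snd M a) = fst M"
  "snd M:extensional (carrier R)" "snd M \<one>\<^bsub>R\<^esub> = 1\<^sub>m (fst M)"
  "a:carrier R==>b:carrier R==>snd M (a *. b) = snd M a * snd M b"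
  "a:carrier R==>b:carrier R==>snd M (%p. a p + b p) = snd M a + snd M b"
  "a:carrier R==>snd M (%p. c * a p) = c \<cdot>\<^sub>m snd M a"
proof -
 have 1: "snd M:carrier R \<rightarrow>\<^sub>E carrier_mat (fst M) (fst M)" "snd M \<one>\<^bsub>R\<^esub> = 1\<^sub>m (fst M)"
  "ALL a:carrier R. ALL b:carrier R. snd M (a *. b) = snd M a * snd M b & snd M (a \<oplus>\<^bsub>R\<^esub> b) = snd M a + snd M b"
  "ALL c. ALL a:carrier R. snd M (%p. c * a p) = c \<cdot>\<^sub>m snd M a"
  using assms unfolding left_module_def Let_def by blast+
 have c: "snd M a:carrier_mat (fst M) (fst M)" if "a:carrier R" for a using PiE_mem[OF 1(1) that] .
 show "a:carrier R==>snd M a:carrier_mat (fst M) (fst M)" by (rule c)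
 show "a:carrier R==>dim_row (snd M a) = fst M" "a:carrier R==>dim_col (snd M a) = fst M" using c by auto
 show "snd M:extensional (carrier R)" using 1(1) by (simp add: PiE_def)
 show "snd M \<one>\<^bsub>R\<^esub> = 1\<^sub>m (fst M)" by (rule 1(2))
 show "a:carrier R==>b:carrier R==>snd M (a *. b) = snd M a * snd M b" using 1(3) by blast
 show "a:carrier R==>b:carrier R==>snd M (%p. a p + b p) = snd M a + snd M b" using 1(3) unfolding add_R by blast
 show "a:carrier R==>snd M (%p. c * a p) = c \<cdot>\<^sub>m snd M a" using 1(4) by blast
qed

lemma lmodI:
 fixes rh :: "(('v, 'a) path=>'k::field)=>'k mat"
 assumes "!!a. a:carrier R==>rh a:carrier_mat n n" "rh \<one>\<^bsub>R\<^esub> = 1\<^sub>m n"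
  "!!a b. a:carrier R==>b:carrier R==>rh (a *. b) = rh a * rh b"
  "!!a b. a:carrier R==>b:carrier R==>rh (%p. a p + b p) = rh a + rh b"
  "!!a c. a:carrier R==>rh (%p. c * a p) = c \<cdot>\<^sub>m rh a"
 shows "left_module Q (n, restrict rh (carrier R))"
proof -
 have add: "(%p. a p + b p):carrier R" if "a:carrier R" "b:carrier R" for a b :: "('v, 'a) path=>'k"
  using that ideal_of_add by (auto simp: carrier_R)
 have scl: "(%p. c * a p):carrier R" if "a:carrier R" for a :: "('v, 'a) path=>'k" and c
  using that ideal_of_scl by (auto simp: carrier_R)
 have mul: "a *. b:carrier R" for a b :: "('v, 'a) path=>'k" by (rule mult_carrier)
 have oc: "(\<one>\<^bsub>R\<^esub> :: ('v, 'a) path=>'k):carrier R" by (rule one_carrier)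
 show ?thesis unfolding left_module_def Let_def add_R
  using assms add scl mul oc by (simp add: PiE_def Pi_def)
qed

abbreviation Mc :: "('k::field, ('v, 'a, 'k) module_obj, 'k mat) lincat" where "Mc == module_cat Q"

lemma Obj_Mc: "M:Obj Mc \<longleftrightarrow> left_module Q M"
 by (simp add: module_cat_def)

lemma hom_Mc: "f:hom Mc M N \<longleftrightarrow> left_module Q M & left_module Q N & src f = M & trg f = N &
  dat f:carrier_mat (fst N) (fst M) & (ALL a:carrier R. dat f * snd M a = snd N a * dat f)"
 by (cases f) (auto simp: hom_def module_cat_def)

lemma hom_McI: "left_module Q M==>left_module Q N==>T:carrier_mat (fst N) (fst M) ==>
  (!!a. a:carrier R==>T * snd M a = snd N a * T)==>Arr M N T:hom Mc M N"
 by (simp add: hom_Mc)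

lemma Mc_sel:
 "Idm Mc M = Arr M M (1\<^sub>m (fst M))" "Cmp Mc g f = Arr (src f) (trg g) (dat g * dat f)"
 "Nul Mc M N = Arr M N (0\<^sub>m (fst N) (fst M))" "Add Mc f h = Arr (src f) (trg f) (dat f + dat h)"
 "Scl Mc c f = Arr (src f) (trg f) (c \<cdot>\<^sub>m dat f)"
 by (simp_all add: module_cat_def)

lemma linear_category_Mc: "linear_category (Mc :: ('k::field, ('v, 'a, 'k) module_obj, 'k mat) lincat)"
proof
 fix f :: "(('v, 'a, 'k) module_obj, 'k mat) arr" and X Y assume f: "f:hom Mc X Y"
 hence fc: "dat f:carrier_mat (fst Y) (fst X)" and fi: "!!a. a:carrier R==>dat f * snd X a = snd Y a * dat f"
  and s [simp]: "src f = X" "trg f = Y" and XY: "left_module Q X" "left_module Q Y" by (auto simp: hom_Mc)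
 note XD = lmodD[OF XY(1)] and YD = lmodD[OF XY(2)]
 show "src f = X" "trg f = Y" by simp_all
 show "Cmp Mc (Idm Mc Y) f = f" "Cmp Mc f (Idm Mc X) = f" "Add Mc f (Nul Mc X Y) = f" "Scl Mc 1 f = f"
  "Scl Mc 0 f = Nul Mc X Y"
  using fc by (auto simp: Mc_sel intro!: arr.expand eq_matI)
 show "Scl Mc a (Scl Mc b f) = Scl Mc (a * b) f" for a b using fc by (auto simp: Mc_sel mult.assoc intro!: eq_matI)
 show "Scl Mc (a + b) f = Add Mc (Scl Mc a f) (Scl Mc b f)" for a b
  using fc by (auto simp: Mc_sel algebra_simps intro!: eq_matI)
 show "Scl Mc c f:hom Mc X Y" for c
  unfolding Mc_sel s using XY fc fi
  by (intro hom_McI) (auto simp: mult_smult_assoc_mat[OF fc XD(1)] mult_smult_distrib[OF YD(1) fc])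
 show "Cmp Mc g f:hom Mc X Z" if g: "g:hom Mc Y Z" for g Z
 proof -
  have gc: "dat g:carrier_mat (fst Z) (fst Y)" "!!a. a:carrier R==>dat g * snd Y a = snd Z a * dat g" "trg g = Z"
  "left_module Q Z" using g by (auto simp: hom_Mc)
  note ZD = lmodD[OF gc(4)]
  have "(dat g * dat f) * snd X a = snd Z a * (dat g * dat f)" if a: "a:carrier R" for a
  proof -
  have "(dat g * dat f) * snd X a = dat g * (snd Y a * dat f)" using mat_assoc[of "dat g" "dat f"] fc gc XD(2)[OF a] fi[OF a] by simp
  also have "... = (snd Z a * dat g) * dat f" using mat_assoc[of "dat g" "snd Y a" "dat f"] fc gc YD(2,3)[OF a] a by simp
  finally show ?thesis using mat_assoc[of "snd Z a" "dat g" "dat f"] fc gc(1) ZD(3)[OF a] by simp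
  qed
  thus ?thesis unfolding Mc_sel s gc(3) using XY gc fc by (intro hom_McI) auto
 qed
 fix g assume g: "g:hom Mc X Y"
 hence gc: "dat g:carrier_mat (fst Y) (fst X)" and gi: "!!a. a:carrier R==>dat g * snd X a = snd Y a * dat g"
  and sg [simp]: "src g = X" "trg g = Y" by (auto simp: hom_Mc)
 show "Add Mc f g = Add Mc g f" using comm_add_mat[OF fc gc] by (simp add: Mc_sel)
 show "Scl Mc a (Add Mc f g) = Add Mc (Scl Mc a f) (Scl Mc a g)" for a
  using fc gc by (auto simp: Mc_sel algebra_simps intro!: eq_matI)
 show "Add Mc f g:hom Mc X Y"
  unfolding Mc_sel s using XY fc gc fi gi
  by (intro hom_McI) (auto simp: add_mult_distrib_mat[OF fc gc XD(1)] mult_add_distrib_mat[OF YD(1) fc gc])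
 show "Add Mc (Add Mc f g) h = Add Mc f (Add Mc g h)" if "h:hom Mc X Y" for h
  using that assoc_add_mat[OF fc gc] by (auto simp: Mc_sel hom_Mc)
 show "Cmp Mc h (Add Mc f g) = Add Mc (Cmp Mc h f) (Cmp Mc h g)" if "h:hom Mc Y Z" for h Z
  using that fc gc mult_add_distrib_mat[of "dat h" "fst Z" "fst Y" "dat f" "fst X" "dat g"] by (auto simp: Mc_sel hom_Mc)
next
 fix X Y :: "('v, 'a, 'k) module_obj" assume "X:Obj Mc"
 hence X: "left_module Q X" by (simp add: Obj_Mc)
 note XD = lmodD[OF X]
 show "Idm Mc X:hom Mc X X" unfolding Mc_sel
  using X by (intro hom_McI) (auto simp: left_mult_one_mat[OF XD(1)] right_mult_one_mat[OF XD(1)])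
 assume "Y:Obj Mc"
 hence Y: "left_module Q Y" by (simp add: Obj_Mc)
 note YD = lmodD[OF Y]
 show "Nul Mc X Y:hom Mc X Y" unfolding Mc_sel
  using X Y by (intro hom_McI) (auto simp: left_mult_zero_mat[OF XD(1)] right_mult_zero_mat[OF YD(1)])
next
 fix h :: "(('v, 'a, 'k) module_obj, 'k mat) arr" and g f Y Z X W assume "h:hom Mc Y Z" "g:hom Mc X Y" "f:hom Mc W X"
 thus "Cmp Mc (Cmp Mc h g) f = Cmp Mc h (Cmp Mc g f)"
  using mat_assoc[of "dat h" "dat g" "dat f"] by (auto simp: Mc_sel hom_Mc)
next
 fix g :: "(('v, 'a, 'k) module_obj, 'k mat) arr" and h f X Y Z
 assume g: "g:hom Mc Y Z" and f: "f:hom Mc X Y"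
 show "Cmp Mc (Scl Mc a g) f = Scl Mc a (Cmp Mc g f)" "Cmp Mc g (Scl Mc a f) = Scl Mc a (Cmp Mc g f)" for a
  using g f mult_smult_assoc_mat[of "dat g" "fst Z" "fst Y" "dat f" "fst X" a]
  mult_smult_distrib[of "dat g" "fst Z" "fst Y" "dat f" "fst X" a] by (auto simp: Mc_sel hom_Mc)
 assume h: "h:hom Mc Y Z"
 show "Cmp Mc (Add Mc g h) f = Add Mc (Cmp Mc g f) (Cmp Mc h f)"
  using g h f add_mult_distrib_mat[of "dat g" "fst Z" "fst Y" "dat h" "dat f" "fst X"] by (auto simp: Mc_sel hom_Mc)
qed

lemma zero_Mc: "EX Z. zero_object (Mc :: ('k::field, ('v, 'a, 'k) module_obj, 'k mat) lincat) Z"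
proof -
 have "left_module Q (0, restrict (%a :: ('v, 'a) path=>'k. 0\<^sub>m 0 0) (carrier R))"
  by (rule lmodI) (auto intro!: eq_matI)
 moreover have "1\<^sub>m 0 = (0\<^sub>m 0 0 :: 'k mat)" by (auto intro!: eq_matI)
 ultimately show ?thesis unfolding zero_object_def Obj_Mc Mc_sel by (intro exI) auto
qed

lemma biprod_mats:
 obtains i1 i2 p1 p2 :: "'k::field mat" where "i1:carrier_mat (m + n) m" "i2:carrier_mat (m + n) n"
  "p1:carrier_mat m (m + n)" "p2:carrier_mat n (m + n)" "p1 * i1 = 1\<^sub>m m" "p2 * i2 = 1\<^sub>m n"
  "p1 * i2 = 0\<^sub>m m n" "p2 * i1 = 0\<^sub>m n m" "i1 * p1 + i2 * p2 = 1\<^sub>m (m + n)"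
proof -
 define i1 :: "'k mat" where "i1 = mat (m + n) m (%(i, j). if i = j then 1 else 0)"
 define i2 :: "'k mat" where "i2 = mat (m + n) n (%(i, j). if i = m + j then 1 else 0)"
 define p1 :: "'k mat" where "p1 = mat m (m + n) (%(i, j). if i = j then 1 else 0)"
 define p2 :: "'k mat" where "p2 = mat n (m + n) (%(i, j). if j = m + i then 1 else 0)"
 have c: "i1:carrier_mat (m + n) m" "i2:carrier_mat (m + n) n" "p1:carrier_mat m (m + n)" "p2:carrier_mat n (m + n)"
  by (auto simp: i1_def i2_def p1_def p2_def)
 have s: "(\<Sum>l = 0..<k. (if P' l then 1 else 0) * (if l = a then 1 else (0 :: 'k))) = (if a < k & P' a then 1 else 0)"
  for P' :: "nat=>bool" and a k :: nat
 proof -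
  have "(\<Sum>l = 0..<k. (if P' l then 1 else 0) * (if l = a then 1 else (0 :: 'k))) = (\<Sum>l = 0..<k. if l = a then (if P' a then 1 else 0) else 0)"
  by (rule sum.cong) auto
  thus ?thesis by simp
 qed
 have 1: "p1 * i1 = 1\<^sub>m m" "p1 * i2 = 0\<^sub>m m n" "p2 * i1 = 0\<^sub>m n m" "p2 * i2 = 1\<^sub>m n"
  by (rule eq_matI; auto simp: i1_def i2_def p1_def p2_def scalar_prod_def s)+
 have 2: "i1 * p1 + i2 * p2 = 1\<^sub>m (m + n)"
 proof (rule eq_matI)
  fix i j assume "i < dim_row (1\<^sub>m (m + n) :: 'k mat)" "j < dim_col (1\<^sub>m (m + n) :: 'k mat)"
  hence ij: "i < m + n" "j < m + n" by auto
  have e1: "(\<Sum>l = 0..<m. (if i = l then 1 else 0) * (if l = j then 1 else (0 :: 'k))) = (if j < m & i = j then 1 else 0)"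
  using s[of "%l. i = l" j m] by simp
  have "(\<Sum>l = 0..<n. (if i = m + l then 1 else 0) * (if j = m + l then 1 else (0 :: 'k)))
  = (\<Sum>l = 0..<n. (if i = m + l then 1 else 0) * (if l = j - m & m <= j then 1 else (0 :: 'k)))"
  by (rule sum.cong) auto
  also have "... = (if m <= j & i = j then 1 else 0)"
  using s[of "%l. i = m + l" "j - m" n] ij by (cases "m <= j") auto
  finally have e2: "(\<Sum>l = 0..<n. (if i = m + l then 1 else 0) * (if j = m + l then 1 else (0 :: 'k))) = (if m <= j & i = j then 1 else 0)" .
  have "(i1 * p1) $$ (i, j) = (if j < m & i = j then 1 else 0)" "(i2 * p2) $$ (i, j) = (if m <= j & i = j then 1 else 0)"
  using ij e1 e2 by (auto simp: i1_def i2_def p1_def p2_def scalar_prod_def)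
  thus "(i1 * p1 + i2 * p2) $$ (i, j) = 1\<^sub>m (m + n) $$ (i, j)" using ij c by auto
 qed (use c in auto)
 show thesis using that c 1 2 by blast
qed

lemma biprod_Mc:
 fixes M N :: "('v, 'a, 'k::field) module_obj"
 assumes M: "M:Obj Mc" and N: "N:Obj Mc" shows "EX Z. direct_sum Mc Z M N"
proof -
 have lM: "left_module Q M" and lN: "left_module Q N" using M N by (auto simp: Obj_Mc)
 note MD = lmodD[OF lM] and ND = lmodD[OF lN]
 let ?m = "fst M" and ?n = "fst N"
 obtain i1 i2 p1 p2 :: "'k mat" where c: "i1:carrier_mat (?m + ?n) ?m" "i2:carrier_mat (?m + ?n) ?n"
  "p1:carrier_mat ?m (?m + ?n)" "p2:carrier_mat ?n (?m + ?n)"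
  and e: "p1 * i1 = 1\<^sub>m ?m" "p2 * i2 = 1\<^sub>m ?n" "p1 * i2 = 0\<^sub>m ?m ?n" "p2 * i1 = 0\<^sub>m ?n ?m" "i1 * p1 + i2 * p2 = 1\<^sub>m (?m + ?n)"
  using biprod_mats[of ?m ?n] by metis
 define rh where "rh a = i1 * (snd M a * p1) + i2 * (snd N a * p2)" for a
 have d [simp]: "dim_row i1 = ?m + ?n" "dim_col i1 = ?m" "dim_row i2 = ?m + ?n" "dim_col i2 = ?n"
  "dim_row p1 = ?m" "dim_col p1 = ?m + ?n" "dim_row p2 = ?n" "dim_col p2 = ?m + ?n" using c by auto
 have rhc: "rh a:carrier_mat (?m + ?n) (?m + ?n)" if "a:carrier R" for a
  by (intro carrier_matI) (simp_all add: rh_def)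
 have p1rh: "p1 * rh a = snd M a * p1" and p2rh: "p2 * rh a = snd N a * p2"
  and rhi1: "rh a * i1 = i1 * snd M a" and rhi2: "rh a * i2 = i2 * snd N a" if a: "a:carrier R" for a
 proof -
  have x: "i1 * (snd M a * p1):carrier_mat (?m + ?n) (?m + ?n)" "i2 * (snd N a * p2):carrier_mat (?m + ?n) (?m + ?n)"
  "snd M a * p1:carrier_mat ?m (?m + ?n)" "snd N a * p2:carrier_mat ?n (?m + ?n)"
  by (intro carrier_matI; simp add: MD(2,3)[OF a] ND(2,3)[OF a])+
  note dd = MD(2,3)[OF a] ND(2,3)[OF a]
  have "p1 * (i1 * (snd M a * p1)) = snd M a * p1" "p1 * (i2 * (snd N a * p2)) = 0\<^sub>m ?m (?m + ?n)"
  "p2 * (i2 * (snd N a * p2)) = snd N a * p2" "p2 * (i1 * (snd M a * p1)) = 0\<^sub>m ?n (?m + ?n)"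
  using mat_assoc[of p1 i1 "snd M a * p1"] mat_assoc[of p1 i2 "snd N a * p2"]
  mat_assoc[of p2 i2 "snd N a * p2"] mat_assoc[of p2 i1 "snd M a * p1"] e x dd by auto
  thus "p1 * rh a = snd M a * p1" "p2 * rh a = snd N a * p2"
  unfolding rh_def using mult_add_distrib_mat[OF c(3) x(1,2)] mult_add_distrib_mat[OF c(4) x(1,2)] x by auto
  have "(i1 * (snd M a * p1)) * i1 = i1 * snd M a" "(i2 * (snd N a * p2)) * i1 = 0\<^sub>m (?m + ?n) ?m"
  "(i2 * (snd N a * p2)) * i2 = i2 * snd N a" "(i1 * (snd M a * p1)) * i2 = 0\<^sub>m (?m + ?n) ?n"
  using e dd c MD(1)[OF a] ND(1)[OF a] by (auto simp: mat_assoc)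
  thus "rh a * i1 = i1 * snd M a" "rh a * i2 = i2 * snd N a"
  unfolding rh_def using add_mult_distrib_mat[OF x(1,2) c(1)] add_mult_distrib_mat[OF x(1,2) c(2)] c MD(1)[OF a] ND(1)[OF a] by auto
 qed
 let ?Z = "(?m + ?n, restrict rh (carrier R))"
 have lZ: "left_module Q ?Z"
 proof (rule lmodI)
  show "rh \<one>\<^bsub>R\<^esub> = 1\<^sub>m (?m + ?n)" using MD(5) ND(5) c e by (simp add: rh_def)
  fix a :: "('v, 'a) path=>'k" assume a: "a:carrier R"
  show "rh a:carrier_mat (?m + ?n) (?m + ?n)" by (rule rhc[OF a])
  note dd = MD(2,3)[OF a] ND(2,3)[OF a]
  have y: "snd M a * p1:carrier_mat ?m (?m + ?n)" "snd N a * p2:carrier_mat ?n (?m + ?n)"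
  by (intro carrier_matI; simp add: dd)+
  have xa: "i1 * (snd M a * p1):carrier_mat (?m + ?n) (?m + ?n)" "i2 * (snd N a * p2):carrier_mat (?m + ?n) (?m + ?n)"
  by (intro carrier_matI; simp)+
  show "rh (%p. k * a p) = k \<cdot>\<^sub>m rh a" for k
  unfolding rh_def MD(8)[OF a] ND(8)[OF a] mult_smult_assoc_mat[OF MD(1)[OF a] c(3)]
  mult_smult_assoc_mat[OF ND(1)[OF a] c(4)] mult_smult_distrib[OF c(1) y(1)] mult_smult_distrib[OF c(2) y(2)]
  by (rule add_smult_distrib_left_mat[OF xa, symmetric])
  fix b :: "('v, 'a) path=>'k" assume b: "b:carrier R"
  note db = MD(2,3)[OF b] ND(2,3)[OF b]
  have ab: "a *. b:carrier R" by (rule mult_carrier)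
  have x: "i1 * (snd M a * p1):carrier_mat (?m + ?n) (?m + ?n)" "i2 * (snd N a * p2):carrier_mat (?m + ?n) (?m + ?n)"
  "i1 * (snd M b * p1):carrier_mat (?m + ?n) (?m + ?n)" "i2 * (snd N b * p2):carrier_mat (?m + ?n) (?m + ?n)"
  by (intro carrier_matI; simp)+
  have "rh a * rh b = i1 * (snd M a * (p1 * rh b)) + i2 * (snd N a * (p2 * rh b))"
  unfolding rh_def[of a] using add_mult_distrib_mat[OF x(1,2) rhc[OF b]] dd rhc[OF b] by (simp add: mat_assoc)
  also have "... = rh (a *. b)"
  unfolding p1rh[OF b] p2rh[OF b] rh_def[of "a *. b"] MD(6)[OF a b] ND(6)[OF a b] using dd db by (simp add: mat_assoc)
  finally show "rh (a *. b) = rh a * rh b" by simp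
  have y': "snd M b * p1:carrier_mat ?m (?m + ?n)" "snd N b * p2:carrier_mat ?n (?m + ?n)"
  by (intro carrier_matI; simp add: db)+
  have "rh (%p. a p + b p) = (i1 * (snd M a * p1) + i1 * (snd M b * p1)) + (i2 * (snd N a * p2) + i2 * (snd N b * p2))"
  unfolding rh_def MD(7)[OF a b] ND(7)[OF a b]
  add_mult_distrib_mat[OF MD(1)[OF a] MD(1)[OF b] c(3)] add_mult_distrib_mat[OF ND(1)[OF a] ND(1)[OF b] c(4)]
  unfolding mult_add_distrib_mat[OF c(1) y(1) y'(1)] mult_add_distrib_mat[OF c(2) y(2) y'(2)] ..
  also have "... = rh a + rh b" unfolding rh_def using x by (auto intro!: eq_matI simp: algebra_simps)
  finally show "rh (%p. a p + b p) = rh a + rh b" .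
 qed
 have Z: "fst ?Z = ?m + ?n" "!!a. a:carrier R==>snd ?Z a = rh a" by auto
 have mor: "Arr A B T:Mor Mc A B" if "Arr A B T:hom Mc A B" for A B T using that by (simp add: hom_def)
 have 1: "Arr M ?Z i1:hom Mc M ?Z" by (rule hom_McI[OF lM lZ]) (use c rhi1 in auto)
 have 2: "Arr N ?Z i2:hom Mc N ?Z" by (rule hom_McI[OF lN lZ]) (use c rhi2 in auto)
 have 3: "Arr ?Z M p1:hom Mc ?Z M" by (rule hom_McI[OF lZ lM]) (use c p1rh in auto)
 have 4: "Arr ?Z N p2:hom Mc ?Z N" by (rule hom_McI[OF lZ lN]) (use c p2rh in auto)
 have "direct_sum Mc ?Z M N"
  unfolding direct_sum_def
 proof (intro conjI)
  show "EX i1:Mor Mc M ?Z. EX i2:Mor Mc N ?Z. EX p1:Mor Mc ?Z M. EX p2:Mor Mc ?Z N.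
  Cmp Mc p1 i1 = Idm Mc M & Cmp Mc p2 i2 = Idm Mc N & Cmp Mc p1 i2 = Nul Mc N M & Cmp Mc p2 i1 = Nul Mc M N &
  Add Mc (Cmp Mc i1 p1) (Cmp Mc i2 p2) = Idm Mc ?Z"
  by (rule bexI[OF _ mor[OF 1]], rule bexI[OF _ mor[OF 2]], rule bexI[OF _ mor[OF 3]], rule bexI[OF _ mor[OF 4]])
  (simp add: Mc_sel e)
 qed (use M N lZ in "simp_all add: Obj_Mc")
 thus ?thesis by blast
qed

text \<open>With the matrix of f split as B A, an element a acts on the image by
  \<open>A * (snd M a * B)\<close>; this is multiplicative because f commutes with the
  action.\<close>

lemma split_Mc:
 fixes M :: "('v, 'a, 'k::field) module_obj"
 assumes M: "M:Obj Mc" and f: "f:hom Mc M M" and ff: "Cmp Mc f f = f"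
 shows "EX Y:Obj Mc. EX a:hom Mc M Y. EX b:hom Mc Y M. Cmp Mc a b = Idm Mc Y & Cmp Mc b a = f"
proof -
 have lM: "left_module Q M" using M by (auto simp: Obj_Mc)
 note MD = lmodD[OF lM]
 let ?n = "fst M"
 have F: "dat f:carrier_mat ?n ?n" "!!a. a:carrier R==>dat f * snd M a = snd M a * dat f" "src f = M" "trg f = M"
  using f by (auto simp: hom_Mc)
 have "dat f * dat f = dat f" using arg_cong[OF ff, of dat] by (simp add: Mc_sel)
 then obtain r A B where AB: "A:carrier_mat r ?n" "B:carrier_mat ?n r" "A * B = 1\<^sub>m r" "B * A = dat f"
  using idempotent_mat_split[OF F(1)] by blast
 have d [simp]: "dim_row A = r" "dim_col A = ?n" "dim_row B = ?n" "dim_col B = r" using AB by auto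
 define rh where "rh a = A * (snd M a * B)" for a
 have Af: "A * dat f = A" using mat_assoc[of A B A] AB by simp
 have fB: "dat f * B = B" using mat_assoc[of B A B] AB by simp
 have Brh: "B * rh a = snd M a * B" and rhA: "rh a * A = A * snd M a" if a: "a:carrier R" for a
 proof -
  note dd = MD(2,3)[OF a]
  have "B * rh a = (dat f * snd M a) * B"
  unfolding rh_def using dd F(1) mat_assoc[of B A "snd M a * B"] AB(4) by (simp add: mat_assoc)
  also have "... = snd M a * (dat f * B)" unfolding F(2)[OF a] using dd F(1) by (simp add: mat_assoc)
  finally show "B * rh a = snd M a * B" using fB by simp
  have "rh a * A = A * (snd M a * dat f)" unfolding rh_def using dd AB(4) by (simp add: mat_assoc)
  also have "... = (A * dat f) * snd M a" unfolding F(2)[OF a, symmetric] using dd F(1) by (simp add: mat_assoc)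
  finally show "rh a * A = A * snd M a" using Af by simp
 qed
 let ?Y = "(r, restrict rh (carrier R))"
 have lY: "left_module Q ?Y"
 proof (rule lmodI)
  show "rh \<one>\<^bsub>R\<^esub> = 1\<^sub>m r" using MD(5) AB by (simp add: rh_def)
  fix a :: "('v, 'a) path=>'k" assume a: "a:carrier R"
  note dd = MD(2,3)[OF a]
  show rhc: "rh a:carrier_mat r r" by (intro carrier_matI) (simp_all add: rh_def)
  have MB: "snd M a * B:carrier_mat ?n r" by (intro carrier_matI) (simp_all add: dd)
  show "rh (%p. k * a p) = k \<cdot>\<^sub>m rh a" for k
  unfolding rh_def MD(8)[OF a] mult_smult_assoc_mat[OF MD(1)[OF a] AB(2)] mult_smult_distrib[OF AB(1) MB] by simp
  fix b :: "('v, 'a) path=>'k" assume b: "b:carrier R"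
  note db = MD(2,3)[OF b]
  have MB': "snd M b * B:carrier_mat ?n r" by (intro carrier_matI) (simp_all add: db)
  have "rh a * rh b = A * (snd M a * (B * rh b))" unfolding rh_def[of a] using dd by (simp add: mat_assoc rh_def)
  also have "... = rh (a *. b)"
  unfolding Brh[OF b] rh_def[of "a *. b"] MD(6)[OF a b] using dd db by (simp add: mat_assoc)
  finally show "rh (a *. b) = rh a * rh b" by simp
  show "rh (%p. a p + b p) = rh a + rh b"
  unfolding rh_def MD(7)[OF a b] add_mult_distrib_mat[OF MD(1)[OF a] MD(1)[OF b] AB(2)]
  mult_add_distrib_mat[OF AB(1) MB MB'] ..
 qed
 have 1: "Arr M ?Y A:hom Mc M ?Y" by (rule hom_McI[OF lM lY]) (use AB rhA in auto)
 have 2: "Arr ?Y M B:hom Mc ?Y M" by (rule hom_McI[OF lY lM]) (use AB Brh in auto)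
 show ?thesis
  by (rule bexI[of _ ?Y], rule bexI[OF _ 1], rule bexI[OF _ 2])
  (use lY AB F(3,4) in "auto simp: Obj_Mc Mc_sel intro!: arr.expand")
qed

lemma additive_endo_Mc: "additive_endo (Mc :: ('k::field, ('v, 'a, 'k) module_obj, 'k mat) lincat)"
proof -
 interpret linear_category "Mc :: ('k, ('v, 'a, 'k) module_obj, 'k mat) lincat" by (rule linear_category_Mc)
 have "additive_category (Mc :: ('k, ('v, 'a, 'k) module_obj, 'k mat) lincat)"
  using zero_Mc biprod_Mc split_Mc by unfold_locales
 moreover have "endo (Mc :: ('k, ('v, 'a, 'k) module_obj, 'k mat) lincat)" by unfold_locales
 ultimately show ?thesis by (simp add: additive_endo_def)
qed

end

subsection \<open>Tensor products\<close>

lemma smult_mat_vec: "dim_vec v = dim_col A==>(c \<cdot>\<^sub>m A) *v v = c .* (A *v (v :: 'k::field vec))"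
 by (rule eq_vecI) (auto simp: scalar_prod_def sum_distrib_left mult.assoc)

text \<open>The type argument pins down the field, so that the module category over it is
  interpreted once.\<close>

locale tree_algebra = tree_paths Q for Q :: "('v, 'a) pre_digraph" +
 fixes K :: "'k::field itself"
begin

sublocale M: additive_endo "Mc :: ('k, ('v, 'a, 'k) module_obj, 'k mat) lincat"
 by (rule additive_endo_Mc)

abbreviation I :: "('v, 'a) path set=>(('v, 'a) path=>'k) set" where "I == ideal_of"
abbreviation V :: "('v, 'a, 'k) module_obj=>'k vec set" where "V M == carrier_vec (fst M)"

text \<open>One coordinate of a balanced map. These forms make up the dual space of the tensor
  product, from which the tensor product itself is built.\<close>

definition bal_form :: "('v, 'a) path set=>('v, 'a, 'k) module_obj=>((('v, 'a) path=>'k)=>'k vec=>'k)=>bool" where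
 "bal_form U M bv \<longleftrightarrow>
  (ALL x:I U. ALL y:I U. ALL v:V M. bv (%p. x p + y p) v = bv x v + bv y v) &
  (ALL x:I U. ALL v:V M. ALL w:V M. bv x (v + w) = bv x v + bv x w) &
  (ALL c. ALL x:I U. ALL v:V M. bv (%p. c * x p) v = c * bv x v & bv x (c .* v) = c * bv x v) &
  (ALL x:I U. ALL a:carrier R. ALL v:V M. bv (x *. a) v = bv x (snd M a *v v))"

lemma bal_form_zero: "bal_form U M (%x v. 0)"
 by (simp add: bal_form_def)

lemma bal_form_add: "bal_form U M bv==>bal_form U M ga==>bal_form U M (%x v. bv x v + ga x v)"
 by (simp add: bal_form_def algebra_simps)

lemma bal_form_scl: "bal_form U M bv==>bal_form U M (%x v. c * bv x v)"
 by (simp add: bal_form_def algebra_simps)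

lemma bal_form_sum: "(!!i. i < n==>bal_form U M (bv i))==>bal_form U M (%x v. \<Sum>i<(n::nat). c i * bv i x v)"
 by (induction n) (simp_all add: bal_form_zero bal_form_add bal_form_scl)

text \<open>Bilinearity reduces x to paths and v to unit vectors. Forms are thus determined on a
  finite set, as \<open>dual_basis\<close> requires.\<close>

lemma bal_form_eqI:
 assumes U: "U <= P" and b: "bal_form U M bv" and g: "bal_form U M ga"
  and *: "!!p i. p:U==>i < fst M==>bv (path_elem p) (unit_vec (fst M) i) = ga (path_elem p) (unit_vec (fst M) i)"
  and x: "x:I U" and v: "v:V M"
 shows "bv x v = ga x v"
proof -
 have bD: "!!x y v. x:I U==>y:I U==>v:V M==>bv (%p. x p + y p) v = bv x v + bv y v"
  "!!x v w. x:I U==>v:V M==>w:V M==>bv x (v + w) = bv x v + bv x w"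
  "!!c x v. x:I U==>v:V M==>bv (%p. c * x p) v = c * bv x v"
  "!!c x v. x:I U==>v:V M==>bv x (c .* v) = c * bv x v"
  if "bal_form U M bv" for bv
  using that unfolding bal_form_def by blast+
 note B = bD[OF b] and G = bD[OF g]
 have z: "bv (%p. 0) v = 0" "bv x (0\<^sub>v (fst M)) = 0" if "bal_form U M bv" "v:V M" "x:I U" for bv v x
 proof -
  show "bv (%p. 0) v = 0" using bD(3)[OF that(1) _ that(2), of "%p. 0" 0] by (simp add: ideal_of_zero)
  have "0 .* 0\<^sub>v (fst M) = (0\<^sub>v (fst M) :: 'k vec)" by (intro eq_vecI) auto
  thus "bv x (0\<^sub>v (fst M)) = 0" using bD(4)[OF that(1,3), of "0\<^sub>v (fst M)" 0] by simp
 qed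
 have pe: "path_elem p:I U" if "p:U" for p using that ideal_of_elem by blast
 have 1: "bv (path_elem p) v = ga (path_elem p) v" if p: "p:U" for p
  using v
 proof (induction rule: vec_induct)
  case zero
  thus ?case using z[OF b v pe[OF p]] z[OF g v pe[OF p]] by simp
 next
  case (unit c i)
  thus ?case using B(4)[OF pe[OF p]] G(4)[OF pe[OF p]] *[OF p] by simp
 next
  case (add x y)
  thus ?case using B(2)[OF pe[OF p]] G(2)[OF pe[OF p]] by simp
 qed
 show ?thesis using x U
 proof (induction rule: span_induct)
  case zero
  thus ?case using z[OF b v x] z[OF g v x] by simp
 next
  case (elem c p)
  thus ?case using B(3)[OF pe v] G(3)[OF pe v] 1 by simp
 next
  case (add x y)
  thus ?case using B(1) G(1) v by simp
 qed
qed

lemma mul_I: "pideal U==>x:I U==>a:carrier R==>x *. a:I U"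
 and lmul_I: "pideal U==>x:I U==>a:carrier R==>a *. x:I U"
 using ideal.I_r_closed[OF ideal_ideal_of] ideal.I_l_closed[OF ideal_ideal_of] by blast+

lemma I_carrier: "pideal U==>x:I U==>x:carrier R"
 using ideal_of_mono[OF pidealD(1)] unfolding carrier_R by blast

lemma mod_vec: "left_module Q M==>a:carrier R==>v:V M==>snd M a *v v:V M"
 using lmodD(1) mvc by blast

lemma balancedD:
 assumes "balanced_map Q (I U) M n b"
 shows "x:I U==>v:V M==>b x v:carrier_vec n" "x:I U==>v:V M==>dim_vec (b x v) = n"
  "x:I U==>y:I U==>v:V M==>b (%p. x p + y p) v = b x v + b y v"
  "x:I U==>v:V M==>w:V M==>b x (v + w) = b x v + b x w"
  "x:I U==>v:V M==>b (%p. c * x p) v = c .* b x v"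
  "x:I U==>v:V M==>b x (c .* v) = c .* b x v"
  "x:I U==>a:carrier R==>v:V M==>b (x *. a) v = b x (snd M a *v v)"
proof -
 have *: "ALL x:I U. ALL v:V M. b x v:carrier_vec n" using assms unfolding balanced_map_def Let_def by blast
 show "x:I U==>v:V M==>b x v:carrier_vec n" "x:I U==>v:V M==>dim_vec (b x v) = n" using * by auto
qed (use assms in "unfold balanced_map_def Let_def add_R, blast+")

lemma balancedI:
 assumes "!!x v. x:I U==>v:V M==>b x v:carrier_vec n"
  "!!x y v. x:I U==>y:I U==>v:V M==>b (%p. x p + y p) v = b x v + b y v"
  "!!x v w. x:I U==>v:V M==>w:V M==>b x (v + w) = b x v + b x w"
  "!!c x v. x:I U==>v:V M==>b (%p. c * x p) v = c .* b x v"
  "!!c x v. x:I U==>v:V M==>b x (c .* v) = c .* b x v"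
  "!!x a v. x:I U==>a:carrier R==>v:V M==>b (x *. a) v = b x (snd M a *v v)"
 shows "balanced_map Q (I U) M n b"
 unfolding balanced_map_def Let_def add_R using assms by blast

lemma balanced_form:
 assumes U: "pideal U" and M: "left_module Q M" and b: "balanced_map Q (I U) M n b" and r: "r < n"
 shows "bal_form U M (%x v. b x v $ r)"
 unfolding bal_form_def
proof (intro conjI ballI allI)
 note B = balancedD[OF b]
 fix x :: "('v, 'a) path=>'k" and v assume x: "x:I U" and v: "v:V M"
 show "b (%p. k * x p) v $ r = k * b x v $ r" "b x (k .* v) $ r = k * b x v $ r" for k
  using B(5)[OF x v, of k] B(6)[OF x v, of k] B(2)[OF x v] r by simp_all
 show "b (x *. a) v $ r = b x (snd M a *v v) $ r" if "a:carrier R" for a using B(7)[OF x that v] by simp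
 show "b x (v + w) $ r = b x v $ r + b x w $ r" if "w:V M" for w using B(4)[OF x v that] B(2)[OF x that] r by simp
 show "b (%p. x p + y p) v $ r = b x v $ r + b y v $ r" if "y:I U" for y using B(3)[OF x that v] B(2)[OF that v] r by simp
qed

lemma form_balanced:
 assumes U: "pideal U" and M: "left_module Q M"
  and c: "!!x v. x:I U==>v:V M==>b x v:carrier_vec n"
  and f: "!!r. r < n==>bal_form U M (%x v. b x v $ r)"
 shows "balanced_map Q (I U) M n b"
proof (rule balancedI)
 fix x assume x: "x:I U"
 have sx: "(%p. k * x p):I U" for k using x ideal_of_scl by blast
 fix v assume v: "v:V M"
 show "b x v:carrier_vec n" using c x v by blast
 show "b (%p. k * x p) v = k .* b x v" for k
  using c[OF sx v] c[OF x v] f x v by (intro eq_vecI) (auto simp: bal_form_def)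
 show "b x (k .* v) = k .* b x v" for k
  using c[OF x, of "k .* v"] c[OF x v] f x v by (intro eq_vecI) (auto simp: bal_form_def)
 show "b (x *. a) v = b x (snd M a *v v)" if a: "a:carrier R" for a
  using c[OF mul_I[OF U x a] v] c[OF x mod_vec[OF M a v]] f x v a by (intro eq_vecI) (auto simp: bal_form_def)
 show "b x (v + w) = b x v + b x w" if w: "w:V M" for w
  using c[OF x v] c[OF x w] c[OF x, of "v + w"] f x v w by (intro eq_vecI) (auto simp: bal_form_def)
 show "b (%p. x p + y p) v = b x v + b y v" if y: "y:I U" for y
  using c[OF x v] c[OF y v] c[OF ideal_of_add[OF x y] v] f x v y by (intro eq_vecI) (auto simp: bal_form_def)
qed

lemma balanced_mat:
 assumes b: "balanced_map Q (I U) M n b" and A: "A:carrier_mat m n"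
 shows "balanced_map Q (I U) M m (%x v. A *v b x v)"
 by (rule balancedI)
  (simp_all add: balancedD(3-7)[OF b] mad[OF A balancedD(1)[OF b] balancedD(1)[OF b]]
  mult_mat_vec[OF A balancedD(1)[OF b]] mvc[OF A balancedD(1)[OF b]])

lemma balanced_lmul:
 assumes U: "pideal U" and b: "balanced_map Q (I U) M n b" and a: "a:carrier R"
 shows "balanced_map Q (I U) M n (%x v. b (a *. x) v)"
proof (rule balancedI)
 fix x :: "('v, 'a) path=>'k" and v assume x: "x:I U" and v: "v:V M"
 note ax = lmul_I[OF U x a]
 show "b (a *. x) v:carrier_vec n" using balancedD(1)[OF b ax v] .
 show "b (a *. (%p. k * x p)) v = k .* b (a *. x) v" for k using balancedD(5)[OF b ax v] by (simp add: mult_scl_r)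
 show "b (a *. x) (k .* v) = k .* b (a *. x) v" for k using balancedD(6)[OF b ax v] .
 show "b (a *. (x *. c)) v = b (a *. x) (snd M c *v v)" if c: "c:carrier R" for c
  using balancedD(7)[OF b ax c v] mult_assoc_R[OF a I_carrier[OF U x] c] by simp
 show "b (a *. x) (v + w) = b (a *. x) v + b (a *. x) w" if w: "w:V M" for w using balancedD(4)[OF b ax v w] .
 show "b (a *. (%p. x p + y p)) v = b (a *. x) v + b (a *. y) v" if y: "y:I U" for y
  using balancedD(3)[OF b ax lmul_I[OF U y a] v] by (simp add: mult_add_r)
qed

lemma tensorD:
 assumes "tensor_product Q (I U) M T t"
 shows "balanced_map Q (I U) M (fst T) t"
  "a:carrier R==>x:I U==>v:V M==>t (a *. x) v = snd T a *v t x v"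
  "balanced_map Q (I U) M n b==>EX! B. B:carrier_mat n (fst T) & (ALL x:I U. ALL v:V M. B *v t x v = b x v)"
 using assms unfolding tensor_product_def by blast+

lemma tensor_eq:
 assumes t: "tensor_product Q (I U) M T t" and AB: "A:carrier_mat n (fst T)" "B:carrier_mat n (fst T)"
  and *: "!!x v. x:I U==>v:V M==>A *v t x v = B *v t x v"
 shows "A = B"
proof -
 have "EX! X. X:carrier_mat n (fst T) & (ALL x:I U. ALL v:V M. X *v t x v = A *v t x v)"
  by (rule tensorD(3)[OF t balanced_mat[OF tensorD(1)[OF t] AB(1)]])
 thus ?thesis using AB * by auto
qed

text \<open>A basis of the space of balanced forms supplies the coordinates of the tensor product:
  \<open>t x v\<close> is the vector of values of the basis forms at (x, v). Duality with the pairs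
  \<open>xs j\<close>, each made of a path and a unit vector, yields existence and uniqueness of
  induced maps.\<close>

lemma tensor_ex:
 assumes U: "pideal U" and M: "left_module Q M"
 shows "EX T t. left_module Q T & tensor_product Q (I U) M T t"
proof -
 let ?m = "fst M"
 define W where "W = {f. bal_form U M (%x v. f (x, v))}"
 define X where "X = (%(p, i). (path_elem p :: ('v, 'a) path=>'k, unit_vec ?m i :: 'k vec)) ` (U \<times> {..<?m})"
 have fX: "finite X" unfolding X_def using pideal_finite[OF U] by simp
 have W: "(%z. 0):W" "ALL f:W. ALL g:W. (%z. f z + g z):W" "ALL f:W. ALL c. (%z. c * f z):W"
  by (auto simp: W_def bal_form_zero bal_form_add bal_form_scl)
 from dual_basis[OF fX W] obtain d :: nat and xs fs
  where hh: "(ALL i<d. xs i:X & fs i:W) & (ALL i<d. ALL j<d. fs i (xs j) = (if i = j then 1 else 0)) &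
  (ALL f:W. ALL x:X. f x = (\<Sum>i<d. f (xs i) * fs i x))" by (elim exE)
 have fW: "bal_form U M (%x v. fs i (x, v))" if "i < d" for i using hh that by (simp add: W_def)
 have del: "fs i (xs j) = (if i = j then 1 else 0)" if "i < d" "j < d" for i j using hh that by simp
 have xs: "fst (xs j):I U" "snd (xs j):V M" if "j < d" for j
 proof -
  have "xs j:X" using hh that by simp
  then obtain p i where pi: "p:U" "xs j = (path_elem p, unit_vec ?m i)" by (auto simp: X_def)
  thus "fst (xs j):I U" "snd (xs j):V M" by (simp_all add: ideal_of_elem)
 qed
 have expand: "bv x v = (\<Sum>j<d. bv (fst (xs j)) (snd (xs j)) * fs j (x, v))"
  if b: "bal_form U M bv" and x: "x:I U" and v: "v:V M" for bv x v
 proof (rule bal_form_eqI[OF pidealD(1)[OF U] b bal_form_sum _ x v])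
  show "bal_form U M (%x v. fs j (x, v))" if "j < d" for j by (rule fW[OF that])
  fix p i assume p: "p:U" and i: "i < ?m"
  hence m: "(path_elem p, unit_vec ?m i):X" unfolding X_def by (intro image_eqI[of _ _ "(p, i)"]) auto
  have "(%z. bv (fst z) (snd z)):W" using b by (simp add: W_def)
  thus "bv (path_elem p) (unit_vec ?m i) = (\<Sum>j<d. bv (fst (xs j)) (snd (xs j)) * fs j (path_elem p, unit_vec ?m i))"
  using hh m by fastforce
 qed
 define t where "t x v = vec d (%i. fs i (x, v))" for x v
 \<comment> \<open>The matrix induced by a balanced map b. Its j-th column is the value of b at the
   pair \<open>xs j\<close>, whose tensor is the j-th unit vector.\<close>
 define ind where "ind n b = mat n d (%(r, j). b (fst (xs j)) (snd (xs j)) $ r)" for n and b :: "(('v, 'a) path=>'k)=>'k vec=>'k vec"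
 have tc: "t x v:carrier_vec d" for x v by (simp add: t_def)
 have indc: "ind n b:carrier_mat n d" for n b by (simp add: ind_def)
 have tb: "balanced_map Q (I U) M d t"
  by (rule form_balanced[OF U M tc]) (use fW in "simp add: t_def")
 have txs: "t (fst (xs j)) (snd (xs j)) = unit_vec d j" if "j < d" for j
  using that del by (intro eq_vecI) (auto simp: t_def unit_vec_def)
 have ind: "ind n b *v t x v = b x v" if b: "balanced_map Q (I U) M n b" and x: "x:I U" and v: "v:V M" for n b x v
 proof (rule eq_vecI)
  fix r assume "r < dim_vec (b x v)"
  hence r: "r < n" using balancedD(2)[OF b x v] by simp
  have "(ind n b *v t x v) $ r = (\<Sum>j<d. b (fst (xs j)) (snd (xs j)) $ r * fs j (x, v))"
  using r by (simp add: ind_def t_def scalar_prod_def atLeast0LessThan)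
  also have "... = b x v $ r" using expand[OF balanced_form[OF U M b r] x v] by simp
  finally show "(ind n b *v t x v) $ r = b x v $ r" .
 qed (use balancedD(2)[OF b x v] in "simp add: ind_def")
 have teq: "A = B" if AB: "A:carrier_mat n d" "B:carrier_mat n d" and *: "!!x v. x:I U==>v:V M==>A *v t x v = B *v t x v"
  for A B n
 proof (rule mat_eq_unit[OF AB])
  fix j assume j: "j < d"
  show "A *v unit_vec d j = B *v unit_vec d j" using *[OF xs(1)[OF j] xs(2)[OF j]] txs[OF j] by simp
 qed
 \<comment> \<open>The action of a is induced by the balanced map that sends (x, v) to the tensor of
   a x and v.\<close>
 define rh where "rh a = ind d (%x v. t (a *. x) v)" for a
 have rhc: "rh a:carrier_mat d d" for a by (simp add: rh_def indc)
 have rht: "rh a *v t x v = t (a *. x) v" if "a:carrier R" "x:I U" "v:V M" for a x v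
  unfolding rh_def using ind[OF balanced_lmul[OF U tb that(1)] that(2,3)] .
 let ?T = "(d, restrict rh (carrier R))"
 have lT: "left_module Q ?T"
 proof (rule lmodI)
  show "rh \<one>\<^bsub>R\<^esub> = 1\<^sub>m d"
  proof (rule teq[OF rhc])
  fix x :: "('v, 'a) path=>'k" and v assume x: "x:I U" and v: "v:V M"
  show "rh \<one>\<^bsub>R\<^esub> *v t x v = 1\<^sub>m d *v t x v"
  using rht[OF one_carrier x v] one_mult(1)[OF I_carrier[OF U x]] tc by simp
  qed simp
  fix a :: "('v, 'a) path=>'k" assume a: "a:carrier R"
  show "rh a:carrier_mat d d" by (rule rhc)
  show "rh (%p. k * a p) = k \<cdot>\<^sub>m rh a" for k
  proof (rule teq[of _ d])
  fix x :: "('v, 'a) path=>'k" and v assume x: "x:I U" and v: "v:V M"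
  have ka: "(%p. k * a p):carrier R" using a ideal_of_scl by (simp add: carrier_R)
  show "rh (%p. k * a p) *v t x v = (k \<cdot>\<^sub>m rh a) *v t x v"
  using rht[OF ka x v] rht[OF a x v] smult_mat_vec[of "t x v" "rh a" k] tc rhc[of a]
  balancedD(5)[OF tb lmul_I[OF U x a] v, of k]
  by (simp add: mult_scl_l carrier_vecD[OF tc])
  qed (use rhc smult_carrier_mat in blast)+
  fix b :: "('v, 'a) path=>'k" assume b: "b:carrier R"
  show "rh (a *. b) = rh a * rh b"
  proof (rule teq)
  fix x :: "('v, 'a) path=>'k" and v assume x: "x:I U" and v: "v:V M"
  show "rh (a *. b) *v t x v = (rh a * rh b) *v t x v"
  using rht[OF mult_carrier x v] rht[OF b x v] rht[OF a lmul_I[OF U x b] v]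
  mult_assoc_R[OF a b I_carrier[OF U x]] amv[OF rhc[of a] rhc[of b] tc[of x v]] by simp
  qed (use rhc mult_carrier_mat in blast)+
  show "rh (%p. a p + b p) = rh a + rh b"
  proof (rule teq[of _ d])
  fix x :: "('v, 'a) path=>'k" and v assume x: "x:I U" and v: "v:V M"
  have ab: "(%p. a p + b p):carrier R" using a b ideal_of_add by (simp add: carrier_R)
  show "rh (%p. a p + b p) *v t x v = (rh a + rh b) *v t x v"
  using rht[OF ab x v] rht[OF a x v] rht[OF b x v] amd[OF rhc[of a] rhc[of b] tc[of x v]]
  balancedD(3)[OF tb lmul_I[OF U x a] lmul_I[OF U x b] v] by (simp add: mult_add_l)
  qed (use rhc add_carrier_mat in blast)+
 qed
 have "tensor_product Q (I U) M ?T t"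
  unfolding tensor_product_def
 proof (intro conjI ballI allI impI)
  show "balanced_map Q (I U) M (fst ?T) t" using tb by simp
  show "t (a *. x) v = snd ?T a *v t x v" if "a:carrier R" "x:I U" "v:V M" for a x v
  using rht[OF that] that(1) by simp
  show "EX! B. B:carrier_mat n (fst ?T) & (ALL x:I U. ALL v:V M. B *v t x v = b x v)"
  if b: "balanced_map Q (I U) M n b" for n b
  proof (rule ex1I[of _ "ind n b"])
  show "ind n b:carrier_mat n (fst ?T) & (ALL x:I U. ALL v:V M. ind n b *v t x v = b x v)"
  using indc ind[OF b] by simp
  fix B assume B: "B:carrier_mat n (fst ?T) & (ALL x:I U. ALL v:V M. B *v t x v = b x v)"
  show "B = ind n b" by (rule teq) (use B indc ind[OF b] in auto)
  qed
 qed
 thus ?thesis using lT by blast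
qed

lemma balanced_hom:
 assumes f: "f:hom Mc M N" and b: "balanced_map Q (I U) N n b"
 shows "balanced_map Q (I U) M n (%x v. b x (dat f *v v))"
proof (rule balancedI)
 have fc: "dat f:carrier_mat (fst N) (fst M)" and fa: "!!a. a:carrier R==>dat f * snd M a = snd N a * dat f"
  and lM: "left_module Q M" and lN: "left_module Q N" using f by (auto simp: hom_Mc)
 fix x :: "('v, 'a) path=>'k" and v assume x: "x:I U" and v: "v:V M"
 have fv: "dat f *v w:V N" if "w:V M" for w using mvc[OF fc that] .
 show "b x (dat f *v v):carrier_vec n" using balancedD(1)[OF b x fv[OF v]] .
 show "b (%p. k * x p) (dat f *v v) = k .* b x (dat f *v v)" for k using balancedD(5)[OF b x fv[OF v]] .
 show "b x (dat f *v (k .* v)) = k .* b x (dat f *v v)" for k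
  using balancedD(6)[OF b x fv[OF v]] mult_mat_vec[OF fc v] by simp
 show "b (x *. a) (dat f *v v) = b x (dat f *v (snd M a *v v))" if a: "a:carrier R" for a
  using balancedD(7)[OF b x a fv[OF v]] amv[OF fc lmodD(1)[OF lM a] v]
  amv[OF lmodD(1)[OF lN a] fc v] fa[OF a] by simp
 show "b x (dat f *v (v + w)) = b x (dat f *v v) + b x (dat f *v w)" if w: "w:V M" for w
  using balancedD(4)[OF b x fv[OF v] fv[OF w]] mad[OF fc v w] by simp
 show "b (%p. x p + y p) (dat f *v v) = b x (dat f *v v) + b y (dat f *v v)" if y: "y:I U" for y
  using balancedD(3)[OF b x y fv[OF v]] .
qed

text \<open>Tensor products are chosen for all modules at once, the universal property supplies the
  matrix of each morphism, and its uniqueness gives functoriality.\<close>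

lemma tensor_functor_ex:
 assumes U: "pideal U" shows "EX F. tensor_functor Q (I U) F"
proof -
 have "ALL M. EX T t. left_module Q M --> left_module Q T & tensor_product Q (I U) M T t" using tensor_ex[OF U] by blast
 then obtain T t where T: "!!M. left_module Q M==>left_module Q (T M)"
  and t: "!!M. left_module Q M==>tensor_product Q (I U) M (T M) (t M)" by metis
 define ch where "ch f B \<longleftrightarrow> B:carrier_mat (fst (T (trg f))) (fst (T (src f))) &
  (ALL x:I U. ALL v:V (src f). B *v t (src f) x v = t (trg f) x (dat f *v v))" for f B
 have ch1: "EX! B. ch f B" if f: "f:hom Mc M N" for f M N
 proof -
  have MN: "left_module Q M" "left_module Q N" "src f = M" "trg f = N" using f by (auto simp: hom_Mc)
  show ?thesis unfolding ch_def MN(3,4)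
  by (rule tensorD(3)[OF t[OF MN(1)] balanced_hom[OF f tensorD(1)[OF t[OF MN(2)]]]])
 qed
 define g where "g f = (THE B. ch f B)" for f
 have gch: "ch f (g f)" if "f:hom Mc M N" for f M N unfolding g_def using theI'[OF ch1[OF that]] .
 have geq: "g f = B" if "f:hom Mc M N" "ch f B" for f M N B using ch1[OF that(1)] gch[OF that(1)] that(2) by blast
 let ?F = "Functor T (%f. Arr (T (src f)) (T (trg f)) (g f))"
 have gc: "g f:carrier_mat (fst (T N)) (fst (T M))" and gt: "x:I U==>v:V M==>g f *v t M x v = t N x (dat f *v v)"
  if f: "f:hom Mc M N" for f M N x v
  using gch[OF f] f by (auto simp: ch_def hom_Mc)
 have tc: "t M x v:carrier_vec (fst (T M))" if "left_module Q M" "x:I U" "v:V M" for M x v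
  using balancedD(1)[OF tensorD(1)[OF t[OF that(1)]] that(2,3)] .
 have lin: "linear_functor Mc ?F"
 proof (rule M.lfunI)
  fix M :: "('v, 'a, 'k) module_obj" assume M: "M:Obj Mc"
  hence lM: "left_module Q M" by (simp add: Obj_Mc)
  show "fobj ?F M:Obj Mc" using T[OF lM] by (simp add: Obj_Mc)
  have iM: "Idm Mc M:hom Mc M M" using M.Idm_hom[OF M] .
  have "g (Idm Mc M) = 1\<^sub>m (fst (T M))"
  by (rule geq[OF iM]) (use tc[OF lM] in "auto simp: ch_def Mc_sel")
  thus "farr ?F (Idm Mc M) = Idm Mc (fobj ?F M)" by (simp add: Mc_sel)
 next
  fix f :: "(('v, 'a, 'k) module_obj, 'k mat) arr" and M N assume f: "f:hom Mc M N"
  have MN: "left_module Q M" "left_module Q N" "src f = M" "trg f = N" "dat f:carrier_mat (fst N) (fst M)" using f by (auto simp: hom_Mc)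
  have fv: "dat f *v v:V N" if "v:V M" for v using mvc[OF MN(5) that] .
  have "g f * snd (T M) a = snd (T N) a * g f" if a: "a:carrier R" for a
  proof (rule tensor_eq[OF t[OF MN(1)]])
  note Ma = lmodD(1)[OF T[OF MN(1)] a] and Na = lmodD(1)[OF T[OF MN(2)] a]
  show "g f * snd (T M) a:carrier_mat (fst (T N)) (fst (T M))" "snd (T N) a * g f:carrier_mat (fst (T N)) (fst (T M))"
  using gc[OF f] Ma Na by auto
  fix x :: "('v, 'a) path=>'k" and v assume x: "x:I U" and v: "v:V M"
  show "(g f * snd (T M) a) *v t M x v = (snd (T N) a * g f) *v t M x v"
  using amv[OF gc[OF f] Ma tc[OF MN(1) x v]] amv[OF Na gc[OF f] tc[OF MN(1) x v]]
  tensorD(2)[OF t[OF MN(1)] a x v] tensorD(2)[OF t[OF MN(2)] a x fv[OF v]] gt[OF f x v] gt[OF f lmul_I[OF U x a] v] by simp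
  qed
  thus "farr ?F f:hom Mc (fobj ?F M) (fobj ?F N)"
  using T MN gc[OF f] by (simp add: hom_Mc)
  show "farr ?F (Scl Mc c f) = Scl Mc c (farr ?F f)" for c
  proof -
  have "g (Scl Mc c f) = c \<cdot>\<^sub>m g f"
  by (rule geq[OF M.Scl_hom[OF f]])
  (use gc[OF f] gt[OF f] MN tc[OF MN(1)] fv balancedD(6)[OF tensorD(1)[OF t[OF MN(2)]]] in
  \<open>auto simp: ch_def Mc_sel smult_mat_vec carrier_vecD\<close>)
  thus ?thesis using MN by (simp add: Mc_sel)
  qed
  show "farr ?F (Add Mc f h) = Add Mc (farr ?F f) (farr ?F h)" if h: "h:hom Mc M N" for h
  proof -
  have hN: "dat h:carrier_mat (fst N) (fst M)" "src h = M" "trg h = N" using h by (auto simp: hom_Mc)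
  have hv: "dat h *v v:V N" if "v:V M" for v using mvc[OF hN(1) that] .
  have "ch (Add Mc f h) (g f + g h)"
  unfolding ch_def Mc_sel arr.sel MN(3,4)
  proof (intro conjI ballI)
  show "g f + g h:carrier_mat (fst (T N)) (fst (T M))" using gc[OF f] gc[OF h] by simp
  fix x :: "('v, 'a) path=>'k" and v assume x: "x:I U" and v: "v:V M"
  show "(g f + g h) *v t M x v = t N x ((dat f + dat h) *v v)"
  using amd[OF gc[OF f] gc[OF h] tc[OF MN(1) x v]] gt[OF f x v] gt[OF h x v]
  amd[OF MN(5) hN(1) v] balancedD(4)[OF tensorD(1)[OF t[OF MN(2)]] x fv[OF v] hv[OF v]] by simp
  qed
  hence "g (Add Mc f h) = g f + g h" using geq[OF M.Add_hom[OF f h]] by blast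
  thus ?thesis using MN hN by (simp add: Mc_sel)
  qed
  show "farr ?F (Cmp Mc h f) = Cmp Mc (farr ?F h) (farr ?F f)" if h: "h:hom Mc N O'" for h O'
  proof -
  have hN: "dat h:carrier_mat (fst O') (fst N)" "src h = N" "trg h = O'" using h by (auto simp: hom_Mc)
  have "ch (Cmp Mc h f) (g h * g f)"
  unfolding ch_def Mc_sel arr.sel MN(3) hN(3)
  proof (intro conjI ballI)
  show "g h * g f:carrier_mat (fst (T O')) (fst (T M))" using gc[OF f] gc[OF h] by simp
  fix x :: "('v, 'a) path=>'k" and v assume x: "x:I U" and v: "v:V M"
  show "(g h * g f) *v t M x v = t O' x ((dat h * dat f) *v v)"
  using amv[OF gc[OF h] gc[OF f] tc[OF MN(1) x v]] gt[OF f x v] gt[OF h x fv[OF v]]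
  amv[OF hN(1) MN(5) v] by simp
  qed
  hence "g (Cmp Mc h f) = g h * g f" using geq[OF M.Cmp_hom[OF h f]] by blast
  thus ?thesis using MN hN by (simp add: Mc_sel)
  qed
 qed
 have "tensor_functor Q (I U) ?F"
  unfolding tensor_functor_def
 proof (intro conjI exI[of _ t] ballI)
  show "linear_functor Mc ?F" by (rule lin)
  show "tensor_product Q (I U) M (fobj ?F M) (t M)" if "M:Obj Mc" for M using t that by (simp add: Obj_Mc)
  fix M N :: "('v, 'a, 'k) module_obj" and f x v assume a: "M:Obj Mc" "N:Obj Mc" "f:Mor Mc M N" "x:I U" "v:V M"
  hence f: "f:hom Mc M N" by (simp add: hom_def)
  show "dat (farr ?F f) *v t M x v = t N x (dat f *v v)" using gt[OF f a(4,5)] by simp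
 qed
 thus ?thesis by blast
qed

abbreviation DU :: "('v, 'a) path set=>(('v, 'a, 'k) module_obj, 'k mat) endofunctor" where "DU U == Dp Q (I U)"

text \<open>\<open>Dp\<close> is itself the result of a choice; \<open>tn\<close> is a family of
  maps sending (x, v) to x tensor v that is compatible with it.\<close>

definition tn :: "('v, 'a) path set=>('v, 'a, 'k) module_obj=>(('v, 'a) path=>'k)=>'k vec=>'k vec" where
 "tn U = (SOME tn. (ALL M:Obj Mc. tensor_product Q (I U) M (fobj (DU U) M) (tn M)) &
  (ALL M:Obj Mc. ALL N:Obj Mc. ALL f:Mor Mc M N. ALL x:I U. ALL v:V M.
  dat (farr (DU U) f) *v tn M x v = tn N x (dat f *v v)))"

lemma DU_all:
 assumes U: "pideal U"
 shows "linear_functor Mc (DU U)"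
  "left_module Q M==>tensor_product Q (I U) M (fobj (DU U) M) (tn U M)"
  "f:hom Mc M N==>x:I U==>v:V M==>dat (farr (DU U) f) *v tn U M x v = tn U N x (dat f *v v)"
proof -
 have tf: "tensor_functor Q (I U) (DU U)" unfolding Dp_def using someI_ex[OF tensor_functor_ex[OF U]] .
 thus "linear_functor Mc (DU U)" by (simp add: tensor_functor_def)
 from tf have "EX tn. (ALL M:Obj Mc. tensor_product Q (I U) M (fobj (DU U) M) (tn M)) &
  (ALL M:Obj Mc. ALL N:Obj Mc. ALL f:Mor Mc M N. ALL x:I U. ALL v:V M.
  dat (farr (DU U) f) *v tn M x v = tn N x (dat f *v v))" unfolding tensor_functor_def by blast
 from someI_ex[OF this] have "(ALL M:Obj Mc. tensor_product Q (I U) M (fobj (DU U) M) (tn U M)) &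
  (ALL M:Obj Mc. ALL N:Obj Mc. ALL f:Mor Mc M N. ALL x:I U. ALL v:V M.
  dat (farr (DU U) f) *v tn U M x v = tn U N x (dat f *v v))" unfolding tn_def[symmetric] .
 thus "left_module Q M==>tensor_product Q (I U) M (fobj (DU U) M) (tn U M)"
  "f:hom Mc M N==>x:I U==>v:V M==>dat (farr (DU U) f) *v tn U M x v = tn U N x (dat f *v v)"
  by (auto simp: hom_def Obj_Mc)
qed

abbreviation "EE == endofunctor_cat (Mc :: ('k, ('v, 'a, 'k) module_obj, 'k mat) lincat)"

lemma lmod:
 fixes M :: "('v, 'a, 'k) module_obj"
 shows "linear_functor Mc F==>left_module Q M==>left_module Q (fobj F M)"
 using M.lfunD(1) by (simp add: Obj_Mc)

text \<open>Natural transformations out of \<open>(I \<otimes> -) \<circ> F\<close> correspond to natural families of balanced,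
  \<open>A\<close>-linear maps.\<close>

lemma nat_ex:
 assumes U: "pideal U" and F: "linear_functor Mc F" and G: "linear_functor Mc G"
  and bal: "!!M :: ('v, 'a, 'k) module_obj. left_module Q M==>balanced_map Q (I U) (fobj F M) (fst (fobj G M)) (b M)"
  and lin: "!!(M :: ('v, 'a, 'k) module_obj) a x v. left_module Q M==>a:carrier R==>x:I U==>v:V (fobj F M) ==>
  b M (a *. x) v = snd (fobj G M) a *v b M x v"
  and nat: "!!f (M :: ('v, 'a, 'k) module_obj) N x v. f:hom Mc M N==>x:I U==>v:V (fobj F M) ==>
  dat (farr G f) *v b M x v = b N x (dat (farr F f) *v v)"
 obtains et where "et:hom EE (M.hcomp (DU U) F) G"
  "!!(M :: ('v, 'a, 'k) module_obj) x v. left_module Q M==>x:I U==>v:V (fobj F M)==>dat (dat et M) *v tn U (fobj F M) x v = b M x v"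
proof -
 note D = DU_all[OF U]
 have "ALL M :: ('v, 'a, 'k) module_obj. EX B. left_module Q M --> B:carrier_mat (fst (fobj G M)) (fst (fobj (DU U) (fobj F M))) &
  (ALL x:I U. ALL v:V (fobj F M). B *v tn U (fobj F M) x v = b M x v)"
  using tensorD(3)[OF D(2)[OF lmod[OF F]] bal] by blast
 then obtain B where Bc: "!!M. left_module Q M==>B M:carrier_mat (fst (fobj G M)) (fst (fobj (DU U) (fobj F M)))"
  and Bt: "!!M x v. left_module Q M==>x:I U==>v:V (fobj F M)==>B M *v tn U (fobj F M) x v = b M x v"
  by metis
 have tc: "tn U M x v:carrier_vec (fst (fobj (DU U) M))" if "left_module Q M" "x:I U" "v:V M" for M x v
  using balancedD(1)[OF tensorD(1)[OF D(2)[OF that(1)]] that(2,3)] .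
 let ?d = "%M. Arr (fobj (M.hcomp (DU U) F) M) (fobj G M) (B M)"
 have H: "Arr (M.hcomp (DU U) F) G (\<lambda>M\<in>Obj Mc. ?d M):hom EE (M.hcomp (DU U) F) G"
 proof (rule M.homE_I[OF M.hcomp_linear[OF D(1) F] G])
  fix M :: "('v, 'a, 'k) module_obj" assume "M:Obj Mc"
  hence lM: "left_module Q M" by (simp add: Obj_Mc)
  note lFM = lmod[OF F lM] and lGM = lmod[OF G lM]
  note lDFM = lmod[OF D(1) lFM]
  show "?d M:hom Mc (fobj (M.hcomp (DU U) F) M) (fobj G M)"
  unfolding M.hcomp_sel
  proof (rule hom_McI[OF lDFM lGM Bc[OF lM]])
  fix a :: "('v, 'a) path=>'k" assume a: "a:carrier R"
  note Da = lmodD(1)[OF lDFM a] and Ga = lmodD(1)[OF lGM a]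
  show "B M * snd (fobj (DU U) (fobj F M)) a = snd (fobj G M) a * B M"
  proof (rule tensor_eq[OF D(2)[OF lFM]])
  show "B M * snd (fobj (DU U) (fobj F M)) a:carrier_mat (fst (fobj G M)) (fst (fobj (DU U) (fobj F M)))"
  "snd (fobj G M) a * B M:carrier_mat (fst (fobj G M)) (fst (fobj (DU U) (fobj F M)))"
  using Bc[OF lM] Da Ga by auto
  fix x :: "('v, 'a) path=>'k" and v assume x: "x:I U" and v: "v:V (fobj F M)"
  show "(B M * snd (fobj (DU U) (fobj F M)) a) *v tn U (fobj F M) x v = (snd (fobj G M) a * B M) *v tn U (fobj F M) x v"
  using amv[OF Bc[OF lM] Da tc[OF lFM x v]] amv[OF Ga Bc[OF lM] tc[OF lFM x v]]
  tensorD(2)[OF D(2)[OF lFM] a x v] Bt[OF lM x v] Bt[OF lM lmul_I[OF U x a] v] lin[OF lM a x v] by simp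
  qed
  qed
 next
  fix f and M N :: "('v, 'a, 'k) module_obj" assume f: "f:hom Mc M N"
  hence lM: "left_module Q M" and lN: "left_module Q N" by (auto simp: hom_Mc)
  note lFM = lmod[OF F lM] and lFN = lmod[OF F lN]
  have Ff: "farr F f:hom Mc (fobj F M) (fobj F N)" using M.lfunD(3)[OF F f] .
  have Gf: "farr G f:hom Mc (fobj G M) (fobj G N)" using M.lfunD(3)[OF G f] .
  have Df: "farr (DU U) (farr F f):hom Mc (fobj (DU U) (fobj F M)) (fobj (DU U) (fobj F N))"
  using M.lfunD(3)[OF D(1) Ff] .
  have Fc: "dat (farr F f):carrier_mat (fst (fobj F N)) (fst (fobj F M))"
  and Gc: "dat (farr G f):carrier_mat (fst (fobj G N)) (fst (fobj G M))" "src (farr G f) = fobj G M" "trg (farr G f) = fobj G N"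
  and Dc: "dat (farr (DU U) (farr F f)):carrier_mat (fst (fobj (DU U) (fobj F N))) (fst (fobj (DU U) (fobj F M)))"
  "src (farr (DU U) (farr F f)) = fobj (DU U) (fobj F M)" "trg (farr (DU U) (farr F f)) = fobj (DU U) (fobj F N)"
  using Ff Gf Df by (auto simp: hom_Mc)
  have "B N * dat (farr (DU U) (farr F f)) = dat (farr G f) * B M"
  proof (rule tensor_eq[OF D(2)[OF lFM]])
  show "B N * dat (farr (DU U) (farr F f)):carrier_mat (fst (fobj G N)) (fst (fobj (DU U) (fobj F M)))"
  "dat (farr G f) * B M:carrier_mat (fst (fobj G N)) (fst (fobj (DU U) (fobj F M)))"
  using Bc[OF lM] Bc[OF lN] Gc Dc by auto
  fix x :: "('v, 'a) path=>'k" and v assume x: "x:I U" and v: "v:V (fobj F M)"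
  have Fv: "dat (farr F f) *v v:V (fobj F N)" using mvc[OF Fc v] .
  show "(B N * dat (farr (DU U) (farr F f))) *v tn U (fobj F M) x v = (dat (farr G f) * B M) *v tn U (fobj F M) x v"
  using amv[OF Bc[OF lN] Dc(1) tc[OF lFM x v]] amv[OF Gc(1) Bc[OF lM] tc[OF lFM x v]]
  D(3)[OF Ff x v] Bt[OF lM x v] Bt[OF lN x Fv] nat[OF f x v] by simp
  qed
  thus "Cmp Mc (?d N) (farr (M.hcomp (DU U) F) f) = Cmp Mc (farr G f) (?d M)"
  using Gc Dc by (simp add: Mc_sel M.hcomp_sel)
 qed
 show thesis by (rule that[OF H]) (use Bt in "simp add: Obj_Mc")
qed

lemma nat_eq:
 assumes U: "pideal U" and F: "linear_functor Mc F"
  and et: "et:hom EE (M.hcomp (DU U) F) G" and ta: "ta:hom EE (M.hcomp (DU U) F) G"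
  and *: "!!(M :: ('v, 'a, 'k) module_obj) x v. left_module Q M==>x:I U==>v:V (fobj F M) ==>
  dat (dat et M) *v tn U (fobj F M) x v = dat (dat ta M) *v tn U (fobj F M) x v"
 shows "et = ta"
proof (rule M.homE_eqI[OF et ta])
 fix M :: "('v, 'a, 'k) module_obj" assume M: "M:Obj Mc"
 hence lM: "left_module Q M" by (simp add: Obj_Mc)
 have h: "dat et M:hom Mc (fobj (DU U) (fobj F M)) (fobj G M)" "dat ta M:hom Mc (fobj (DU U) (fobj F M)) (fobj G M)"
  using M.homE_D(6)[OF et M] M.homE_D(6)[OF ta M] by (auto simp: M.hcomp_sel)
 have "dat (dat et M) = dat (dat ta M)"
  by (rule tensor_eq[OF DU_all(2)[OF U lmod[OF F lM]]]) (use h *[OF lM] in "auto simp: hom_Mc")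
 thus "dat et M = dat ta M" using h by (auto simp: hom_Mc intro: arr.expand)
qed

end

lemma lin_mat:
 fixes L :: "'k::field vec=>'k vec"
 assumes c: "!!v. v:carrier_vec m==>L v:carrier_vec n"
  and a: "!!v w. v:carrier_vec m==>w:carrier_vec m==>L (v + w) = L v + L w"
  and s: "!!v k. v:carrier_vec m==>L (k .* v) = k .* L v"
 obtains A where "A:carrier_mat n m" "!!v. v:carrier_vec m==>A *v v = L v"
proof -
 define A where "A = mat n m (%(r, j). L (unit_vec m j) $ r)"
 have A: "A:carrier_mat n m" by (simp add: A_def)
 have u: "A *v unit_vec m j = L (unit_vec m j)" if "j < m" for j
  using mat_mult_unit[OF A that] c[of "unit_vec m j"] that by (intro eq_vecI) (auto simp: A_def)
 have "A *v v = L v" if v: "v:carrier_vec m" for v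
  using v
 proof (induction rule: vec_induct)
  case zero
  have z: "0 .* x = 0\<^sub>v k" if "x:carrier_vec k" for x :: "'k vec" and k using that by (intro eq_vecI) auto
  have "L (0\<^sub>v m) = 0\<^sub>v n" using s[of "0\<^sub>v m" 0] z[of "0\<^sub>v m" m] z[OF c[of "0\<^sub>v m"]] by simp
  moreover have "A *v 0\<^sub>v m = 0\<^sub>v n" using mult_mat_vec[OF A, of "0\<^sub>v m" 0] z[of "0\<^sub>v m" m] z[of "A *v 0\<^sub>v m" n] mvc[OF A] by simp
  ultimately show ?case by simp
 next
  case (unit c i)
  thus ?case using mult_mat_vec[OF A, of "unit_vec m i" c] u s[of "unit_vec m i"] by simp
 next
  case (add x y)
  thus ?case using mad[OF A add(1,2)] a by simp
 qed
 thus thesis using that A by blast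
qed

lemma zero_smult_vec: "x:carrier_vec k==>0 .* x = (0\<^sub>v k :: 'k::field vec)"
 by (intro eq_vecI) auto

section \<open>Evaluation of natural transformations, and inclusions of ideals\<close>

context tree_algebra begin

abbreviation lm :: "('v, 'a, 'k) module_obj=>bool" where "lm M == left_module Q M"
abbreviation Id0 :: "(('v, 'a, 'k) module_obj, 'k mat) endofunctor" where "Id0 == Functor (%M. M) (%f. f)"
abbreviation ev where "ev et M w == dat (dat et M) *v w"
abbreviation el :: "('v, 'a) path=>('v, 'a) path=>'k" where "el == path_elem"
abbreviation cmpE (infixl \<open>oE\<close> 70) where "ta oE et == Cmp EE ta et"

lemma Id0_linear: "linear_functor Mc Id0"
 by (rule M.lfunI) simp_all

lemma hcomp_Id0: "M.hcomp F Id0 = F" "M.hcomp Id0 F = F"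
 by (cases F; simp add: M.hcomp_def o_def)+

lemma DU_lm: "pideal U==>lm M==>lm (fobj (DU U) M)"
 using lmod[OF DU_all(1)] .

lemma tn_carrier: "pideal U==>lm M==>x:I U==>v:V M==>tn U M x v:V (fobj (DU U) M)"
 using balancedD(1)[OF tensorD(1)[OF DU_all(2)]] by blast

lemma tn_bal:
 assumes "pideal U" "lm M"
 shows "x:I U==>y:I U==>v:V M==>tn U M (%p. x p + y p) v = tn U M x v + tn U M y v"
  "x:I U==>v:V M==>w:V M==>tn U M x (v + w) = tn U M x v + tn U M x w"
  "x:I U==>v:V M==>tn U M (%p. c * x p) v = c .* tn U M x v"
  "x:I U==>v:V M==>tn U M x (c .* v) = c .* tn U M x v"
  "x:I U==>a:carrier R==>v:V M==>tn U M (x *. a) v = tn U M x (snd M a *v v)"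
 using balancedD(3-7)[OF tensorD(1)[OF DU_all(2)[OF assms]]] by blast+

lemma tn_act: "pideal U==>lm M==>a:carrier R==>x:I U==>v:V M==>tn U M (a *. x) v = snd (fobj (DU U) M) a *v tn U M x v"
 using tensorD(2)[OF DU_all(2)] by blast

lemma tn_zero:
 assumes U: "pideal U" and M: "lm M"
 shows "v:V M==>tn U M (%p. 0) v = 0\<^sub>v (fst (fobj (DU U) M))"
  "x:I U==>tn U M x (0\<^sub>v (fst M)) = 0\<^sub>v (fst (fobj (DU U) M))"
 using tn_bal(3)[OF U M ideal_of_zero[of U], of v 0] zero_smult_vec[OF tn_carrier[OF U M ideal_of_zero]]
  tn_bal(4)[OF U M, of x "0\<^sub>v (fst M)" 0] zero_smult_vec[OF tn_carrier[OF U M, of x "0\<^sub>v (fst M)"]]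
  zero_smult_vec[of "0\<^sub>v (fst M) :: 'k vec" "fst M"]
 by simp_all

lemma ev_dat:
 assumes "et:hom EE F G" "lm M"
 shows "dat (dat et M):carrier_mat (fst (fobj G M)) (fst (fobj F M))"
  "src (dat et M) = fobj F M" "trg (dat et M) = fobj G M"
  "a:carrier R==>dat (dat et M) * snd (fobj F M) a = snd (fobj G M) a * dat (dat et M)"
 using M.homE_D(6)[OF assms(1), of M] assms(2) by (auto simp: hom_Mc Obj_Mc)

lemma ev_carrier: "et:hom EE F G==>lm M==>w:V (fobj F M)==>ev et M w:V (fobj G M)"
 using ev_dat(1) mvc by blast

lemma ev_lin:
 assumes "et:hom EE F G" "lm M"
 shows "v:V (fobj F M)==>w:V (fobj F M)==>ev et M (v + w) = ev et M v + ev et M w"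
  "v:V (fobj F M)==>ev et M (c .* v) = c .* ev et M v"
  "ev et M (0\<^sub>v (fst (fobj F M))) = 0\<^sub>v (fst (fobj G M))"
  "v:V (fobj F M)==>a:carrier R==>ev et M (snd (fobj F M) a *v v) = snd (fobj G M) a *v ev et M v"
proof -
 note A = ev_dat[OF assms]
 have FG: "linear_functor Mc F" "linear_functor Mc G" using M.homE_D(1,2)[OF assms(1)] .
 show "v:V (fobj F M)==>w:V (fobj F M)==>ev et M (v + w) = ev et M v + ev et M w"
  and 2: "v:V (fobj F M)==>ev et M (c .* v) = c .* ev et M v" for v c
  using mad[OF A(1)] mult_mat_vec[OF A(1)] by blast+
 show "ev et M (0\<^sub>v (fst (fobj F M))) = 0\<^sub>v (fst (fobj G M))"
  using 2[of "0\<^sub>v (fst (fobj F M))" 0] zero_smult_vec[of "0\<^sub>v (fst (fobj F M)) :: 'k vec" "fst (fobj F M)"]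
  zero_smult_vec[OF ev_carrier[OF assms, of "0\<^sub>v (fst (fobj F M))"]] by simp
 show "v:V (fobj F M)==>a:carrier R==>ev et M (snd (fobj F M) a *v v) = snd (fobj G M) a *v ev et M v"
  using amv[OF A(1) lmodD(1)[OF lmod[OF FG(1) assms(2)]]]
  amv[OF lmodD(1)[OF lmod[OF FG(2) assms(2)]] A(1)] A(4)[of a] by metis
qed

lemma ev_ops:
 assumes et: "et:hom EE F G" and M: "lm M" and w: "w:V (fobj F M)"
 shows "ta:hom EE G H'==>ev (ta oE et) M w = ev ta M (ev et M w)"
  "ev (Idm EE F) M w = w" "ev (Scl EE c et) M w = c .* ev et M w"
  "zv:hom EE F G==>ev (Add EE et zv) M w = ev et M w + ev zv M w"
  "ev (Nul EE F G) M w = 0\<^sub>v (fst (fobj G M))"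
proof -
 have MO: "M:Obj Mc" using M by (simp add: Obj_Mc)
 note A = ev_dat[OF et M]
 show "ev (ta oE et) M w = ev ta M (ev et M w)" if t: "ta:hom EE G H'"
  using amv[OF ev_dat(1)[OF t M] A(1) w] MO by (simp add: M.E_sel Mc_sel)
 show "ev (Idm EE F) M w = w" using MO w by (simp add: M.E_sel Mc_sel)
 show "ev (Scl EE c et) M w = c .* ev et M w" using MO w A(1) by (simp add: M.E_sel Mc_sel smult_mat_vec)
 show "ev (Add EE et zv) M w = ev et M w + ev zv M w" if z: "zv:hom EE F G"
  using MO amd[OF A(1) ev_dat(1)[OF z M] w] by (simp add: M.E_sel Mc_sel)
 show "ev (Nul EE F G) M w = 0\<^sub>v (fst (fobj G M))" using MO w by (auto simp: M.E_sel Mc_sel intro!: eq_vecI)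
qed

lemma ev_natural:
 assumes "et:hom EE F G" "f:hom Mc M N" "w:V (fobj F M)"
 shows "ev et N (dat (farr F f) *v w) = dat (farr G f) *v ev et M w"
proof -
 have lm: "lm M" "lm N" using assms(2) by (auto simp: hom_Mc)
 have FG: "farr F f:hom Mc (fobj F M) (fobj F N)" "farr G f:hom Mc (fobj G M) (fobj G N)"
  using M.lfunD(3)[OF M.homE_D(1)[OF assms(1)] assms(2)] M.lfunD(3)[OF M.homE_D(2)[OF assms(1)] assms(2)] .
 have "dat (Cmp Mc (dat et N) (farr F f)) = dat (Cmp Mc (farr G f) (dat et M))" using M.homE_D(7)[OF assms(1,2)] by simp
 hence "dat (dat et N) * dat (farr F f) = dat (farr G f) * dat (dat et M)" by (simp add: Mc_sel)
 thus ?thesis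
  using amv[OF ev_dat(1)[OF assms(1) lm(2)] _ assms(3), of "dat (farr F f)"]
  amv[OF _ ev_dat(1)[OF assms(1) lm(1)] assms(3), of "dat (farr G f)" "fst (fobj G N)"] FG by (simp add: hom_Mc)
qed

lemma ev_harr:
 assumes U: "pideal U" and a: "av:hom EE F G" and M: "lm M" and x: "x:I U" and w: "w:V (fobj F M)"
 shows "ev (M.harr (Idm EE (DU U)) av) M (tn U (fobj F M) x w) = tn U (fobj G M) x (ev av M w)"
proof -
 have MO: "M:Obj Mc" using M by (simp add: Obj_Mc)
 have "dat av M:hom Mc (fobj F M) (fobj G M)" using M.homE_D(6)[OF a MO] .
 thus ?thesis using M.harr_Idm_left[OF DU_all(1)[OF U] a MO] DU_all(3)[OF U _ x w] by simp
qed

lemma nat_eq_el: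
 assumes U: "pideal U" and F: "linear_functor Mc F"
  and et: "et:hom EE (M.hcomp (DU U) F) G" and ta: "ta:hom EE (M.hcomp (DU U) F) G"
  and *: "!!M p v. lm M==>p:U==>v:V (fobj F M) ==>
  ev et M (tn U (fobj F M) (el p) v) = ev ta M (tn U (fobj F M) (el p) v)"
 shows "et = ta"
proof (rule nat_eq[OF U F et ta])
 fix M x v assume M: "lm M" and x: "x:I U" and v: "v:V (fobj F M)"
 note FM = lmod[OF F M]
 note E = ev_lin[OF et M, unfolded M.hcomp_sel] and T = ev_lin[OF ta M, unfolded M.hcomp_sel]
 note B = tn_bal[OF U FM] and C = tn_carrier[OF U FM]
 show "ev et M (tn U (fobj F M) x v) = ev ta M (tn U (fobj F M) x v)"
  using x pidealD(1)[OF U]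
 proof (induction rule: span_induct)
  case zero
  show ?case using tn_zero(1)[OF U FM v] E(3) T(3) by simp
 next
  case (elem c p)
  have p: "el p:I U" using elem by (simp add: ideal_of_elem)
  show ?case using B(3)[OF p v] E(2)[OF C[OF p v]] T(2)[OF C[OF p v]] *[OF M elem v] by simp
 next
  case (add x y)
  thus ?case using B(1)[OF add(1,2) v] E(1)[OF C[OF add(1) v] C[OF add(2) v]] T(1)[OF C[OF add(1) v] C[OF add(2) v]] by simp
 qed
qed

text \<open>A vector of \<open>fobj (DU Y) M\<close> need not be a pure tensor. For a fixed path p
  both transformations define matrices on \<open>fobj (DU Y) M\<close>, and these can be compared on
  pure tensors by \<open>tensor_eq\<close>.\<close>

lemma nat_eq2:
 assumes X: "pideal X" and Y: "pideal Y"
  and et: "et:hom EE (M.hcomp (DU X) (DU Y)) G" and ta: "ta:hom EE (M.hcomp (DU X) (DU Y)) G"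
  and *: "!!M p q v. lm M==>p:X==>q:Y==>v:V M ==>
  ev et M (tn X (fobj (DU Y) M) (el p) (tn Y M (el q) v)) = ev ta M (tn X (fobj (DU Y) M) (el p) (tn Y M (el q) v))"
 shows "et = ta"
proof (rule nat_eq_el[OF X DU_all(1)[OF Y] et ta])
 fix M p w assume M: "lm M" and p: "p:X" and w: "w:V (fobj (DU Y) M)"
 note YM = DU_lm[OF Y M]
 note E = ev_lin[OF et M, unfolded M.hcomp_sel] and T = ev_lin[OF ta M, unfolded M.hcomp_sel]
 note B = tn_bal[OF X YM] and C = tn_carrier[OF X YM]
 have ep: "el p:I X" using p by (simp add: ideal_of_elem)
 have ec: "ev zv M (tn X (fobj (DU Y) M) (el p) v):V (fobj G M)" if "zv:hom EE (M.hcomp (DU X) (DU Y)) G" "v:V (fobj (DU Y) M)" for zv v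
  using ev_carrier[OF that(1) M, unfolded M.hcomp_sel, OF C[OF ep that(2)]] .
 have mat: "EX A. A:carrier_mat (fst (fobj G M)) (fst (fobj (DU Y) M)) &
  (ALL v:V (fobj (DU Y) M). A *v v = ev zv M (tn X (fobj (DU Y) M) (el p) v))" if z: "zv:hom EE (M.hcomp (DU X) (DU Y)) G" for zv
 proof -
  note Z = ev_lin[OF z M, unfolded M.hcomp_sel]
  show ?thesis
  by (rule lin_mat[of "fst (fobj (DU Y) M)" "%v. ev zv M (tn X (fobj (DU Y) M) (el p) v)" "fst (fobj G M)"])
  (use ec[OF z] B(2,4)[OF ep] Z(1,2) C[OF ep] in auto)
 qed
 obtain A B where A: "A:carrier_mat (fst (fobj G M)) (fst (fobj (DU Y) M))"
  "!!v. v:V (fobj (DU Y) M)==>A *v v = ev et M (tn X (fobj (DU Y) M) (el p) v)"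
  and B: "B:carrier_mat (fst (fobj G M)) (fst (fobj (DU Y) M))"
  "!!v. v:V (fobj (DU Y) M)==>B *v v = ev ta M (tn X (fobj (DU Y) M) (el p) v)"
  using mat[OF et] mat[OF ta] by blast
 have "A = B"
 proof (rule tensor_eq[OF DU_all(2)[OF Y M] A(1) B(1)])
  fix y v assume y: "y:I Y" and v: "v:V M"
  note C = tn_carrier[OF Y M _ v]
  show "A *v tn Y M y v = B *v tn Y M y v" using y pidealD(1)[OF Y]
  proof (induction rule: span_induct)
  case zero
  have "L *v 0\<^sub>v (fst (fobj (DU Y) M)) = 0\<^sub>v (fst (fobj G M))" if "L:carrier_mat (fst (fobj G M)) (fst (fobj (DU Y) M))" for L :: "'k mat"
  using that by (intro eq_vecI) auto
  thus ?case using tn_zero(1)[OF Y M v] A(1) B(1) by simp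
  next
  case (elem c q)
  have q: "el q:I Y" using elem by (simp add: ideal_of_elem)
  show ?case
  using tn_bal(3)[OF Y M q v, of c] mult_mat_vec[OF A(1) C[OF q], of c] mult_mat_vec[OF B(1) C[OF q], of c]
  A(2)[OF C[OF q]] B(2)[OF C[OF q]] *[OF M p elem v] by simp
  next
  case (add x y)
  thus ?case
  using tn_bal(1)[OF Y M add(1,2) v] mad[OF A(1) C[OF add(1)] C[OF add(2)]]
  mad[OF B(1) C[OF add(1)] C[OF add(2)]] by simp
  qed
 qed
 thus "ev et M (tn X (fobj (DU Y) M) (el p) w) = ev ta M (tn X (fobj (DU Y) M) (el p) w)" using A(2)[OF w] B(2)[OF w] by simp
qed

lemmas nat_ex0 = nat_ex[OF _ Id0_linear, unfolded hcomp_Id0 endofunctor.sel]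
lemmas nat_eq0 = nat_eq[OF _ Id0_linear, unfolded hcomp_Id0 endofunctor.sel]
lemmas nat_eq_el0 = nat_eq_el[OF _ Id0_linear, unfolded hcomp_Id0 endofunctor.sel]

text \<open>Induced by the inclusion of ideals. The formula on tensors determines it by
  \<open>nat_eq0\<close>, so the choice is harmless.\<close>

definition inc :: "('v, 'a) path set=>('v, 'a) path set=>((('v, 'a, 'k) module_obj, 'k mat) endofunctor, ('v, 'a, 'k) module_obj=>(('v, 'a, 'k) module_obj, 'k mat) arr) arr" where
 "inc U W = (SOME et. et:hom EE (DU U) (DU W) & (ALL M x v. lm M --> x:I U --> v:V M --> ev et M (tn U M x v) = tn W M x v))"

lemma bimodule_nat:
 assumes U: "pideal U" and W: "pideal W"
  and c: "!!x. x:I U==>g x:I W"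
  and a: "!!x y. x:I U==>y:I U==>g (%p. x p + y p) = (%p. g x p + g y p)"
  and s: "!!x k. x:I U==>g (%p. k * x p) = (%p. k * g x p)"
  and l: "!!x a. x:I U==>a:carrier R==>g (a *. x) = a *. g x"
  and r: "!!x a. x:I U==>a:carrier R==>g (x *. a) = g x *. a"
 obtains et where "et:hom EE (DU U) (DU W)" "!!M x v. lm M==>x:I U==>v:V M==>ev et M (tn U M x v) = tn W M (g x) v"
proof (rule nat_ex0[OF U DU_all(1)[OF W], of "%M x v. tn W M (g x) v"])
 show "balanced_map Q (I U) M (fst (fobj (DU W) M)) (%x. tn W M (g x))" if M: "lm M" for M
  by (rule balancedI) (use tn_bal[OF W M] tn_carrier[OF W M] c a s r in simp_all)
 show "tn W M (g (a *. x)) v = snd (fobj (DU W) M) a *v tn W M (g x) v" if "lm M" "a:carrier R" "x:I U" "v:V M" for M a x v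
  using tn_act[OF W that(1,2) c[OF that(3)] that(4)] l that by simp
 show "dat (farr (DU W) f) *v tn W M (g x) v = tn W N (g x) (dat f *v v)" if "f:hom Mc M N" "x:I U" "v:V M" for f M N x v
  using DU_all(3)[OF W that(1) c[OF that(2)] that(3)] .
qed (use that in blast)

lemma inc:
 assumes U: "pideal U" and W: "pideal W" and UW: "U <= W"
 shows "inc U W:hom EE (DU U) (DU W)" "lm M==>x:I U==>v:V M==>ev (inc U W) M (tn U M x v) = tn W M x v"
proof -
 have "EX et. et:hom EE (DU U) (DU W) & (ALL M x v. lm M --> x:I U --> v:V M --> ev et M (tn U M x v) = tn W M x v)"
 proof (rule bimodule_nat[OF U W, of "%x. x"])
  show "x:I W" if "x:I U" for x using ideal_of_mono[OF UW] that by blast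
  fix et assume "et:hom EE (DU U) (DU W)" "!!M x v. lm M==>x:I U==>v:V M==>ev et M (tn U M x v) = tn W M x v"
  thus ?thesis by (intro exI[of _ et] conjI allI impI)
 qed (rule refl)+
 from someI_ex[OF this] show "inc U W:hom EE (DU U) (DU W)" "lm M==>x:I U==>v:V M==>ev (inc U W) M (tn U M x v) = tn W M x v"
  unfolding inc_def[symmetric] by blast+
qed

lemma DU_Obj: "pideal U==>DU U:Obj EE" using DU_all(1) by (simp add: M.Obj_E)

lemma inc_id: assumes U: "pideal U" shows "inc U U = Idm EE (DU U)"
 by (rule nat_eq0[OF U inc(1)[OF U U] M.E.Idm_hom[OF DU_Obj[OF U]]])
  (use inc(2)[OF U U] ev_ops(2)[OF M.E.Idm_hom[OF DU_Obj[OF U]]] tn_carrier[OF U] in auto)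

lemma inc_inc:
 assumes U: "pideal U" and W: "pideal W" and Z: "pideal Z" and s: "U <= W" "W <= Z"
 shows "inc W Z oE inc U W = inc U Z"
proof -
 note a = inc(1)[OF U W s(1)] and b = inc(1)[OF W Z s(2)]
 have UZ: "U <= Z" using s by blast
 show ?thesis
 proof (rule nat_eq0[OF U M.E.Cmp_hom[OF b a] inc(1)[OF U Z UZ]])
  fix M x v assume *: "lm M" "x:I U" "v:V M"
  have xW: "x:I W" using ideal_of_mono[OF s(1)] * by blast
  show "ev (inc W Z oE inc U W) M (tn U M x v) = ev (inc U Z) M (tn U M x v)"
  using ev_ops(1)[OF a *(1) tn_carrier[OF U *] b] inc(2)[OF U W s(1) *] inc(2)[OF W Z s(2) *(1) xW *(3)] inc(2)[OF U Z UZ *] by simp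
 qed
qed

text \<open>For disjoint path ideals the restrictions of coefficients are bimodule maps, so the
  decomposition of the ideal passes to the functors. The sum relation is recorded since it is what
  the spanning argument consumes.\<close>

lemma DU_split:
 assumes U: "pideal U" and W: "pideal W" and d: "U \<inter> W = {}"
 obtains r s where "r:hom EE (DU (U \<union> W)) (DU U)" "s:hom EE (DU (U \<union> W)) (DU W)"
  "Add EE (inc U (U \<union> W) oE r) (inc W (U \<union> W) oE s) = Idm EE (DU (U \<union> W))"
proof -
 let ?Z = "U \<union> W"
 have Z: "pideal ?Z" using pideal_Un U W .
 have proj: "EX r. r:hom EE (DU ?Z) (DU X) & (ALL M x v. lm M --> x:I ?Z --> v:V M --> ev r M (tn ?Z M x v) = tn X M (restr X x) v)"
  if X: "pideal X" and Y: "pideal Y" and XY: "X \<union> Y = ?Z" "X \<inter> Y = {}" for X Y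
 proof -
  have dec: "(%p. restr X x p + restr Y x p) = x" if "x:I ?Z" for x :: "('v, 'a) path=>'k"
  proof (rule ext)
  fix p show "restr X x p + restr Y x p = x p"
  using that[unfolded ideal_of_iff, rule_format, of p] XY by (cases "p:X"; cases "p:Y") (auto simp: restr_def)
  qed
  have un: "restr X (%p. x p + y p) = x" if "x:I X" "y:I Y" for x y :: "('v, 'a) path=>'k"
  proof (rule ext)
  fix p show "restr X (%p. x p + y p) p = x p"
  using that[unfolded ideal_of_iff, rule_format, of p] XY by (cases "p:X"; cases "p:Y") (auto simp: restr_def)
  qed
  show ?thesis
  proof (rule bimodule_nat[OF Z X, of "restr X"])
  fix x a :: "('v, 'a) path=>'k" assume x: "x:I ?Z" and a: "a:carrier R"
  \<comment> \<open>a x is the sum of its products with the two restrictions, and each of these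
    stays in its own ideal.\<close>
  show "restr X (a *. x) = a *. restr X x"
  using un[OF lmul_I[OF X restr_ideal a] lmul_I[OF Y restr_ideal a], of x x] mult_add_r[of a "restr X x" "restr Y x"] dec[OF x] by simp
  show "restr X (x *. a) = restr X x *. a"
  using un[OF mul_I[OF X restr_ideal a] mul_I[OF Y restr_ideal a], of x x] mult_add_l[of "restr X x" "restr Y x" a] dec[OF x] by simp
  next
  show "restr X (%p. k * x p) = (%p. k * restr X x p)" for k and x :: "('v, 'a) path=>'k" by (rule ext) (simp add: restr_def)
  show "restr X x:I X" for x :: "('v, 'a) path=>'k" by (rule restr_ideal)
  show "restr X (%p. x p + y p) = (%p. restr X x p + restr X y p)" for x y :: "('v, 'a) path=>'k" by (rule ext) (simp add: restr_def)
  next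
  fix r assume "r:hom EE (DU ?Z) (DU X)" "!!M x v. lm M==>x:I ?Z==>v:V M==>ev r M (tn ?Z M x v) = tn X M (restr X x) v"
  thus ?thesis by (intro exI[of _ r] conjI allI impI)
  qed
 qed
 obtain r where r: "r:hom EE (DU ?Z) (DU U)" "!!M x v. lm M==>x:I ?Z==>v:V M==>ev r M (tn ?Z M x v) = tn U M (restr U x) v"
  using proj[OF U W _ d] by blast
 obtain s where s: "s:hom EE (DU ?Z) (DU W)" "!!M x v. lm M==>x:I ?Z==>v:V M==>ev s M (tn ?Z M x v) = tn W M (restr W x) v"
  using proj[OF W U] d by blast
 have iu: "inc U ?Z:hom EE (DU U) (DU ?Z)" and iw: "inc W ?Z:hom EE (DU W) (DU ?Z)" using inc(1)[OF U Z] inc(1)[OF W Z] by blast+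
 have "Add EE (inc U ?Z oE r) (inc W ?Z oE s) = Idm EE (DU ?Z)"
 proof (rule nat_eq0[OF Z M.E.Add_hom[OF M.E.Cmp_hom[OF iu r(1)] M.E.Cmp_hom[OF iw s(1)]] M.E.Idm_hom[OF DU_Obj[OF Z]]])
  fix M x v assume *: "lm M" "x:I ?Z" "v:V M"
  have t: "tn ?Z M x v:V (fobj (DU ?Z) M)" using tn_carrier[OF Z *] .
  have i: "restr U x:I ?Z" "restr W x:I ?Z" using ideal_of_mono restr_ideal by blast+
  have dec: "(%p. restr U x p + restr W x p) = x"
  proof (rule ext)
  fix p show "restr U x p + restr W x p = x p"
  using *(2)[unfolded ideal_of_iff, rule_format, of p] d by (cases "p:U"; cases "p:W") (auto simp: restr_def)
  qed
  have "ev (inc U ?Z oE r) M (tn ?Z M x v) = tn ?Z M (restr U x) v"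
  using ev_ops(1)[OF r(1) *(1) t iu] r(2)[OF *] inc(2)[OF U Z _ *(1) restr_ideal *(3)] by simp
  moreover have "ev (inc W ?Z oE s) M (tn ?Z M x v) = tn ?Z M (restr W x) v"
  using ev_ops(1)[OF s(1) *(1) t iw] s(2)[OF *] inc(2)[OF W Z _ *(1) restr_ideal *(3)] by simp
  ultimately show "ev (Add EE (inc U ?Z oE r) (inc W ?Z oE s)) M (tn ?Z M x v) = ev (Idm EE (DU ?Z)) M (tn ?Z M x v)"
  using ev_ops(4)[OF M.E.Cmp_hom[OF iu r(1)] *(1) t M.E.Cmp_hom[OF iw s(1)]] ev_ops(2)[OF M.E.Idm_hom[OF DU_Obj[OF Z]] *(1) t]
  tn_bal(1)[OF Z *(1) i *(3)] dec by simp
 qed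
 thus thesis using that r(1) s(1) by blast
qed

text \<open>Induction on the size of W: a disconnected W splits into two smaller ideals, and their
  spans are carried along the inclusions. The zero ideal contributes the empty sum.\<close>

lemma DU_span:
 assumes W: "pideal W"
 shows "Idm EE (DU W):aspan EE (DU W) (DU W) {inc c W oE r | c r. conn c & c <= W & r:hom EE (DU W) (DU c)}"
  (is "_:aspan EE (DU W) (DU W) (?S W)")
 using W
proof (induction "card W" arbitrary: W rule: less_induct)
 case less
 note W = less.prems
 note iW = M.E.Idm_hom[OF DU_Obj[OF W]]
 show ?case
 proof (cases "W = {} \<or> conn W")
  case True
  thus ?thesis
  proof
  assume e: "W = {}"
  have "Idm EE (DU W) = Nul EE (DU W) (DU W)"
  proof (rule nat_eq0[OF W iW M.E.Nul_hom[OF DU_Obj[OF W] DU_Obj[OF W]]])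
  fix M x v assume *: "lm M" "x:I W" "v:V M"
  have x: "x = (%p. 0)" using *(2) e unfolding ideal_of_iff by auto
  have t: "tn W M x v:V (fobj (DU W) M)" using tn_carrier[OF W *] .
  show "ev (Idm EE (DU W)) M (tn W M x v) = ev (Nul EE (DU W) (DU W)) M (tn W M x v)"
  using ev_ops(2,5)[OF iW *(1) t] tn_zero(1)[OF W *(1,3)] x by simp
  qed
  thus ?thesis by (simp only: aspan.nul)
  next
  assume c: "conn W"
  have "Idm EE (DU W) = inc W W oE Idm EE (DU W)" using M.E.Cmp_Idm_right[OF inc(1)[OF W W]] inc_id[OF W] by simp
  thus ?thesis using c iW by (intro aspan.base) blast
  qed
 next
  case False
  then obtain A B where AB: "pideal A" "pideal B" "A \<inter> B = {}" "A \<union> B = W" "A ~= {}" "B ~= {}" using W unfolding conn_def by blast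
  have fW: "finite W" using pideal_finite[OF W] .
  have "A \<subset> W" "B \<subset> W" using AB by blast+
  hence cd: "card A < card W" "card B < card W" using psubset_card_mono[OF fW] by blast+
  obtain r s where rs: "r:hom EE (DU W) (DU A)" "s:hom EE (DU W) (DU B)" "Add EE (inc A W oE r) (inc B W oE s) = Idm EE (DU W)"
  using DU_split[OF AB(1-3)] unfolding AB(4) by blast
  have X: "inc X W oE r:aspan EE (DU W) (DU W) (?S W)"
  if X: "pideal X" "X <= W" "card X < card W" and r: "r:hom EE (DU W) (DU X)" for X r
  proof -
  have sub: "?S X <= hom EE (DU X) (DU X)" using inc(1)[OF _ X(1)] conn_def by blast
  note ih = less.hyps[OF X(3,1)]
  have 1: "Idm EE (DU X) oE r:aspan EE (DU W) (DU X) ((%f. f oE r) ` ?S X)"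
  using M.E.aspan_Cmp_right[OF ih sub r DU_Obj[OF X(1)]] .
  have sub2: "(%f. f oE r) ` ?S X <= hom EE (DU W) (DU X)" using sub M.E.Cmp_hom[OF _ r] by blast
  have 2: "inc X W oE (Idm EE (DU X) oE r):aspan EE (DU W) (DU W) ((oE) (inc X W) ` (%f. f oE r) ` ?S X)"
  using M.E.aspan_Cmp_left[OF 1 sub2 inc(1)[OF X(1) W X(2)] DU_Obj[OF W]] .
  have "(oE) (inc X W) ` (%f. f oE r) ` ?S X <= ?S W"
  proof
  fix y assume "y:(oE) (inc X W) ` (%f. f oE r) ` ?S X"
  then obtain c q where c: "conn c" "c <= X" "q:hom EE (DU X) (DU c)" "y = inc X W oE ((inc c X oE q) oE r)" by blast
  have pc: "pideal c" using c(1) by (simp add: conn_def)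
  note icX = inc(1)[OF pc X(1) c(2)] and iXW = inc(1)[OF X(1) W X(2)]
  have "y = inc c W oE (q oE r)"
  using c(4) M.E.Cmp_assoc[OF icX c(3) r] M.E.Cmp_assoc[OF iXW icX M.E.Cmp_hom[OF c(3) r]] inc_inc[OF pc X(1) W c(2) X(2)] by simp
  thus "y:?S W" using c X(2) M.E.Cmp_hom[OF c(3) r] by blast
  qed
  hence "inc X W oE (Idm EE (DU X) oE r):aspan EE (DU W) (DU W) (?S W)"
  by (intro M.E.aspan_subset[OF 2] subset_trans[OF _ subsetI[OF aspan.base]])
  thus ?thesis using M.E.Cmp_Idm_left[OF r] by simp
  qed
  show ?thesis unfolding rs(3)[symmetric]
  by (rule aspan.add[OF X[OF AB(1) _ cd(1) rs(1)] X[OF AB(2) _ cd(2) rs(2)]]) (use AB(4) in blast)+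
 qed
qed

end

subsection \<open>Composition of dual projection functors\<close>

context tree_paths begin

text \<open>When two factorizations cut the same path at different places, \<open>us\<close> is the
  piece between the cuts; it can be attached to the factor on either side.\<close>

lemma refactor:
 assumes P: "b:P" "b':P" "a:P" and t: "tgt b = fst a" and f: "fst b = fst b'"
  and us: "snd b @ us = snd b'" "snd a = us @ snd a'"
 shows "(tgt b, us):P" "(tgt b, us) \<cdot> b = b'" "a' \<cdot> (tgt b, us) = a" "tgt (tgt b, us) = tgt b'"
proof -
 have "awalk (fst b) (snd b @ us) (tgt b')" using P(2) f us(1) by (simp add: paths_iff)
 hence aw: "awalk (tgt b) us (tgt b')" by (simp add: path_target_def)
 thus "(tgt b, us):P" by (auto simp: paths_def)
 show "tgt (tgt b, us) = tgt b'" using aw by (auto simp: path_target_def)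
 show "(tgt b, us) \<cdot> b = b'" using us f by (simp add: path_comp_def prod_eq_iff)
 show "a' \<cdot> (tgt b, us) = a" using us t by (simp add: path_comp_def prod_eq_iff)
qed

end

context tree_algebra begin

lemma module_zero: "lm M==>w:V M==>snd M (%p. 0) *v w = 0\<^sub>v (fst M)"
proof -
 assume M: "lm M" and w: "w:V M"
 have z: "(%p. 0 :: 'k):carrier R" by (simp add: carrier_R ideal_of_zero)
 show ?thesis
  using lmodD(8)[OF M z, of 0] smult_mat_vec[of w "snd M (%p. 0)" 0] zero_smult_vec[OF mod_vec[OF M z w]] w lmodD(3)[OF M z] by simp
qed

lemma el_mult: "p:P==>q:P==>tgt p = fst q==>el q *. el p = el (q \<cdot> p)"
 and el_mult0: "p:P==>q:P==>tgt p ~= fst q==>el q *. el p = (%p. 0)"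
 by (simp_all add: mult_elem)

text \<open>A balanced map on an ideal may be prescribed on its paths, with compatibility checked
  for composable paths only: for paths that do not compose, inserting a trivial path makes both
  sides zero.\<close>

lemma path_extension:
 fixes b :: "(('v, 'a) path=>'k)=>'k vec=>'k vec"
 assumes Z: "pideal Z" and M: "lm M" and T: "lm T"
  and c: "!!p v. p:Z==>v:V M==>h p v:V T"
  and a: "!!p v w. p:Z==>v:V M==>w:V M==>h p (v + w) = h p v + h p w"
  and s: "!!p v k. p:Z==>v:V M==>h p (k .* v) = k .* h p v"
  and r: "!!p q v. p:Z==>q:P==>tgt q = fst p==>v:V M==>h (p \<cdot> q) v = h p (snd M (el q) *v v)"
  and l: "!!p q v. p:Z==>q:P==>tgt p = fst q==>v:V M==>h (q \<cdot> p) v = snd T (el q) *v h p v"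
  and b: "!!z v. b z v = vec (fst T) (%i. \<Sum>p\<in>Z. z p * h p v $ i)"
 shows "b z v:V T" "b (%p. x p + y p) v = b x v + b y v" "b (%p. k * x p) v = k .* b x v"
  "p:Z==>v:V M==>b (el p) v = h p v" "balanced_map Q (I Z) M (fst T) b"
  "d:carrier R==>z:I Z==>v:V M==>b (d *. z) v = snd T d *v b z v"
proof -
 have fZ: "finite Z" using pideal_finite[OF Z] .
 show bc: "b z v:V T" for z v by (simp add: b)
 show ba: "b (%p. x p + y p) v = b x v + b y v" for x y v by (intro eq_vecI) (simp_all add: b distrib_right sum.distrib)
 show bs: "b (%p. k * x p) v = k .* b x v" for k x v by (intro eq_vecI) (simp_all add: b sum_distrib_left mult.assoc)
 have b0: "b (%p. 0) v = 0\<^sub>v (fst T)" for v by (intro eq_vecI) (simp_all add: b)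
 have hd: "dim_vec (h p v) = fst T" if "p:Z" "v:V M" for p v using c[OF that] by simp
 have bva: "b z (v + w) = b z v + b z w" if v: "v:V M" and w: "w:V M" for z v w
  using v w by (intro eq_vecI) (simp_all add: b a hd distrib_left sum.distrib cong: sum.cong)
 have bvs: "b z (k .* v) = k .* b z v" if v: "v:V M" for z v k
  using v by (intro eq_vecI) (simp_all add: b s hd sum_distrib_left mult.left_commute cong: sum.cong)
 show be: "b (el p) v = h p v" if "p:Z" "v:V M" for p v
 proof (rule eq_vecI)
  fix i assume "i < dim_vec (h p v)"
  hence i: "i < fst T" using hd[OF that] by simp
  have "(\<Sum>q\<in>Z. el p q * h q v $ i) = (\<Sum>q\<in>Z. if q = p then h q v $ i else 0)" by (rule sum.cong) (auto simp: path_elem_def)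
  thus "b (el p) v $ i = h p v $ i" using i fZ that(1) by (simp add: b)
 qed (use hd[OF that] in "simp add: b")
 have h0: "h p (0\<^sub>v (fst M)) = 0\<^sub>v (fst T)" if "p:Z" for p
  using s[OF that, of "0\<^sub>v (fst M)" 0] zero_smult_vec[OF c[OF that, of "0\<^sub>v (fst M)"]] zero_smult_vec[of "0\<^sub>v (fst M) :: 'k vec" "fst M"] by simp
 have ec: "el q:carrier R" if "q:P" for q using elem_carrier[OF that] .
 have tc: "el (fst p, []):carrier R" "el (tgt p, []):carrier R" if "p:P" for p
  using ec triv_paths(1) path_verts[OF that] by blast+
 have right: "b (el p *. el q) v = h p (snd M (el q) *v v)" if p: "p:Z" and q: "q:P" and v: "v:V M" for p q v
 proof (cases "tgt q = fst p")
  case True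
  have pP: "p:P" and pq: "p \<cdot> q:Z" using pidealD(2,4)[OF Z] p q True by blast+
  show ?thesis using be[OF pq v] r[OF p q True v] el_mult[OF q pP True] by simp
 next
  case False
  have pP: "p:P" using pidealD(2)[OF Z p] .
  note w = mod_vec[OF M ec[OF q] v]
  note tp = triv_paths(1)[OF path_verts(1)[OF pP]]
  have z: "el (fst p, []) *. el q = (%p. 0)" using el_mult0[OF q tp] False by simp
  \<comment> \<open>p absorbs the trivial path at its source, while that trivial path annihilates
    q.\<close>
  have "h p (snd M (el q) *v v) = h p (snd M (el (fst p, [])) *v (snd M (el q) *v v))"
  using r[OF p tp _ w] comp_triv(1)[of p] triv_paths(2) by simp
  also have "snd M (el (fst p, [])) *v (snd M (el q) *v v) = snd M (el (fst p, []) *. el q) *v v"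
  using lmodD(6)[OF M tc(1)[OF pP] ec[OF q]]
  amv[OF lmodD(1)[OF M tc(1)[OF pP]] lmodD(1)[OF M ec[OF q]] v] by simp
  also have "... = 0\<^sub>v (fst M)" unfolding z using module_zero[OF M v] .
  finally have "h p (snd M (el q) *v v) = 0\<^sub>v (fst T)" using h0[OF p] by simp
  thus ?thesis using b0 el_mult0[OF q pP False] by simp
 qed
 have left: "b (el q *. el p) v = snd T (el q) *v h p v" if p: "p:Z" and q: "q:P" and v: "v:V M" for p q v
 proof (cases "tgt p = fst q")
  case True
  have pP: "p:P" and pq: "q \<cdot> p:Z" using pidealD(2,3)[OF Z] p q True by blast+
  show ?thesis using be[OF pq v] l[OF p q True v] el_mult[OF pP q True] by simp
 next
  case False
  have pP: "p:P" using pidealD(2)[OF Z p] .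
  note tp = triv_paths(1)[OF path_verts(2)[OF pP]]
  have z: "el q *. el (tgt p, []) = (%p. 0)" using el_mult0[OF tp q] False triv_paths(2) by simp
  have "snd T (el q) *v h p v = snd T (el q) *v (snd T (el (tgt p, [])) *v h p v)"
  using l[OF p tp _ v] comp_triv(2) by simp
  also have "... = snd T (el q *. el (tgt p, [])) *v h p v"
  using lmodD(6)[OF T ec[OF q] tc(2)[OF pP]]
  amv[OF lmodD(1)[OF T ec[OF q]] lmodD(1)[OF T tc(2)[OF pP]] c[OF p v]] by simp
  also have "... = 0\<^sub>v (fst T)" unfolding z using module_zero[OF T c[OF p v]] .
  finally show ?thesis using b0 el_mult0[OF pP q False] by simp
 qed
 have RP: "d:I P \<longleftrightarrow> d:carrier R" for d :: "('v, 'a) path=>'k" by (simp add: carrier_R)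
 have bal: "b (z *. d) v = b z (snd M d *v v)" if d: "d:carrier R" and v: "v:V M" and z: "z:I Z" for d z v
  using d[folded RP] subset_refl
 proof (induction rule: span_induct)
  case zero
  have "b z (0\<^sub>v (fst M)) = 0\<^sub>v (fst T)"
  using bvs[of "0\<^sub>v (fst M)" z 0] zero_smult_vec[of "0\<^sub>v (fst M) :: 'k vec" "fst M"] zero_smult_vec[OF bc[of z "0\<^sub>v (fst M)"]] by simp
  thus ?case using b0 module_zero[OF M v] by (simp add: mult_zero_r)
 next
  case (elem k q)
  note w = mod_vec[OF M ec[OF elem] v]
  have "b (z *. el q) v = b z (snd M (el q) *v v)" using z pidealD(1)[OF Z]
  proof (induction rule: span_induct)
  case zero
  thus ?case using b0 by (simp add: mult_zero_l)
  next
  case (elem m p)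
  thus ?case using right[OF elem \<open>q:P\<close> v] be[OF elem w] by (simp add: mult_scl_l bs)
  next
  case (add x y)
  thus ?case by (simp add: mult_add_l ba)
  qed
  thus ?case
  using lmodD(8)[OF M ec[OF elem], of k] smult_mat_vec[of v "snd M (el q)" k] v lmodD(3)[OF M ec[OF elem]] bvs[OF w]
  by (simp add: mult_scl_r bs)
 next
  case (add x y)
  hence xy: "x:carrier R" "y:carrier R" by (simp_all add: RP)
  show ?case
  using add(3,4) lmodD(7)[OF M xy] amd[OF lmodD(1)[OF M xy(1)] lmodD(1)[OF M xy(2)] v]
  bva[OF mod_vec[OF M xy(1) v] mod_vec[OF M xy(2) v]] by (simp add: mult_add_r ba)
 qed
 show "b (d *. z) v = snd T d *v b z v" if d: "d:carrier R" and z: "z:I Z" and v: "v:V M"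
  using d[folded RP] subset_refl
 proof (induction rule: span_induct)
  case zero
  thus ?case using b0 module_zero[OF T bc] by (simp add: mult_zero_l)
 next
  case (elem k q)
  note Tq = lmodD(1)[OF T ec[OF elem]]
  have "b (el q *. z) v = snd T (el q) *v b z v" using z pidealD(1)[OF Z]
  proof (induction rule: span_induct)
  case zero
  have "snd T (el q) *v 0\<^sub>v (fst T) = 0\<^sub>v (fst T)" using Tq by (intro eq_vecI) auto
  thus ?case using b0 by (simp add: mult_zero_r)
  next
  case (elem m p)
  thus ?case using left[OF elem \<open>q:P\<close> v] be[OF elem v] mult_mat_vec[OF Tq c[OF elem v], of m] by (simp add: mult_scl_r bs)
  next
  case (add x y)
  thus ?case using mad[OF Tq bc bc, of x v y v] by (simp add: mult_add_r ba)
  qed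
  thus ?case
  using lmodD(8)[OF T ec[OF elem], of k] smult_mat_vec[of "b z v" "snd T (el q)" k] bc[of z v] lmodD(3)[OF T ec[OF elem]]
  by (simp add: mult_scl_l bs)
 next
  case (add x y)
  hence xy: "x:carrier R" "y:carrier R" by (simp_all add: RP)
  show ?case
  using add(3,4) lmodD(7)[OF T xy] amd[OF lmodD(1)[OF T xy(1)] lmodD(1)[OF T xy(2)] bc]
  by (simp add: mult_add_l ba)
 qed
 show "balanced_map Q (I Z) M (fst T) b"
  by (rule balancedI) (use bc ba bs bva bvs bal in auto)
qed

lemma tn_mismatch:
 assumes X: "pideal X" and Y: "pideal Y" and M: "lm M" and p: "p:X" and q: "q:Y" and v: "v:V M" and t: "tgt q ~= fst p"
 shows "tn X (fobj (DU Y) M) (el p) (tn Y M (el q) v) = 0\<^sub>v (fst (fobj (DU X) (fobj (DU Y) M)))"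
proof -
 note YM = DU_lm[OF Y M]
 have pP: "p:P" and qP: "q:P" using pidealD(2) X Y p q by blast+
 note tp = triv_paths(1)[OF path_verts(1)[OF pP]]
 have ep: "el p:I X" and eq: "el q:I Y" using p q by (simp_all add: ideal_of_elem)
 have "tn X (fobj (DU Y) M) (el p) (tn Y M (el q) v) = tn X (fobj (DU Y) M) (el p *. el (fst p, [])) (tn Y M (el q) v)"
  using el_mult[OF tp pP] triv_paths(2) comp_triv(1)[of p] by simp
 also have "... = tn X (fobj (DU Y) M) (el p) (tn Y M (el (fst p, []) *. el q) v)"
  using tn_bal(5)[OF X YM ep elem_carrier[OF tp] tn_carrier[OF Y M eq v]] tn_act[OF Y M elem_carrier[OF tp] eq v] by simp
 also have "el (fst p, []) *. el q = (%p. 0)" using el_mult0[OF qP tp] t by simp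
 finally show ?thesis using tn_zero(1)[OF Y M v] tn_zero(2)[OF X YM ep] by simp
qed

text \<open>The piece between the two cuts is moved across the tensor sign; hence the tensor
  attached to a path is independent of where it is cut.\<close>

lemma tn_refactor:
 assumes X: "pideal X" and Y: "pideal Y" and M: "lm M" and v: "v:V M"
  and a: "a:X" "a':X" and b: "b:Y" "b':Y" and t: "tgt b = fst a" "tgt b' = fst a'" and e: "a \<cdot> b = a' \<cdot> b'"
 shows "tn X (fobj (DU Y) M) (el a) (tn Y M (el b) v) = tn X (fobj (DU Y) M) (el a') (tn Y M (el b') v)"
proof -
 note YM = DU_lm[OF Y M]
 have shift: "tn X (fobj (DU Y) M) (el a) (tn Y M (el b) v) = tn X (fobj (DU Y) M) (el a') (tn Y M (el b') v)"
  if a: "a:X" "a':X" and b: "b:Y" "b':Y" and t: "tgt b = fst a" "tgt b' = fst a'" and f: "fst b = fst b'"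
  and us: "snd b @ us = snd b'" "snd a = us @ snd a'" for a a' b b' us
 proof -
  have P: "b:P" "b':P" "a:P" "a':P" using pidealD(2) X Y a b by blast+
  note rf = refactor[OF P(1-3) t(1) f us]
  let ?c = "(tgt b, us)"
  have ea: "el a = el a' *. el ?c" using el_mult[OF rf(1) P(4)] rf(3,4) t by simp
  have eb: "el b' = el ?c *. el b" using el_mult[OF P(1) rf(1)] rf(2) by simp
  have ia: "el a':I X" and ib: "el b:I Y" using a b by (simp_all add: ideal_of_elem)
  show ?thesis unfolding ea eb
  using tn_bal(5)[OF X YM ia elem_carrier[OF rf(1)] tn_carrier[OF Y M ib v]] tn_act[OF Y M elem_carrier[OF rf(1)] ib v] by simp
 qed
 have f: "fst b = fst b'" and s: "snd b @ snd a = snd b' @ snd a'" using e by (simp_all add: path_comp_def)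
 obtain us where "snd b = snd b' @ us & us @ snd a = snd a' \<or> snd b @ us = snd b' & snd a = us @ snd a'"
  using s unfolding append_eq_append_conv2 by blast
 thus ?thesis
 proof
  assume "snd b = snd b' @ us & us @ snd a = snd a'"
  thus ?thesis using shift[OF a(2,1) b(2,1) t(2,1) f[symmetric], of us] by simp
 next
  assume "snd b @ us = snd b' & snd a = us @ snd a'"
  thus ?thesis using shift[OF a b t f, of us] by simp
 qed
qed

text \<open>Built in two stages, since the second factor is itself a tensor product: for fixed x the
  universal property of \<open>DU Y\<close> gives a matrix \<open>L M x\<close>, and then the
  dependence on x is shown to be balanced.\<close>

lemma tensor_mult_ex:
 assumes X: "pideal X" and Y: "pideal Y"
 shows "EX av. av:hom EE (M.hcomp (DU X) (DU Y)) (DU (pmul X Y)) &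
  (ALL M x y v. lm M --> x:I X --> y:I Y --> v:V M --> ev av M (tn X (fobj (DU Y) M) x (tn Y M y v)) = tn (pmul X Y) M (x *. y) v)"
proof -
 let ?Z = "pmul X Y"
 have Z: "pideal ?Z" using pideal_pmul[OF X Y] .
 have xy: "x *. y:I ?Z" if "x:I X" "y:I Y" for x y :: "('v, 'a) path=>'k"
  using mult_ideal_of[OF _ that, of ?Z] pmulI by blast
 have "EX L. lm M --> x:I X --> L:carrier_mat (fst (fobj (DU ?Z) M)) (fst (fobj (DU Y) M)) &
  (ALL y:I Y. ALL v:V M. L *v tn Y M y v = tn ?Z M (x *. y) v)" for M x
 proof (cases "lm M & x:I X")
  case True
  hence M: "lm M" and x: "x:I X" by blast+
  have xc: "x:carrier R" using I_carrier[OF X x] .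
  have "balanced_map Q (I Y) M (fst (fobj (DU ?Z) M)) (%y. tn ?Z M (x *. y))"
  proof (rule balancedI)
  fix y d :: "('v, 'a) path=>'k" and v assume y: "y:I Y" and d: "d:carrier R" and v: "v:V M"
  show "tn ?Z M (x *. (y *. d)) v = tn ?Z M (x *. y) (snd M d *v v)"
  using tn_bal(5)[OF Z M xy[OF x y] d v] mult_assoc_R[OF xc I_carrier[OF Y y] d] by simp
  qed (use tn_bal[OF Z M] tn_carrier[OF Z M] xy[OF x] in "simp_all add: mult_add_r mult_scl_r")
  thus ?thesis using tensorD(3)[OF DU_all(2)[OF Y M]] by blast
 qed blast
 hence "EX L. ALL M x. lm M --> x:I X --> L M x:carrier_mat (fst (fobj (DU ?Z) M)) (fst (fobj (DU Y) M)) &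
  (ALL y:I Y. ALL v:V M. L M x *v tn Y M y v = tn ?Z M (x *. y) v)" by (intro choice allI)
 then obtain L where L: "ALL M x. lm M --> x:I X --> L M x:carrier_mat (fst (fobj (DU ?Z) M)) (fst (fobj (DU Y) M)) &
  (ALL y:I Y. ALL v:V M. L M x *v tn Y M y v = tn ?Z M (x *. y) v)" by (elim exE)
 have Lc: "!!M x. lm M==>x:I X==>L M x:carrier_mat (fst (fobj (DU ?Z) M)) (fst (fobj (DU Y) M))"
  and Lt: "!!M x y v. lm M==>x:I X==>y:I Y==>v:V M==>L M x *v tn Y M y v = tn ?Z M (x *. y) v" using L by blast+
 note Leq = tensor_eq[OF DU_all(2)[OF Y]]
 have La: "L M (d *. x) = snd (fobj (DU ?Z) M) d * L M x" if M: "lm M" and d: "d:carrier R" and x: "x:I X" for M d x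
 proof (rule Leq[OF M Lc[OF M lmul_I[OF X x d]]])
  note Zd = lmodD(1)[OF DU_lm[OF Z M] d]
  show "snd (fobj (DU ?Z) M) d * L M x:carrier_mat (fst (fobj (DU ?Z) M)) (fst (fobj (DU Y) M))" using Zd Lc[OF M x] by simp
  fix y v assume y: "y:I Y" and v: "v:V M"
  show "L M (d *. x) *v tn Y M y v = snd (fobj (DU ?Z) M) d * L M x *v tn Y M y v"
  using Lt[OF M lmul_I[OF X x d] y v] Lt[OF M x y v] amv[OF Zd Lc[OF M x] tn_carrier[OF Y M y v]]
  tn_act[OF Z M d xy[OF x y] v] mult_assoc_R[OF d I_carrier[OF X x] I_carrier[OF Y y]] by simp
 qed
 show ?thesis
 proof (rule nat_ex[OF X DU_all(1)[OF Y] DU_all(1)[OF Z], of "%M x w. L M x *v w"])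
  fix M assume M: "lm M"
  note LM = Lc[OF M]
  show "balanced_map Q (I X) (fobj (DU Y) M) (fst (fobj (DU ?Z) M)) (%x v. L M x *v v)"
  proof (rule balancedI)
  fix x :: "('v, 'a) path=>'k" and w assume x: "x:I X" and w: "w:V (fobj (DU Y) M)"
  show "L M x *v w:V (fobj (DU ?Z) M)" using mvc[OF LM[OF x] w] .
  show "L M x *v (w + w') = L M x *v w + L M x *v w'" if "w':V (fobj (DU Y) M)" for w'
  using mad[OF LM[OF x] w that] .
  show "L M x *v (k .* w) = k .* (L M x *v w)" for k using mult_mat_vec[OF LM[OF x] w] .
  have "L M (%p. k * x p) = k \<cdot>\<^sub>m L M x" for k
  proof (rule Leq[OF M LM[OF ideal_of_scl[OF x]] smult_carrier_mat[OF LM[OF x]]])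
  fix y v assume y: "y:I Y" and v: "v:V M"
  show "L M (%p. k * x p) *v tn Y M y v = (k \<cdot>\<^sub>m L M x) *v tn Y M y v"
  using Lt[OF M ideal_of_scl[OF x] y v] Lt[OF M x y v] smult_mat_vec[of "tn Y M y v" "L M x" k] LM[OF x] tn_carrier[OF Y M y v]
  tn_bal(3)[OF Z M xy[OF x y] v] by (simp add: mult_scl_l)
  qed
  thus "L M (%p. k * x p) *v w = k .* (L M x *v w)" for k using smult_mat_vec[of w "L M x" k] LM[OF x] w by simp
  show "L M (%p. x p + x' p) *v w = L M x *v w + L M x' *v w" if x': "x':I X" for x'
  proof -
  have "L M (%p. x p + x' p) = L M x + L M x'"
  proof (rule Leq[OF M LM[OF ideal_of_add[OF x x']] add_carrier_mat[OF LM[OF x']]])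
  fix y v assume y: "y:I Y" and v: "v:V M"
  show "L M (%p. x p + x' p) *v tn Y M y v = (L M x + L M x') *v tn Y M y v"
  using Lt[OF M ideal_of_add[OF x x'] y v] Lt[OF M x y v] Lt[OF M x' y v]
  amd[OF LM[OF x] LM[OF x'] tn_carrier[OF Y M y v]] tn_bal(1)[OF Z M xy[OF x y] xy[OF x' y] v] by (simp add: mult_add_l)
  qed
  thus ?thesis using amd[OF LM[OF x] LM[OF x'] w] by simp
  qed
  show "L M (x *. d) *v w = L M x *v (snd (fobj (DU Y) M) d *v w)" if d: "d:carrier R" for d
  proof -
  note Yd = lmodD(1)[OF DU_lm[OF Y M] d]
  have "L M (x *. d) = L M x * snd (fobj (DU Y) M) d"
  proof (rule Leq[OF M LM[OF mul_I[OF X x d]] mult_carrier_mat[OF LM[OF x] Yd]])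
  fix y v assume y: "y:I Y" and v: "v:V M"
  show "L M (x *. d) *v tn Y M y v = (L M x * snd (fobj (DU Y) M) d) *v tn Y M y v"
  using Lt[OF M mul_I[OF X x d] y v] Lt[OF M x lmul_I[OF Y y d] v] amv[OF LM[OF x] Yd tn_carrier[OF Y M y v]]
  tn_act[OF Y M d y v] mult_assoc_R[OF I_carrier[OF X x] d I_carrier[OF Y y]] by simp
  qed
  thus ?thesis using amv[OF LM[OF x] Yd w] by simp
  qed
  qed
  fix d :: "('v, 'a) path=>'k" and x w assume d: "d:carrier R" and x: "x:I X" and w: "w:V (fobj (DU Y) M)"
  show "L M (d *. x) *v w = snd (fobj (DU ?Z) M) d *v (L M x *v w)"
  unfolding La[OF M d x] using amv[OF lmodD(1)[OF DU_lm[OF Z M] d] LM[OF x] w] .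
 next
  fix f M N x w assume f: "f:hom Mc M N" and x: "x:I X" and w: "w:V (fobj (DU Y) M)"
  have lm: "lm M" "lm N" using f by (auto simp: hom_Mc)
  have fc: "dat f:carrier_mat (fst N) (fst M)" using f by (auto simp: hom_Mc)
  have Zf: "dat (farr (DU ?Z) f):carrier_mat (fst (fobj (DU ?Z) N)) (fst (fobj (DU ?Z) M))"
  and Yf: "dat (farr (DU Y) f):carrier_mat (fst (fobj (DU Y) N)) (fst (fobj (DU Y) M))"
  using M.lfunD(3)[OF DU_all(1)[OF Z] f] M.lfunD(3)[OF DU_all(1)[OF Y] f] by (auto simp: hom_Mc)
  have "dat (farr (DU ?Z) f) * L M x = L N x * dat (farr (DU Y) f)"
  proof (rule Leq[OF lm(1) mult_carrier_mat[OF Zf Lc[OF lm(1) x]] mult_carrier_mat[OF Lc[OF lm(2) x] Yf]])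
  fix y v assume y: "y:I Y" and v: "v:V M"
  note t = tn_carrier[OF Y lm(1) y v]
  show "(dat (farr (DU ?Z) f) * L M x) *v tn Y M y v = (L N x * dat (farr (DU Y) f)) *v tn Y M y v"
  using amv[OF Zf Lc[OF lm(1) x] t] amv[OF Lc[OF lm(2) x] Yf t] Lt[OF lm(1) x y v]
  Lt[OF lm(2) x y mvc[OF fc v]] DU_all(3)[OF Z f xy[OF x y] v] DU_all(3)[OF Y f y v] by simp
  qed
  thus "dat (farr (DU ?Z) f) *v (L M x *v w) = L N x *v (dat (farr (DU Y) f) *v w)"
  using amv[OF Zf Lc[OF lm(1) x] w] amv[OF Lc[OF lm(2) x] Yf w] by simp
 next
  fix av assume av: "av:hom EE (M.hcomp (DU X) (DU Y)) (DU ?Z)"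
  and e: "!!M x w. lm M==>x:I X==>w:V (fobj (DU Y) M)==>ev av M (tn X (fobj (DU Y) M) x w) = L M x *v w"
  show ?thesis
  proof (intro exI[of _ av] conjI allI impI)
  fix M x y v assume *: "lm M" "x:I X" "y:I Y" "v:V M"
  show "ev av M (tn X (fobj (DU Y) M) x (tn Y M y v)) = tn ?Z M (x *. y) v"
  using e[OF *(1,2) tn_carrier[OF Y *(1,3,4)]] Lt[OF *] by simp
  qed (rule av)
 qed
qed

text \<open>The inverse of multiplication sends a path of the product ideal to the tensor of a
  chosen factorization into l p and r p. Independence of this choice, by \<open>tn_refactor\<close>,
  is what makes it compatible with multiplication on both sides.\<close>

lemma tensor_split_ex:
 assumes X: "pideal X" and Y: "pideal Y"
 shows "EX bv. bv:hom EE (DU (pmul X Y)) (M.hcomp (DU X) (DU Y)) &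
  (ALL M p q v. lm M --> p:X --> q:Y --> tgt q = fst p --> v:V M -->
  ev bv M (tn (pmul X Y) M (el (p \<cdot> q)) v) = tn X (fobj (DU Y) M) (el p) (tn Y M (el q) v))"
proof -
 let ?Z = "pmul X Y" and ?T = "%M. fobj (DU X) (fobj (DU Y) M)"
 have Z: "pideal ?Z" using pideal_pmul[OF X Y] .
 have "EX a b. p:?Z --> a:X & b:Y & tgt b = fst a & a \<cdot> b = p" for p unfolding pmul_def by blast
 then obtain l r where lr: "!!p. p:?Z==>l p:X & r p:Y & tgt (r p) = fst (l p) & l p \<cdot> r p = p" by metis
 define h where "h M p v = tn X (fobj (DU Y) M) (el (l p)) (tn Y M (el (r p)) v)" for M p v
 define b where "b M z v = vec (fst (?T M)) (%i. \<Sum>p\<in>?Z. z p * h M p v $ i)" for M z v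
 have elc: "el (l p):I X" "el (r p):I Y" if "p:?Z" for p using lr[OF that] by (simp_all add: ideal_of_elem)
 have hI: "h M (p \<cdot> q) v = tn X (fobj (DU Y) M) (el p) (tn Y M (el q) v)"
  if M: "lm M" and p: "p:X" and q: "q:Y" and t: "tgt q = fst p" and v: "v:V M" for M p q v
  unfolding h_def using lr[OF pmulI[OF p q t]] tn_refactor[OF X Y M v _ p _ q _ t] by blast
 have ext: "b M z v:V (?T M)" "b M (%p. x p + y p) v = b M x v + b M y v" "b M (%p. k * x p) v = k .* b M x v"
  "p:?Z==>v:V M==>b M (el p) v = h M p v" "balanced_map Q (I ?Z) M (fst (?T M)) (b M)"
  "d:carrier R==>z:I ?Z==>v:V M==>b M (d *. z) v = snd (?T M) d *v b M z v" if M: "lm M" for M z v x y k p d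
 proof -
  note YM = DU_lm[OF Y M] and XYM = DU_lm[OF X DU_lm[OF Y M]]
  have 1: "h M p v:V (?T M)" if "p:?Z" "v:V M" for p v
  unfolding h_def using tn_carrier[OF X YM elc(1) tn_carrier[OF Y M elc(2)]] that by blast
  have 2: "h M p (v + w) = h M p v + h M p w" if "p:?Z" "v:V M" "w:V M" for p v w
  unfolding h_def using tn_bal(2)[OF Y M elc(2)[OF that(1)] that(2,3)]
  tn_bal(2)[OF X YM elc(1)[OF that(1)] tn_carrier[OF Y M elc(2)[OF that(1)] that(2)] tn_carrier[OF Y M elc(2)[OF that(1)] that(3)]] by simp
  have 3: "h M p (k .* v) = k .* h M p v" if "p:?Z" "v:V M" for p v k
  unfolding h_def using tn_bal(4)[OF Y M elc(2)[OF that(1)] that(2)]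
  tn_bal(4)[OF X YM elc(1)[OF that(1)] tn_carrier[OF Y M elc(2)[OF that(1)] that(2)]] by simp
  have 4: "h M (p \<cdot> q) v = h M p (snd M (el q) *v v)" if p: "p:?Z" and q: "q:P" and t: "tgt q = fst p" and v: "v:V M" for p q v
  proof -
  have f: "l p:X" "r p:Y" "tgt (r p) = fst (l p)" "l p \<cdot> r p = p" using lr[OF p] by blast+
  have fr: "fst (r p) = fst p" using comp_fst[of "l p" "r p"] f(4) by simp
  have rP: "r p:P" using pidealD(2)[OF Y f(2)] .
  have tq: "tgt q = fst (r p)" using t fr by simp
  have "p \<cdot> q = l p \<cdot> (r p \<cdot> q)" using f(4) comp_assoc[of "l p" "r p" q] by simp
  hence "h M (p \<cdot> q) v = tn X (fobj (DU Y) M) (el (l p)) (tn Y M (el (r p \<cdot> q)) v)"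
  using hI[OF M f(1) pidealD(4)[OF Y f(2) q tq] _ v] comp_tgt[OF q rP tq] f(3) by simp
  also have "tn Y M (el (r p \<cdot> q)) v = tn Y M (el (r p)) (snd M (el q) *v v)"
  using tn_bal(5)[OF Y M elc(2)[OF p] elem_carrier[OF q] v] el_mult[OF q rP tq] by simp
  finally show ?thesis by (simp add: h_def)
  qed
  have 5: "h M (q \<cdot> p) v = snd (?T M) (el q) *v h M p v" if p: "p:?Z" and q: "q:P" and t: "tgt p = fst q" and v: "v:V M" for p q v
  proof -
  have f: "l p:X" "r p:Y" "tgt (r p) = fst (l p)" "l p \<cdot> r p = p" using lr[OF p] by blast+
  have lP: "l p:P" and rP: "r p:P" using pidealD(2)[OF X f(1)] pidealD(2)[OF Y f(2)] .
  have tq: "tgt (l p) = fst q" using t f(4) comp_tgt[OF rP lP f(3)] by simp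
  have "q \<cdot> p = (q \<cdot> l p) \<cdot> r p" using f(4) comp_assoc[of q "l p" "r p"] by simp
  hence "h M (q \<cdot> p) v = tn X (fobj (DU Y) M) (el (q \<cdot> l p)) (tn Y M (el (r p)) v)"
  using hI[OF M pidealD(3)[OF X f(1) q tq] f(2) _ v] f(3) by simp
  thus ?thesis
  using tn_act[OF X YM elem_carrier[OF q] elc(1)[OF p] tn_carrier[OF Y M elc(2)[OF p] v]] el_mult[OF lP q tq] by (simp add: h_def)
  qed
  note E = path_extension[OF Z M XYM 1 2 3 4 5 b_def]
  show "b M z v:V (?T M)" "b M (%p. x p + y p) v = b M x v + b M y v" "b M (%p. k * x p) v = k .* b M x v"
  "p:?Z==>v:V M==>b M (el p) v = h M p v" "balanced_map Q (I ?Z) M (fst (?T M)) (b M)"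
  "d:carrier R==>z:I ?Z==>v:V M==>b M (d *. z) v = snd (?T M) d *v b M z v"
  using E by blast+
 qed
 show ?thesis
 proof (rule nat_ex0[OF Z M.hcomp_linear[OF DU_all(1)[OF X] DU_all(1)[OF Y]], unfolded M.hcomp_sel, of b])
  show "balanced_map Q (I ?Z) M (fst (?T M)) (b M)" if "lm M" for M using ext(5)[OF that] .
  show "b M (d *. z) v = snd (?T M) d *v b M z v" if "lm M" "d:carrier R" "z:I ?Z" "v:V M" for M d z v
  using ext(6)[OF that] .
 next
  fix f M N z v assume f: "f:hom Mc M N" and z: "z:I ?Z" and v: "v:V M"
  have lm: "lm M" "lm N" and fc: "dat f:carrier_mat (fst N) (fst M)" using f by (auto simp: hom_Mc)
  have Yf: "farr (DU Y) f:hom Mc (fobj (DU Y) M) (fobj (DU Y) N)" using M.lfunD(3)[OF DU_all(1)[OF Y] f] .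
  let ?f = "dat (farr (DU X) (farr (DU Y) f))"
  have Xf: "?f:carrier_mat (fst (?T N)) (fst (?T M))"
  using M.lfunD(3)[OF DU_all(1)[OF X] Yf] by (auto simp: hom_Mc)
  note fv = mvc[OF fc v]
  show "?f *v b M z v = b N z (dat f *v v)" using z pidealD(1)[OF Z]
  proof (induction rule: span_induct)
  case zero
  have "?f *v 0\<^sub>v (fst (?T M)) = 0\<^sub>v (fst (?T N))" using Xf by (intro eq_vecI) auto
  moreover have "b L (%p. 0) v = 0\<^sub>v (fst (?T L))" for L v unfolding b_def by (intro eq_vecI) auto
  ultimately show ?case by simp
  next
  case (elem k p)
  have "?f *v h M p v = h N p (dat f *v v)"
  unfolding h_def using DU_all(3)[OF X Yf elc(1)[OF elem] tn_carrier[OF Y lm(1) elc(2)[OF elem] v]] DU_all(3)[OF Y f elc(2)[OF elem] v] by simp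
  thus ?case
  using ext(3)[OF lm(1), of k "el p" v] ext(3)[OF lm(2), of k "el p" "dat f *v v"] ext(4)[OF lm(1) elem v] ext(4)[OF lm(2) elem fv]
  mult_mat_vec[OF Xf ext(1)[OF lm(1), of "el p" v], of k] by simp
  next
  case (add x y)
  thus ?case
  using ext(2)[OF lm(1), of x y v] ext(2)[OF lm(2), of x y "dat f *v v"]
  mad[OF Xf ext(1)[OF lm(1)] ext(1)[OF lm(1)], of x v y v] by simp
  qed
 next
  fix bv assume bv: "bv:hom EE (DU ?Z) (M.hcomp (DU X) (DU Y))"
  and e: "!!M z v. lm M==>z:I ?Z==>v:V M==>ev bv M (tn ?Z M z v) = b M z v"
  show ?thesis
  proof (intro exI[of _ bv] conjI allI impI)
  fix M p q v assume *: "lm M" "p:X" "q:Y" "tgt q = fst p" "v:V M"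
  have z: "p \<cdot> q:?Z" using pmulI[OF *(2-4)] .
  hence "el (p \<cdot> q):I ?Z" by (simp add: ideal_of_elem)
  thus "ev bv M (tn ?Z M (el (p \<cdot> q)) v) = tn X (fobj (DU Y) M) (el p) (tn Y M (el q) v)"
  using e[OF *(1) _ *(5)] ext(4)[OF *(1) z *(5)] hI[OF *] by simp
  qed (rule bv)
 qed
qed

definition mu where
 "mu X Y = (SOME av. av:hom EE (M.hcomp (DU X) (DU Y)) (DU (pmul X Y)) &
  (ALL M x y v. lm M --> x:I X --> y:I Y --> v:V M --> ev av M (tn X (fobj (DU Y) M) x (tn Y M y v)) = tn (pmul X Y) M (x *. y) v))"

definition mu' where
 "mu' X Y = (SOME bv. bv:hom EE (DU (pmul X Y)) (M.hcomp (DU X) (DU Y)) &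
  (ALL M p q v. lm M --> p:X --> q:Y --> tgt q = fst p --> v:V M -->
  ev bv M (tn (pmul X Y) M (el (p \<cdot> q)) v) = tn X (fobj (DU Y) M) (el p) (tn Y M (el q) v)))"

lemma mu:
 assumes X: "pideal X" and Y: "pideal Y"
 shows "mu X Y:hom EE (M.hcomp (DU X) (DU Y)) (DU (pmul X Y))"
  "lm M==>x:I X==>y:I Y==>v:V M==>ev (mu X Y) M (tn X (fobj (DU Y) M) x (tn Y M y v)) = tn (pmul X Y) M (x *. y) v"
 using someI_ex[OF tensor_mult_ex[OF X Y]] unfolding mu_def[symmetric] by blast+

lemma mu':
 assumes X: "pideal X" and Y: "pideal Y"
 shows "mu' X Y:hom EE (DU (pmul X Y)) (M.hcomp (DU X) (DU Y))"
  "lm M==>p:X==>q:Y==>tgt q = fst p==>v:V M ==>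
  ev (mu' X Y) M (tn (pmul X Y) M (el (p \<cdot> q)) v) = tn X (fobj (DU Y) M) (el p) (tn Y M (el q) v)"
 using someI_ex[OF tensor_split_ex[OF X Y]] unfolding mu'_def[symmetric] by blast+

lemma mu_mu':
 assumes X: "pideal X" and Y: "pideal Y"
 shows "mu X Y oE mu' X Y = Idm EE (DU (pmul X Y))" "mu' X Y oE mu X Y = Idm EE (M.hcomp (DU X) (DU Y))"
proof -
 let ?Z = "pmul X Y"
 have Z: "pideal ?Z" using pideal_pmul[OF X Y] .
 note m = mu(1)[OF X Y] and m' = mu'(1)[OF X Y]
 have HO: "M.hcomp (DU X) (DU Y):Obj EE" using M.hcomp_linear[OF DU_all(1)[OF X] DU_all(1)[OF Y]] by (simp add: M.Obj_E)
 show "mu X Y oE mu' X Y = Idm EE (DU ?Z)"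
 proof (rule nat_eq_el0[OF Z M.E.Cmp_hom[OF m m'] M.E.Idm_hom[OF DU_Obj[OF Z]]])
  fix M p v assume *: "lm M" "p:?Z" "v:V M"
  obtain a b where ab: "a:X" "b:Y" "tgt b = fst a" "p = a \<cdot> b" using *(2) unfolding pmul_def by blast
  have el: "el a:I X" "el b:I Y" "el p:I ?Z" using ab *(2) by (simp_all add: ideal_of_elem)
  have P: "b:P" "a:P" using pidealD(2)[OF Y ab(2)] pidealD(2)[OF X ab(1)] .
  note t = tn_carrier[OF Z *(1) el(3) *(3)]
  show "ev (mu X Y oE mu' X Y) M (tn ?Z M (el p) v) = ev (Idm EE (DU ?Z)) M (tn ?Z M (el p) v)"
  using ev_ops(1)[OF m' *(1) t m] ev_ops(2)[OF M.E.Idm_hom[OF DU_Obj[OF Z]] *(1) t] mu'(2)[OF X Y *(1) ab(1-3) *(3)]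
  mu(2)[OF X Y *(1) el(1,2) *(3)] el_mult[OF P ab(3)] ab(4) by simp
 qed
 show "mu' X Y oE mu X Y = Idm EE (M.hcomp (DU X) (DU Y))"
 proof (rule nat_eq2[OF X Y M.E.Cmp_hom[OF m' m] M.E.Idm_hom[OF HO]])
  fix M p q v assume *: "lm M" "p:X" "q:Y" "v:V M"
  have el: "el p:I X" "el q:I Y" using * by (simp_all add: ideal_of_elem)
  have P: "q:P" "p:P" using pidealD(2)[OF Y *(3)] pidealD(2)[OF X *(2)] .
  note t = tn_carrier[OF X DU_lm[OF Y *(1)] el(1) tn_carrier[OF Y *(1) el(2) *(4)]]
  note t' = t[folded M.hcomp_sel]
  have "ev (mu' X Y) M (tn ?Z M (el p *. el q) v) = tn X (fobj (DU Y) M) (el p) (tn Y M (el q) v)"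
  proof (cases "tgt q = fst p")
  case True
  thus ?thesis using mu'(2)[OF X Y *(1-3) True *(4)] el_mult[OF P True] by simp
  next
  case False
  thus ?thesis
  using tn_mismatch[OF X Y *(1-4) False] el_mult0[OF P False] tn_zero(1)[OF Z *(1,4)] ev_lin(3)[OF m' *(1)] by (simp add: M.hcomp_sel)
  qed
  thus "ev (mu' X Y oE mu X Y) M (tn X (fobj (DU Y) M) (el p) (tn Y M (el q) v)) =
  ev (Idm EE (M.hcomp (DU X) (DU Y))) M (tn X (fobj (DU Y) M) (el p) (tn Y M (el q) v))"
  using ev_ops(1)[OF m *(1) t' m'] ev_ops(2)[OF M.E.Idm_hom[OF HO] *(1) t'] mu(2)[OF X Y *(1) el *(4)] by simp
 qed
qed

text \<open>Replaces whiskered inclusions by inclusions of product ideals, so that the action of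
  Dp_I on generators becomes arithmetic of ideals.\<close>

lemma mu_natural:
 assumes X: "pideal X" and Y: "pideal Y" and W: "pideal W" and YW: "Y <= W"
 shows "mu X W oE M.harr (Idm EE (DU X)) (inc Y W) = inc (pmul X Y) (pmul X W) oE mu X Y"
proof -
 note ZY = pideal_pmul[OF X Y] and ZW = pideal_pmul[OF X W]
 note s = pmul_mono[OF YW, of X]
 note iY = inc(1)[OF Y W YW] and iZ = inc(1)[OF ZY ZW s] and mY = mu(1)[OF X Y] and mW = mu(1)[OF X W]
 note h = M.harr_hom[OF M.E.Idm_hom[OF DU_Obj[OF X]] iY]
 show ?thesis
 proof (rule nat_eq2[OF X Y M.E.Cmp_hom[OF mW h] M.E.Cmp_hom[OF iZ mY]])
  fix M p q v assume *: "lm M" "p:X" "q:Y" "v:V M"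
  have el: "el p:I X" "el q:I Y" "el q:I W" using * YW by (auto simp: ideal_of_elem)
  have pq: "el p *. el q:I (pmul X Y)" using mult_ideal_of[OF _ el(1,2), of "pmul X Y"] pmulI by blast
  note tY = tn_carrier[OF Y *(1) el(2) *(4)]
  note t = tn_carrier[OF X DU_lm[OF Y *(1)] el(1) tY]
  note t' = t[folded M.hcomp_sel]
  have "ev (mu X W oE M.harr (Idm EE (DU X)) (inc Y W)) M (tn X (fobj (DU Y) M) (el p) (tn Y M (el q) v)) = tn (pmul X W) M (el p *. el q) v"
  using ev_ops(1)[OF h *(1) t' mW] ev_harr[OF X iY *(1) el(1) tY] inc(2)[OF Y W YW *(1) el(2) *(4)] mu(2)[OF X W *(1) el(1,3) *(4)] by simp
  moreover have "ev (inc (pmul X Y) (pmul X W) oE mu X Y) M (tn X (fobj (DU Y) M) (el p) (tn Y M (el q) v)) = tn (pmul X W) M (el p *. el q) v"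
  using ev_ops(1)[OF mY *(1) t' iZ] mu(2)[OF X Y *(1) el(1,2) *(4)] inc(2)[OF ZY ZW s *(1) pq *(4)] by simp
  ultimately show "ev (mu X W oE M.harr (Idm EE (DU X)) (inc Y W)) M (tn X (fobj (DU Y) M) (el p) (tn Y M (el q) v)) =
  ev (inc (pmul X Y) (pmul X W) oE mu X Y) M (tn X (fobj (DU Y) M) (el p) (tn Y M (el q) v))" by simp
 qed
qed

end

context tree_algebra begin

subsection \<open>Morphisms between dual projection functors\<close>

text \<open>An enumeration of the paths, giving coordinates for the regular module as a column
  space.\<close>

definition pidx :: "nat=>('v, 'a) path" where
 "pidx = (SOME f. bij_betw f {..<card P} P)"

lemma pidx: "bij_betw pidx {..<card P} P"
proof -
 have "EX f. bij_betw f {..<card P} P" using ex_bij_betw_nat_finite[OF finite_paths] by (simp add: atLeast0LessThan)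
 thus ?thesis unfolding pidx_def by (rule someI_ex)
qed

definition vec_of :: "(('v, 'a) path=>'k)=>'k vec" where "vec_of x = vec (card P) (%i. x (pidx i))"
definition elem_of :: "'k vec=>(('v, 'a) path=>'k)" where
 "elem_of v = (%p. if p:P then v $ (the_inv_into {..<card P} pidx p) else 0)"

lemma pidx_inv: "p:P==>the_inv_into {..<card P} pidx p < card P" "p:P==>pidx (the_inv_into {..<card P} pidx p) = p"
 "i < card P==>the_inv_into {..<card P} pidx (pidx i) = i" "i < card P==>pidx i:P"
proof -
 have inj: "inj_on pidx {..<card P}" and im: "pidx ` {..<card P} = P" using pidx by (auto simp: bij_betw_def)
 show "p:P==>the_inv_into {..<card P} pidx p < card P" using the_inv_into_into[OF inj, of p "{..<card P}"] im by auto
 show "p:P==>pidx (the_inv_into {..<card P} pidx p) = p" using f_the_inv_into_f[OF inj, of p] im by auto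
 show "i < card P==>the_inv_into {..<card P} pidx (pidx i) = i" using the_inv_into_f_f[OF inj, of i] by auto
 show "i < card P==>pidx i:P" using im by blast
qed

lemma elem_vec: "x:carrier R==>elem_of (vec_of x) = x"
 by (rule ext) (auto simp: elem_of_def vec_of_def pidx_inv carrier_R ideal_of_iff)

lemma vec_elem: "v:carrier_vec (card P)==>vec_of (elem_of v) = v"
 by (intro eq_vecI) (auto simp: elem_of_def vec_of_def pidx_inv)

lemma vec_of_carrier: "vec_of x:carrier_vec (card P)" by (simp add: vec_of_def)
lemma elem_of_carrier: "elem_of v:carrier R" by (simp add: elem_of_def carrier_R ideal_of_iff)

lemma vec_of_lin: "vec_of (%p. x p + y p) = vec_of x + vec_of y" "vec_of (%p. c * x p) = c .* vec_of x"
 by (auto simp: vec_of_def)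

lemma elem_of_lin:
 assumes "v:carrier_vec (card P)" "w:carrier_vec (card P)"
 shows "elem_of (v + w) = (%p. elem_of v p + elem_of w p)" "elem_of (c .* v) = (%p. c * elem_of v p)"
 using assms by (auto simp: elem_of_def fun_eq_iff pidx_inv)

lemma lin_mat_R:
 assumes c: "!!x. x:carrier R==>L x:carrier_vec n"
  and a: "!!x y. x:carrier R==>y:carrier R==>L (%p. x p + y p) = L x + L y"
  and s: "!!x k. x:carrier R==>L (%p. k * x p) = k .* L x"
 shows "EX A. A:carrier_mat n (card P) & (ALL x:carrier R. A *v vec_of x = L x)"
proof -
 obtain A where "A:carrier_mat n (card P)" "!!v. v:carrier_vec (card P)==>A *v v = L (elem_of v)"
  by (rule lin_mat[of "card P" "%v. L (elem_of v)" n]) (use c a s elem_of_carrier in "auto simp: elem_of_lin")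
 thus ?thesis using vec_of_carrier elem_vec by auto
qed

lemma mat_eq_R:
 assumes "A:carrier_mat n (card P)" "B:carrier_mat n (card P)" "!!x. x:carrier R==>A *v vec_of x = B *v vec_of x"
 shows "A = B"
proof (rule mat_eq_unit[OF assms(1,2)])
 fix j assume "j < card P"
 show "A *v unit_vec (card P) j = B *v unit_vec (card P) j"
  using assms(3)[OF elem_of_carrier, of "unit_vec (card P) j"] vec_elem[of "unit_vec (card P) j"] by simp
qed

lemma reg_ex: "EX N :: ('v, 'a, 'k) module_obj. lm N & fst N = card P &
  (ALL a:carrier R. ALL x:carrier R. snd N a *v vec_of x = vec_of (a *. x))"
proof -
 have "EX A. A:carrier_mat (card P) (card P) & (ALL x:carrier R. A *v vec_of x = vec_of (a *. x))" for a
  by (rule lin_mat_R) (simp_all add: vec_of_carrier mult_add_r mult_scl_r vec_of_lin)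
 then obtain rh where rh: "!!a. rh a:carrier_mat (card P) (card P)" "!!a x. x:carrier R==>rh a *v vec_of x = vec_of (a *. x)" by metis
 have "lm (card P, restrict rh (carrier R))"
 proof (rule lmodI)
  show "rh \<one>\<^bsub>R\<^esub> = 1\<^sub>m (card P)" by (rule mat_eq_R[OF rh(1)]) (simp_all add: rh(2) one_mult vec_of_carrier)
  fix a :: "('v, 'a) path=>'k" assume a: "a:carrier R"
  show "rh a:carrier_mat (card P) (card P)" by (rule rh)
  show "rh (%p. c * a p) = c \<cdot>\<^sub>m rh a" for c
  by (rule mat_eq_R[OF rh(1)]) (use rh(1)[of a] vec_of_carrier in "simp_all add: rh(2) smult_mat_vec mult_scl_l vec_of_lin")
  fix b :: "('v, 'a) path=>'k" assume b: "b:carrier R"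
  show "rh (a *. b) = rh a * rh b"
  proof (rule mat_eq_R[OF rh(1) mult_carrier_mat[OF rh(1) rh(1)]])
  fix x :: "('v, 'a) path=>'k" assume x: "x:carrier R"
  show "rh (a *. b) *v vec_of x = (rh a * rh b) *v vec_of x"
  using rh(2)[OF x] rh(2)[OF mult_carrier, of a b x] amv[OF rh(1) rh(1) vec_of_carrier] mult_assoc_R[OF a b x] by simp
  qed
  show "rh (%p. a p + b p) = rh a + rh b"
  proof (rule mat_eq_R[OF rh(1) add_carrier_mat[OF rh(1)]])
  fix x :: "('v, 'a) path=>'k" assume x: "x:carrier R"
  show "rh (%p. a p + b p) *v vec_of x = (rh a + rh b) *v vec_of x"
  using rh(2)[OF x] amd[OF rh(1) rh(1) vec_of_carrier] by (simp add: mult_add_l vec_of_lin)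
  qed
 qed
 thus ?thesis using rh(2) by (intro exI[of _ "(card P, restrict rh (carrier R))"]) simp
qed

definition reg :: "('v, 'a, 'k) module_obj" where
 "reg = (SOME N. lm N & fst N = card P & (ALL a:carrier R. ALL x:carrier R. snd N a *v vec_of x = vec_of (a *. x)))"

lemma reg: "lm reg" "fst reg = card P" "a:carrier R==>x:carrier R==>snd reg a *v vec_of x = vec_of (a *. x)"
 using someI_ex[OF reg_ex] unfolding reg_def[symmetric] by blast+

abbreviation "uno == vec_of \<one>\<^bsub>R\<^esub>"

lemma uno: "uno:V reg" by (simp add: reg vec_of_carrier)

text \<open>Freeness of the regular module on \<open>uno\<close>; naturality along these maps
  determines a transformation from its component at \<open>reg\<close>.\<close>

lemma reg_map:
 assumes M: "lm M" and v: "v:V M"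
 obtains f where "f:hom Mc reg M" "!!x. x:carrier R==>dat f *v vec_of x = snd M x *v v"
proof -
 note Mc = lmodD(1)[OF M]
 have "EX A. A:carrier_mat (fst M) (card P) & (ALL x:carrier R. A *v vec_of x = snd M x *v v)"
  by (rule lin_mat_R)
  (use Mc v lmodD(7,8)[OF M] in "simp_all add: amd[OF Mc Mc v] smult_mat_vec mod_vec[OF M] lmodD(3)[OF M]")
 then obtain A where A: "A:carrier_mat (fst M) (card P)" "!!x. x:carrier R==>A *v vec_of x = snd M x *v v" by blast
 have "Arr reg M A:hom Mc reg M"
 proof (rule hom_McI[OF reg(1) M])
  show "A:carrier_mat (fst M) (fst reg)" using A(1) by (simp add: reg)
  fix a :: "('v, 'a) path=>'k" assume a: "a:carrier R"
  have ra: "snd reg a:carrier_mat (card P) (card P)" using lmodD(1)[OF reg(1) a] by (simp add: reg)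
  show "A * snd reg a = snd M a * A"
  proof (rule mat_eq_R[OF mult_carrier_mat[OF A(1) ra] mult_carrier_mat[OF Mc[OF a] A(1)]])
  fix x :: "('v, 'a) path=>'k" assume x: "x:carrier R"
  show "(A * snd reg a) *v vec_of x = (snd M a * A) *v vec_of x"
  using amv[OF A(1) ra vec_of_carrier, of x] amv[OF Mc[OF a] A(1) vec_of_carrier, of x]
  reg(3)[OF a x] A(2)[OF x] A(2)[OF mult_carrier, of a x] lmodD(6)[OF M a x] amv[OF Mc[OF a] Mc[OF x] v] by simp
  qed
 qed
 thus thesis using that A(2) by simp
qed

text \<open>Evaluation at the regular module recovers the ideal: \<open>U \<otimes> A \<cong> U\<close>.\<close>

lemma reg_tensor:
 assumes U: "pideal U"
 shows "EX ke. (ALL w:V (fobj (DU U) reg). ke w:I U & tn U reg (ke w) uno = w) & (ALL x:I U. ke (tn U reg x uno) = x)"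
proof -
 let ?n = "fst (fobj (DU U) reg)"
 note c = tn_carrier[OF U reg(1)]
 have t1: "tn U reg x (vec_of a) = tn U reg (x *. a) uno" if "x:I U" "a:carrier R" for x a
  using tn_bal(5)[OF U reg(1) that uno] reg(3)[OF that(2) one_carrier] one_mult(2)[OF that(2)] by simp
 have "balanced_map Q (I U) reg (card P) (%x v. vec_of (x *. elem_of v))"
 proof (rule balancedI)
  fix x a :: "('v, 'a) path=>'k" and v assume x: "x:I U" and a: "a:carrier R" and v: "v:V reg"
  have "snd reg a *v v = vec_of (a *. elem_of v)" using reg(3)[OF a elem_of_carrier, of v] vec_elem[of v] v by (simp add: reg)
  thus "vec_of (x *. a *. elem_of v) = vec_of (x *. elem_of (snd reg a *v v))"
  using elem_vec[OF mult_carrier, of a "elem_of v"] mult_assoc_R[OF I_carrier[OF U x] a elem_of_carrier] by simp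
 qed (simp_all add: reg vec_of_carrier vec_of_lin elem_of_lin mult_add_l mult_add_r mult_scl_l mult_scl_r)
 then obtain B where B: "B:carrier_mat (card P) ?n" "!!x v. x:I U==>v:V reg==>B *v tn U reg x v = vec_of (x *. elem_of v)"
  using tensorD(3)[OF DU_all(2)[OF U reg(1)]] by blast
 have "EX S. S:carrier_mat ?n (card P) & (ALL x:carrier R. S *v vec_of x = tn U reg (restr U x) uno)"
 proof (rule lin_mat_R)
  have "restr U (%p. x p + y p) = (%p. restr U x p + restr U y p)" "restr U (%p. k * x p) = (%p. k * restr U x p)" for k and x y :: "('v, 'a) path=>'k"
  by (auto simp: restr_def)
  thus "tn U reg (restr U (%p. x p + y p)) uno = tn U reg (restr U x) uno + tn U reg (restr U y) uno"
  "tn U reg (restr U (%p. k * x p)) uno = k .* tn U reg (restr U x) uno" for k x y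
  using tn_bal(1)[OF U reg(1) restr_ideal restr_ideal uno] tn_bal(3)[OF U reg(1) restr_ideal uno] by simp_all
 qed (use c[OF restr_ideal uno] in blast)
 then obtain S where S: "S:carrier_mat ?n (card P)" "!!x. x:carrier R==>S *v vec_of x = tn U reg (restr U x) uno" by blast
 have SB: "S * B = 1\<^sub>m ?n"
 proof (rule tensor_eq[OF DU_all(2)[OF U reg(1)] mult_carrier_mat[OF S(1) B(1)] one_carrier_mat])
  fix x :: "('v, 'a) path=>'k" and v assume x: "x:I U" and v: "v:V reg"
  have m: "x *. elem_of v:I U" using mul_I[OF U x elem_of_carrier] .
  show "(S * B) *v tn U reg x v = 1\<^sub>m ?n *v tn U reg x v"
  using amv[OF S(1) B(1) c[OF x v]] B(2)[OF x v] S(2)[OF I_carrier[OF U m]] restr_id[OF m]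
  t1[OF x elem_of_carrier, of v] vec_elem[of v] v c[OF x v] by (simp add: reg)
 qed
 let ?ke = "%w. restr U (elem_of (B *v w))"
 have "tn U reg (?ke w) uno = w" if w: "w:V (fobj (DU U) reg)" for w
  using S(2)[OF elem_of_carrier, of "B *v w"] vec_elem[OF mvc[OF B(1) w]] amv[OF S(1) B(1) w] SB w by simp
 moreover have "?ke (tn U reg x uno) = x" if x: "x:I U" for x
  using B(2)[OF x uno] elem_vec[OF one_carrier] one_mult(2)[OF I_carrier[OF U x]] elem_vec[OF I_carrier[OF U x]] restr_id[OF x] by simp
 ultimately show ?thesis using restr_ideal by (intro exI[of _ ?ke]) blast
qed

text \<open>g is the component at the regular module, read through \<open>reg_tensor\<close>.
  Naturality along the map that sends \<open>uno\<close> to v recovers all components; for v in the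
  regular module itself it also gives right linearity.\<close>

lemma hom_bimodule:
 assumes U: "pideal U" and W: "pideal W" and fz: "fz:hom EE (DU U) (DU W)"
 obtains g where "!!x. x:I U==>g x:I W"
  "!!x y. x:I U==>y:I U==>g (%p. x p + y p) = (%p. g x p + g y p)"
  "!!x k. x:I U==>g (%p. k * x p) = (%p. k * g x p)"
  "!!x a. x:I U==>a:carrier R==>g (a *. x) = a *. g x"
  "!!x a. x:I U==>a:carrier R==>g (x *. a) = g x *. a"
  "!!M x v. lm M==>x:I U==>v:V M==>ev fz M (tn U M x v) = tn W M (g x) v"
proof -
 obtain ke where ke: "!!w. w:V (fobj (DU W) reg)==>ke w:I W" "!!w. w:V (fobj (DU W) reg)==>tn W reg (ke w) uno = w"
  "!!x. x:I W==>ke (tn W reg x uno) = x" using reg_tensor[OF W] by blast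
 define g where "g x = ke (ev fz reg (tn U reg x uno))" for x
 note c = tn_carrier[OF U reg(1) _ uno]
 note bU = tn_bal[OF U reg(1)] and bW = tn_bal[OF W reg(1)]
 have ec: "ev fz reg (tn U reg x uno):V (fobj (DU W) reg)" if "x:I U" for x using ev_carrier[OF fz reg(1) c[OF that]] .
 have g: "g x:I W" if "x:I U" for x unfolding g_def using ke(1)[OF ec[OF that]] .
 have gt: "tn W reg (g x) uno = ev fz reg (tn U reg x uno)" if "x:I U" for x unfolding g_def using ke(2)[OF ec[OF that]] .
 have gI: "g x = y" if "x:I U" "y:I W" "ev fz reg (tn U reg x uno) = tn W reg y uno" for x y
  unfolding g_def that(3) using ke(3)[OF that(2)] .
 have main: "ev fz M (tn U M x v) = tn W M (g x) v" if M: "lm M" and x: "x:I U" and v: "v:V M" for M x v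
 proof -
  obtain f where f: "f:hom Mc reg M" "!!x. x:carrier R==>dat f *v vec_of x = snd M x *v v" using reg_map[OF M v] by blast
  have fu: "dat f *v uno = v" using f(2)[OF one_carrier] lmodD(5)[OF M] v by simp
  show ?thesis
  using ev_natural[OF fz f(1) c[OF x]] DU_all(3)[OF U f(1) x uno] DU_all(3)[OF W f(1) g[OF x] uno] gt[OF x] fu by simp
 qed
 show thesis
 proof (rule that[OF g _ _ _ _ main])
  fix x :: "('v, 'a) path=>'k" assume x: "x:I U"
  note L = ev_lin[OF fz reg(1)]
  show "g (%p. k * x p) = (%p. k * g x p)" for k
  by (rule gI[OF ideal_of_scl[OF x] ideal_of_scl[OF g[OF x]]]) (simp add: bU(3)[OF x uno] bW(3)[OF g[OF x] uno] L(2)[OF c[OF x]] gt[OF x])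
  show "g (%p. x p + y p) = (%p. g x p + g y p)" if y: "y:I U" for y
  by (rule gI[OF ideal_of_add[OF x y] ideal_of_add[OF g[OF x] g[OF y]]])
  (simp add: bU(1)[OF x y uno] bW(1)[OF g[OF x] g[OF y] uno] L(1)[OF c[OF x] c[OF y]] gt[OF x] gt[OF y])
  fix a :: "('v, 'a) path=>'k" assume a: "a:carrier R"
  show "g (a *. x) = a *. g x"
  by (rule gI[OF lmul_I[OF U x a] lmul_I[OF W g[OF x] a]])
  (simp add: tn_act[OF U reg(1) a x uno] tn_act[OF W reg(1) a g[OF x] uno] L(4)[OF c[OF x] a] gt[OF x])
  have "snd reg a *v uno:V reg" using mod_vec[OF reg(1) a uno] .
  thus "g (x *. a) = g x *. a"
  by (intro gI[OF mul_I[OF U x a] mul_I[OF W g[OF x] a]])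
  (simp add: bU(5)[OF x a uno] bW(5)[OF g[OF x] a uno] main[OF reg(1) x])
 qed
qed

text \<open>A bimodule map sends a path p into the corner between its ends, which in a tree is
  spanned by p. The coefficients so obtained do not change under multiplication by paths, hence are
  constant on the connected ideal by \<open>conn_const\<close>.\<close>

lemma hom_scalar:
 assumes U: "conn U" and W: "pideal W" and fz: "fz:hom EE (DU U) (DU W)" and nz: "fz ~= Nul EE (DU U) (DU W)"
 shows "U <= W & (EX c. fz = Scl EE c (inc U W))"
proof -
 have pU: "pideal U" using U by (simp add: conn_def)
 obtain g where g: "!!x. x:I U==>g x:I W"
  "!!x y. x:I U==>y:I U==>g (%p. x p + y p) = (%p. g x p + g y p)"
  "!!x k. x:I U==>g (%p. k * x p) = (%p. k * g x p)"
  "!!x a. x:I U==>a:carrier R==>g (a *. x) = a *. g x"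
  "!!x a. x:I U==>a:carrier R==>g (x *. a) = g x *. a"
  "!!M x v. lm M==>x:I U==>v:V M==>ev fz M (tn U M x v) = tn W M (g x) v"
  using hom_bimodule[OF pU W fz] by blast
 have pe: "el p:I U" if "p:U" for p using that by (simp add: ideal_of_elem)
 define c where "c p = g (el p) p" for p
 have gc: "g (el p) = (%q. c p * el p q)" if p: "p:U" for p
 proof -
  have pP: "p:P" using pidealD(2)[OF pU p] .
  have tv: "el (tgt p, []):carrier R" "el (fst p, []):carrier R"
  using elem_carrier triv_paths(1) path_verts[OF pP] by blast+
  have e: "el (tgt p, []) *. (el p *. el (fst p, [])) = el p"
  using corner[OF elem_carrier[OF pP] pP] by (simp add: path_elem_def)
  have "g (el p) = el (tgt p, []) *. (g (el p) *. el (fst p, []))"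
  using g(4)[OF mul_I[OF pU pe[OF p] tv(2)] tv(1)] g(5)[OF pe[OF p] tv(2)] e by simp
  thus ?thesis using corner[OF I_carrier[OF W g(1)[OF pe[OF p]]] pP] by (simp add: c_def)
 qed
 have cl: "c (q \<cdot> p) = c p" if p: "p:U" and q: "q:P" and t: "tgt p = fst q" for p q
 proof -
  have pP: "p:P" using pidealD(2)[OF pU p] .
  have "g (el (q \<cdot> p)) = el q *. g (el p)" using g(4)[OF pe[OF p] elem_carrier[OF q]] el_mult[OF pP q t] by simp
  also have "... = (%r. c p * el (q \<cdot> p) r)" unfolding gc[OF p] mult_scl_r el_mult[OF pP q t] by simp
  finally show ?thesis unfolding c_def by (simp add: path_elem_def)
 qed
 have cr: "c (p \<cdot> q) = c p" if p: "p:U" and q: "q:P" and t: "tgt q = fst p" for p q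
 proof -
  have pP: "p:P" using pidealD(2)[OF pU p] .
  have "g (el (p \<cdot> q)) = g (el p) *. el q" using g(5)[OF pe[OF p] elem_carrier[OF q]] el_mult[OF q pP t] by simp
  also have "... = (%r. c p * el (p \<cdot> q) r)" unfolding gc[OF p] mult_scl_l el_mult[OF q pP t] by simp
  finally show ?thesis unfolding c_def by (simp add: path_elem_def)
 qed
 obtain p0 where p0: "p0:U" using U by (auto simp: conn_def)
 define k where "k = c p0"
 have ck: "c p = k" if "p:U" for p unfolding k_def using conn_const[OF U, of c, OF cl cr that p0] by blast
 have ge: "ev fz M (tn U M (el p) v) = k .* tn W M (el p) v \<or> ~ el p:I W" if "lm M" "p:U" "v:V M" for M p v
  using g(6)[OF that(1) pe[OF that(2)] that(3)] gc[OF that(2)] ck[OF that(2)] tn_bal(3)[OF W that(1) _ that(3)] by metis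
 have k0: "k ~= 0"
 proof
  assume k: "k = 0"
  have "fz = Nul EE (DU U) (DU W)"
  proof (rule nat_eq_el0[OF pU fz M.E.Nul_hom[OF DU_Obj[OF pU] DU_Obj[OF W]]])
  fix M p v assume *: "lm M" "p:U" "v:V M"
  show "ev fz M (tn U M (el p) v) = ev (Nul EE (DU U) (DU W)) M (tn U M (el p) v)"
  using g(6)[OF *(1) pe[OF *(2)] *(3)] gc[OF *(2)] ck[OF *(2)] k tn_zero(1)[OF W *(1,3)]
  ev_ops(5)[OF fz *(1) tn_carrier[OF pU *(1) pe[OF *(2)] *(3)]] by simp
  qed
  thus False using nz by simp
 qed
 \<comment> \<open>For each p in U a nonzero multiple of p lies in the ideal of W.\<close>
 have UW: "U <= W"
 proof
  fix p assume p: "p:U"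
  have "(%q. k * el p q):I W" using g(1)[OF pe[OF p]] gc[OF p] ck[OF p] by simp
  hence "p \<notin> W==>k * el p p = 0" unfolding ideal_of_iff by blast
  thus "p:W" using k0 by (auto simp: path_elem_def)
 qed
 note i = inc[OF pU W UW]
 have "fz = Scl EE k (inc U W)"
 proof (rule nat_eq_el0[OF pU fz M.E.Scl_hom[OF i(1)]])
  fix M p v assume *: "lm M" "p:U" "v:V M"
  have "el p:I W" using UW *(2) by (auto simp: ideal_of_elem)
  thus "ev fz M (tn U M (el p) v) = ev (Scl EE k (inc U W)) M (tn U M (el p) v)"
  using ge[OF *] ev_ops(3)[OF i(1) *(1) tn_carrier[OF pU *(1) pe[OF *(2)] *(3)]] i(2)[OF *(1) pe[OF *(2)] *(3)] by auto
 qed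
 thus ?thesis using UW by blast
qed

text \<open>At the regular module the transformation is the inclusion of ideals itself, which does
  not kill a path of U.\<close>

lemma inc_nz:
 assumes U: "pideal U" and W: "pideal W" and UW: "U <= W" and ne: "U ~= {}"
 shows "inc U W ~= Nul EE (DU U) (DU W)"
proof
 assume eq: "inc U W = Nul EE (DU U) (DU W)"
 obtain p where p: "p:U" using ne by blast
 have pU: "el p:I U" and pW: "el p:I W" using p UW by (auto simp: ideal_of_elem)
 obtain ke where ke: "!!x. x:I W==>ke (tn W reg x uno) = x" using reg_tensor[OF W] by blast
 have "tn W reg (el p) uno = tn W reg (%p. 0) uno"
  using inc(2)[OF U W UW reg(1) pU uno] ev_ops(5)[OF inc(1)[OF U W UW] reg(1) tn_carrier[OF U reg(1) pU uno]] eq tn_zero(1)[OF W reg(1) uno] by simp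
 moreover have "el p = ke (tn W reg (el p) uno)" using ke[OF pW] by simp
 ultimately have "el p = ke (tn W reg (%p. 0) uno)" by (simp only:)
 hence "el p = (%p. 0)" unfolding ke[OF ideal_of_zero] .
 from fun_cong[OF this, of p] show False by (simp add: path_elem_def)
qed

text \<open>The mutually inverse maps send a tensor v to a v and v to 1 tensor v. This is what
  realizes the unit as a representative of the greatest generator.\<close>

lemma unit_iso:
 obtains a a' where "a:hom EE (DU P) Id0" "a':hom EE Id0 (DU P)" "a' oE a = Idm EE (DU P)" "a oE a' = Idm EE Id0"
proof -
 note Pp = pideal_P
 have car: "I P = carrier R" by (simp add: carrier_R)
 obtain a where a: "a:hom EE (DU P) Id0" "!!M x v. lm M==>x:I P==>v:V M==>ev a M (tn P M x v) = snd M x *v v"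
 proof (rule nat_ex0[OF Pp Id0_linear, of "%M x v. snd M x *v v", unfolded endofunctor.sel])
  fix M assume M: "lm M"
  note MD = lmodD(1)[OF M]
  show "balanced_map Q (I P) M (fst M) (%x v. snd M x *v v)"
  by (rule balancedI)
  (use lmodD[OF M] MD in \<open>simp_all add: car mod_vec[OF M] amd[OF MD MD] mad[OF MD]
  smult_mat_vec mult_mat_vec[OF MD] amv[OF MD MD]\<close>)
  show "snd M (b *. x) *v v = snd M b *v (snd M x *v v)" if "b:carrier R" "x:I P" "v:V M" for b x v
  using that lmodD(6)[OF M] amv[OF MD MD] car by simp
 next
  fix f M N x v assume f: "f:hom Mc M N" and x: "x:I P" and v: "v:V M"
  have lm: "lm M" "lm N" and fc: "dat f:carrier_mat (fst N) (fst M)" and fa: "dat f * snd M x = snd N x * dat f"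
  using f x by (auto simp: hom_Mc car)
  show "dat f *v (snd M x *v v) = snd N x *v (dat f *v v)"
  using amv[OF fc lmodD(1)[OF lm(1)] v, of x] amv[OF lmodD(1)[OF lm(2)] fc v, of x] fa x car by simp
 qed blast
 have one: "\<one>\<^bsub>R\<^esub>:I P" using one_carrier car by simp
 have "EX B. lm M --> B:carrier_mat (fst (fobj (DU P) M)) (fst M) & (ALL v:V M. B *v v = tn P M \<one>\<^bsub>R\<^esub> v)" for M
 proof (cases "lm M")
  case True
  show ?thesis
  by (rule lin_mat[of "fst M" "tn P M \<one>\<^bsub>R\<^esub>" "fst (fobj (DU P) M)"])
  (use tn_carrier[OF Pp True one] tn_bal(2,4)[OF Pp True one] in auto)
 qed simp
 hence "EX B. ALL M. lm M --> B M:carrier_mat (fst (fobj (DU P) M)) (fst M) & (ALL v:V M. B M *v v = tn P M \<one>\<^bsub>R\<^esub> v)"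
  by (intro choice allI)
 then obtain B where L: "ALL M. lm M --> B M:carrier_mat (fst (fobj (DU P) M)) (fst M) & (ALL v:V M. B M *v v = tn P M \<one>\<^bsub>R\<^esub> v)"
  by (elim exE)
 have B: "!!M. lm M==>B M:carrier_mat (fst (fobj (DU P) M)) (fst M)"
  "!!M v. lm M==>v:V M==>B M *v v = tn P M \<one>\<^bsub>R\<^esub> v" using L by blast+
 define a' where "a' = Arr Id0 (DU P) (\<lambda>M\<in>Obj Mc. Arr M (fobj (DU P) M) (B M))"
 have a': "a':hom EE Id0 (DU P)"
  unfolding a'_def
 proof (rule M.homE_I[OF Id0_linear DU_all(1)[OF Pp], unfolded endofunctor.sel])
  fix M :: "('v, 'a, 'k) module_obj" assume "M:Obj Mc"
  hence M: "lm M" by (simp add: Obj_Mc)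
  show "Arr M (fobj (DU P) M) (B M):hom Mc M (fobj (DU P) M)"
  proof (rule hom_McI[OF M DU_lm[OF Pp M] B(1)[OF M]])
  fix b :: "('v, 'a) path=>'k" assume b: "b:carrier R"
  note Mb = lmodD(1)[OF M b] and Db = lmodD(1)[OF DU_lm[OF Pp M] b]
  show "B M * snd M b = snd (fobj (DU P) M) b * B M"
  proof (rule mat_eq_unit[OF mult_carrier_mat[OF B(1)[OF M] Mb] mult_carrier_mat[OF Db B(1)[OF M]]])
  fix j assume "j < fst M"
  have u: "unit_vec (fst M) j:V M" by simp
  show "(B M * snd M b) *v unit_vec (fst M) j = (snd (fobj (DU P) M) b * B M) *v unit_vec (fst M) j"
  using amv[OF B(1)[OF M] Mb u] amv[OF Db B(1)[OF M] u] B(2)[OF M u] B(2)[OF M mod_vec[OF M b u]]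
  tn_act[OF Pp M b one u] tn_bal(5)[OF Pp M one b u] one_mult[OF b] by simp
  qed
  qed
 next
  fix f and M N :: "('v, 'a, 'k) module_obj" assume f: "f:hom Mc M N"
  have lm: "lm M" "lm N" and fc: "dat f:carrier_mat (fst N) (fst M)" "src f = M" "trg f = N" using f by (auto simp: hom_Mc)
  have Df: "dat (farr (DU P) f):carrier_mat (fst (fobj (DU P) N)) (fst (fobj (DU P) M))" "src (farr (DU P) f) = fobj (DU P) M" "trg (farr (DU P) f) = fobj (DU P) N"
  using M.lfunD(3)[OF DU_all(1)[OF Pp] f] by (auto simp: hom_Mc)
  have "B N * dat f = dat (farr (DU P) f) * B M"
  proof (rule mat_eq_unit[OF mult_carrier_mat[OF B(1)[OF lm(2)] fc(1)] mult_carrier_mat[OF Df(1) B(1)[OF lm(1)]]])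
  fix j assume "j < fst M"
  have u: "unit_vec (fst M) j:V M" by simp
  show "(B N * dat f) *v unit_vec (fst M) j = (dat (farr (DU P) f) * B M) *v unit_vec (fst M) j"
  using amv[OF B(1)[OF lm(2)] fc(1) u] amv[OF Df(1) B(1)[OF lm(1)] u]
  B(2)[OF lm(1) u] B(2)[OF lm(2) mvc[OF fc(1) u]] DU_all(3)[OF Pp f one u] by simp
  qed
  thus "Cmp Mc (Arr N (fobj (DU P) N) (B N)) f = Cmp Mc (farr (DU P) f) (Arr M (fobj (DU P) M) (B M))"
  using fc Df by (simp add: Mc_sel)
 qed
 have ev': "ev a' M v = tn P M \<one>\<^bsub>R\<^esub> v" if "lm M" "v:V M" for M v using B(2)[OF that] that(1) by (simp add: a'_def Obj_Mc)
 have 1: "a' oE a = Idm EE (DU P)"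
 proof (rule nat_eq0[OF Pp M.E.Cmp_hom[OF a' a(1)] M.E.Idm_hom[OF DU_Obj[OF Pp]]])
  fix M x v assume *: "lm M" "x:I P" "v:V M"
  have x: "x:carrier R" using *(2) car by simp
  note t = tn_carrier[OF Pp *]
  show "ev (a' oE a) M (tn P M x v) = ev (Idm EE (DU P)) M (tn P M x v)"
  using ev_ops(1)[OF a(1) *(1) t a'] a(2)[OF *] ev'[OF *(1) mod_vec[OF *(1) x *(3)]] tn_bal(5)[OF Pp *(1) one x *(3)] one_mult(1)[OF x]
  ev_ops(2)[OF M.E.Idm_hom[OF DU_Obj[OF Pp]] *(1) t] by simp
 qed
 have IdO: "Id0:Obj EE" using Id0_linear by (simp add: M.Obj_E)
 have 2: "a oE a' = Idm EE Id0"
 proof (rule M.homE_eqI[OF M.E.Cmp_hom[OF a(1) a'] M.E.Idm_hom[OF IdO]])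
  fix M :: "('v, 'a, 'k) module_obj" assume "M:Obj Mc"
  hence M: "lm M" by (simp add: Obj_Mc)
  note d1 = ev_dat[OF M.E.Cmp_hom[OF a(1) a'] M, unfolded endofunctor.sel] and d2 = ev_dat[OF M.E.Idm_hom[OF IdO] M, unfolded endofunctor.sel]
  have "dat (dat (a oE a') M) = dat (dat (Idm EE Id0) M)"
  proof (rule mat_eq_unit[OF d1(1) d2(1)])
  fix j assume "j < fst M"
  have u: "unit_vec (fst M) j:V M" by simp
  hence u': "unit_vec (fst M) j:V (fobj Id0 M)" by simp
  show "ev (a oE a') M (unit_vec (fst M) j) = ev (Idm EE Id0) M (unit_vec (fst M) j)"
  using ev_ops(1)[OF a' M u' a(1)] ev'[OF M u] a(2)[OF M one u] ev_ops(2)[OF M.E.Idm_hom[OF IdO] M u'] lmodD(5)[OF M] by simp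
  qed
  thus "dat (a oE a') M = dat (Idm EE Id0) M" using d1(2,3) d2(2,3) by (intro arr.expand) simp
 qed
 show thesis by (rule that[OF a(1) a' 1 2])
qed

end

subsection \<open>The 2-category of dual projection functors\<close>

lemma aspan_mono: "f:aspan C X Y S==>S <= T==>f:aspan C X Y T"
 by (induction rule: aspan.induct) (auto intro: aspan.intros)

lemma (in linear_category) aspan_map:
 assumes f: "f:aspan C X Y S" and S: "S <= H X Y" and XY: "X:Obj C" "Y:Obj C"
  and a: "!!f g. f:H X Y==>g:H X Y==>fz (f+.g) = fz f+.fz g" and n: "fz (Nul C X Y) = Nul C X' Y'"
 shows "fz f:aspan C X' Y' (fz ` S)"
 using f
proof (induction rule: aspan.induct)
 case nul
 thus ?case unfolding n by (rule aspan.nul)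
next
 case (base f)
 thus ?case by (intro aspan.base imageI)
next
 case (add f g)
 have "f:H X Y" "g:H X Y" using aspan_hom[OF _ S XY] add(1,2) by blast+
 thus ?case using aspan.add[OF add(3,4)] a by simp
qed

context tree_algebra begin

lemma harr_Nul:
 assumes F: "F:Obj EE" and G: "G:Obj EE" and X: "X:Obj EE"
 shows "M.harr (Idm EE F) (Nul EE G X) = Nul EE (M.hcomp F G) (M.hcomp F X)"
  "M.harr (Nul EE G X) (Idm EE F) = Nul EE (M.hcomp G F) (M.hcomp X F)"
proof -
 note n = M.E.Nul_hom[OF G X] and i = M.E.Idm_hom[OF F]
 have z: "Scl EE 0 (Nul EE G X) = Nul EE G X" using M.E.Scl_0[OF n] .
 show "M.harr (Idm EE F) (Nul EE G X) = Nul EE (M.hcomp F G) (M.hcomp F X)"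
  using M.harr_linear_right(2)[OF F n n, of 0] M.E.Scl_0[OF M.harr_hom[OF i n]] z by simp
 show "M.harr (Nul EE G X) (Idm EE F) = Nul EE (M.hcomp G F) (M.hcomp X F)"
  using M.harr_linear_left(2)[OF F n n, of 0] M.E.Scl_0[OF M.harr_hom[OF n i]] z by simp
qed

lemma harr_Cmp_left:
 assumes "F:Obj EE" "av:hom EE G G'" "bv:hom EE G' G''"
 shows "M.harr (Idm EE F) (bv oE av) = M.harr (Idm EE F) bv oE M.harr (Idm EE F) av"
  "M.harr (bv oE av) (Idm EE F) = M.harr bv (Idm EE F) oE M.harr av (Idm EE F)"
proof -
 note i = M.E.Idm_hom[OF assms(1)]
 show "M.harr (Idm EE F) (bv oE av) = M.harr (Idm EE F) bv oE M.harr (Idm EE F) av"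
  "M.harr (bv oE av) (Idm EE F) = M.harr bv (Idm EE F) oE M.harr av (Idm EE F)"
  using M.harr_Cmp[OF i i assms(2,3)] M.harr_Cmp[OF assms(2,3) i i] M.E.Cmp_Idm_left[OF i] by simp_all
qed

abbreviation "conns == {U. conn U}"
abbreviation "gend == M.E.generated DU conns"

lemma conn_pideal: "conn U==>pideal U" by (simp add: conn_def)

lemma gend_DU: assumes W: "pideal W" shows "gend (DU W)"
 unfolding M.E.generated_def
proof
 let ?S = "{inc c W oE r |c r. conn c & c <= W & r:hom EE (DU W) (DU c)}"
 have "?S <= through EE DU conns (DU W) (DU W)"
 proof
  fix x assume "x:?S"
  then obtain c r where c: "conn c" "c <= W" "r:hom EE (DU W) (DU c)" "x = inc c W oE r" by blast
  thus "x:through EE DU conns (DU W) (DU W)" unfolding through_def using inc(1)[OF conn_pideal[OF c(1)] W c(2)] by blast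
 qed
 thus "Idm EE (DU W):aspan EE (DU W) (DU W) (through EE DU conns (DU W) (DU W))"
  by (rule aspan_mono[OF DU_span[OF W]])
qed (rule DU_Obj[OF W])

lemma gend_trans:
 assumes X: "X:Obj EE" and i: "Idm EE X:aspan EE X X (through EE D' T X X)" and g: "!!t. t:T==>gend (D' t)"
 shows "gend X"
 unfolding M.E.generated_def
proof
 have "through EE D' T X X <= aspan EE X X (through EE DU conns X X)"
 proof
  fix x assume "x:through EE D' T X X"
  then obtain a p t where x: "x = a oE p" "t:T" "p:hom EE X (D' t)" "a:hom EE (D' t) X" unfolding through_def by blast
  have "Idm EE (D' t):aspan EE (D' t) (D' t) (through EE DU conns (D' t) (D' t))" using g[OF x(2)] unfolding M.E.generated_def by blast
  from M.E.span_through_Cmp[OF this x(4,3)] show "x:aspan EE X X (through EE DU conns X X)"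
  using M.E.Cmp_Idm_left[OF x(3)] x(1) by simp
 qed
 from M.E.aspan_subset[OF i this] show "Idm EE X:aspan EE X X (through EE DU conns X X)" .
qed (rule X)

text \<open>Whiskering turns an expansion of an identity into an expansion of the identity of the
  composite. The factors are thereby reduced to connected ideals one after the other, and for those
  the composite is isomorphic to \<open>DU\<close> of the product ideal.\<close>

lemma gend_hcomp:
 assumes X: "gend X" and Y: "gend Y"
 shows "gend (M.hcomp X Y)"
proof -
 have XO: "X:Obj EE" and YO: "Y:Obj EE" using X Y by (simp_all add: M.E.generated_def)
 have sX: "Idm EE X:aspan EE X X (through EE DU conns X X)" and sY: "Idm EE Y:aspan EE Y Y (through EE DU conns Y Y)"
  using X Y unfolding M.E.generated_def by blast+
 have HO: "M.hcomp F G:Obj EE" if "F:Obj EE" "G:Obj EE" for F G using M.hcomp_linear that by (simp add: M.Obj_E)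
 have 1: "gend (M.hcomp (DU c) (DU d))" if "conn c" "conn d" for c d
 proof -
  note c = conn_pideal[OF that(1)] and d = conn_pideal[OF that(2)]
  show ?thesis by (rule M.E.generated_retract[OF gend_DU[OF pideal_pmul[OF c d]] mu(1)[OF c d] mu'(1)[OF c d] mu_mu'(2)[OF c d]])
 qed
 have 2: "gend (M.hcomp (DU c) Y)" if "conn c" for c
 proof (rule gend_trans[of _ "%d. M.hcomp (DU c) (DU d)" conns])
  note cO = DU_Obj[OF conn_pideal[OF that]]
  let ?fz = "M.harr (Idm EE (DU c))" and ?Z = "M.hcomp (DU c) Y"
  show "?Z:Obj EE" using HO cO YO .
  have "?fz (Idm EE Y):aspan EE ?Z ?Z (?fz ` through EE DU conns Y Y)"
  by (rule M.E.aspan_map[OF sY M.E.through_H YO YO M.harr_linear_right(1)[OF cO] harr_Nul(1)[OF cO YO YO]])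
  moreover have "?fz ` through EE DU conns Y Y <= through EE (%d. M.hcomp (DU c) (DU d)) conns ?Z ?Z"
  proof
  fix x assume "x:?fz ` through EE DU conns Y Y"
  then obtain a p d where d: "x = ?fz (a oE p)" "d:conns" "p:hom EE Y (DU d)" "a:hom EE (DU d) Y" unfolding through_def by blast
  have "x = ?fz a oE ?fz p" using harr_Cmp_left(1)[OF cO d(3,4)] d(1) by simp
  thus "x:through EE (%d. M.hcomp (DU c) (DU d)) conns ?Z ?Z"
  unfolding through_def using d(2) M.harr_hom[OF M.E.Idm_hom[OF cO] d(3)] M.harr_hom[OF M.E.Idm_hom[OF cO] d(4)] by blast
  qed
  ultimately show "Idm EE ?Z:aspan EE ?Z ?Z (through EE (%d. M.hcomp (DU c) (DU d)) conns ?Z ?Z)"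
  unfolding M.harr_Idm[OF cO YO] by (rule aspan_mono)
  show "gend (M.hcomp (DU c) (DU d))" if d: "d:conns" for d using 1[OF \<open>conn c\<close>, of d] d by simp
 qed
 show ?thesis
 proof (rule gend_trans[of _ "%d. M.hcomp (DU d) Y" conns])
  let ?fz = "%av. M.harr av (Idm EE Y)" and ?Z = "M.hcomp X Y"
  show "?Z:Obj EE" using HO XO YO .
  have "?fz (Idm EE X):aspan EE ?Z ?Z (?fz ` through EE DU conns X X)"
  by (rule M.E.aspan_map[OF sX M.E.through_H XO XO, of ?fz, OF M.harr_linear_left(1)[OF YO] harr_Nul(2)[OF YO XO XO]])
  moreover have "?fz ` through EE DU conns X X <= through EE (%d. M.hcomp (DU d) Y) conns ?Z ?Z"
  proof
  fix x assume "x:?fz ` through EE DU conns X X"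
  then obtain a p d where d: "x = ?fz (a oE p)" "d:conns" "p:hom EE X (DU d)" "a:hom EE (DU d) X" unfolding through_def by blast
  have "x = ?fz a oE ?fz p" using harr_Cmp_left(2)[OF YO d(3,4)] d(1) by simp
  thus "x:through EE (%d. M.hcomp (DU d) Y) conns ?Z ?Z"
  unfolding through_def using d(2) M.harr_hom[OF d(3) M.E.Idm_hom[OF YO]] M.harr_hom[OF d(4) M.E.Idm_hom[OF YO]] by blast
  qed
  ultimately show "Idm EE ?Z:aspan EE ?Z ?Z (through EE (%d. M.hcomp (DU d) Y) conns ?Z ?Z)"
  unfolding M.harr_Idm[OF XO YO] by (rule aspan_mono)
  show "gend (M.hcomp (DU d) Y)" if d: "d:conns" for d using 2[of d] d by simp
 qed
qed

abbreviation DD :: "('k, (('v, 'a, 'k) module_obj, 'k mat) endofunctor, ('v, 'a, 'k) module_obj=>(('v, 'a, 'k) module_obj, 'k mat) arr) two_cat"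
 where "DD == dual_projection_2cat Q"

lemma DD_sel: "Mor DD = Mor EE" "Idm DD = Idm EE" "Cmp DD = Cmp EE" "Nul DD = Nul EE" "Add DD = Add EE" "Scl DD = Scl EE"
  "Unit DD = Id0" "HObj DD = M.hcomp" "HArr DD = M.harr"
 by (simp_all add: dual_projection_2cat_def Let_def M.hcomp_def[abs_def] M.harr_def[abs_def])

text \<open>Exchanges the inductive additive closure for the spanning condition. Ideals are path
  ideals, these are generated by connected ones, and \<open>generated_add_closure\<close> provides
  the way back.\<close>

lemma Obj_DD: "X:Obj DD \<longleftrightarrow> gend X"
proof -
 let ?S = "{Dp Q J | J. ideal J (R :: (('v, 'a) path=>'k) ring)}"
 have "gend Y" if "Y:?S" for Y
 proof -
  from that obtain J :: "(('v, 'a) path=>'k) set" where J: "ideal J R" "Y = Dp Q J" by blast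
  obtain U where "pideal U" "J = I U" using ideal_pideal[OF J(1)] by blast
  thus ?thesis using gend_DU J(2) by simp
 qed
 moreover have "DU ` conns <= ?S" using ideal_ideal_of conn_pideal by blast
 ultimately have "X:add_closure EE ?S \<longleftrightarrow> gend X"
  using M.E.add_closure_generated[of ?S DU conns X] M.E.generated_add_closure[of DU conns ?S X] by blast
 thus ?thesis by (simp add: dual_projection_2cat_def Let_def)
qed

lemma Obj_DD_EE: "X:Obj DD==>X:Obj EE" by (simp add: Obj_DD M.E.generated_def)

lemma hom_DD: "f:hom DD X Y \<longleftrightarrow> f:hom EE X Y & X:Obj DD & Y:Obj DD"
 unfolding hom_def DD_sel using Obj_DD_EE by blast

lemma linear_category_DD: "linear_category DD"
 by (rule linear_category.intro; unfold hom_DD DD_sel; (elim conjE)?; (intro conjI)?;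
  (assumption | (rule M.E.Idm_hom M.E.Nul_hom; rule Obj_DD_EE; assumption) |
  (rule M.E.hom_src M.E.hom_trg M.E.Cmp_hom M.E.Cmp_assoc M.E.Cmp_Idm_left M.E.Cmp_Idm_right M.E.Add_hom M.E.Scl_hom
  M.E.Add_assoc M.E.Add_commute M.E.Add_Nul M.E.Scl_0 M.E.Scl_1 M.E.Scl_Scl M.E.Scl_add M.E.Scl_Add M.E.Cmp_Add_left M.E.Cmp_Add_right
  M.E.Cmp_Scl_left M.E.Cmp_Scl_right; assumption)))

lemma aspan_DD: "aspan DD X Y S = aspan EE X Y S"
proof (intro equalityI subsetI)
 show "f:aspan EE X Y S" if "f:aspan DD X Y S" for f
  using that by (induction rule: aspan.induct) (auto simp: DD_sel intro: aspan.intros)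
 show "f:aspan DD X Y S" if "f:aspan EE X Y S" for f
  using that by (induction rule: aspan.induct) (auto simp: DD_sel[symmetric] intro: aspan.intros simp del: DD_sel)
qed

lemma conns_DD: "U:conns==>DU U:Obj DD" using gend_DU conn_pideal by (simp add: Obj_DD)

lemma direct_sum_DD: "direct_sum EE Z X Y==>X:Obj DD==>Y:Obj DD==>Z:Obj DD==>direct_sum DD Z X Y"
 by (simp add: direct_sum_def DD_sel)

text \<open>Biproducts and split idempotents are inherited from the endofunctor category because
  generated objects are closed under both; the description of maps between generators is
  \<open>hom_scalar\<close>.\<close>

lemma poset_category_DD: "poset_category DD DU inc conns"
proof -
 interpret L: linear_category DD by (rule linear_category_DD)
 show ?thesis
 proof unfold_locales
  have "conns <= Pow P" using conn_pideal pidealD(1) by blast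
  thus "finite conns" using finite_paths by (simp add: finite_subset)
  fix s assume s: "s:conns"
  hence ps: "pideal s" using conn_pideal by simp
  show "DU s:Obj DD" using conns_DD[OF s] .
  show "inc s s = Idm DD (DU s)" using inc_id[OF ps] by (simp add: DD_sel)
  fix t assume t: "t:conns"
  hence pt: "pideal t" using conn_pideal by simp
  show "inc s t:hom DD (DU s) (DU t)" if "s <= t" using inc(1)[OF ps pt that] conns_DD s t by (simp add: hom_DD)
  show "inc s t ~= Nul DD (DU s) (DU t)" if "s <= t" using inc_nz[OF ps pt that] s by (auto simp: DD_sel conn_def)
  show "s <= t & (EX c. f = Scl DD c (inc s t))" if "f:hom DD (DU s) (DU t)" "f ~= Nul DD (DU s) (DU t)" for f
  using hom_scalar[of s t f] s pt that by (simp add: DD_sel hom_DD)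
  show "Cmp DD (inc t u) (inc s t) = inc s u" if "u:conns" "s <= t" "t <= u" for u
  using inc_inc[OF ps pt _ that(2,3)] that(1) conn_pideal by (simp add: DD_sel)
 next
  fix X Y assume XY: "X:Obj DD" "Y:Obj DD"
  obtain Z where Z: "direct_sum EE Z X Y" using M.E.has_biprod XY Obj_DD_EE by blast
  hence "Z:Obj DD" using M.E.generated_sum XY by (simp add: Obj_DD)
  thus "EX Z. direct_sum DD Z X Y" using direct_sum_DD[OF Z XY] by blast
 next
  obtain Z where Z: "zero_object EE Z" using M.E.has_zero by blast
  hence "Z:Obj DD" using M.E.generated_zero by (simp add: Obj_DD)
  hence "zero_object DD Z" using Z by (simp add: zero_object_def DD_sel)
  thus "EX Z. zero_object DD Z" by blast
 next
  fix X assume X: "X:Obj DD"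
  have sub: "through EE DU conns X X <= through DD DU conns X X"
  proof
  fix x assume "x:through EE DU conns X X"
  then obtain a p t where x: "x = a oE p" "t:conns" "p:hom EE X (DU t)" "a:hom EE (DU t) X" unfolding through_def by blast
  thus "x:through DD DU conns X X" using X conns_DD[OF x(2)] unfolding through_def DD_sel by (auto simp: hom_DD)
  qed
  have "Idm EE X:aspan EE X X (through EE DU conns X X)" using X by (simp add: Obj_DD M.E.generated_def)
  from aspan_mono[OF this sub] show "Idm DD X:aspan DD X X (through DD DU conns X X)"
  unfolding aspan_DD DD_sel .
  show "EX Y:Obj DD. EX a:hom DD X Y. EX b:hom DD Y X. Cmp DD a b = Idm DD Y & Cmp DD b a = f"
  if f: "f:hom DD X X" "Cmp DD f f = f" for f
  proof -
  obtain Y a b where Y: "Y:Obj EE" "a:hom EE X Y" "b:hom EE Y X" "Cmp EE a b = Idm EE Y" "Cmp EE b a = f"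
  using M.E.has_split[of X f] f X Obj_DD_EE by (auto simp: DD_sel hom_DD)
  have "Y:Obj DD" using M.E.generated_retract[OF _ Y(3,2,4)] X by (simp add: Obj_DD)
  thus ?thesis using Y X by (intro bexI[of _ Y] bexI[of _ a] bexI[of _ b] conjI) (simp_all add: hom_DD DD_sel)
  qed
 qed
qed

lemma hcomp_DD: "X:Obj DD==>Y:Obj DD==>M.hcomp X Y:Obj DD"
 using gend_hcomp by (simp add: Obj_DD)

text \<open>The isomorphisms \<open>mu\<close> turn each hypothesis on compositions into one on
  product ideals: \<open>pmul_sub\<close> gives \<open>cell\<close>, \<open>pmul_Int_srcs\<close>
  gives \<open>vanish\<close>, \<open>srcs_least\<close> gives \<open>full\<close>, and
  \<open>pmul_srcs\<close> gives \<open>faithful\<close>.\<close>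

lemma duflo_setting_DD:
 assumes G: "G <= P" and cG: "conn (pgen G)" and min: "!!G'. G' \<subset> G==>pgen G' ~= pgen G"
 obtains u where "duflo_setting DD DU inc conns (pgen G) (pgen (srcs G)) P u"
proof -
 interpret L: poset_category DD DU inc conns by (rule poset_category_DD)
 obtain a a' where a: "a:hom EE (DU P) Id0" "a':hom EE Id0 (DU P)" "a' oE a = Idm EE (DU P)" "a oE a' = Idm EE Id0"
  by (rule unit_iso)
 let ?i = "pgen G" and ?j = "pgen (srcs G)"
 note fG = G cG min
 have cj: "conn ?j" using conn_srcs[OF fG] .
 have i: "pideal ?i" and j: "pideal ?j" using conn_pideal cG cj by blast+
 have ij: "pmul ?i ?j = ?i" using pmul_srcs[OF fG] .
 have iO: "DU ?i:Obj EE" using DU_Obj[OF i] .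
 have UnitO: "Id0:Obj DD"
  using M.E.generated_retract[OF gend_DU[OF pideal_P] a(2,1,4)] by (simp add: Obj_DD)
 let ?W = "M.harr (Idm EE (DU ?i))"
 have Wh: "?W x:hom EE (M.hcomp (DU ?i) X) (M.hcomp (DU ?i) Y)" if "x:hom EE X Y" for x X Y
  using M.harr_hom[OF M.E.Idm_hom[OF iO] that] .
 have "duflo_setting DD DU inc conns ?i ?j P (%s. a oE inc s P)"
 proof unfold_locales
  show "?i:conns" "?j:conns" using cG cj by simp_all
  show "s <= P" if "s:conns" for s using pidealD(1)[OF conn_pideal] that by simp
  show "L.rep (Unit DD) P (%s. a oE inc s P)"
  unfolding L.rep_def
  proof (intro conjI)
  show "P:conns" using conn_P by simp
  hence "DU P:Obj DD" by (rule conns_DD)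
  thus "EX b:hom DD (DU P) (Unit DD). EX b':hom DD (Unit DD) (DU P). Cmp DD b' b = Idm DD (DU P) & Cmp DD b b' = Idm DD (Unit DD) &
  (%s. a oE inc s P) = (%s. Cmp DD b (inc s P))"
  using a UnitO by (intro bexI[of _ a] bexI[of _ a'] conjI) (simp_all add: hom_DD DD_sel)
  qed
  show "HObj DD (Unit DD) X = X" for X by (simp add: DD_sel hcomp_Id0)
  show "HArr DD ta av:hom DD (HObj DD F X) (HObj DD F' Y)" if "ta:hom DD F F'" "av:hom DD X Y" for ta F F' av X Y
  using that M.harr_hom[of ta F F' av X Y] hcomp_DD by (simp add: hom_DD DD_sel)
  show "HArr DD (Idm DD F) (Idm DD X) = Idm DD (HObj DD F X)" if "F:Obj DD" "X:Obj DD" for F X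
  using M.harr_Idm that Obj_DD_EE by (simp add: DD_sel)
  show "HArr DD (Cmp DD ta' ta) (Cmp DD bv av) = Cmp DD (HArr DD ta' bv) (HArr DD ta av)"
  if "ta:hom DD F F'" "ta':hom DD F' F''" "av:hom DD X Y" "bv:hom DD Y Z" for ta ta' F F' F'' av bv X Y Z
  using that M.harr_Cmp[of ta F F' ta' F'' av X Y bv Z] by (simp add: hom_DD DD_sel)
  fix F :: "(('v, 'a, 'k) module_obj, 'k mat) endofunctor" assume "F:Obj DD"
  hence F: "F:Obj EE" by (rule Obj_DD_EE)
  fix av bv X Y assume "av:hom DD X Y"
  hence av: "av:hom EE X Y" by (simp add: hom_DD)
  show "HArr DD (Idm DD F) (Scl DD c av) = Scl DD c (HArr DD (Idm DD F) av)" "HArr DD (Scl DD c av) (Idm DD F) = Scl DD c (HArr DD av (Idm DD F))" for c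
  using M.harr_linear_right(2)[OF F av av] M.harr_linear_left(2)[OF F av av] by (simp_all add: DD_sel)
  assume "bv:hom DD X Y"
  hence bv: "bv:hom EE X Y" by (simp add: hom_DD)
  show "HArr DD (Idm DD F) (Add DD av bv) = Add DD (HArr DD (Idm DD F) av) (HArr DD (Idm DD F) bv)"
  "HArr DD (Add DD av bv) (Idm DD F) = Add DD (HArr DD av (Idm DD F)) (HArr DD bv (Idm DD F))"
  using M.harr_linear_right(1)[OF F av bv] M.harr_linear_left(1)[OF F av bv] by (simp_all add: DD_sel)
 next
  fix g h t x y assume g: "g:conns" and h: "h:conns" and t: "t:conns"
  and "x:hom DD (DU g) (HObj DD (DU h) (DU t))" "y:hom DD (HObj DD (DU h) (DU t)) (DU g)"
  and nz: "Cmp DD y x ~= Nul DD (DU g) (DU g)"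
  hence x: "x:hom EE (DU g) (M.hcomp (DU h) (DU t))" and y: "y:hom EE (M.hcomp (DU h) (DU t)) (DU g)"
  by (simp_all add: hom_DD DD_sel)
  have ph: "pideal h" and pt: "pideal t" and pg: "pideal g" using g h t conn_pideal by simp_all
  note mx = M.E.Cmp_hom[OF mu(1)[OF ph pt] x]
  \<comment> \<open>\<open>mu\<close> is invertible, so x yields a nonzero map from
    \<open>DU g\<close> to the functor of the product ideal, which must then contain g.\<close>
  have "mu h t oE x ~= Nul EE (DU g) (DU (pmul h t))"
  proof
  assume "mu h t oE x = Nul EE (DU g) (DU (pmul h t))"
  hence "mu' h t oE (mu h t oE x) = Nul EE (DU g) (M.hcomp (DU h) (DU t))"
  using M.E.Cmp_Nul_right[OF mu'(1)[OF ph pt] DU_Obj[OF pg]] by simp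
  hence "x = Nul EE (DU g) (M.hcomp (DU h) (DU t))"
  using M.E.Cmp_assoc[OF mu'(1)[OF ph pt] mu(1)[OF ph pt] x] mu_mu'(2)[OF ph pt] M.E.Cmp_Idm_left[OF x] by simp
  thus False using nz M.E.Cmp_Nul_right[OF y DU_Obj[OF pg]] by (simp add: DD_sel)
  qed
  hence "g <= pmul h t" using hom_scalar[OF _ pideal_pmul[OF ph pt] mx] g by simp
  thus "g <= t" using pmul_sub(2)[OF ph pt] by blast
 next
  fix g assume g: "g:conns" and ng: "~ g <= ?j"
  have pg: "pideal g" using g conn_pideal by simp
  let ?U = "?j \<inter> g"
  have pU: "pideal ?U" and Ug: "?U <= g" using pideal_Int[OF j pg] by blast+
  \<comment> \<open>Equality of these products provides a right inverse h of the whiskered inclusion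
    of \<open>?U\<close> into g.\<close>
  have eq: "pmul ?i g = pmul ?i ?U" using pmul_Int_srcs[OF fG pg] .
  note mg = mu(1)[OF i pg] and mU = mu(1)[OF i pU, folded eq] and mg' = mu'(1)[OF i pg] and mU' = mu'(1)[OF i pU, folded eq]
  note ii = inc(1)[OF pU pg Ug]
  define h where "h = mu' ?i ?U oE mu ?i g"
  have h: "h:hom EE (M.hcomp (DU ?i) (DU g)) (M.hcomp (DU ?i) (DU ?U))" unfolding h_def using M.E.Cmp_hom[OF mU' mg] .
  have nat: "mu ?i g oE ?W (inc ?U g) = mu ?i ?U"
  using mu_natural[OF i pU pg Ug] inc_id[OF pideal_pmul[OF i pg]] M.E.Cmp_Idm_left[OF mU] eq by simp
  have Wm: "?W (inc ?U g) = mu' ?i g oE mu ?i ?U"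
  using M.E.Cmp_assoc[OF mg' mg Wh[OF ii]] mu_mu'(2)[OF i pg] M.E.Cmp_Idm_left[OF Wh[OF ii]] nat by simp
  have "mu ?i ?U oE h = mu ?i g"
  unfolding h_def using M.E.Cmp_assoc[OF mU mU' mg] mu_mu'(1)[OF i pU] eq M.E.Cmp_Idm_left[OF mg] by simp
  hence Wid: "?W (inc ?U g) oE h = Idm EE (M.hcomp (DU ?i) (DU g))"
  unfolding Wm using M.E.Cmp_assoc[OF mg' mU h] mu_mu'(2)[OF i pg] by simp
  let ?Z = "M.hcomp (DU ?i) (DU g)" and ?S = "{inc c ?U oE r |c r. conn c & c <= ?U & r:hom EE (DU ?U) (DU c)}"
  let ?T = "{HArr DD (Idm DD (DU ?i)) (inc c g) oE x |c x. c:conns & c < g & x:hom DD ?Z (HObj DD (DU ?i) (DU c))}"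
  \<comment> \<open>Carries the span of the identity of \<open>DU ?U\<close> to one of the identity
    of \<open>?Z\<close>. Its members go through connected c inside \<open>?U\<close>, and these are
    strictly smaller than g because g is not contained in J.\<close>
  define fz where "fz f = ?W (inc ?U g oE f) oE h" for f
  have UO: "DU ?U:Obj EE" and gO: "DU g:Obj EE" using DU_Obj pU pg by blast+
  have ZO: "?Z:Obj EE" using M.E.hom_Obj(1)[OF h] .
  have S: "?S <= hom EE (DU ?U) (DU ?U)" using M.E.Cmp_hom[OF inc(1)[OF conn_pideal pU]] by blast
  have span: "fz (Idm EE (DU ?U)):aspan EE ?Z ?Z (fz ` ?S)"
  proof (rule M.E.aspan_map[OF DU_span[OF pU] S UO UO])
  show "fz (Add EE f k) = Add EE (fz f) (fz k)" if "f:hom EE (DU ?U) (DU ?U)" "k:hom EE (DU ?U) (DU ?U)" for f k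
  unfolding fz_def
  using M.E.Cmp_Add_right[OF ii that] M.harr_linear_right(1)[OF iO M.E.Cmp_hom[OF ii that(1)] M.E.Cmp_hom[OF ii that(2)]]
  M.E.Cmp_Add_left[OF Wh[OF M.E.Cmp_hom[OF ii that(1)]] Wh[OF M.E.Cmp_hom[OF ii that(2)]] h] by simp
  show "fz (Nul EE (DU ?U) (DU ?U)) = Nul EE ?Z ?Z"
  unfolding fz_def using M.E.Cmp_Nul_right[OF ii UO] harr_Nul(1)[OF iO UO gO] M.E.Cmp_Nul_left[OF h ZO] by simp
  qed
  have id: "fz (Idm EE (DU ?U)) = Idm EE ?Z" unfolding fz_def using M.E.Cmp_Idm_right[OF ii] Wid by simp
  have "fz ` ?S <= ?T"
  proof
  fix y assume "y:fz ` ?S"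
  then obtain c r where c: "conn c" "c <= ?U" "r:hom EE (DU ?U) (DU c)" "y = fz (inc c ?U oE r)" by blast
  have pc: "pideal c" and cg: "c <= g" "c < g" using conn_pideal[OF c(1)] c(2) ng by blast+
  note cU = inc(1)[OF pc pU c(2)] and icg = inc(1)[OF pc pg cg(1)]
  have "inc ?U g oE (inc c ?U oE r) = inc c g oE r" using M.E.Cmp_assoc[OF ii cU c(3)] inc_inc[OF pc pU pg c(2) Ug] by simp
  hence y: "y = ?W (inc c g) oE (?W r oE h)"
  unfolding c(4) fz_def using harr_Cmp_left(1)[OF iO c(3) icg] M.E.Cmp_assoc[OF Wh[OF icg] Wh[OF c(3)] h] by simp
  have "?Z:Obj DD" "M.hcomp (DU ?i) (DU c):Obj DD" using hcomp_DD conns_DD g cG c(1) by simp_all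
  hence "?W r oE h:hom DD ?Z (HObj DD (DU ?i) (DU c))" using M.E.Cmp_hom[OF Wh[OF c(3)] h] by (simp add: hom_DD DD_sel)
  thus "y:?T" using y c(1) cg(2) unfolding DD_sel by blast
  qed
  from aspan_mono[OF span this] show "Idm DD (HObj DD (DU ?i) (DU g)):aspan DD (HObj DD (DU ?i) (DU g)) (HObj DD (DU ?i) (DU g))
  {Cmp DD (HArr DD (Idm DD (DU ?i)) (inc c g)) x |c x. c:conns & c < g & x:hom DD (HObj DD (DU ?i) (DU g)) (HObj DD (DU ?i) (DU c))}"
  unfolding aspan_DD DD_sel id .
 next
  fix s x assume s: "s:conns" and "x:hom DD (HObj DD (DU ?i) (DU ?j)) (HObj DD (DU ?i) (DU s))"
  hence x: "x:hom EE (M.hcomp (DU ?i) (DU ?j)) (M.hcomp (DU ?i) (DU s))" by (simp add: hom_DD DD_sel)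
  have ps: "pideal s" using s conn_pideal by simp
  have jO: "DU ?j:Obj EE" and sO: "DU s:Obj EE" using DU_Obj j ps by blast+
  let ?n = "pmul ?i s"
  have pn: "pideal ?n" using pideal_pmul[OF i ps] .
  note mj = mu(1)[OF i j, unfolded ij] and mj' = mu'(1)[OF i j, unfolded ij] and ms = mu(1)[OF i ps] and ms' = mu'(1)[OF i ps]
  \<comment> \<open>x conjugated with \<open>mu\<close> is a map between the functors of I = I J and
    I s. If nonzero, it forces I into I s, hence J into s by \<open>srcs_least\<close>, and x is a
    multiple of the whiskered inclusion.\<close>
  define fz where "fz = mu ?i s oE (x oE mu' ?i ?j)"
  have fz: "fz:hom EE (DU ?i) (DU ?n)" unfolding fz_def using M.E.Cmp_hom[OF ms M.E.Cmp_hom[OF x mj']] .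
  have "fz oE mu ?i ?j = mu ?i s oE x"
  unfolding fz_def using M.E.Cmp_assoc[OF ms M.E.Cmp_hom[OF x mj'] mj] M.E.Cmp_assoc[OF x mj' mj] mu_mu'(2)[OF i j] M.E.Cmp_Idm_right[OF x] by simp
  hence xfz: "x = mu' ?i s oE (fz oE mu ?i ?j)"
  using M.E.Cmp_assoc[OF ms' ms x] mu_mu'(2)[OF i ps] M.E.Cmp_Idm_left[OF x] by simp
  have "EX y:hom EE (DU ?j) (DU s). x = ?W y"
  proof (cases "fz = Nul EE (DU ?i) (DU ?n)")
  case True
  have "x = Nul EE (M.hcomp (DU ?i) (DU ?j)) (M.hcomp (DU ?i) (DU s))"
  unfolding xfz True using M.E.Cmp_Nul_left[OF mj DU_Obj[OF pn]] M.E.Cmp_Nul_right[OF ms' M.E.hom_Obj(1)[OF mj]] by simp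
  thus ?thesis using harr_Nul(1)[OF iO jO sO] M.E.Nul_hom[OF jO sO] by (intro bexI[of _ "Nul EE (DU ?j) (DU s)"]) simp_all
  next
  case False
  from hom_scalar[OF cG pn fz False] obtain c where sub: "?i <= ?n" and c: "fz = Scl EE c (inc ?i ?n)" by blast
  have js: "?j <= s" using srcs_least[OF fG ps sub] .
  note ijs = inc(1)[OF j ps js] and iin = inc(1)[OF i pn sub]
  have nat: "mu ?i s oE ?W (inc ?j s) = inc ?i ?n oE mu ?i ?j" using mu_natural[OF i j ps js] ij by simp
  have "mu' ?i s oE (inc ?i ?n oE mu ?i ?j) = ?W (inc ?j s)"
  unfolding nat[symmetric] using M.E.Cmp_assoc[OF ms' ms Wh[OF ijs]] mu_mu'(2)[OF i ps] M.E.Cmp_Idm_left[OF Wh[OF ijs]] by simp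
  hence "x = Scl EE c (?W (inc ?j s))"
  unfolding xfz c using M.E.Cmp_Scl_left[OF iin mj] M.E.Cmp_Scl_right[OF ms' M.E.Cmp_hom[OF iin mj]] by simp
  hence "x = ?W (Scl EE c (inc ?j s))" using M.harr_linear_right(2)[OF iO ijs ijs] by simp
  thus ?thesis using M.E.Scl_hom[OF ijs] by blast
  qed
  thus "EX y:hom DD (DU ?j) (DU s). x = HArr DD (Idm DD (DU ?i)) y"
  using conns_DD[OF s] conns_DD[of ?j] cj unfolding Bex_def hom_DD DD_sel by simp
 next
  fix s y assume s: "s:conns" and "y:hom DD (DU ?j) (DU s)"
  and "HArr DD (Idm DD (DU ?i)) y = Nul DD (HObj DD (DU ?i) (DU ?j)) (HObj DD (DU ?i) (DU s))"
  hence y: "y:hom EE (DU ?j) (DU s)" and Wy: "?W y = Nul EE (M.hcomp (DU ?i) (DU ?j)) (M.hcomp (DU ?i) (DU s))"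
  by (simp_all add: hom_DD DD_sel)
  have ps: "pideal s" using s conn_pideal by simp
  have pn: "pideal (pmul ?i s)" using pideal_pmul[OF i ps] .
  note mj = mu(1)[OF i j, unfolded ij] and mj' = mu'(1)[OF i j, unfolded ij] and ms = mu(1)[OF i ps]
  show "y = Nul DD (DU ?j) (DU s)"
  proof (rule ccontr)
  assume "y ~= Nul DD (DU ?j) (DU s)"
  hence nz: "y ~= Nul EE (DU ?j) (DU s)" by (simp add: DD_sel)
  \<comment> \<open>y is a multiple of the inclusion of J into s. Its whiskering corresponds under
    \<open>mu\<close> to the inclusion of I into I s, which is nonzero.\<close>
  from hom_scalar[OF cj ps y nz] obtain c where js: "?j <= s" and c: "y = Scl EE c (inc ?j s)" by blast
  note ijs = inc(1)[OF j ps js]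
  have c0: "c ~= 0" using nz c M.E.Scl_0[OF ijs] by auto
  have sub: "?i <= pmul ?i s" using pmul_mono[OF js, of ?i] ij by simp
  note iin = inc(1)[OF i pn sub]
  have "inc ?j s = Scl EE (1 / c) y" unfolding c using M.E.Scl_Scl[OF ijs] M.E.Scl_1[OF ijs] c0 by simp
  hence "?W (inc ?j s) = Scl EE (1 / c) (?W y)" using M.harr_linear_right(2)[OF iO y y] by simp
  also have "... = Nul EE (M.hcomp (DU ?i) (DU ?j)) (M.hcomp (DU ?i) (DU s))"
  unfolding Wy using M.E.Scl_Nul M.E.hom_Obj[OF Wh[OF y]] by blast
  finally have "inc ?i (pmul ?i s) oE mu ?i ?j = Nul EE (M.hcomp (DU ?i) (DU ?j)) (DU (pmul ?i s))"
  using mu_natural[OF i j ps js] ij M.E.Cmp_Nul_right[OF ms M.E.hom_Obj(1)[OF mj]] by simp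
  hence "inc ?i (pmul ?i s) oE (mu ?i ?j oE mu' ?i ?j) = Nul EE (DU ?i) (DU (pmul ?i s))"
  using M.E.Cmp_assoc[OF iin mj mj'] M.E.Cmp_Nul_left[OF mj' DU_Obj[OF pn]] by simp
  hence "inc ?i (pmul ?i s) = Nul EE (DU ?i) (DU (pmul ?i s))"
  using mu_mu'(1)[OF i j] ij M.E.Cmp_Idm_right[OF iin] by simp
  thus False using inc_nz[OF i pn sub] cG by (auto simp: conn_def)
  qed
 qed
 thus thesis using that by blast
qed

end

theorem theorem13:
  fixes Q :: "('v, 'a) pre_digraph"
    and I J :: "(('v, 'a) path \<Rightarrow> 'k::alg_closed_field) set"
    and G :: "('v, 'a) path set"
  assumes "tree_quiver Q"
    and "indecomposable_ideal (path_algebra Q) I"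
    and "minimal_path_generators Q I G"
    and "J = Idl\<^bsub>path_algebra Q\<^esub> (vertex_idem ` path_source ` G)"
  shows "duflo_involution (dual_projection_2cat Q) (iso_class (dual_projection_2cat Q) (Dp Q I)) (Dp Q J)
    \<and> (\<forall>F. duflo_involution (dual_projection_2cat Q) (iso_class (dual_projection_2cat Q) (Dp Q I)) F \<longrightarrow>
          isomorphic (dual_projection_2cat Q) F (Dp Q J))"
proof -
 interpret T: tree_algebra Q "TYPE('k)" by unfold_locales (rule assms(1))
 have G: "G <= paths Q" and GI: "Idl\<^bsub>path_algebra Q\<^esub> (path_elem ` G) = I"
  and min: "!!G'. G' \<subset> G==>Idl\<^bsub>path_algebra Q\<^esub> (path_elem ` G') ~= I"
  using assms(3) unfolding minimal_path_generators_def by blast+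
 have I: "I = T.I (T.pgen G)" using T.Idl_elem[where ?'k = 'k, OF G] GI by simp
 have c: "T.conn (T.pgen G)" using T.indecomposable_conn[where ?'k = 'k, of "T.pgen G"] T.pideal_pgen[OF G] assms(2) I by simp
 have m: "T.pgen G' ~= T.pgen G" if "G' \<subset> G" for G'
  using min[OF that] T.Idl_elem[where ?'k = 'k, of G'] that G I by auto
 \<comment> \<open>Matches the idempotents that generate J with the trivial paths in
   \<open>srcs\<close>.\<close>
 have "vertex_idem ` path_source ` G = (path_elem ` T.srcs G :: (('v, 'a) path=>'k) set)"
 proof -
  have sd: "T.srcs G = (%v. (v, [])) ` fst ` G" by (rule T.srcs_def[OF G c m])
  show ?thesis unfolding sd by (simp add: image_image vertex_idem_def path_source_def)
 qed
 hence J: "J = T.I (T.pgen (T.srcs G))" using assms(4) T.Idl_elem[where ?'k = 'k, OF T.srcs_P[OF G c m]] by simp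
 obtain u where "duflo_setting (dual_projection_2cat Q) T.DU T.inc T.conns (T.pgen G) (T.pgen (T.srcs G)) (paths Q) u"
  using T.duflo_setting_DD[OF G c m] by blast
 then interpret D: duflo_setting "dual_projection_2cat Q" T.DU T.inc T.conns "T.pgen G" "T.pgen (T.srcs G)" "paths Q" u .
 show ?thesis unfolding I J using D.duflo_j D.duflo_unique by blast
qed

end
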